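(* Let $N\ge2$, let $b^-<b^+$ be real constants, let $\Omega=\{x\in\mathbb{R}^N : b^-<x_N<b^+\}$ and $\Gamma^\pm=\{x\in\mathbb{R}^N : x_N=b^\pm\}$. Let $a>0$, $m\in\mathbb{N}$ with $m\ge2$, and $1<p<\infty$. Suppose that $f_k^\pm\in W^{m-1-k,p}_{\mathrm{loc}}(\mathbb{R}^{N-1})$ for $k=0,\dots,m-2$ and $f_{m-1}^\pm\in L^p_{\mathrm{loc}}(\mathbb{R}^{N-1})$ satisfy $$\int_{\mathbb{R}^{N-1}}|Q_{i,m,n}(x')|^p\,dx'<\infty$$ for all $n,i\in\mathbb{N}_0$ with $0\le n+i\le m-1$, where $$Q_{i,m,n}(x'):=\sum_{k=0}^{m-i-n-1}\frac{(-1)^k}{k!}\big(\nabla_{\parallel}^if_{k+n}^+(x')+(-1)^{k+1}\nabla_{\parallel}^if_{k+n}^-(x')\big)\left(\frac{b^+-b^-}{2}\right)^k,$$ and $$\int_{\mathbb{R}^{N-1}}\int_{B'(0,a)}\frac{|\nabla_{\parallel}^{m-k-1}f_k^\pm(x'+h')-\nabla_{\parallel}^{m-k-1}f_k^\pm(x')|^p}{|h'|^{p+N-2}}\,dh'\,dx'<\infty$$ for all $k=0,\dots,m-1$. Then there exists $u\in\dot{W}^{m,p}(\Omega)$ such that $\operatorname{Tr}(u)=f_0^\pm$ and $\operatorname{Tr}(\partial_N^ku)=f_k^\pm$ on $\Gamma^\pm$ for $k=1,\dots,m-1$, and $$\begin{aligned}\int_\Omega|\nabla^mu(x)|^p\,dx\le{}&c\sum_{n=0}^{m-1}\sum_{i=0}^{m-1-n}(b^+-b^-)^{(n+i-m)p+1}\int_{\mathbb{R}^{N-1}}|Q_{i,m,n}(x')|^p\,dx'\\&+c\sum_{k=0}^{m-1}\int_{\mathbb{R}^{N-1}}\int_{B'(0,a)}\frac{|\nabla_{\parallel}^{m-k-1}f_k^-(x'+h')-\nabla_{\parallel}^{m-k-1}f_k^-(x')|^p}{|h'|^{p+N-2}}\,dh'\,dx'\\&+c\sum_{k=0}^{m-1}\int_{\mathbb{R}^{N-1}}\int_{B'(0,a)}\frac{|\nabla_{\parallel}^{m-k-1}f_k^+(x'+h')-\nabla_{\parallel}^{m-k-1}f_k^+(x')|^p}{|h'|^{p+N-2}}\,dh'\,dx'\end{aligned}$$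 for some constant $c=c(a,m,N,p)>0$. Moreover, the map $(f_0^-,\dots,f_{m-1}^-,f_0^+,\dots,f_{m-1}^+)\mapsto u$ is linear.
   Context: $\mathbb{N}_0=\{0,1,2,\dots\}$; points are written $x=(x',x_N)\in\mathbb{R}^{N-1}\times\mathbb{R}$; $B'(0,r)$ is the open ball in $\mathbb{R}^{N-1}$ with center $0$ and radius $r$. $\dot{W}^{m,p}(\Omega)$ is the space of real-valued $u\in L^1_{\mathrm{loc}}(\Omega)$ all of whose weak derivatives of order $m$ belong to $L^p(\Omega)$. $\nabla^m$ denotes the vector of all partial derivatives $\partial^\alpha$ with $|\alpha|=m$, and $\nabla_{\parallel}^k$ the vector of all partial derivatives of order $k$ in the variables $x'=(x_1,\dots,x_{N-1})$ only; $\nabla_{\parallel}^0f=f$. $\operatorname{Tr}$ is the usual Sobolev boundary trace with values in $L^p_{\mathrm{loc}}(\partial\Omega)$ (derivatives of $u\in\dot W^{m,p}(\Omega)$ of order at most $m-1$ are in $W^{1,p}$ of bounded Lipschitz subdomains of $\Omega$). Functions on $\Gamma^\pm$ are identified with functions of $x'\in\mathbb{R}^{N-1}$.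
   Formalization: The constant c may depend, besides a, m, N, p, on an upper bound d for the thickness b^+ - b^-; with c independent of the thickness the estimate fails for wide strips (N=m=p=2, f_0^± = φ(x/R), f_1^± = 0, thickness R large). *)

theory Defs
  imports "HOL-Analysis.Analysis"
begin

section \<open>Multi-indices and smooth functions\<close>

text \<open>A multi-index assigns an order to each coordinate direction, i.e. to each basis vector.\<close>

definition multi_indices :: "nat \<Rightarrow> ('a::euclidean_space \<Rightarrow> nat) set" where
  "multi_indices j = {\<alpha>. (\<forall>b. b \<notin> Basis \<longrightarrow> \<alpha> b = 0) \<and> (\<Sum>b\<in>Basis. \<alpha> b) = j}"

text \<open>Finiteness is what makes the sums and Euclidean norms over \<^term>\<open>multi_indices j\<close> meaningful.\<close>

lemma finite_multi_indices: "finite (multi_indices j :: ('a::euclidean_space \<Rightarrow> nat) set)"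
proof -
  have "multi_indices j \<subseteq> {\<alpha> :: 'a \<Rightarrow> nat. \<forall>b. (b \<in> Basis \<longrightarrow> \<alpha> b \<in> {..j}) \<and> (b \<notin> Basis \<longrightarrow> \<alpha> b = 0)}"
    unfolding multi_indices_def using member_le_sum[OF _ _ finite_Basis] by fastforce
  then show ?thesis
    by (rule finite_subset) (intro finite_set_of_finite_funs finite_Basis finite_atMost)
qed

fun iter_pderiv :: "'a::euclidean_space list \<Rightarrow> ('a \<Rightarrow> real) \<Rightarrow> 'a \<Rightarrow> real" where
  "iter_pderiv [] f = f"
| "iter_pderiv (b # bs) f = (\<lambda>x. frechet_derivative (iter_pderiv bs f) (at x) b)"

definition smooth :: "('a::euclidean_space \<Rightarrow> real) \<Rightarrow> bool" where
  "smooth f \<longleftrightarrow> (\<forall>bs. set bs \<subseteq> Basis \<longrightarrow> iter_pderiv bs f differentiable_on UNIV)"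

text \<open>The classical derivative \<open>\<partial>\<^sup>\<alpha> f\<close>, used for smooth \<open>f\<close> only, so that the order in which the
  directions are taken is immaterial.\<close>

definition pderiv_mi :: "('a::euclidean_space \<Rightarrow> nat) \<Rightarrow> ('a \<Rightarrow> real) \<Rightarrow> 'a \<Rightarrow> real" where
  "pderiv_mi \<alpha> f =
     iter_pderiv (SOME bs. set bs \<subseteq> Basis \<and> (\<forall>b\<in>Basis. count_list bs b = \<alpha> b)) f"

definition test_fun :: "'a::euclidean_space set \<Rightarrow> ('a \<Rightarrow> real) \<Rightarrow> bool" where
  "test_fun U \<phi> \<longleftrightarrow> smooth \<phi> \<and> (\<exists>K. compact K \<and> K \<subseteq> U \<and> (\<forall>x. x \<notin> K \<longrightarrow> \<phi> x = 0))"

section \<open>Lebesgue and Sobolev spaces\<close>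

definition L1_loc :: "'a::euclidean_space set \<Rightarrow> ('a \<Rightarrow> real) \<Rightarrow> bool" where
  "L1_loc U u \<longleftrightarrow> (\<forall>K. compact K \<and> K \<subseteq> U \<longrightarrow> set_integrable lebesgue K u)"

definition Lp :: "real \<Rightarrow> 'a::euclidean_space set \<Rightarrow> ('a \<Rightarrow> real) \<Rightarrow> bool" where
  "Lp p U u \<longleftrightarrow> u \<in> borel_measurable (lebesgue_on U) \<and>
     (\<integral>\<^sup>+x\<in>U. ennreal (\<bar>u x\<bar> powr p) \<partial>lebesgue) < \<infinity>"

definition Lp_loc :: "real \<Rightarrow> 'a::euclidean_space set \<Rightarrow> ('a \<Rightarrow> real) \<Rightarrow> bool" where
  "Lp_loc p U u \<longleftrightarrow> (\<forall>K. compact K \<and> K \<subseteq> U \<longrightarrow> Lp p K u)"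

definition has_weak_pderiv ::
    "'a::euclidean_space set \<Rightarrow> ('a \<Rightarrow> nat) \<Rightarrow> ('a \<Rightarrow> real) \<Rightarrow> ('a \<Rightarrow> real) \<Rightarrow> bool" where
  "has_weak_pderiv U \<alpha> u v \<longleftrightarrow> L1_loc U u \<and> L1_loc U v \<and>
     (\<forall>\<phi>. test_fun U \<phi> \<longrightarrow>
        (LINT x:U|lebesgue. u x * pderiv_mi \<alpha> \<phi> x) =
        (- 1) ^ (\<Sum>b\<in>Basis. \<alpha> b) * (LINT x:U|lebesgue. v x * \<phi> x))"

text \<open>Weak derivatives are unique up to null sets; \<open>weak_pderiv U \<alpha> u\<close> is a representative
  when one exists. The derivative of order zero is \<open>u\<close> itself.\<close>

definition weak_pderiv ::
    "'a::euclidean_space set \<Rightarrow> ('a \<Rightarrow> nat) \<Rightarrow> ('a \<Rightarrow> real) \<Rightarrow> 'a \<Rightarrow> real" where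
  "weak_pderiv U \<alpha> u = (if \<alpha> = (\<lambda>b. 0) then u else (SOME v. has_weak_pderiv U \<alpha> u v))"

text \<open>\<open>W\<^sup>j\<^sup>,\<^sup>p(U)\<close>, \<open>W\<^sup>j\<^sup>,\<^sup>p\<^sub>l\<^sub>o\<^sub>c(U)\<close> and the homogeneous space
  \<open>W\<^sup>j\<^sup>,\<^sup>p(U)\<close> with a dot.\<close>

definition sobolev :: "nat \<Rightarrow> real \<Rightarrow> 'a::euclidean_space set \<Rightarrow> ('a \<Rightarrow> real) \<Rightarrow> bool" where
  "sobolev j p U u \<longleftrightarrow> (\<forall>i\<le>j. \<forall>\<alpha>\<in>multi_indices i. \<exists>v. has_weak_pderiv U \<alpha> u v \<and> Lp p U v)"

definition sobolev_loc :: "nat \<Rightarrow> real \<Rightarrow> 'a::euclidean_space set \<Rightarrow> ('a \<Rightarrow> real) \<Rightarrow> bool" where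
  "sobolev_loc j p U u \<longleftrightarrow>
     (\<forall>i\<le>j. \<forall>\<alpha>\<in>multi_indices i. \<exists>v. has_weak_pderiv U \<alpha> u v \<and> Lp_loc p U v)"

definition homogeneous_sobolev ::
    "nat \<Rightarrow> real \<Rightarrow> 'a::euclidean_space set \<Rightarrow> ('a \<Rightarrow> real) \<Rightarrow> bool" where
  "homogeneous_sobolev j p U u \<longleftrightarrow>
     L1_loc U u \<and> (\<forall>\<alpha>\<in>multi_indices j. \<exists>v. has_weak_pderiv U \<alpha> u v \<and> Lp p U v)"

text \<open>The \<open>p\<close>-th power of the norm of \<open>W\<^sup>1\<^sup>,\<^sup>p(U)\<close>.\<close>

definition W1p_norm_pow :: "real \<Rightarrow> 'a::euclidean_space set \<Rightarrow> ('a \<Rightarrow> real) \<Rightarrow> ennreal" where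
  "W1p_norm_pow p U w =
     (\<Sum>i\<le>1. \<Sum>\<alpha>\<in>multi_indices i. \<integral>\<^sup>+x\<in>U. ennreal (\<bar>weak_pderiv U \<alpha> w x\<bar> powr p) \<partial>lebesgue)"

text \<open>\<open>\<integral>\<^sub>U |\<nabla>\<^sup>j u|\<^sup>p\<close>, where \<open>\<nabla>\<^sup>j u\<close> is the vector of all derivatives of order
  \<open>j\<close> with its Euclidean norm.\<close>

definition grad_energy :: "nat \<Rightarrow> real \<Rightarrow> 'a::euclidean_space set \<Rightarrow> ('a \<Rightarrow> real) \<Rightarrow> ennreal" where
  "grad_energy j p U u =
     (\<integral>\<^sup>+x\<in>U. ennreal (L2_set (\<lambda>\<alpha>. weak_pderiv U \<alpha> u x) (multi_indices j) powr p) \<partial>lebesgue)"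

section \<open>The strip and traces on its faces\<close>

text \<open>From here on \<open>\<real>\<^sup>N\<^sup>-\<^sup>1\<close> is \<^typ>\<open>real^'n\<close> and \<open>\<real>\<^sup>N\<close> is
  \<^typ>\<open>(real^'n) \<times> real\<close>, so that \<open>N = CARD('n) + 1 \<ge> 2\<close>. The numbers \<open>bm\<close> and \<open>bp\<close>
  stand for \<open>b\<^sup>-\<close> and \<open>b\<^sup>+\<close>.\<close>

definition strip :: "real \<Rightarrow> real \<Rightarrow> ((real^'n) \<times> real) set" where
  "strip bm bp = UNIV \<times> {bm<..<bp}"

definition normal_mi :: "nat \<Rightarrow> (real^'n) \<times> real \<Rightarrow> nat" where
  "normal_mi k = (\<lambda>b. if b = (0, 1) then k else 0)"

text \<open>\<open>has_trace p bm bp b v g\<close>: the function \<open>v\<close> on the strip has the Sobolev trace \<open>g\<close> on the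
  face \<open>x\<^sub>N = b\<close> (\<open>b\<close> being \<open>bm\<close> or \<open>bp\<close>), where \<open>g\<close> is regarded as a function of \<open>x'\<close>.
  The trace on the bounded Lipschitz domain \<open>U = B'(0,R) \<times> (bm,bp)\<close> is the continuous
  extension to \<open>W\<^sup>1\<^sup>,\<^sup>p(U)\<close> of the restriction of functions smooth up to the boundary, which are
  dense; thus \<open>g\<close> is the limit of the boundary values of an approximating sequence.\<close>

definition has_trace ::
    "real \<Rightarrow> real \<Rightarrow> real \<Rightarrow> real \<Rightarrow> ((real^'n) \<times> real \<Rightarrow> real) \<Rightarrow> (real^'n \<Rightarrow> real) \<Rightarrow> bool" where
  "has_trace p bm bp b v g \<longleftrightarrow> Lp_loc p UNIV g \<and>
     (\<forall>R>0. let U = ball 0 R \<times> {bm<..<bp} in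
        sobolev 1 p U v \<and>
        (\<exists>\<phi> :: nat \<Rightarrow> (real^'n) \<times> real \<Rightarrow> real. (\<forall>j. smooth (\<phi> j)) \<and>
           (\<lambda>j. W1p_norm_pow p U (\<lambda>x. \<phi> j x - v x)) \<longlonglongrightarrow> 0 \<and>
           (\<lambda>j. \<integral>\<^sup>+x'\<in>ball 0 R. ennreal (\<bar>\<phi> j (x', b) - g x'\<bar> powr p) \<partial>lebesgue) \<longlonglongrightarrow> 0))"

section \<open>Boundary data\<close>

text \<open>\<open>Q_coeff bm bp fm fp m i n x'\<close> is the vector \<open>Q\<^sub>i\<^sub>,\<^sub>m\<^sub>,\<^sub>n(x')\<close>, with components indexed by
  the multi-indices of order \<open>i\<close>.\<close>

definition Q_coeff ::
    "real \<Rightarrow> real \<Rightarrow> (nat \<Rightarrow> real^'n \<Rightarrow> real) \<Rightarrow> (nat \<Rightarrow> real^'n \<Rightarrow> real) \<Rightarrow>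
     nat \<Rightarrow> nat \<Rightarrow> nat \<Rightarrow> real^'n \<Rightarrow> (real^'n \<Rightarrow> nat) \<Rightarrow> real" where
  "Q_coeff bm bp fm fp m i n x' \<alpha> =
     (\<Sum>k=0..m - i - n - 1. (- 1) ^ k / fact k *
        (weak_pderiv UNIV \<alpha> (fp (k + n)) x' + (- 1) ^ (k + 1) * weak_pderiv UNIV \<alpha> (fm (k + n)) x') *
        ((bp - bm) / 2) ^ k)"

definition Q_energy ::
    "real \<Rightarrow> real \<Rightarrow> real \<Rightarrow> (nat \<Rightarrow> real^'n \<Rightarrow> real) \<Rightarrow> (nat \<Rightarrow> real^'n \<Rightarrow> real) \<Rightarrow>
     nat \<Rightarrow> nat \<Rightarrow> nat \<Rightarrow> ennreal" where
  "Q_energy p bm bp fm fp m i n =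
     (\<integral>\<^sup>+x'. ennreal (L2_set (Q_coeff bm bp fm fp m i n x') (multi_indices i) powr p) \<partial>lebesgue)"

text \<open>The double integral of
  \<open>|\<nabla>\<^sup>j g(x'+h') - \<nabla>\<^sup>j g(x')|\<^sup>p / |h'|\<^sup>p\<^sup>+\<^sup>N\<^sup>-\<^sup>2\<close> over \<open>x' \<in> \<real>\<^sup>N\<^sup>-\<^sup>1\<close> and \<open>h' \<in> B'(0,a)\<close>.\<close>

definition gagliardo_energy :: "real \<Rightarrow> real \<Rightarrow> nat \<Rightarrow> (real^'n \<Rightarrow> real) \<Rightarrow> ennreal" where
  "gagliardo_energy a p j g =
     (\<integral>\<^sup>+x'. (\<integral>\<^sup>+h'\<in>ball 0 a.
        ennreal (L2_set (\<lambda>\<alpha>. weak_pderiv UNIV \<alpha> g (x' + h') - weak_pderiv UNIV \<alpha> g x')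
                   (multi_indices j) powr p
                 / norm h' powr (p + real (CARD('n) + 1) - 2)) \<partial>lebesgue) \<partial>lebesgue)"

text \<open>Only the entries \<open>fm k\<close>, \<open>fp k\<close> with \<open>k < m\<close> are part of the data.\<close>

definition boundary_data ::
    "real \<Rightarrow> nat \<Rightarrow> real \<Rightarrow> real \<Rightarrow> real \<Rightarrow>
     (nat \<Rightarrow> real^'n \<Rightarrow> real) \<Rightarrow> (nat \<Rightarrow> real^'n \<Rightarrow> real) \<Rightarrow> bool" where
  "boundary_data a m p bm bp fm fp \<longleftrightarrow>
     (\<forall>k\<le>m - 2. sobolev_loc (m - 1 - k) p UNIV (fm k) \<and> sobolev_loc (m - 1 - k) p UNIV (fp k)) \<and>
     Lp_loc p UNIV (fm (m - 1)) \<and> Lp_loc p UNIV (fp (m - 1)) \<and>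
     (\<forall>n i. n + i \<le> m - 1 \<longrightarrow> Q_energy p bm bp fm fp m i n < \<infinity>) \<and>
     (\<forall>k\<le>m - 1. gagliardo_energy a p (m - k - 1) (fm k) < \<infinity> \<and>
                  gagliardo_energy a p (m - k - 1) (fp k) < \<infinity>)"

end

theory Submission
  imports Defs "HOL-Computational_Algebra.Polynomial"
begin

text \<open>Let \<open>\<eta>\<close> be a smooth compactly supported kernel of integral one whose moments of orders
  \<open>1, \<dots>, m - 1\<close> vanish. In the half-space \<open>t > 0\<close> the function
  \<open>V(x, t) = \<Sum>k<m. t\<^sup>k/k! \<integral> \<eta>(h) f\<^sub>k(x + t h) dh\<close> has the normal derivatives \<open>f\<^sub>k\<close> at \<open>t = 0\<close>:
  the moment conditions cancel all unwanted terms, and a derivative of order \<open>m\<close> is a sum of terms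
  \<open>t\<^sup>-\<^sup>1 \<integral> \<psi>(h) g(x + t h) dh\<close> with \<open>\<integral> \<psi> = 0\<close> and \<open>g\<close> a top order derivative of some \<open>f\<^sub>k\<close>, which
  the Gagliardo integrals control. Such extensions \<open>v\<^sup>-\<close>, \<open>v\<^sup>+\<close> from the two faces are glued to
  \<open>u = v\<^sup>- + X (v\<^sup>+ - v\<^sup>-)\<close> by a cutoff \<open>X\<close> in the normal variable. Its derivatives cost powers of
  \<open>1/(b\<^sup>+ - b\<^sup>-)\<close>, paid for by a Poincare inequality based at the midplane, where Taylor expansion
  from both faces shows that the derivatives of \<open>v\<^sup>+ - v\<^sup>-\<close> are the jumps \<open>Q\<close> up to controlled
  errors. The traces are identified by contracting the strip in the normal direction.\<close>

section \<open>Smooth functions\<close>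

text \<open>An average at height t reads the data at distance less than r t, where r is the radius
  of the kernel. Since the Gagliardo integrals are truncated at a, r t must stay below a for all t
  up to the thickness of the strip; so r = a/d is taken from an upper bound d of the thickness, and
  the final constant depends on d. The obstacle is the thickness \<delta>. In the Leibniz rule X^(j)
  has size \<delta>^(-j), so the derivatives of order m - j of v^+ - v^- must have size \<delta>^j
  in L^p. Integrating j times in the normal direction gains this power if the values on one slice
  are controlled. The midplane has distance \<delta>/2 from both faces, whence the powers of (b^+ -
  b^-)/2 in Q; the exponent (n + i - m)p + 1 is what remains after division by \<delta>^(jp), the 1
  being the thickness over which a slice is spread. Linearity is delicate because weak derivatives
  are picked by a choice operator. The extension itself averages only the functions f_k; their
  derivatives occur in the estimates alone.\<close>

abbreviation pd :: "'a::euclidean_space \<Rightarrow> ('a \<Rightarrow> real) \<Rightarrow> 'a \<Rightarrow> real" where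
  "pd b f x \<equiv> frechet_derivative f (at x) b"

text \<open>Differentiability in the ambient space at the points of \<open>S\<close>: the extensions
  are smooth on open half-spaces and slabs only, while \<open>smooth\<close> speaks of the whole
  space.\<close>

definition smooth_on :: "'a::euclidean_space set \<Rightarrow> ('a \<Rightarrow> real) \<Rightarrow> bool" where
  "smooth_on S f \<longleftrightarrow> (\<forall>bs. set bs \<subseteq> Basis \<longrightarrow> (\<forall>x\<in>S. iter_pderiv bs f differentiable (at x)))"

lemma smooth_iff: "smooth f \<longleftrightarrow> smooth_on UNIV f"
  by (auto simp: smooth_def smooth_on_def differentiable_on_def)

lemma iter_pderiv_append: "iter_pderiv (as @ bs) f = iter_pderiv as (iter_pderiv bs f)"
  by (induction as) auto

lemma frechet_derivative_cong_open:
  assumes "open S" "x \<in> S" "\<And>y. y \<in> S \<Longrightarrow> f y = g y"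
  shows "frechet_derivative f (at x) = frechet_derivative g (at x)"
proof -
  have "(f has_derivative D) (at x) \<longleftrightarrow> (g has_derivative D) (at x)" for D
    using has_derivative_transform_within_open[of f D x UNIV S g]
      has_derivative_transform_within_open[of g D x UNIV S f] assms by auto
  then show ?thesis unfolding frechet_derivative_def by simp
qed

lemma differentiable_cong_open:
  assumes "open S" "x \<in> S" "\<And>y. y \<in> S \<Longrightarrow> f y = g y" "f differentiable (at x)"
  shows "g differentiable (at x)"
  using has_derivative_transform_within_open[of f _ x UNIV S g] assms
  unfolding differentiable_def by blast

lemma iter_pderiv_cong:
  assumes "open S" "\<And>y. y \<in> S \<Longrightarrow> f y = g y" "x \<in> S"
  shows "iter_pderiv bs f x = iter_pderiv bs g x"
  using assms(3)
proof (induction bs arbitrary: x)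
  case (Cons b bs)
  have "frechet_derivative (iter_pderiv bs f) (at x) = frechet_derivative (iter_pderiv bs g) (at x)"
    by (rule frechet_derivative_cong_open[OF assms(1) Cons.prems]) (rule Cons.IH)
  then show ?case by simp
qed (use assms in auto)

lemma smooth_on_cong:
  assumes "open S" "\<And>y. y \<in> S \<Longrightarrow> f y = g y" "smooth_on S f"
  shows "smooth_on S g"
  unfolding smooth_on_def
proof safe
  fix bs :: "'a list" and x assume "set bs \<subseteq> Basis" "x \<in> S"
  then show "iter_pderiv bs g differentiable at x"
    using differentiable_cong_open[of S x "iter_pderiv bs f" "iter_pderiv bs g"]
      iter_pderiv_cong[of S f g] assms unfolding smooth_on_def by metis
qed

lemma smooth_on_subset: "smooth_on T f \<Longrightarrow> S \<subseteq> T \<Longrightarrow> smooth_on S f"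
  unfolding smooth_on_def by blast

lemma smooth_on_Un: "smooth_on S f \<Longrightarrow> smooth_on T f \<Longrightarrow> smooth_on (S \<union> T) f"
  unfolding smooth_on_def by blast

lemma smooth_on_iter: "smooth_on S f \<Longrightarrow> set bs \<subseteq> Basis \<Longrightarrow> smooth_on S (iter_pderiv bs f)"
  unfolding smooth_on_def iter_pderiv_append[symmetric] by (metis le_sup_iff set_append)

lemma smooth_on_pd: "smooth_on S f \<Longrightarrow> b \<in> Basis \<Longrightarrow> smooth_on S (pd b f)"
  using smooth_on_iter[of S f "[b]"] by simp

lemma smooth_on_differentiable: "smooth_on S f \<Longrightarrow> x \<in> S \<Longrightarrow> f differentiable (at x)"
  unfolding smooth_on_def by (metis empty_set empty_subsetI iter_pderiv.simps(1))

lemma smooth_on_continuous_on: "smooth_on S f \<Longrightarrow> continuous_on S f"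
  by (meson continuous_at_imp_continuous_on differentiable_imp_continuous_within smooth_on_differentiable)

lemma smooth_on_continuous_on_iter:
  "smooth_on S f \<Longrightarrow> set bs \<subseteq> Basis \<Longrightarrow> continuous_on S (iter_pderiv bs f)"
  by (simp add: smooth_on_continuous_on smooth_on_iter)

lemma frechet_derivative_basis_sum:
  assumes "f differentiable (at x)"
  shows "frechet_derivative f (at x) v = (\<Sum>b\<in>Basis. (v \<bullet> b) * pd b f x)"
proof -
  have l: "linear (frechet_derivative f (at x))" using assms by (rule linear_frechet_derivative)
  have "frechet_derivative f (at x) v = frechet_derivative f (at x) (\<Sum>b\<in>Basis. (v \<bullet> b) *\<^sub>R b)"
    by (simp add: euclidean_representation)
  also have "\<dots> = (\<Sum>b\<in>Basis. (v \<bullet> b) * pd b f x)"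
    by (simp add: linear_sum[OF l] linear_cmul[OF l])
  finally show ?thesis .
qed

lemma smooth_on_has_derivative:
  assumes "smooth_on S f" "x \<in> S"
  shows "(f has_derivative (\<lambda>v. \<Sum>b\<in>Basis. (v \<bullet> b) * pd b f x)) (at x)"
proof -
  have d: "f differentiable (at x)" using assms smooth_on_differentiable by blast
  have "frechet_derivative f (at x) = (\<lambda>v. \<Sum>b\<in>Basis. (v \<bullet> b) * pd b f x)"
    by (rule ext) (rule frechet_derivative_basis_sum[OF d])
  then show ?thesis using d frechet_derivative_works by metis
qed

lemma pd_eqI: "(f has_derivative D) (at x) \<Longrightarrow> pd b f x = D b"
  by (metis frechet_derivative_at)

text \<open>An invariant kept by first partial derivatives passes to all iterated ones by induction
  over the list of directions. Agreement on the open set \<open>S\<close> is enough at each step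
  because derivatives are local.\<close>

lemma smooth_on_coinduct:
  assumes "open S" "P f"
    and step: "\<And>f. P f \<Longrightarrow> (\<forall>x\<in>S. f differentiable (at x)) \<and>
      (\<forall>b\<in>Basis. \<exists>g. P g \<and> (\<forall>x\<in>S. pd b f x = g x))"
  shows "smooth_on S f"
proof -
  have *: "\<exists>g. P g \<and> (\<forall>x\<in>S. iter_pderiv bs f x = g x)" if "set bs \<subseteq> Basis" for bs
    using that
  proof (induction bs)
    case Nil then show ?case using assms(2) by auto
  next
    case (Cons b bs)
    then obtain g where g: "P g" "\<forall>x\<in>S. iter_pderiv bs f x = g x" by auto
    have "b \<in> Basis" using Cons.prems by simp
    then obtain h where h: "P h" "\<forall>x\<in>S. pd b g x = h x" using step[OF g(1)] by blast
    have "iter_pderiv (b # bs) f x = h x" if "x \<in> S" for x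
      using frechet_derivative_cong_open[OF assms(1) that, of "iter_pderiv bs f" g] g(2) h(2) that
      by simp
    then show ?case using h(1) by blast
  qed
  show ?thesis
    unfolding smooth_on_def
  proof safe
    fix bs :: "'a list" and x assume bs: "set bs \<subseteq> Basis" and x: "x \<in> S"
    obtain g where g: "P g" "\<forall>x\<in>S. iter_pderiv bs f x = g x" using *[OF bs] by blast
    have "g differentiable at x" using step[OF g(1)] x by blast
    then show "iter_pderiv bs f differentiable at x"
      using differentiable_cong_open[OF assms(1) x, of g "iter_pderiv bs f"] g(2) by simp
  qed
qed

text \<open>Product and chain rules lead out of a class of generators, but not out of its closure
  under constants, sums and products.\<close>

inductive alg_hull :: "(('a \<Rightarrow> real) \<Rightarrow> bool) \<Rightarrow> ('a \<Rightarrow> real) \<Rightarrow> bool" for G where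
  base: "G f \<Longrightarrow> alg_hull G f"
| const: "alg_hull G (\<lambda>_. c)"
| add: "alg_hull G f \<Longrightarrow> alg_hull G g \<Longrightarrow> alg_hull G (\<lambda>x. f x + g x)"
| mult: "alg_hull G f \<Longrightarrow> alg_hull G g \<Longrightarrow> alg_hull G (\<lambda>x. f x * g x)"

lemma alg_hull_sum: "(\<And>i. i \<in> I \<Longrightarrow> alg_hull G (f i)) \<Longrightarrow> alg_hull G (\<lambda>x. \<Sum>i\<in>I. f i x)"
  by (induction I rule: infinite_finite_induct) (auto intro: alg_hull.intros)

lemma pd_add:
  assumes "f differentiable (at x)" "g differentiable (at x)"
  shows "pd b (\<lambda>x. f x + g x) x = pd b f x + pd b g x"
  using assms by (intro pd_eqI has_derivative_add) (auto simp: frechet_derivative_works)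

lemma pd_mult:
  assumes "f differentiable (at x)" "g differentiable (at x)"
  shows "pd b (\<lambda>x. f x * g x) x = f x * pd b g x + pd b f x * g x"
  using assms by (intro pd_eqI has_derivative_mult) (auto simp: frechet_derivative_works)

text \<open>If the derivatives of the generators lie in the hull, the product rule keeps all
  derivatives there, so the hull is an invariant for \<open>smooth_on_coinduct\<close>.\<close>

lemma smooth_on_alg_hull:
  assumes S: "open S" and f: "alg_hull G f"
    and G: "\<And>f. G f \<Longrightarrow> (\<forall>x\<in>S. f differentiable (at x)) \<and>
      (\<forall>b\<in>Basis. \<exists>g. alg_hull G g \<and> (\<forall>x\<in>S. pd b f x = g x))"
  shows "smooth_on S f"
proof (rule smooth_on_coinduct[where P = "alg_hull G", OF S f])
  fix f assume "alg_hull G f"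
  then show "(\<forall>x\<in>S. f differentiable (at x)) \<and>
      (\<forall>b\<in>Basis. \<exists>g. alg_hull G g \<and> (\<forall>x\<in>S. pd b f x = g x))"
  proof induction
    case (base f) then show ?case using G by blast
  next
    case (const c)
    then show ?case by (auto intro!: exI[of _ "\<lambda>_. 0"] alg_hull.const)
  next
    case (add f g)
    show ?case
    proof (intro conjI ballI)
      fix b :: 'a assume "b \<in> Basis"
      then obtain f' g' where "alg_hull G f'" "\<forall>x\<in>S. pd b f x = f' x" "alg_hull G g'" "\<forall>x\<in>S. pd b g x = g' x"
        using add by blast
      then show "\<exists>h. alg_hull G h \<and> (\<forall>x\<in>S. pd b (\<lambda>x. f x + g x) x = h x)"
        using add.IH by (intro exI[of _ "\<lambda>x. f' x + g' x"]) (auto simp: pd_add intro: alg_hull.add)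
    qed (use add in auto)
  next
    case (mult f g)
    show ?case
    proof (intro conjI ballI)
      fix b :: 'a assume "b \<in> Basis"
      then obtain f' g' where "alg_hull G f'" "\<forall>x\<in>S. pd b f x = f' x" "alg_hull G g'" "\<forall>x\<in>S. pd b g x = g' x"
        using mult by blast
      then show "\<exists>h. alg_hull G h \<and> (\<forall>x\<in>S. pd b (\<lambda>x. f x * g x) x = h x)"
        using mult by (intro exI[of _ "\<lambda>x. f x * g' x + f' x * g x"])
          (auto simp: pd_mult intro: alg_hull.add alg_hull.mult)
    qed (use mult in auto)
  qed
qed

lemma smooth_on_alg_hull_self:
  assumes "open S" "alg_hull (smooth_on S) f"
  shows "smooth_on S f"
  using assms(1,2)
proof (rule smooth_on_alg_hull)
  fix f :: "'a \<Rightarrow> real" assume "smooth_on S f"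
  then show "(\<forall>x\<in>S. f differentiable at x) \<and>
      (\<forall>b\<in>Basis. \<exists>g. alg_hull (smooth_on S) g \<and> (\<forall>x\<in>S. pd b f x = g x))"
    using alg_hull.base smooth_on_pd smooth_on_differentiable by metis
qed

lemma smooth_on_const: "open S \<Longrightarrow> smooth_on S (\<lambda>_. c)"
  using smooth_on_alg_hull_self[OF _ alg_hull.const] by blast

lemma smooth_on_add: "open S \<Longrightarrow> smooth_on S f \<Longrightarrow> smooth_on S g \<Longrightarrow> smooth_on S (\<lambda>x. f x + g x)"
  by (rule smooth_on_alg_hull_self) (auto intro: alg_hull.intros)

lemma smooth_on_mult: "open S \<Longrightarrow> smooth_on S f \<Longrightarrow> smooth_on S g \<Longrightarrow> smooth_on S (\<lambda>x. f x * g x)"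
  by (rule smooth_on_alg_hull_self) (auto intro: alg_hull.intros)

lemma smooth_on_sum:
  "open S \<Longrightarrow> (\<And>i. i \<in> I \<Longrightarrow> smooth_on S (f i)) \<Longrightarrow> smooth_on S (\<lambda>x. \<Sum>i\<in>I. f i x)"
  by (rule smooth_on_alg_hull_self) (auto intro: alg_hull_sum alg_hull.base)

lemma smooth_on_diff:
  assumes "open S" "smooth_on S f" "smooth_on S g" shows "smooth_on S (\<lambda>x. f x - g x)"
proof -
  have "smooth_on S (\<lambda>x. f x + (-1) * g x)"
    by (intro smooth_on_add smooth_on_mult smooth_on_const assms)
  then show ?thesis by simp
qed

lemma smooth_on_power: "open S \<Longrightarrow> smooth_on S f \<Longrightarrow> smooth_on S (\<lambda>x. f x ^ n)"
  by (induction n) (auto intro: smooth_on_const smooth_on_mult)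

lemma smooth_on_linear:
  assumes "open S" "bounded_linear f" shows "smooth_on S f"
  using assms(1)
proof (rule smooth_on_alg_hull[where G = "\<lambda>h. h = f"])
  fix g assume "g = f"
  have d: "(f has_derivative f) (at x)" for x using assms(2) by (rule bounded_linear_imp_has_derivative)
  show "(\<forall>x\<in>S. g differentiable at x) \<and> (\<forall>b\<in>Basis. \<exists>h. alg_hull (\<lambda>h. h = f) h \<and> (\<forall>x\<in>S. pd b g x = h x))"
    using d pd_eqI[OF d] alg_hull.const[of "\<lambda>h. h = f"] \<open>g = f\<close> unfolding differentiable_def by metis
qed (simp add: alg_hull.base)

lemma smooth_on_inner: "open S \<Longrightarrow> smooth_on S (\<lambda>x. x \<bullet> c)"
  by (rule smooth_on_linear) (auto intro: bounded_linear_inner_left)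

lemma has_derivative_compose_basis:
  fixes q :: "'a::euclidean_space \<Rightarrow> 'b::euclidean_space" and F :: "'b \<Rightarrow> real"
  assumes F: "F differentiable (at (q x))" and q: "\<And>i. i \<in> Basis \<Longrightarrow> (\<lambda>x. q x \<bullet> i) differentiable (at x)"
  shows "((\<lambda>x. F (q x)) has_derivative
     (\<lambda>v. \<Sum>i\<in>Basis. pd i F (q x) * frechet_derivative (\<lambda>x. q x \<bullet> i) (at x) v)) (at x)"
proof -
  define Dq where "Dq = (\<lambda>v. \<Sum>i\<in>Basis. frechet_derivative (\<lambda>x. q x \<bullet> i) (at x) v *\<^sub>R i)"
  have "(q has_derivative Dq) (at x)"
    unfolding has_derivative_componentwise_within[of q]
  proof
    fix i :: 'b assume i: "i \<in> Basis"
    have "(\<lambda>v. Dq v \<bullet> i) = frechet_derivative (\<lambda>x. q x \<bullet> i) (at x)"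
      using i unfolding Dq_def by simp
    then show "((\<lambda>x. q x \<bullet> i) has_derivative (\<lambda>x. Dq x \<bullet> i)) (at x)"
      using q[OF i] frechet_derivative_works by metis
  qed
  from has_derivative_compose[OF this F[unfolded frechet_derivative_works]]
  show ?thesis
  proof (rule has_derivative_eq_rhs, intro ext)
    fix v
    have "Dq v \<bullet> i = frechet_derivative (\<lambda>x. q x \<bullet> i) (at x) v" if "i \<in> Basis" for i
      using that unfolding Dq_def by simp
    then show "frechet_derivative F (at (q x)) (Dq v) =
        (\<Sum>i\<in>Basis. pd i F (q x) * frechet_derivative (\<lambda>x. q x \<bullet> i) (at x) v)"
      by (simp add: frechet_derivative_basis_sum[OF F, of "Dq v"] mult.commute)
  qed
qed

lemma smooth_on_compose:
  fixes q :: "'a::euclidean_space \<Rightarrow> 'b::euclidean_space" and F :: "'b \<Rightarrow> real"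
  assumes S: "open S" and F: "smooth_on T F" and q: "\<And>i. i \<in> Basis \<Longrightarrow> smooth_on S (\<lambda>x. q x \<bullet> i)"
    and im: "\<And>x. x \<in> S \<Longrightarrow> q x \<in> T"
  shows "smooth_on S (\<lambda>x. F (q x))"
proof -
  \<comment> \<open>The chain rule produces derivatives of the outer function, pulled back by
    \<open>q\<close>, times derivatives of the coordinates of \<open>q\<close>; both kinds are taken
    as generators.\<close>
  define G where "G = (\<lambda>h. smooth_on S h \<or> (\<exists>H. smooth_on T H \<and> h = (\<lambda>x. H (q x))))"
  show ?thesis
    using S
  proof (rule smooth_on_alg_hull[where G = G])
    fix h assume "G h"
    then consider "smooth_on S h" | H where "smooth_on T H" "h = (\<lambda>x. H (q x))" unfolding G_def by blast
    then show "(\<forall>x\<in>S. h differentiable at x) \<and> (\<forall>b\<in>Basis. \<exists>g. alg_hull G g \<and> (\<forall>x\<in>S. pd b h x = g x))"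
    proof cases
      case 1
      then have "G (pd b h)" if "b \<in> Basis" for b using that smooth_on_pd unfolding G_def by blast
      then show ?thesis using 1 smooth_on_differentiable alg_hull.base by metis
    next
      case 2
      have d: "((\<lambda>x. H (q x)) has_derivative
         (\<lambda>v. \<Sum>i\<in>Basis. pd i H (q x) * frechet_derivative (\<lambda>x. q x \<bullet> i) (at x) v)) (at x)" if "x \<in> S" for x
        using that by (intro has_derivative_compose_basis smooth_on_differentiable[OF 2(1)]
          smooth_on_differentiable[OF q] im)
      have "G (\<lambda>x. pd i H (q x))" "G (pd b (\<lambda>x. q x \<bullet> i))" if "i \<in> Basis" "b \<in> Basis" for i b
        using smooth_on_pd[OF 2(1) that(1)] smooth_on_pd[OF q[OF that(1)] that(2)] unfolding G_def by auto
      then have "alg_hull G (\<lambda>x. \<Sum>i\<in>Basis. pd i H (q x) * pd b (\<lambda>x. q x \<bullet> i) x)" if "b \<in> Basis" for b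
        using that by (intro alg_hull_sum alg_hull.mult alg_hull.base) auto
      moreover have "pd b h x = (\<Sum>i\<in>Basis. pd i H (q x) * pd b (\<lambda>x. q x \<bullet> i) x)" if "x \<in> S" for x b
        unfolding 2(2) by (rule pd_eqI[OF d[OF that]])
      ultimately show ?thesis using d unfolding 2(2) differentiable_def by blast
    qed
  next
    show "alg_hull G (\<lambda>x. F (q x))" by (rule alg_hull.base) (use F in \<open>auto simp: G_def\<close>)
  qed
qed

text \<open>The derivative is -(1/x)^2, a polynomial in the function itself, so a single generator
  is enough.\<close>

lemma smooth_on_inverse: "smooth_on {x::real. x \<noteq> 0} inverse"
proof (rule smooth_on_alg_hull[where G = "\<lambda>h. h = inverse"])
  show "open {x::real. x \<noteq> 0}" by (simp add: open_Collect_neq)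
  have d: "(inverse has_derivative (\<lambda>v. - (inverse x * v * inverse x))) (at x)" if "x \<noteq> 0" for x :: real
    using that by (rule has_derivative_inverse')
  fix g :: "real \<Rightarrow> real" assume g: "g = inverse"
  have "alg_hull (\<lambda>h. h = inverse) (\<lambda>x. -1 * (inverse x * inverse x))"
    by (intro alg_hull.mult alg_hull.const alg_hull.base refl)
  then show "(\<forall>x\<in>{x. x \<noteq> 0}. g differentiable at x) \<and>
      (\<forall>b\<in>Basis. \<exists>h. alg_hull (\<lambda>h. h = inverse) h \<and> (\<forall>x\<in>{x. x \<noteq> 0}. pd b g x = h x))"
    using d g by (auto simp: pd_eqI[OF d] intro: differentiableI intro!: exI[of _ "\<lambda>x. -1 * (inverse x * inverse x)"])
qed (simp add: alg_hull.base)

section \<open>Flat functions, smooth steps and bumps\<close>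

definition exp_flat :: "real \<Rightarrow> real" where
  "exp_flat x = (if x > 0 then exp (- (1 / x)) else 0)"

text \<open>With y = 1/x this is the decay of p(y) exp(-y) at infinity.\<close>

lemma poly_exp_flat_tendsto_0:
  "((\<lambda>x. poly p (1 / x) * exp (- (1 / x))) \<longlongrightarrow> 0) (at_right (0::real))"
proof -
  have "((\<lambda>y. poly p y * exp (- y)) \<longlongrightarrow> 0) at_top"
  proof (induction p)
    case (pCons a p)
    have mono: "((\<lambda>y::real. y ^ k * exp (- y)) \<longlongrightarrow> 0) at_top" for k
      using tendsto_power_div_exp_0[of k] by (simp add: exp_minus field_simps)
    \<comment> \<open>The additional power \<open>y ^ k\<close> makes the induction over the
      coefficients close, since \<open>pCons\<close> multiplies the remaining polynomial by
      y.\<close>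
    have all: "((\<lambda>y. y ^ k * (poly p y * exp (- y))) \<longlongrightarrow> 0) at_top" for p :: "real poly" and k
    proof (induction p arbitrary: k)
      case (pCons a p)
      have "((\<lambda>y. a * (y ^ k * exp (- y)) + y ^ Suc k * (poly p y * exp (- y))) \<longlongrightarrow> a * 0 + 0) at_top"
        by (intro tendsto_intros mono pCons)
      then show ?case by (simp add: algebra_simps)
    qed simp
    show ?case using all[of 0 "pCons a p"] by simp
  qed simp
  then show ?thesis
    by (rule filterlim_compose) (simp add: inverse_eq_divide[symmetric] filterlim_inverse_at_top_right)
qed

lemma smooth_exp_flat: "smooth_on UNIV exp_flat"
proof -
  define E where "E p = (\<lambda>x::real. if x > 0 then poly p (1 / x) * exp (- (1 / x)) else 0)" for p
  have Edef: "E p x = (if x > 0 then poly p (1 / x) * exp (- (1 / x)) else 0)" for p x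
    unfolding E_def by simp
  \<comment> \<open>In y = 1/x one has d/dx = -y^2 d/dy, so p(y) exp(-y) turns into y^2 (p - p')(y)
    exp(-y). Thus the class of all \<open>E p\<close> is closed under differentiation.\<close>
  define D where "D p = [:0, 0, 1:] * (p - pderiv p)" for p :: "real poly"
  have der: "(E p has_real_derivative E (D p) x) (at x)" for p x
  proof -
    consider "x > 0" | "x < 0" | "x = 0" by linarith
    then show ?thesis
    proof cases
      case 1
      have "((\<lambda>x. poly p (1 / x) * exp (- (1 / x))) has_real_derivative E (D p) x) (at x)"
        unfolding Edef D_def using 1
        by (auto intro!: derivative_eq_intros poly_DERIV simp: field_simps power2_eq_square)
      then show ?thesis
        by (rule has_field_derivative_transform_within_open[where S = "{0<..}"]) (use 1 in \<open>auto simp: Edef\<close>)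
    next
      case 2
      have "((\<lambda>x. 0) has_real_derivative E (D p) x) (at x)" using 2 by (simp add: Edef)
      then show ?thesis
        by (rule has_field_derivative_transform_within_open[where S = "{..<0}"]) (use 2 in \<open>auto simp: Edef\<close>)
    next
      case 3
      \<comment> \<open>From the right the difference quotient at 0 is again a polynomial in 1/x
        times the exponential, with one more factor 1/x.\<close>
      have "((\<lambda>y. (E p y - E p 0) / (y - 0)) \<longlongrightarrow> 0) (at 0)"
      proof (rule filterlim_split_at_real)
        show "((\<lambda>y. (E p y - E p 0) / (y - 0)) \<longlongrightarrow> 0) (at_left 0)"
          by (rule tendsto_eventually) (auto simp: eventually_at_filter Edef)
        have "((\<lambda>x. poly ([:0,1:] * p) (1 / x) * exp (- (1 / x))) \<longlongrightarrow> 0) (at_right (0::real))"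
          by (rule poly_exp_flat_tendsto_0)
        then show "((\<lambda>y. (E p y - E p 0) / (y - 0)) \<longlongrightarrow> 0) (at_right 0)"
          by (rule tendsto_cong[THEN iffD1, rotated]) (auto simp: eventually_at_filter Edef)
      qed
      then show ?thesis using 3 by (simp add: has_field_derivative_iff Edef)
    qed
  qed
  have "smooth_on UNIV (E p)" for p
  proof (rule smooth_on_coinduct[where P = "\<lambda>h. \<exists>p. h = E p"])
    fix f assume "\<exists>p. f = E p"
    then obtain p where p: "f = E p" by blast
    have "pd b f x = E (D p) x" if "b \<in> Basis" for b x
      using pd_eqI[OF der[of p x, unfolded has_field_derivative_def]] p that by simp
    moreover have "f differentiable at x" for x
      using der[of p x] p real_differentiable_def by blast
    ultimately show "(\<forall>x\<in>UNIV. f differentiable at x) \<and>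
       (\<forall>b\<in>Basis. \<exists>g. (\<exists>p. g = E p) \<and> (\<forall>x\<in>UNIV. pd b f x = g x))" by blast
  qed auto
  moreover have "exp_flat = E 1" by (auto simp: E_def exp_flat_def)
  ultimately show ?thesis by metis
qed

text \<open>With the flat function e, the quotient e(x) / (e(x) + e(1 - x)) does it: x and 1 - x are
  never both nonpositive, so the denominator is positive.\<close>

lemma smooth_step_exists:
  "\<exists>\<kappa>::real \<Rightarrow> real. smooth_on UNIV \<kappa> \<and> (\<forall>x\<le>0. \<kappa> x = 0) \<and> (\<forall>x\<ge>1. \<kappa> x = 1) \<and> (\<forall>x. 0 \<le> \<kappa> x \<and> \<kappa> x \<le> 1)"
proof -
  define \<kappa> where "\<kappa> x = exp_flat x * inverse (exp_flat x + exp_flat (1 - x))" for x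
  have pos: "exp_flat x + exp_flat (1 - x) > 0" for x
    unfolding exp_flat_def using exp_gt_zero[of "-(1/x)"] exp_gt_zero[of "-(1/(1-x))"]
    by (auto simp: add_pos_pos)
  have s1: "smooth_on UNIV (\<lambda>x. exp_flat (1 - x))"
    by (rule smooth_on_compose[OF _ smooth_exp_flat]) (auto intro!: smooth_on_diff smooth_on_const smooth_on_linear[of _ "\<lambda>x. x"] bounded_linear_ident)
  have "smooth_on UNIV (\<lambda>x. inverse (exp_flat x + exp_flat (1 - x)))"
    by (rule smooth_on_compose[OF _ smooth_on_inverse])
      (use pos in \<open>auto intro!: smooth_on_add smooth_exp_flat s1 simp: less_imp_neq[THEN not_sym]\<close>)
  then have "smooth_on UNIV \<kappa>"
    unfolding \<kappa>_def by (intro smooth_on_mult smooth_exp_flat) auto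
  moreover have "0 \<le> \<kappa> x \<and> \<kappa> x \<le> 1" for x
    unfolding \<kappa>_def using pos[of x] by (auto simp: exp_flat_def field_simps)
  moreover have "\<kappa> x = 1" if "x \<ge> 1" for x
    using that pos[of x] by (auto simp: \<kappa>_def exp_flat_def)
  moreover have "\<kappa> x = 0" if "x \<le> 0" for x
    using that by (auto simp: \<kappa>_def exp_flat_def)
  ultimately show ?thesis by blast
qed

text \<open>The flat function is applied to r^2 - |x|^2, written as a sum over coordinates because
  this is visibly a polynomial.\<close>

lemma smooth_bump_exists:
  fixes r :: real assumes "r > 0"
  shows "\<exists>\<rho>::'a::euclidean_space \<Rightarrow> real. smooth_on UNIV \<rho> \<and> (\<forall>x. 0 \<le> \<rho> x) \<and> \<rho> 0 > 0 \<and> (\<forall>x. norm x \<ge> r \<longrightarrow> \<rho> x = 0)"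
proof -
  define \<rho> where "\<rho> x = exp_flat (r\<^sup>2 - (\<Sum>b\<in>Basis. (x \<bullet> b) ^ 2))" for x :: 'a
  have "smooth_on UNIV \<rho>"
    unfolding \<rho>_def by (rule smooth_on_compose[OF _ smooth_exp_flat])
      (auto intro!: smooth_on_mult smooth_on_diff smooth_on_const smooth_on_sum smooth_on_power smooth_on_inner)
  moreover have "(\<Sum>b\<in>Basis. (x \<bullet> b) ^ 2) = (norm x)\<^sup>2" for x :: 'a
    unfolding power2_norm_eq_inner by (subst euclidean_inner) (simp add: power2_eq_square)
  moreover have "\<not> (norm x)\<^sup>2 < r\<^sup>2" if "r \<le> norm x" for x :: 'a
    using power_mono[OF that less_imp_le[OF assms], where n = 2] by linarith
  ultimately show ?thesis
    using assms by (intro exI[of _ \<rho>]) (auto simp: \<rho>_def exp_flat_def)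
qed

section \<open>Symmetry of partial derivatives and integration by parts\<close>

lemma smooth_on_line_derivative:
  assumes "smooth_on S f" "y + s *\<^sub>R v \<in> S"
  shows "((\<lambda>s. f (y + s *\<^sub>R v)) has_real_derivative pd v f (y + s *\<^sub>R v)) (at s)"
proof -
  have d: "(f has_derivative frechet_derivative f (at (y + s *\<^sub>R v))) (at (y + s *\<^sub>R v))"
    using smooth_on_differentiable[OF assms] frechet_derivative_works by blast
  have "((\<lambda>s. y + s *\<^sub>R v) has_derivative (\<lambda>h. h *\<^sub>R v)) (at s)"
    by (auto intro!: derivative_eq_intros)
  from has_derivative_compose[OF this d]
  have "((\<lambda>s. f (y + s *\<^sub>R v)) has_derivative (\<lambda>h. pd (h *\<^sub>R v) f (y + s *\<^sub>R v))) (at s)" .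
  moreover have "pd (h *\<^sub>R v) f (y + s *\<^sub>R v) = pd v f (y + s *\<^sub>R v) * h" for h
    using linear_cmul[OF has_derivative_linear[OF d], of h v] by (simp add: mult.commute)
  ultimately show ?thesis unfolding has_field_derivative_def by simp
qed

text \<open>Mean value theorem twice: along \<open>i\<close> for the difference of \<open>f\<close>
  across a step in direction \<open>j\<close>, then along \<open>j\<close> for the partial
  derivative thus obtained.\<close>

lemma second_difference_mvt:
  assumes f: "smooth_on UNIV f" and ij: "i \<in> Basis" "j \<in> Basis" and h: "h > 0"
  shows "\<exists>s t. 0 < s \<and> s < h \<and> 0 < t \<and> t < h \<and>
    f (x + h *\<^sub>R i + h *\<^sub>R j) - f (x + h *\<^sub>R i) - f (x + h *\<^sub>R j) + f x
      = h * h * pd j (pd i f) (x + s *\<^sub>R i + t *\<^sub>R j)"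
proof -
  define \<phi> where "\<phi> s = f ((x + h *\<^sub>R j) + s *\<^sub>R i) - f (x + s *\<^sub>R i)" for s
  have d: "(\<phi> has_real_derivative pd i f ((x + h *\<^sub>R j) + s *\<^sub>R i) - pd i f (x + s *\<^sub>R i)) (at s)" for s
    unfolding \<phi>_def by (intro DERIV_diff smooth_on_line_derivative[OF f] UNIV_I)
  obtain s where s: "0 < s" "s < h" "\<phi> h - \<phi> 0 = (h - 0) * (pd i f ((x + h *\<^sub>R j) + s *\<^sub>R i) - pd i f (x + s *\<^sub>R i))"
    using MVT2[OF h d] by blast
  have d2: "((\<lambda>t. pd i f ((x + s *\<^sub>R i) + t *\<^sub>R j)) has_real_derivative pd j (pd i f) ((x + s *\<^sub>R i) + t *\<^sub>R j)) (at t)" for t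
    by (rule smooth_on_line_derivative[OF smooth_on_pd[OF f ij(1)]]) simp
  obtain t where t: "0 < t" "t < h" "pd i f ((x + s *\<^sub>R i) + h *\<^sub>R j) - pd i f ((x + s *\<^sub>R i) + 0 *\<^sub>R j) = (h - 0) * pd j (pd i f) ((x + s *\<^sub>R i) + t *\<^sub>R j)"
    using MVT2[OF h d2] by blast
  show ?thesis
  proof (intro exI conjI)
    have e: "x + h *\<^sub>R j + s *\<^sub>R i = x + s *\<^sub>R i + h *\<^sub>R j" "x + h *\<^sub>R j + h *\<^sub>R i = x + h *\<^sub>R i + h *\<^sub>R j" by simp_all
    have "f (x + h *\<^sub>R i + h *\<^sub>R j) - f (x + h *\<^sub>R i) - f (x + h *\<^sub>R j) + f x = \<phi> h - \<phi> 0"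
      unfolding \<phi>_def e by simp
    also have "\<dots> = h * (h * pd j (pd i f) (x + s *\<^sub>R i + t *\<^sub>R j))"
      using s(3) t(3) unfolding e by simp
    finally show "f (x + h *\<^sub>R i + h *\<^sub>R j) - f (x + h *\<^sub>R i) - f (x + h *\<^sub>R j) + f x
      = h * h * pd j (pd i f) (x + s *\<^sub>R i + t *\<^sub>R j)" by simp
  qed (use s t in auto)
qed

text \<open>The second difference is symmetric in \<open>i\<close> and \<open>j\<close>, and over
  small squares both mixed derivatives have a value near \<open>x\<close> that equals it divided by
  h^2. Continuity of the mixed derivatives does the rest.\<close>

lemma pd_commute:
  assumes f: "smooth_on UNIV f" and ij: "i \<in> Basis" "j \<in> Basis"
  shows "pd i (pd j f) x = pd j (pd i f) x"
proof (rule ccontr)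
  assume ne: "pd i (pd j f) x \<noteq> pd j (pd i f) x"
  define e where "e = dist (pd i (pd j f) x) (pd j (pd i f) x) / 2"
  have e: "e > 0" using ne by (simp add: e_def)
  have near: "\<exists>d>0. \<forall>y. dist y x < d \<longrightarrow> dist (pd k (pd l f) y) (pd k (pd l f) x) < e"
    if "k \<in> Basis" "l \<in> Basis" for k l
    using smooth_on_continuous_on[OF smooth_on_pd[OF smooth_on_pd[OF f that(2)] that(1)]] e
    unfolding continuous_on_iff by auto
  obtain d1 where d1: "d1 > 0" "\<And>y. dist y x < d1 \<Longrightarrow> dist (pd i (pd j f) y) (pd i (pd j f) x) < e"
    using near[OF ij] by blast
  obtain d2 where d2: "d2 > 0" "\<And>y. dist y x < d2 \<Longrightarrow> dist (pd j (pd i f) y) (pd j (pd i f) x) < e"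
    using near[OF ij(2,1)] by blast
  \<comment> \<open>A third of the radius leaves room for two steps of length below
    \<open>h\<close>.\<close>
  define h where "h = min d1 d2 / 3"
  have h: "h > 0" using d1 d2 by (simp add: h_def)
  obtain s t where st: "0 < s" "s < h" "0 < t" "t < h"
    "f (x + h *\<^sub>R i + h *\<^sub>R j) - f (x + h *\<^sub>R i) - f (x + h *\<^sub>R j) + f x = h * h * pd j (pd i f) (x + s *\<^sub>R i + t *\<^sub>R j)"
    using second_difference_mvt[OF f ij h] by blast
  obtain s' t' where st': "0 < s'" "s' < h" "0 < t'" "t' < h"
    "f (x + h *\<^sub>R j + h *\<^sub>R i) - f (x + h *\<^sub>R j) - f (x + h *\<^sub>R i) + f x = h * h * pd i (pd j f) (x + s' *\<^sub>R j + t' *\<^sub>R i)"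
    using second_difference_mvt[OF f ij(2,1) h] by blast
  have "h * h * pd j (pd i f) (x + s *\<^sub>R i + t *\<^sub>R j) = h * h * pd i (pd j f) (x + s' *\<^sub>R j + t' *\<^sub>R i)"
    unfolding st(5)[symmetric] st'(5)[symmetric] by (simp add: algebra_simps)
  then have eq: "pd j (pd i f) (x + s *\<^sub>R i + t *\<^sub>R j) = pd i (pd j f) (x + s' *\<^sub>R j + t' *\<^sub>R i)"
    using h by simp
  have nb: "dist (x + s *\<^sub>R k + t *\<^sub>R l) x < min d1 d2" if "k \<in> Basis" "l \<in> Basis" "0 < s" "s < h" "0 < t" "t < h" for k l s t
  proof -
    have "dist (x + s *\<^sub>R k + t *\<^sub>R l) x \<le> norm (s *\<^sub>R k) + norm (t *\<^sub>R l)"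
      using norm_triangle_ineq[of "s *\<^sub>R k" "t *\<^sub>R l"] by (simp add: dist_norm add.assoc)
    also have "\<dots> < 2 * h" using that by simp
    also have "2 * h < 3 * h" using h by simp
    finally show ?thesis by (simp add: h_def)
  qed
  have "dist (pd j (pd i f) (x + s *\<^sub>R i + t *\<^sub>R j)) (pd j (pd i f) x) < e"
    using d2(2)[of "x + s *\<^sub>R i + t *\<^sub>R j"] nb[OF ij st(1-4)] by simp
  moreover have "dist (pd i (pd j f) (x + s' *\<^sub>R j + t' *\<^sub>R i)) (pd i (pd j f) x) < e"
    using d1(2)[of "x + s' *\<^sub>R j + t' *\<^sub>R i"] nb[OF ij(2,1) st'(1-4)] by simp
  ultimately have "dist (pd i (pd j f) x) (pd j (pd i f) x) < e + e"
    unfolding eq using dist_triangle2[of "pd i (pd j f) x" "pd j (pd i f) x" "pd i (pd j f) (x + s' *\<^sub>R j + t' *\<^sub>R i)"]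
    by (simp add: dist_commute)
  then show False unfolding e_def by simp
qed

lemma iter_pderiv_pull:
  assumes "smooth_on UNIV f" "set cs \<subseteq> Basis" "b \<in> set cs"
  shows "iter_pderiv cs f = iter_pderiv (b # remove1 b cs) f"
  using assms(2,3)
proof (induction cs)
  case (Cons c cs)
  show ?case
  proof (cases "c = b")
    case False
    then have ih: "iter_pderiv cs f = iter_pderiv (b # remove1 b cs) f" using Cons by auto
    have "set (remove1 b cs) \<subseteq> Basis" using Cons.prems set_remove1_subset[of b cs] by auto
    from pd_commute[OF smooth_on_iter[OF assms(1) this]]
    show ?thesis using False Cons.prems ih by auto
  qed auto
qed simp

text \<open>By symmetry only the multiset of directions counts, so the list picked by
  \<open>SOME\<close> in \<open>pderiv_mi\<close> may be replaced by any other.\<close>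

lemma iter_pderiv_mset_cong:
  assumes "smooth_on UNIV f" "set bs \<subseteq> Basis" "mset bs = mset cs"
  shows "iter_pderiv bs f = iter_pderiv cs f"
  using assms(2,3)
proof (induction bs arbitrary: cs)
  case (Cons b bs)
  then have cs: "set cs \<subseteq> Basis" "b \<in> set cs" by (metis mset_eq_setD, metis list.set_intros(1) mset_eq_setD)
  have "mset bs = mset (remove1 b cs)" using Cons.prems(2) by (metis add_mset_remove_trivial mset.simps(2) mset_remove1)
  then have "iter_pderiv bs f = iter_pderiv (remove1 b cs) f" using Cons by simp
  then show ?case using iter_pderiv_pull[OF assms(1) cs] by simp
qed auto

lemma pderiv_mi_eq:
  assumes f: "smooth_on UNIV f" and bs: "set bs \<subseteq> Basis" "\<And>b. b \<in> Basis \<Longrightarrow> count_list bs b = \<alpha> b"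
  shows "pderiv_mi \<alpha> f = iter_pderiv bs f"
proof -
  define cs where "cs = (SOME bs. set bs \<subseteq> Basis \<and> (\<forall>b\<in>Basis. count_list bs b = \<alpha> b))"
  have cs: "set cs \<subseteq> Basis \<and> (\<forall>b\<in>Basis. count_list cs b = \<alpha> b)"
    unfolding cs_def by (rule someI[where x = bs]) (use bs in auto)
  have z: "count_list bs x = 0" "count_list cs x = 0" if "x \<notin> Basis" for x
    using that cs bs(1) by (auto simp del: count_list_0_iff intro!: count_notin)
  have "mset cs = mset bs"
  proof (rule multiset_eqI)
    fix x show "count (mset cs) x = count (mset bs) x"
      by (cases "x \<in> Basis") (use cs bs z in \<open>auto simp: count_mset simp del: count_list_0_iff\<close>)
  qed
  then show ?thesis
    unfolding pderiv_mi_def cs_def[symmetric] using iter_pderiv_mset_cong[OF f, of cs bs] cs by blast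
qed

text \<open>Derivatives are iterated along lists of directions, which is the working form below;
  this map leads back to the multi-indices of the statement.\<close>

definition mi_of :: "'a list \<Rightarrow> 'a \<Rightarrow> nat" where "mi_of bs = count_list bs"

lemma sum_count_list: "set bs \<subseteq> Basis \<Longrightarrow> (\<Sum>b\<in>Basis. count_list bs b) = length (bs :: 'a::euclidean_space list)"
  by (metis finite_Basis sum_count_set)

lemma mi_of_multi_indices: "set bs \<subseteq> Basis \<Longrightarrow> mi_of bs \<in> multi_indices (length bs)"
  unfolding multi_indices_def mi_of_def by (auto simp: sum_count_list count_list_0_iff)

lemma multi_indices_list:
  assumes "\<alpha> \<in> multi_indices n"
  obtains bs :: "'a::euclidean_space list" where "set bs \<subseteq> Basis" "length bs = n" "\<alpha> = mi_of bs"
proof -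
  define M where "M = (\<Sum>b\<in>(Basis::'a set). replicate_mset (\<alpha> b) b)"
  obtain bs where bs: "mset bs = M" using ex_mset by blast
  have cnt: "count M b = (if b \<in> Basis then \<alpha> b else 0)" for b
    unfolding M_def by (simp add: count_sum sum.delta' if_distrib[of "\<lambda>x. count (replicate_mset x _) _"] cong: if_cong)
  then have al: "\<alpha> = mi_of bs"
    using assms bs unfolding multi_indices_def mi_of_def by (auto simp: fun_eq_iff count_mset[symmetric])
  have sub: "set bs \<subseteq> Basis" using bs cnt by (metis count_eq_zero_iff set_mset_mset subsetI)
  have "length bs = n" using sub al assms sum_count_list[OF sub] unfolding multi_indices_def mi_of_def by simp
  with al sub that show thesis by blast
qed

lemma pderiv_mi_mi_of: "smooth_on UNIV f \<Longrightarrow> set bs \<subseteq> Basis \<Longrightarrow> pderiv_mi (mi_of bs) f = iter_pderiv bs f"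
  by (rule pderiv_mi_eq) (auto simp: mi_of_def)

lemma mi_of_rev: "mi_of (rev bs) = mi_of bs"
  by (auto simp: mi_of_def)

text \<open>Translation invariance makes the integrals of the difference quotients vanish.\<close>

lemma integral_pd_zero:
  fixes F :: "'a::euclidean_space \<Rightarrow> real"
  assumes F: "smooth_on UNIV F" and R: "\<And>x. R \<le> norm x \<Longrightarrow> F x = 0" and b: "b \<in> Basis"
  shows "integrable lborel (pd b F)" "(\<integral>x. pd b F x \<partial>lborel) = 0"
proof -
  \<comment> \<open>A margin of one, because the difference quotients use steps of length at most
    one.\<close>
  define R' where "R' = \<bar>R\<bar> + 1"
  have R': "F x = 0" if "R' - 1 \<le> norm x" for x using R that unfolding R'_def by auto
  have contF: "continuous_on UNIV F" and contP: "continuous_on UNIV (pd b F)"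
    using F b smooth_on_continuous_on smooth_on_pd by blast+
  have Fb: "F \<in> borel_measurable borel" by (rule borel_measurable_continuous_onI[OF contF])
  have Pb: "pd b F \<in> borel_measurable borel" by (rule borel_measurable_continuous_onI[OF contP])
  have "compact (pd b F ` cball 0 (R' + 1))"
    by (intro compact_continuous_image continuous_on_subset[OF contP]) auto
  then have "bounded (pd b F ` cball 0 (R' + 1))" by (rule compact_imp_bounded)
  then obtain C where C: "\<And>x. x \<in> cball 0 (R' + 1) \<Longrightarrow> norm (pd b F x) \<le> C"
    unfolding bounded_iff by blast
  define h where "h n = 1 / real (Suc n)" for n
  have h: "h n > 0" "h n \<le> 1" for n unfolding h_def by auto
  define D where "D n x = (F (x + h n *\<^sub>R b) - F x) / h n" for n x
  have lim: "(\<lambda>n. D n x) \<longlonglongrightarrow> pd b F x" for x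
  proof -
    have "((\<lambda>s. F (x + s *\<^sub>R b)) has_real_derivative pd b F (x + 0 *\<^sub>R b)) (at 0)"
      by (rule smooth_on_line_derivative[OF F]) simp
    then have "((\<lambda>s. (F (x + s *\<^sub>R b) - F x) / s) \<longlongrightarrow> pd b F x) (at 0)"
      unfolding has_field_derivative_iff by simp
    moreover have "filterlim h (at 0) sequentially"
      unfolding filterlim_at using h lim_inverse_n' LIMSEQ_inverse_real_of_nat
      by (auto simp: h_def[abs_def] inverse_eq_divide add.commute intro!: always_eventually)
    ultimately show ?thesis unfolding D_def by (rule filterlim_compose)
  qed
  \<comment> \<open>Mean value theorem inside the ball; outside it both values of \<open>F\<close>
    vanish. The result is the dominating function.\<close>
  have bound: "norm (D n x) \<le> indicator (cball 0 R') x *\<^sub>R C" for n x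
  proof (cases "x \<in> cball 0 R'")
    case True
    have "\<exists>z. 0 < z \<and> z < h n \<and> F (x + h n *\<^sub>R b) - F (x + 0 *\<^sub>R b) = (h n - 0) * pd b F (x + z *\<^sub>R b)"
      by (rule MVT2[where f = "\<lambda>s. F (x + s *\<^sub>R b)", OF h(1)])
        (rule smooth_on_line_derivative[OF F UNIV_I])
    then obtain z where z: "0 < z" "z < h n" "F (x + h n *\<^sub>R b) - F x = h n * pd b F (x + z *\<^sub>R b)" by auto
    have "norm (x + z *\<^sub>R b) \<le> R' + 1"
      using norm_triangle_ineq[of x "z *\<^sub>R b"] True z h(2)[of n] b by simp
    then have "norm (pd b F (x + z *\<^sub>R b)) \<le> C" by (intro C) simp
    then show ?thesis using True z h(1)[of n] unfolding D_def by simp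
  next
    case False
    then have "norm x > R'" by simp
    moreover have "norm (x + h n *\<^sub>R b) \<ge> norm x - 1"
      using norm_triangle_ineq4[of "x + h n *\<^sub>R b" "h n *\<^sub>R b"] h[of n] b by simp
    ultimately have "F x = 0" "F (x + h n *\<^sub>R b) = 0" using R' by auto
    then show ?thesis unfolding D_def using False by simp
  qed
  have intw: "integrable lborel (\<lambda>x. indicator (cball 0 R') x *\<^sub>R C)"
    by (rule borel_integrable_compact[where f = "\<lambda>_. C"]) auto
  have Db: "D n \<in> borel_measurable lborel" for n
    unfolding D_def using Fb by measurable
  have conv: "integrable lborel (pd b F)" "(\<lambda>n. \<integral>x. D n x \<partial>lborel) \<longlonglongrightarrow> (\<integral>x. pd b F x \<partial>lborel)"
    using integrable_dominated_convergence[of "pd b F" lborel D, OF _ Db intw]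
      integral_dominated_convergence[of "pd b F" lborel D, OF _ Db intw] lim bound Pb by auto
  have Fint: "integrable lborel F"
  proof -
    have "integrable lborel (\<lambda>x. indicator (cball 0 R') x *\<^sub>R F x)"
      by (rule borel_integrable_compact) (auto intro: continuous_on_subset[OF contF])
    also have "(\<lambda>x. indicator (cball 0 R') x *\<^sub>R F x) = F"
      using R' by (auto simp: indicator_def fun_eq_iff)
    finally show ?thesis .
  qed
  have "(\<integral>x. D n x \<partial>lborel) = 0" for n
  proof -
    have eq: "(\<integral>x. F (h n *\<^sub>R b + x) \<partial>lborel) = (\<integral>x. F x \<partial>lborel)"
      using integral_distr[of "(+) (h n *\<^sub>R b)" lborel borel F] Fb by (simp add: lborel_distr_plus)
    have "integrable lborel (\<lambda>x. F (h n *\<^sub>R b + x))"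
      using integrable_distr_eq[of "(+) (h n *\<^sub>R b)" lborel borel F] Fb Fint by (simp add: lborel_distr_plus)
    then show ?thesis unfolding D_def using eq Fint by (simp add: add.commute)
  qed
  then show "integrable lborel (pd b F)" "(\<integral>x. pd b F x \<partial>lborel) = 0"
    using conv LIMSEQ_unique[OF conv(2), of 0] by auto
qed

section \<open>Integration by parts and classical derivatives as weak ones\<close>

lemma test_fun_pd:
  assumes "test_fun U \<phi>" "b \<in> Basis" shows "test_fun U (pd b \<phi>)"
proof -
  obtain K where K: "compact K" "K \<subseteq> U" "\<And>x. x \<notin> K \<Longrightarrow> \<phi> x = 0" using assms unfolding test_fun_def by blast
  have "pd b \<phi> x = 0" if "x \<notin> K" for x
    using frechet_derivative_cong_open[of "- K" x \<phi> "\<lambda>_. 0"] K that compact_imp_closed[OF K(1)] by (simp add: open_Compl)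
  then show ?thesis using assms K smooth_on_pd unfolding test_fun_def smooth_iff by blast
qed

text \<open>Two open sets cover the space: \<open>U\<close>, where the function is a smooth product,
  and the complement of \<open>K\<close>, where it is zero.\<close>

lemma smooth_on_zero_extend:
  assumes U: "open U" and u: "smooth_on U u" and phi: "smooth_on UNIV \<phi>" and K: "closed K" "K \<subseteq> U" "\<And>x. x \<notin> K \<Longrightarrow> \<phi> x = 0"
  shows "smooth_on UNIV (\<lambda>x. if x \<in> U then u x * \<phi> x else 0)" (is "smooth_on UNIV ?F")
proof -
  have "smooth_on U ?F"
    by (rule smooth_on_cong[OF U, of "\<lambda>x. u x * \<phi> x"])
      (auto intro: smooth_on_mult U u smooth_on_subset[OF phi])
  moreover have "smooth_on (-K) ?F"
    by (rule smooth_on_cong[of _ "\<lambda>_. 0"]) (use K in \<open>auto intro: smooth_on_const\<close>)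
  ultimately have "smooth_on (U \<union> -K) ?F" by (rule smooth_on_Un)
  moreover have "U \<union> -K = UNIV" using K by auto
  ultimately show ?thesis by simp
qed

lemma set_integral_eq_lborel:
  fixes f :: "'a::euclidean_space \<Rightarrow> real"
  assumes "continuous_on UNIV f'" "\<And>x. x \<in> U \<Longrightarrow> f x = f' x" "\<And>x. x \<notin> U \<Longrightarrow> f' x = 0"
  shows "(LINT x:U|lebesgue. f x) = (\<integral>x. f' x \<partial>lborel)"
proof -
  have "(LINT x:U|lebesgue. f x) = (\<integral>x. f' x \<partial>lebesgue)"
    unfolding set_lebesgue_integral_def using assms by (intro Bochner_Integration.integral_cong) (auto simp: indicator_def)
  also have "\<dots> = (\<integral>x. f' x \<partial>lborel)"
    using assms(1) by (intro integral_completion) (auto intro: borel_measurable_continuous_onI)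
  finally show ?thesis .
qed

text \<open>The product of \<open>u\<close> and \<open>\<phi>\<close>, extended by zero, is smooth
  on the whole space and compactly supported; the integral of its partial derivative
  vanishes.\<close>

lemma set_integral_by_parts:
  assumes U: "open U" and u: "smooth_on U u" and phi: "test_fun U \<phi>" and b: "b \<in> Basis"
  shows "(LINT x:U|lebesgue. u x * pd b \<phi> x) = - (LINT x:U|lebesgue. pd b u x * \<phi> x)"
proof -
  obtain K where K: "compact K" "K \<subseteq> U" "\<And>x. x \<notin> K \<Longrightarrow> \<phi> x = 0" and sm: "smooth_on UNIV \<phi>"
    using phi unfolding test_fun_def smooth_iff by blast
  have cK: "closed K" using K compact_imp_closed by blast
  have pK: "pd b \<phi> x = 0" if "x \<notin> K" for x
    using frechet_derivative_cong_open[of "- K" x \<phi> "\<lambda>_. 0"] K that cK by (simp add: open_Compl)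
  define F where "F x = (if x \<in> U then u x * \<phi> x else 0)" for x
  define G where "G x = (if x \<in> U then u x * pd b \<phi> x else 0)" for x
  define H where "H x = (if x \<in> U then pd b u x * \<phi> x else 0)" for x
  have F: "smooth_on UNIV F" unfolding F_def by (rule smooth_on_zero_extend[OF U u sm cK K(2,3)])
  have G: "smooth_on UNIV G" unfolding G_def by (rule smooth_on_zero_extend[OF U u smooth_on_pd[OF sm b] cK K(2) pK])
  have H: "smooth_on UNIV H" unfolding H_def by (rule smooth_on_zero_extend[OF U smooth_on_pd[OF u b] sm cK K(2,3)])
  have pF: "pd b F x = G x + H x" for x
  proof (cases "x \<in> U")
    case True
    have "frechet_derivative F (at x) = frechet_derivative (\<lambda>x. u x * \<phi> x) (at x)"
      by (rule frechet_derivative_cong_open[OF U True]) (simp add: F_def)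
    then show ?thesis using True pd_mult[of u x \<phi> b] smooth_on_differentiable[OF u] smooth_on_differentiable[OF sm]
      by (simp add: G_def H_def)
  next
    case False
    then have "x \<in> -K" using K by auto
    then have "frechet_derivative F (at x) = frechet_derivative (\<lambda>x. 0) (at x)"
      using cK K by (intro frechet_derivative_cong_open[of "-K"]) (auto simp: F_def)
    then show ?thesis using False by (simp add: G_def H_def)
  qed
  obtain R where R: "\<And>x. x \<in> K \<Longrightarrow> norm x < R"
    using compact_imp_bounded[OF K(1)] unfolding bounded_pos_less by blast
  have z: "F x = 0" "G x = 0" "H x = 0" if "R \<le> norm x" for x
    using R[of x] K(3)[of x] pK[of x] that by (auto simp: F_def G_def H_def)
  have int: "integrable lborel f" if "smooth_on UNIV f" "\<And>x. R \<le> norm x \<Longrightarrow> f x = 0" for f :: "'a \<Rightarrow> real"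
  proof -
    have "integrable lborel (\<lambda>x. indicator (cball 0 R) x *\<^sub>R f x)"
      by (rule borel_integrable_compact) (auto intro: continuous_on_subset[OF smooth_on_continuous_on[OF that(1)]])
    also have "(\<lambda>x. indicator (cball 0 R) x *\<^sub>R f x) = f"
      using that(2) by (auto simp: indicator_def fun_eq_iff)
    finally show ?thesis .
  qed
  have "0 = (\<integral>x. G x + H x \<partial>lborel)"
    using integral_pd_zero(2)[OF F z(1) b] unfolding pF by simp
  also have "\<dots> = (\<integral>x. G x \<partial>lborel) + (\<integral>x. H x \<partial>lborel)"
    by (intro Bochner_Integration.integral_add int G H z)
  also have "(\<integral>x. G x \<partial>lborel) = (LINT x:U|lebesgue. u x * pd b \<phi> x)"
    by (rule set_integral_eq_lborel[symmetric]) (auto simp: G_def[symmetric] smooth_on_continuous_on[OF G], auto simp: G_def)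
  also have "(\<integral>x. H x \<partial>lborel) = (LINT x:U|lebesgue. pd b u x * \<phi> x)"
    by (rule set_integral_eq_lborel[symmetric]) (auto simp: H_def[symmetric] smooth_on_continuous_on[OF H], auto simp: H_def)
  finally show ?thesis by simp
qed

lemma test_fun_iter: "test_fun U \<phi> \<Longrightarrow> set bs \<subseteq> Basis \<Longrightarrow> test_fun U (iter_pderiv bs \<phi>)"
  by (induction bs) (auto intro: test_fun_pd)

text \<open>The outermost derivative leaves \<open>\<phi>\<close> first and becomes the innermost
  one on \<open>u\<close>; this is why the list is reversed.\<close>

lemma set_integral_by_parts_iter:
  assumes U: "open U" and u: "smooth_on U u" and phi: "test_fun U \<phi>" and bs: "set bs \<subseteq> Basis"
  shows "(LINT x:U|lebesgue. u x * iter_pderiv bs \<phi> x) = (-1) ^ length bs * (LINT x:U|lebesgue. iter_pderiv (rev bs) u x * \<phi> x)"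
  using u bs
proof (induction bs arbitrary: u)
  case (Cons b bs)
  have b: "b \<in> Basis" and bs: "set bs \<subseteq> Basis" using Cons.prems by auto
  have "(LINT x:U|lebesgue. u x * iter_pderiv (b # bs) \<phi> x) = - (LINT x:U|lebesgue. pd b u x * iter_pderiv bs \<phi> x)"
    using set_integral_by_parts[OF U Cons.prems(1) test_fun_iter[OF phi bs] b] by simp
  also have "\<dots> = - ((-1) ^ length bs * (LINT x:U|lebesgue. iter_pderiv (rev bs) (pd b u) x * \<phi> x))"
    using Cons.IH[OF smooth_on_pd[OF Cons.prems(1) b] bs] by simp
  finally show ?case by (simp add: iter_pderiv_append)
qed simp

lemma L1_loc_continuous_on:
  assumes "continuous_on U u" shows "L1_loc U u"
  unfolding L1_loc_def set_integrable_def
proof (intro allI impI)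
  fix K assume "compact K \<and> K \<subseteq> U"
  then have "integrable lborel (\<lambda>x. indicator K x *\<^sub>R u x)"
    using assms by (intro borel_integrable_compact) (auto intro: continuous_on_subset)
  then show "integrable lebesgue (\<lambda>x. indicator K x *\<^sub>R u x)"
    by (subst integrable_completion) auto
qed

lemma smooth_on_has_weak_pderiv:
  assumes U: "open U" and u: "smooth_on U u" and bs: "set bs \<subseteq> Basis"
  shows "has_weak_pderiv U (mi_of bs) u (iter_pderiv bs u)"
  unfolding has_weak_pderiv_def
proof (intro conjI allI impI)
  fix \<phi> assume phi: "test_fun U \<phi>"
  then have sm: "smooth_on UNIV \<phi>" unfolding test_fun_def smooth_iff by blast
  \<comment> \<open>Reversing the list on the test function in advance undoes the reversal caused by
    the integrations by parts.\<close>
  have eq: "pderiv_mi (mi_of bs) \<phi> = iter_pderiv (rev bs) \<phi>"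
    using pderiv_mi_mi_of[OF sm, of "rev bs"] bs by (simp add: mi_of_rev)
  show "(LINT x:U|lebesgue. u x * pderiv_mi (mi_of bs) \<phi> x) =
       (- 1) ^ sum (mi_of bs) Basis * (LINT x:U|lebesgue. iter_pderiv bs u x * \<phi> x)"
    using set_integral_by_parts_iter[OF U u phi, of "rev bs"] bs
    unfolding eq by (simp add: mi_of_def sum_count_list)
qed (auto intro!: L1_loc_continuous_on smooth_on_continuous_on smooth_on_iter u bs)

section \<open>Local Lebesgue spaces and averages at scale \<open>t\<close>\<close>

lemma pred_mem_ball[measurable (raw)]:
  fixes f :: "'b \<Rightarrow> 'a::euclidean_space"
  assumes [measurable]: "f \<in> borel_measurable M"
  shows "Measurable.pred M (\<lambda>x. f x \<in> ball c R)"
  unfolding mem_ball by measurable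

text \<open>The p-th power of the L^p norm over \<open>A\<close>. It is extended-real valued, so
  that estimates and finiteness are kept apart, and taken over \<open>lborel\<close>, where Fubini's
  theorem is at hand; the value over \<open>lebesgue\<close> is the same.\<close>

definition Ip :: "real \<Rightarrow> 'a::euclidean_space set \<Rightarrow> ('a \<Rightarrow> real) \<Rightarrow> ennreal" where
  "Ip p A f = (\<integral>\<^sup>+x. ennreal (\<bar>f x\<bar> powr p) * indicator A x \<partial>lborel)"

lemma Ip_mono: "A \<subseteq> B \<Longrightarrow> Ip p A f \<le> Ip p B f"
  unfolding Ip_def by (intro nn_integral_mono mult_left_mono) (auto split: split_indicator)

lemma Ip_le: "0 \<le> p \<Longrightarrow> (\<And>x. x \<in> A \<Longrightarrow> \<bar>f x\<bar> \<le> \<bar>g x\<bar>) \<Longrightarrow> Ip p A f \<le> Ip p A g"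
  unfolding Ip_def by (intro nn_integral_mono) (auto split: split_indicator intro!: ennreal_leI powr_mono2)

lemma Ip_cong: "(\<And>x. x \<in> A \<Longrightarrow> f x = g x) \<Longrightarrow> Ip p A f = Ip p A g"
  unfolding Ip_def by (intro nn_integral_cong) (auto split: split_indicator)

lemma Ip_cong_AE: "(AE x in lborel. x \<in> A \<longrightarrow> f x = g x) \<Longrightarrow> Ip p A f = Ip p A g"
  unfolding Ip_def by (intro nn_integral_cong_AE) (auto elim!: eventually_mono split: split_indicator)

lemma Ip_cmult:
  assumes [measurable]: "f \<in> borel_measurable borel" "A \<in> sets borel"
  shows "Ip p A (\<lambda>x. c * f x) = ennreal (\<bar>c\<bar> powr p) * Ip p A f"
  unfolding Ip_def
  by (subst nn_integral_cmult[symmetric]) (auto simp: abs_mult powr_mult ennreal_mult mult.assoc)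

section \<open>Convexity inequalities for p-th powers\<close>

lemma powr_add_le:
  fixes x y p :: real
  assumes "0 \<le> p" shows "\<bar>x + y\<bar> powr p \<le> 2 powr p * (\<bar>x\<bar> powr p + \<bar>y\<bar> powr p)"
proof -
  have "\<bar>x + y\<bar> powr p \<le> (2 * max \<bar>x\<bar> \<bar>y\<bar>) powr p"
    using assms by (intro powr_mono2) auto
  also have "\<dots> = 2 powr p * max \<bar>x\<bar> \<bar>y\<bar> powr p" by (simp add: powr_mult)
  also have "\<dots> \<le> 2 powr p * (\<bar>x\<bar> powr p + \<bar>y\<bar> powr p)"
    by (intro mult_left_mono) (auto simp: max_def)
  finally show ?thesis .
qed

lemma powr_sum_le:
  fixes f :: "'i \<Rightarrow> real"
  assumes "0 \<le> p" "finite I"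
  shows "\<bar>sum f I\<bar> powr p \<le> real (card I) powr p * (\<Sum>i\<in>I. \<bar>f i\<bar> powr p)"
proof (cases "I = {}")
  case False
  define M where "M = Max ((\<lambda>i. \<bar>f i\<bar>) ` I)"
  obtain j where j: "j \<in> I" "M = \<bar>f j\<bar>"
    using Max_in[of "(\<lambda>i. \<bar>f i\<bar>) ` I"] assms False unfolding M_def
    by (metis (no_types, lifting) finite_imageI image_iff image_is_empty)
  have "\<bar>sum f I\<bar> \<le> (\<Sum>i\<in>I. \<bar>f i\<bar>)" by (rule sum_abs)
  also have "\<dots> \<le> (\<Sum>i\<in>I. M)" by (intro sum_mono) (auto simp: M_def assms)
  finally have "\<bar>sum f I\<bar> powr p \<le> (real (card I) * M) powr p"
    using assms by (intro powr_mono2) auto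
  also have "\<dots> = real (card I) powr p * \<bar>f j\<bar> powr p" using j by (simp add: powr_mult)
  also have "\<dots> \<le> real (card I) powr p * (\<Sum>i\<in>I. \<bar>f i\<bar> powr p)"
    using assms j by (intro mult_left_mono member_le_sum) auto
  finally show ?thesis .
qed simp

lemma Ip_sum:
  assumes "0 \<le> p" "finite I" and [measurable]: "A \<in> sets borel" "\<And>i. i \<in> I \<Longrightarrow> f i \<in> borel_measurable borel"
  shows "Ip p A (\<lambda>x. \<Sum>i\<in>I. f i x) \<le> ennreal (real (card I) powr p) * (\<Sum>i\<in>I. Ip p A (f i))"
proof -
  have "Ip p A (\<lambda>x. \<Sum>i\<in>I. f i x) \<le> (\<integral>\<^sup>+x. ennreal (real (card I) powr p) * (\<Sum>i\<in>I. ennreal (\<bar>f i x\<bar> powr p) * indicator A x) \<partial>lborel)"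
    unfolding Ip_def
  proof (rule nn_integral_mono)
    fix x
    have "ennreal (\<bar>\<Sum>i\<in>I. f i x\<bar> powr p) \<le> ennreal (real (card I) powr p * (\<Sum>i\<in>I. \<bar>f i x\<bar> powr p))"
      by (intro ennreal_leI powr_sum_le assms)
    also have "\<dots> = ennreal (real (card I) powr p) * (\<Sum>i\<in>I. ennreal (\<bar>f i x\<bar> powr p))"
      by (simp add: ennreal_mult sum_nonneg)
    finally show "ennreal (\<bar>\<Sum>i\<in>I. f i x\<bar> powr p) * indicator A x
       \<le> ennreal (real (card I) powr p) * (\<Sum>i\<in>I. ennreal (\<bar>f i x\<bar> powr p) * indicator A x)"
      by (auto split: split_indicator)
  qed
  also have "\<dots> = ennreal (real (card I) powr p) * (\<Sum>i\<in>I. Ip p A (f i))"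
    unfolding Ip_def by (subst nn_integral_cmult) (auto simp: nn_integral_sum)
  finally show ?thesis .
qed

lemma Ip_add:
  assumes "0 \<le> p" and [measurable]: "A \<in> sets borel" "f \<in> borel_measurable borel" "g \<in> borel_measurable borel"
  shows "Ip p A (\<lambda>x. f x + g x) \<le> ennreal (2 powr p) * (Ip p A f + Ip p A g)"
proof -
  have "Ip p A (\<lambda>x. f x + g x) \<le> (\<integral>\<^sup>+x. ennreal (2 powr p) * (ennreal (\<bar>f x\<bar> powr p) * indicator A x + ennreal (\<bar>g x\<bar> powr p) * indicator A x) \<partial>lborel)"
    unfolding Ip_def
    using powr_add_le[OF assms(1)] by (intro nn_integral_mono)
      (auto split: split_indicator simp: ennreal_mult[symmetric] ennreal_plus[symmetric] simp del: ennreal_plus intro!: ennreal_leI)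
  also have "\<dots> = ennreal (2 powr p) * (Ip p A f + Ip p A g)"
    unfolding Ip_def by (subst nn_integral_cmult) (auto simp: nn_integral_add)
  finally show ?thesis .
qed

lemma Ip_diff:
  assumes "0 \<le> p" and [measurable]: "A \<in> sets borel" "f \<in> borel_measurable borel" "g \<in> borel_measurable borel"
  shows "Ip p A (\<lambda>x. f x - g x) \<le> ennreal (2 powr p) * (Ip p A f + Ip p A g)"
  using Ip_add[of p A f "\<lambda>x. - g x"] assms by (simp add: Ip_def)

text \<open>Convexity of the p-th power: the tangent at \<open>a\<close> lies below the graph.
  Divided by a^p this is Young's inequality for y/a and 1 with the conjugate exponent p/(p -
  1).\<close>

lemma powr_tangent:
  fixes a y p :: real
  assumes p: "1 \<le> p" and a: "0 \<le> a" and y: "0 \<le> y"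
  shows "a powr p + p * a powr (p - 1) * (y - a) \<le> y powr p"
proof -
  consider "a = 0" | "a > 0" "p = 1" | "a > 0" "p > 1" using p a by linarith
  then show ?thesis
  proof cases
    case 3
    define x where "x = y / a"
    have x: "x \<ge> 0" "y = a * x" using 3 y by (auto simp: x_def)
    define q where "q = p / (p - 1)"
    have q: "q > 1" "1 / p + 1 / q = 1" using 3 by (auto simp: q_def field_simps)
    have "x * 1 \<le> x powr p / p + 1 powr q / q"
      by (rule Youngs_inequality) (use 3 q x in auto)
    moreover have "1 / q = 1 - 1 / p" using q by simp
    ultimately have "x \<le> x powr p / p + (1 - 1 / p)" by simp
    then have "p * x \<le> p * (x powr p / p + (1 - 1 / p))" using 3 by (intro mult_left_mono) auto
    also have "\<dots> = x powr p + p - 1" using 3 by (simp add: algebra_simps)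
    finally have "1 + p * (x - 1) \<le> x powr p" by (simp add: algebra_simps)
    then have "a powr p * (1 + p * (x - 1)) \<le> a powr p * x powr p" by (intro mult_left_mono) auto
    also have "a powr p * x powr p = y powr p" using 3 x by (simp add: powr_mult)
    finally have "a powr p * (1 + p * (x - 1)) \<le> y powr p" .
    moreover have "a powr p = a powr (p - 1) * a" using 3 by (simp add: powr_diff)
    ultimately show ?thesis using x by (simp add: algebra_simps)
  qed (use y in auto)
qed

lemma Lp_finite_imp_integrable:
  fixes f :: "'a::euclidean_space \<Rightarrow> real"
  assumes p: "1 \<le> p" and [measurable]: "f \<in> borel_measurable borel" "A \<in> sets borel"
    and A: "emeasure lborel A < \<infinity>" and fin: "Ip p A f < \<infinity>"
  shows "integrable lborel (\<lambda>x. \<bar>f x\<bar> powr p * indicator A x)" "integrable lborel (\<lambda>x. \<bar>f x\<bar> * indicator A x)"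
    "integrable lborel (\<lambda>x. indicator A x *\<^sub>R f x)"
proof -
  show 1: "integrable lborel (\<lambda>x. \<bar>f x\<bar> powr p * indicator A x)"
    using fin unfolding Ip_def by (intro integrableI_nonneg) (auto simp: ennreal_mult' ennreal_indicator)
  have 2: "integrable lborel (\<lambda>x. indicator A x + \<bar>f x\<bar> powr p * indicator A x)"
    using A by (intro Bochner_Integration.integrable_add 1) auto
  have "\<bar>y\<bar> \<le> 1 + \<bar>y\<bar> powr p" for y :: real
  proof (cases "\<bar>y\<bar> \<ge> 1")
    case True
    then show ?thesis using powr_mono[of 1 p "\<bar>y\<bar>"] p by simp
  next
    case False
    then show ?thesis using powr_ge_zero[of "\<bar>y\<bar>" p] by linarith
  qed
  then show "integrable lborel (\<lambda>x. \<bar>f x\<bar> * indicator A x)" "integrable lborel (\<lambda>x. indicator A x *\<^sub>R f x)"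
    by (intro Bochner_Integration.integrable_bound[OF 2]; simp add: indicator_def)+
qed

text \<open>The tangent inequality at the mean of |f| over \<open>A\<close>, integrated over
  \<open>A\<close>, bounds the p-th power of that mean; the kernel enters through its sup norm
  \<open>B\<close> only.\<close>

lemma jensen_kernel:
  fixes f \<psi> :: "'a::euclidean_space \<Rightarrow> real"
  assumes p: "1 \<le> p" and [measurable]: "f \<in> borel_measurable borel" "\<psi> \<in> borel_measurable borel" "A \<in> sets borel"
    and A: "emeasure lborel A < \<infinity>" "measure lborel A > 0" and B: "B > 0" "\<And>x. \<bar>\<psi> x\<bar> \<le> B * indicator A x"
  shows "ennreal (\<bar>\<integral>x. \<psi> x * f x \<partial>lborel\<bar> powr p)
    \<le> ennreal (B powr p * measure lborel A powr (p - 1)) * Ip p A f"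
proof (cases "Ip p A f = \<infinity>")
  case True
  then show ?thesis using A B by (simp add: ennreal_mult_top)
next
  case False
  note int = Lp_finite_imp_integrable[OF p, of f A, OF _ _ A(1)]
  have i1: "integrable lborel (\<lambda>x. \<bar>f x\<bar> powr p * indicator A x)" and i2: "integrable lborel (\<lambda>x. \<bar>f x\<bar> * indicator A x)"
    using int False by (auto simp: less_top)
  define \<mu> where "\<mu> = measure lborel A"
  define F where "F = (\<integral>x. \<bar>f x\<bar> powr p * indicator A x \<partial>lborel)"
  define a where "a = (\<integral>x. \<bar>f x\<bar> * indicator A x \<partial>lborel) / \<mu>"
  have mu: "\<mu> > 0" using A by (simp add: \<mu>_def)
  have a0: "a \<ge> 0" unfolding a_def using mu by (intro divide_nonneg_pos integral_nonneg_AE) auto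
  have iA: "integrable lborel (indicator A :: 'a \<Rightarrow> real)" using A by simp
  have eqs: "(\<integral>x. (a powr p - p * a powr (p - 1) * a) * indicator A x + p * a powr (p - 1) * (\<bar>f x\<bar> * indicator A x) \<partial>lborel)
     = (a powr p - p * a powr (p - 1) * a) * \<mu> + p * a powr (p - 1) * (a * \<mu>)"
    using i2 iA mu by (simp add: \<mu>_def[symmetric] a_def)
  have "(\<integral>x. (a powr p - p * a powr (p - 1) * a) * indicator A x + p * a powr (p - 1) * (\<bar>f x\<bar> * indicator A x) \<partial>lborel) \<le> F"
    unfolding F_def
  proof (rule integral_mono)
    show "integrable lborel (\<lambda>x. (a powr p - p * a powr (p - 1) * a) * indicator A x + p * a powr (p - 1) * (\<bar>f x\<bar> * indicator A x))"
      using i2 iA by (intro Bochner_Integration.integrable_add integrable_mult_right)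
    fix x show "(a powr p - p * a powr (p - 1) * a) * indicator A x + p * a powr (p - 1) * (\<bar>f x\<bar> * indicator A x)
      \<le> \<bar>f x\<bar> powr p * indicator A x"
      using powr_tangent[OF p a0, of "\<bar>f x\<bar>"] by (auto split: split_indicator simp: algebra_simps)
  qed (rule i1)
  then have aF: "a powr p * \<mu> \<le> F" unfolding eqs by (simp add: algebra_simps)
  have "\<bar>\<integral>x. \<psi> x * f x \<partial>lborel\<bar> \<le> (\<integral>x. B * (\<bar>f x\<bar> * indicator A x) \<partial>lborel)"
  proof (rule integral_abs_bound[THEN order_trans], rule integral_mono')
    show "integrable lborel (\<lambda>x. B * (\<bar>f x\<bar> * indicator A x))" using i2 by simp
    fix x show "\<bar>\<psi> x * f x\<bar> \<le> B * (\<bar>f x\<bar> * indicator A x)"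
      using mult_right_mono[OF B(2)[of x], of "\<bar>f x\<bar>"] by (simp add: abs_mult mult.assoc mult.commute mult.left_commute)
  qed (use B in auto)
  also have "\<dots> = B * (a * \<mu>)" using mu by (simp add: a_def)
  finally have "\<bar>\<integral>x. \<psi> x * f x \<partial>lborel\<bar> powr p \<le> (B * (a * \<mu>)) powr p"
    using p by (intro powr_mono2) auto
  also have "\<dots> = B powr p * \<mu> powr (p - 1) * (a powr p * \<mu>)"
    using mu B a0 by (simp add: powr_mult powr_diff)
  also have "\<dots> \<le> B powr p * \<mu> powr (p - 1) * F" by (intro mult_left_mono aF) auto
  finally have "ennreal (\<bar>\<integral>x. \<psi> x * f x \<partial>lborel\<bar> powr p) \<le> ennreal (B powr p * \<mu> powr (p - 1) * F)"
    by (rule ennreal_leI)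
  also have "\<dots> = ennreal (B powr p * \<mu> powr (p - 1)) * ennreal F"
    unfolding F_def by (intro ennreal_mult integral_nonneg_AE) auto
  also have "ennreal F = Ip p A f"
    unfolding F_def Ip_def using i1 by (subst nn_integral_eq_integral[symmetric]) (auto simp: ennreal_mult' ennreal_indicator)
  finally show ?thesis unfolding \<mu>_def .
qed

section \<open>Affine substitutions and averages\<close>

lemma lborel_affine_change:
  fixes f :: "'a::euclidean_space \<Rightarrow> real"
  assumes c: "c \<noteq> 0" and [measurable]: "f \<in> borel_measurable borel"
  shows "integrable lborel f \<Longrightarrow> integrable lborel (\<lambda>h. f (x + c *\<^sub>R h))"
    "(\<integral>y. f y \<partial>lborel) = \<bar>c\<bar> ^ DIM('a) * (\<integral>h. f (x + c *\<^sub>R h) \<partial>lborel)"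
proof -
  have eq: "lborel = density (distr lborel borel (\<lambda>h. x + c *\<^sub>R h)) (\<lambda>_. ennreal (\<bar>c\<bar> ^ DIM('a)))"
    using lborel_affine[OF c, of x] by (simp add: ennreal_power)
  have pos: "\<bar>c\<bar> ^ DIM('a) > 0" using c by simp
  show "integrable lborel (\<lambda>h. f (x + c *\<^sub>R h))" if "integrable lborel f"
  proof -
    from that have "integrable (density (distr lborel borel (\<lambda>h. x + c *\<^sub>R h)) (\<lambda>_. ennreal (\<bar>c\<bar> ^ DIM('a)))) f"
      using eq by metis
    then have "integrable (distr lborel borel (\<lambda>h. x + c *\<^sub>R h)) (\<lambda>y. \<bar>c\<bar> ^ DIM('a) *\<^sub>R f y)"
      by (subst (asm) integrable_density) auto
    then have "integrable lborel (\<lambda>h. \<bar>c\<bar> ^ DIM('a) *\<^sub>R f (x + c *\<^sub>R h))"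
      by (subst (asm) integrable_distr_eq) auto
    then show ?thesis using pos c by simp
  qed
  have "(\<integral>y. f y \<partial>lborel) = (\<integral>y. f y \<partial>density (distr lborel borel (\<lambda>h. x + c *\<^sub>R h)) (\<lambda>_. ennreal (\<bar>c\<bar> ^ DIM('a))))"
    using eq by metis
  also have "\<dots> = (\<integral>y. \<bar>c\<bar> ^ DIM('a) *\<^sub>R f y \<partial>distr lborel borel (\<lambda>h. x + c *\<^sub>R h))"
    by (subst integral_density) auto
  also have "\<dots> = (\<integral>h. \<bar>c\<bar> ^ DIM('a) *\<^sub>R f (x + c *\<^sub>R h) \<partial>lborel)"
    by (subst integral_distr) auto
  finally show "(\<integral>y. f y \<partial>lborel) = \<bar>c\<bar> ^ DIM('a) * (\<integral>h. f (x + c *\<^sub>R h) \<partial>lborel)" by simp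
qed

lemma nn_integral_affine_change:
  fixes f :: "'a::euclidean_space \<Rightarrow> ennreal"
  assumes c: "c \<noteq> 0" and [measurable]: "f \<in> borel_measurable borel"
  shows "(\<integral>\<^sup>+y. f y \<partial>lborel) = ennreal (\<bar>c\<bar> ^ DIM('a)) * (\<integral>\<^sup>+h. f (x + c *\<^sub>R h) \<partial>lborel)"
proof -
  have eq: "lborel = density (distr lborel borel (\<lambda>h. x + c *\<^sub>R h)) (\<lambda>_. ennreal (\<bar>c\<bar> ^ DIM('a)))"
    using lborel_affine[OF c, of x] by (simp add: ennreal_power)
  have "(\<integral>\<^sup>+y. f y \<partial>lborel) = (\<integral>\<^sup>+y. f y \<partial>density (distr lborel borel (\<lambda>h. x + c *\<^sub>R h)) (\<lambda>_. ennreal (\<bar>c\<bar> ^ DIM('a))))"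
    using eq by metis
  also have "\<dots> = (\<integral>\<^sup>+y. ennreal (\<bar>c\<bar> ^ DIM('a)) * f y \<partial>distr lborel borel (\<lambda>h. x + c *\<^sub>R h))"
    by (subst nn_integral_density) auto
  also have "\<dots> = (\<integral>\<^sup>+h. ennreal (\<bar>c\<bar> ^ DIM('a)) * f (x + c *\<^sub>R h) \<partial>lborel)"
    by (subst nn_integral_distr) auto
  finally show ?thesis by (simp add: nn_integral_cmult)
qed

lemma nn_integral_shift:
  fixes f :: "'a::euclidean_space \<Rightarrow> ennreal"
  assumes [measurable]: "f \<in> borel_measurable borel"
  shows "(\<integral>\<^sup>+y. f (c + y) \<partial>lborel) = (\<integral>\<^sup>+y. f y \<partial>lborel)"
  using nn_integral_affine_change[of 1 f c] assms by simp

definition mol :: "('a::euclidean_space \<Rightarrow> real) \<Rightarrow> ('a \<Rightarrow> real) \<Rightarrow> 'a \<times> real \<Rightarrow> real" where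
  "mol \<psi> g z = (\<integral>h. \<psi> h * g (fst z + snd z *\<^sub>R h) \<partial>lebesgue)"

lemma mol_lborel:
  assumes [measurable]: "\<psi> \<in> borel_measurable borel" "g \<in> borel_measurable borel"
  shows "mol \<psi> g z = (\<integral>h. \<psi> h * g (fst z + snd z *\<^sub>R h) \<partial>lborel)"
  unfolding mol_def by (rule integral_completion) measurable

lemma mol_measurable_slice[measurable (raw)]:
  assumes [measurable]: "\<psi> \<in> borel_measurable borel" "g \<in> borel_measurable borel"
  shows "(\<lambda>x. mol \<psi> g (x, t)) \<in> borel_measurable borel"
proof -
  have "(\<lambda>x. \<integral>h. \<psi> h * g (x + t *\<^sub>R h) \<partial>lborel) \<in> borel_measurable lborel"
    by (rule lborel.borel_measurable_lebesgue_integral) measurable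
  then show ?thesis by (simp add: mol_lborel)
qed

text \<open>Borel counterpart of \<open>Lp_loc\<close>. Slices and double integrals call for Borel
  functions; general data are replaced by Borel representatives before they enter.\<close>

definition Lploc :: "real \<Rightarrow> ('a::euclidean_space \<Rightarrow> real) \<Rightarrow> bool" where
  "Lploc p g \<longleftrightarrow> g \<in> borel_measurable borel \<and> (\<forall>R. Ip p (ball 0 R) g < \<infinity>)"

definition kern :: "real \<Rightarrow> ('a::euclidean_space \<Rightarrow> real) \<Rightarrow> bool" where
  "kern r \<psi> \<longleftrightarrow> 0 < r \<and> continuous_on UNIV \<psi> \<and> (\<forall>x. r \<le> norm x \<longrightarrow> \<psi> x = 0)"

lemma kern_borel: "kern r \<psi> \<Longrightarrow> \<psi> \<in> borel_measurable borel"
  unfolding kern_def by (auto intro: borel_measurable_continuous_onI)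

lemma kern_bound:
  fixes \<psi> :: "'a::euclidean_space \<Rightarrow> real"
  assumes "kern r \<psi>" obtains B where "B > 0" "\<And>x. \<bar>\<psi> x\<bar> \<le> B * indicator (ball 0 r) x"
proof -
  have "compact (\<psi> ` cball 0 r)" using assms unfolding kern_def
    by (intro compact_continuous_image) (auto intro: continuous_on_subset)
  then obtain B where B: "B > 0" "\<And>x. x \<in> cball 0 r \<Longrightarrow> norm (\<psi> x) \<le> B"
    using compact_imp_bounded bounded_pos by (metis imageI)
  have "\<bar>\<psi> x\<bar> \<le> B * indicator (ball 0 r) x" for x
    using B(2)[of x] assms by (auto simp: kern_def indicator_def)
  then show ?thesis using B that by blast
qed

lemma kern_integrable:
  fixes \<psi> :: "'a::euclidean_space \<Rightarrow> real"
  assumes "kern r \<psi>" shows "integrable lborel \<psi>"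
proof -
  have "integrable lborel (\<lambda>x. indicator (cball 0 r) x *\<^sub>R \<psi> x)"
    using assms unfolding kern_def by (intro borel_integrable_compact) (auto intro: continuous_on_subset)
  also have "(\<lambda>x. indicator (cball 0 r) x *\<^sub>R \<psi> x) = \<psi>"
    using assms by (auto simp: kern_def indicator_def fun_eq_iff)
  finally show ?thesis .
qed

lemma Lploc_borel: "Lploc p g \<Longrightarrow> g \<in> borel_measurable borel"
  unfolding Lploc_def by blast

lemma emeasure_ball_finite: "emeasure lborel (ball (x::'a::euclidean_space) r) < \<infinity>"
  using emeasure_bounded_finite[of "ball x r"] by simp

lemma measure_ball_pos: "0 < r \<Longrightarrow> 0 < measure lborel (ball (x::'a::euclidean_space) r)"
  using content_ball_pos[of r x] by simp

lemma Lploc_integrable: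
  fixes g :: "'a::euclidean_space \<Rightarrow> real"
  assumes "1 \<le> p" "Lploc p g"
  shows "integrable lborel (\<lambda>x. indicator (ball 0 R) x *\<^sub>R g x)"
  using Lp_finite_imp_integrable(3)[OF assms(1), of g "ball 0 R"] assms(2) emeasure_ball_finite unfolding Lploc_def by auto

lemma mol_integrable:
  assumes p: "1 \<le> p" and k: "kern r \<psi>" and g: "Lploc p g" and t: "t \<noteq> 0"
  shows "integrable lborel (\<lambda>h. \<psi> h * g (x + t *\<^sub>R h))"
proof -
  obtain B where B: "B > 0" "\<And>x. \<bar>\<psi> x\<bar> \<le> B * indicator (ball 0 r) x" using kern_bound[OF k] by blast
  define R where "R = norm x + \<bar>t\<bar> * r + 1"
  note [measurable] = kern_borel[OF k] Lploc_borel[OF g]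
  have "integrable lborel (\<lambda>h. indicator (ball 0 R) (x + t *\<^sub>R h) *\<^sub>R g (x + t *\<^sub>R h))"
    by (rule lborel_affine_change(1)[OF t borel_measurable_scaleR[OF borel_measurable_indicator] Lploc_integrable[OF p g]])
      (auto intro: Lploc_borel[OF g])
  then have "integrable lborel (\<lambda>h. B * (indicator (ball 0 R) (x + t *\<^sub>R h) * g (x + t *\<^sub>R h)))" by simp
  then show ?thesis
  proof (rule Bochner_Integration.integrable_bound, measurable, intro AE_I2)
    fix h
    show "norm (\<psi> h * g (x + t *\<^sub>R h)) \<le> norm (B * (indicator (ball 0 R) (x + t *\<^sub>R h) * g (x + t *\<^sub>R h)))"
    proof (cases "norm h < r")
      case True
      have "norm (x + t *\<^sub>R h) \<le> norm x + \<bar>t\<bar> * norm h" by (metis norm_scaleR norm_triangle_ineq)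
      also have "\<bar>t\<bar> * norm h \<le> \<bar>t\<bar> * r" using True by (intro mult_left_mono) auto
      finally have "x + t *\<^sub>R h \<in> ball 0 R" unfolding R_def by simp
      moreover have "\<bar>\<psi> h\<bar> \<le> B" using B(2)[of h] True by simp
      ultimately show ?thesis using B by (simp add: abs_mult mult_right_mono)
    next
      case False
      then have "\<psi> h = 0" using k unfolding kern_def by simp
      then show ?thesis by simp
    qed
  qed
qed

text \<open>Jensen in \<open>h\<close> for fixed \<open>x\<close>, Fubini, and a translation by t h,
  which moves the ball of radius \<open>R\<close> into the one of radius
  \<open>R + \<bar>t\<bar> * r\<close>.\<close>

lemma mol_Ip_bound:
  fixes \<psi> g :: "'a::euclidean_space \<Rightarrow> real"
  assumes p: "1 \<le> p" and k: "kern r \<psi>" and B: "B > 0" "\<And>x. \<bar>\<psi> x\<bar> \<le> B * indicator (ball 0 r) x"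
    and [measurable]: "g \<in> borel_measurable borel"
  shows "Ip p (ball 0 R) (\<lambda>x. mol \<psi> g (x, t))
    \<le> ennreal (B powr p * measure lborel (ball (0::'a) r) powr p) * Ip p (ball 0 (R + \<bar>t\<bar> * r)) g"
proof -
  let ?K = "\<lambda>x h. (ennreal (\<bar>g (x + t *\<^sub>R h)\<bar> powr p) * indicator (ball 0 r) h) * indicator (ball 0 R) x"
  note [measurable] = kern_borel[OF k]
  have r: "r > 0" using k unfolding kern_def by blast
  define \<mu> where "\<mu> = measure lborel (ball (0::'a) r)"
  let ?C = "B powr p * \<mu> powr (p - 1)" and ?B = "ball (0::'a) (R + \<bar>t\<bar> * r)"
  have mu: "\<mu> > 0" using measure_ball_pos[OF r] by (simp add: \<mu>_def)
  have [measurable]: "(\<lambda>x. mol \<psi> g (x, t)) \<in> borel_measurable borel" by measurable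
  have "Ip p (ball 0 R) (\<lambda>x. mol \<psi> g (x, t)) \<le>
    (\<integral>\<^sup>+x. ennreal (?C) * (\<integral>\<^sup>+h. ?K x h \<partial>lborel) \<partial>lborel)"
    unfolding Ip_def
  proof (rule nn_integral_mono)
    fix x
    have "ennreal (\<bar>mol \<psi> g (x, t)\<bar> powr p) \<le> ennreal (?C) * Ip p (ball 0 r) (\<lambda>h. g (x + t *\<^sub>R h))"
      unfolding \<mu>_def using jensen_kernel[OF p, of "\<lambda>h. g (x + t *\<^sub>R h)" \<psi> "ball 0 r" B] B emeasure_ball_finite[of "0::'a" r] measure_ball_pos[OF r, of "0::'a"]
      by (simp add: mol_lborel less_top)
    then show "ennreal (\<bar>mol \<psi> g (x, t)\<bar> powr p) * indicator (ball 0 R) x \<le> ennreal (?C) * (\<integral>\<^sup>+h. ?K x h \<partial>lborel)"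
      unfolding Ip_def by (auto split: split_indicator)
  qed
  also have "\<dots> = ennreal (?C) * (\<integral>\<^sup>+x. (\<integral>\<^sup>+h. ?K x h \<partial>lborel) \<partial>lborel)"
    by (rule nn_integral_cmult) measurable
  also have "(\<integral>\<^sup>+x. (\<integral>\<^sup>+h. ?K x h \<partial>lborel) \<partial>lborel)
    = (\<integral>\<^sup>+h. (\<integral>\<^sup>+x. ?K x h \<partial>lborel) \<partial>lborel)"
    by (rule lborel_pair.Fubini') measurable
  also have "\<dots> \<le> (\<integral>\<^sup>+h. indicator (ball (0::'a) r) h * Ip p ?B g \<partial>lborel)"
  proof (rule nn_integral_mono)
    fix h :: 'a
    show "(\<integral>\<^sup>+x. ?K x h \<partial>lborel) \<le> indicator (ball (0::'a) r) h * Ip p ?B g"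
    proof (cases "norm h < r")
      case True
      have "(\<integral>\<^sup>+x. ennreal (\<bar>g (x + t *\<^sub>R h)\<bar> powr p) * indicator (ball 0 R) x \<partial>lborel)
        \<le> (\<integral>\<^sup>+x. ennreal (\<bar>g (t *\<^sub>R h + x)\<bar> powr p) * indicator ?B (t *\<^sub>R h + x) \<partial>lborel)"
      proof (rule nn_integral_mono)
        fix x :: 'a
        have "norm (t *\<^sub>R h + x) < R + \<bar>t\<bar> * r" if "norm x < R"
        proof -
          have "norm (t *\<^sub>R h + x) \<le> \<bar>t\<bar> * norm h + norm x" by (metis norm_scaleR norm_triangle_ineq)
          also have "\<bar>t\<bar> * norm h \<le> \<bar>t\<bar> * r" using True by (intro mult_left_mono) auto
          finally show ?thesis using that by simp
        qed
        then show "ennreal (\<bar>g (x + t *\<^sub>R h)\<bar> powr p) * indicator (ball 0 R) x \<le> ennreal (\<bar>g (t *\<^sub>R h + x)\<bar> powr p) * indicator ?B (t *\<^sub>R h + x)"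
          by (auto simp: add.commute split: split_indicator)
      qed
      also have "\<dots> = Ip p ?B g"
        unfolding Ip_def by (rule nn_integral_shift) measurable
      finally show ?thesis using True by simp
    qed simp
  qed
  also have "\<dots> = ennreal \<mu> * Ip p ?B g"
    using emeasure_eq_ennreal_measure[of lborel "ball (0::'a) r"] emeasure_ball_finite[of "0::'a" r]
    by (subst nn_integral_multc) (auto simp: \<mu>_def)
  finally have "Ip p (ball 0 R) (\<lambda>x. mol \<psi> g (x, t))
    \<le> ennreal (?C) * (ennreal \<mu> * Ip p ?B g)"
    by (simp add: mult_left_mono)
  also have "\<dots> = ennreal (?C * \<mu>) * Ip p ?B g"
    using mu by (simp add: ennreal_mult mult.assoc)
  also have "?C * \<mu> = B powr p * \<mu> powr p"
    using mu by (simp add: powr_diff)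
  finally show ?thesis unfolding \<mu>_def .
qed

section \<open>Density of continuous functions and convergence of averages\<close>

lemma tendsto_ennreal_powr_0:
  fixes f :: "'b \<Rightarrow> real"
  assumes "(f \<longlongrightarrow> 0) F" "0 < p"
  shows "((\<lambda>x. ennreal (\<bar>f x\<bar> powr p)) \<longlongrightarrow> 0) F"
proof -
  have "((\<lambda>x. \<bar>f x\<bar> powr p) \<longlongrightarrow> 0) F"
    using assms by (intro tendsto_zero_powrI[of _ _ "\<lambda>_. p" p]) (auto intro: tendsto_rabs_zero)
  then show ?thesis using tendsto_ennrealI by fastforce
qed

lemma Ip_dominated_tendsto_0:
  fixes f :: "nat \<Rightarrow> 'a::euclidean_space \<Rightarrow> real"
  assumes p: "0 < p" and [measurable]: "\<And>n. f n \<in> borel_measurable borel" "w \<in> borel_measurable borel" "A \<in> sets borel"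
    and b: "\<And>n x. x \<in> A \<Longrightarrow> \<bar>f n x\<bar> \<le> \<bar>w x\<bar>" and w: "Ip p A w < \<infinity>"
    and lim: "AE x in lborel. x \<in> A \<longrightarrow> (\<lambda>n. f n x) \<longlonglongrightarrow> 0"
  shows "(\<lambda>n. Ip p A (f n)) \<longlonglongrightarrow> 0"
proof -
  have "(\<lambda>n. \<integral>\<^sup>+x. ennreal (\<bar>f n x\<bar> powr p) * indicator A x \<partial>lborel) \<longlonglongrightarrow> (\<integral>\<^sup>+(x::'a). 0 \<partial>lborel)"
  proof (rule nn_integral_dominated_convergence[where w = "\<lambda>x. ennreal (\<bar>w x\<bar> powr p) * indicator A x"])
    show "AE x in lborel. ennreal (\<bar>f n x\<bar> powr p) * indicator A x \<le> ennreal (\<bar>w x\<bar> powr p) * indicator A x" for n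
      using b p by (intro AE_I2) (auto split: split_indicator intro!: ennreal_leI powr_mono2)
    show "AE x in lborel. (\<lambda>n. ennreal (\<bar>f n x\<bar> powr p) * indicator A x) \<longlonglongrightarrow> 0"
      using lim by eventually_elim (auto split: split_indicator intro: tendsto_ennreal_powr_0 p)
  qed (use w in \<open>auto simp: Ip_def\<close>)
  then show ?thesis unfolding Ip_def by simp
qed

lemma Ip_bounded_finite:
  fixes f :: "'a::euclidean_space \<Rightarrow> real"
  assumes "0 \<le> p" "\<And>x. x \<in> A \<Longrightarrow> \<bar>f x\<bar> \<le> M" "A \<in> sets borel" "emeasure lborel A < \<infinity>" "0 \<le> M"
  shows "Ip p A f \<le> ennreal (M powr p * measure lborel A)" "Ip p A f < \<infinity>"
proof -
  have "Ip p A f \<le> (\<integral>\<^sup>+x. ennreal (M powr p) * indicator A x \<partial>lborel)"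
    unfolding Ip_def using assms by (intro nn_integral_mono) (auto split: split_indicator intro!: ennreal_leI powr_mono2)
  also have "\<dots> = ennreal (M powr p) * emeasure lborel A" using assms by (simp add: nn_integral_cmult)
  also have "\<dots> = ennreal (M powr p * measure lborel A)"
    using assms by (simp add: emeasure_eq_ennreal_measure ennreal_mult less_top)
  finally show 1: "Ip p A f \<le> ennreal (M powr p * measure lborel A)" .
  show "Ip p A f < \<infinity>" by (rule le_less_trans[OF 1]) simp
qed

lemma Lploc_continuous:
  fixes c :: "'a::euclidean_space \<Rightarrow> real"
  assumes "continuous_on UNIV c" "0 \<le> p" shows "Lploc p c"
  unfolding Lploc_def
proof (intro conjI allI)
  show "c \<in> borel_measurable borel" using assms by (auto intro: borel_measurable_continuous_onI)
  fix R
  have "compact (c ` cball 0 R)" using assms by (intro compact_continuous_image) (auto intro: continuous_on_subset)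
  then have "bounded (c ` cball 0 R)" by (rule compact_imp_bounded)
  then obtain B where B: "B > 0" "\<And>x. x \<in> cball 0 R \<Longrightarrow> norm (c x) \<le> B"
    unfolding bounded_pos by blast
  then show "Ip p (ball 0 R) c < \<infinity>"
    using emeasure_ball_finite[of "0::'a" R] assms by (intro Ip_bounded_finite(2)[where M = B]) auto
qed

lemma Lploc_diff: "0 \<le> p \<Longrightarrow> Lploc p f \<Longrightarrow> Lploc p g \<Longrightarrow> Lploc p (\<lambda>x. f x - g x)"
  unfolding Lploc_def
  by (auto intro!: le_less_trans[OF Ip_diff] simp: ennreal_mult_less_top)

lemma ennreal_pos_between:
  assumes "0 < (a::ennreal)" obtains e :: real where "e > 0" "ennreal e < a"
proof -
  obtain b where b: "0 < b" "b < a" using dense[OF assms] by blast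
  then have "b < top" by (metis less_le_trans top_greatest)
  then show thesis using b that[of "enn2real b"] by (auto simp: enn2real_positive_iff)
qed

text \<open>The function is first truncated at a height n. The truncation is an almost everywhere
  limit of continuous functions, and truncating these as well makes dominated convergence
  applicable.\<close>

lemma Lp_continuous_approx:
  fixes g :: "'a::euclidean_space \<Rightarrow> real"
  assumes p: "1 \<le> p" and [measurable]: "g \<in> borel_measurable borel"
    and fin: "Ip p (ball 0 R) g < \<infinity>" and e: "0 < e"
  obtains c where "continuous_on UNIV c" "Ip p (ball 0 R) (\<lambda>x. g x - c x) < ennreal e"
proof -
  define \<eta> where "\<eta> = e / (4 * 2 powr p)"
  have eta: "\<eta> > 0" "2 powr p * (\<eta> + \<eta>) < e" using e by (auto simp: \<eta>_def field_simps)
  define tr where "tr n y = max (- real n) (min (real n) y)" for n y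
  have [measurable]: "tr n \<in> borel_measurable borel" for n unfolding tr_def by measurable
  have "(\<lambda>n. Ip p (ball 0 R) (\<lambda>x. g x - tr n (g x))) \<longlonglongrightarrow> 0"
  proof (rule Ip_dominated_tendsto_0[where w = g])
    show "AE x in lborel. x \<in> ball 0 R \<longrightarrow> (\<lambda>n. g x - tr n (g x)) \<longlonglongrightarrow> 0"
    proof (intro AE_I2 impI tendsto_eventually)
      fix x
      have "\<forall>n\<ge>nat \<lceil>\<bar>g x\<bar>\<rceil>. g x - tr n (g x) = 0" unfolding tr_def by (auto simp: max_def min_def)
      then show "\<forall>\<^sub>F n in sequentially. g x - tr n (g x) = 0" unfolding eventually_sequentially by blast
    qed
  qed (use p fin in \<open>auto simp: tr_def max_def min_def\<close>)
  from order_tendstoD(2)[OF this, of "ennreal \<eta>"] eta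
  obtain n where n: "Ip p (ball 0 R) (\<lambda>x. g x - tr n (g x)) < ennreal \<eta>"
    by (auto simp: eventually_sequentially)
  have "(\<lambda>x. tr n (g x)) \<in> borel_measurable lebesgue" by (intro measurable_completion) measurable
  then have "(\<lambda>x. tr n (g x)) measurable_on UNIV" by (rule lebesgue_measurable_imp_measurable_on) simp
  \<comment> \<open>Lebesgue measurability in the form of a limit of continuous functions off a
    negligible set.\<close>
  then obtain N cs where N: "negligible N" and cs: "\<And>k. continuous_on UNIV (cs k)"
      and lim: "\<And>x. x \<notin> N \<Longrightarrow> (\<lambda>k. cs k x) \<longlonglongrightarrow> tr n (g x)"
    unfolding measurable_on_def by auto
  have AEN: "AE x in lborel. x \<notin> N"
    using N AE_not_in[of N lebesgue] unfolding negligible_iff_null_sets by (simp add: AE_completion_iff)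
  have cont: "continuous_on UNIV (\<lambda>x. tr n (cs k x))" for k
    unfolding tr_def by (intro continuous_intros cs)
  have [measurable]: "cs k \<in> borel_measurable borel" for k using cs by (auto intro: borel_measurable_continuous_onI)
  have "(\<lambda>k. Ip p (ball 0 R) (\<lambda>x. tr n (g x) - tr n (cs k x))) \<longlonglongrightarrow> 0"
  proof (rule Ip_dominated_tendsto_0[where w = "\<lambda>_. 2 * real n"])
    show "\<bar>tr n (g x) - tr n (cs k x)\<bar> \<le> \<bar>2 * real n\<bar>" for k x unfolding tr_def by (auto simp: max_def min_def)
    show "Ip p (ball (0::'a) R) (\<lambda>_. 2 * real n) < \<infinity>"
      using p emeasure_ball_finite[of "0::'a" R] by (intro Ip_bounded_finite(2)[where M = "2 * real n"]) auto
    show "AE x in lborel. x \<in> ball 0 R \<longrightarrow> (\<lambda>k. tr n (g x) - tr n (cs k x)) \<longlonglongrightarrow> 0"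
      using AEN
    proof eventually_elim
      fix x assume "x \<notin> N"
      then have "(\<lambda>k. tr n (cs k x)) \<longlonglongrightarrow> tr n (tr n (g x))"
        unfolding tr_def[of n "tr n (g x)"] tr_def[of n "cs _ x"] by (intro tendsto_intros lim)
      moreover have "tr n (tr n (g x)) = tr n (g x)" unfolding tr_def by (auto simp: max_def min_def)
      ultimately show "x \<in> ball 0 R \<longrightarrow> (\<lambda>k. tr n (g x) - tr n (cs k x)) \<longlonglongrightarrow> 0"
        using tendsto_diff[OF tendsto_const[of "tr n (g x)"]] by fastforce
    qed
  qed (use p in auto)
  from order_tendstoD(2)[OF this, of "ennreal \<eta>"] eta
  obtain k where k: "Ip p (ball 0 R) (\<lambda>x. tr n (g x) - tr n (cs k x)) < ennreal \<eta>"
    by (auto simp: eventually_sequentially)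
  have "Ip p (ball 0 R) (\<lambda>x. g x - tr n (cs k x)) = Ip p (ball 0 R) (\<lambda>x. (g x - tr n (g x)) + (tr n (g x) - tr n (cs k x)))"
    by (rule Ip_cong) simp
  also have "\<dots> \<le> ennreal (2 powr p) * (Ip p (ball 0 R) (\<lambda>x. g x - tr n (g x)) + Ip p (ball 0 R) (\<lambda>x. tr n (g x) - tr n (cs k x)))"
    using p by (intro Ip_add) auto
  also have "\<dots> \<le> ennreal (2 powr p) * (ennreal \<eta> + ennreal \<eta>)"
    using n k by (intro mult_left_mono add_mono) auto
  also have "\<dots> = ennreal (2 powr p * (\<eta> + \<eta>))" using eta by (simp add: ennreal_mult ennreal_plus[symmetric] del: ennreal_plus)
  also have "\<dots> < ennreal e" using e eta(2) by (rule ennreal_lessI)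
  finally show thesis using that cont by blast
qed

lemma mol_continuous_near:
  fixes \<psi> c :: "'a::euclidean_space \<Rightarrow> real"
  assumes k: "kern r \<psi>" and B: "B > 0" "\<And>x. \<bar>\<psi> x\<bar> \<le> B * indicator (ball 0 r) x"
    and c: "continuous_on UNIV c" and s: "\<And>h. norm h < r \<Longrightarrow> \<bar>c (x + t *\<^sub>R h) - c x\<bar> \<le> s" and t: "t \<noteq> 0" and s0: "0 \<le> s"
  shows "\<bar>mol \<psi> c (x, t) - integral\<^sup>L lborel \<psi> * c x\<bar> \<le> B * measure lborel (ball (0::'a) r) * s"
proof -
  have [measurable]: "c \<in> borel_measurable borel" using c by (auto intro: borel_measurable_continuous_onI)
  note [measurable] = kern_borel[OF k]
  have i1: "integrable lborel (\<lambda>h. \<psi> h * c (x + t *\<^sub>R h))" by (rule mol_integrable[OF _ k Lploc_continuous[OF c] t, of 1]) auto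
  have i2: "integrable lborel (\<lambda>h. \<psi> h * c x)" using kern_integrable[OF k] by simp
  have "mol \<psi> c (x, t) - integral\<^sup>L lborel \<psi> * c x = (\<integral>h. \<psi> h * c (x + t *\<^sub>R h) - \<psi> h * c x \<partial>lborel)"
    using i1 i2 by (simp add: mol_lborel)
  also have "\<bar>\<dots>\<bar> \<le> (\<integral>h. (B * s) * indicator (ball (0::'a) r) h \<partial>lborel)"
  proof (rule integral_abs_bound[THEN order_trans], rule integral_mono')
    show "integrable lborel (\<lambda>h. (B * s) * indicator (ball (0::'a) r) h)" using emeasure_ball_finite[of "0::'a" r] by simp
    fix h :: 'a
    show "\<bar>\<psi> h * c (x + t *\<^sub>R h) - \<psi> h * c x\<bar> \<le> (B * s) * indicator (ball 0 r) h"
    proof (cases "norm h < r")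
      case True
      have "\<bar>\<psi> h * c (x + t *\<^sub>R h) - \<psi> h * c x\<bar> = \<bar>\<psi> h\<bar> * \<bar>c (x + t *\<^sub>R h) - c x\<bar>"
        by (metis abs_mult right_diff_distrib)
      also have "\<dots> \<le> B * s" using B(2)[of h] True B(1) by (intro mult_mono s) auto
      finally show ?thesis using True by simp
    next
      case False then show ?thesis using B(2)[of h] by simp
    qed
  qed (use B s0 in auto)
  also have "\<dots> = B * measure lborel (ball (0::'a) r) * s" by simp
  finally show ?thesis .
qed

text \<open>Density argument: for a continuous \<open>c\<close> near \<open>g\<close> the claim is
  uniform continuity on a ball, and the averages of \<open>g - c\<close> are controlled by
  \<open>mol_Ip_bound\<close> uniformly in small t.\<close>

theorem mol_tendsto:
  fixes \<psi> g :: "'a::euclidean_space \<Rightarrow> real"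
  assumes p: "1 \<le> p" and k: "kern r \<psi>" and g: "Lploc p g"
  shows "((\<lambda>t. Ip p (ball 0 R) (\<lambda>x. mol \<psi> g (x, t) - integral\<^sup>L lborel \<psi> * g x)) \<longlongrightarrow> 0) (at 0)"
proof (rule order_tendstoI)
  fix a :: ennreal assume "0 < a"
  then obtain e where e: "e > 0" "ennreal e < a" using ennreal_pos_between by blast
  obtain B where B: "B > 0" "\<And>x. \<bar>\<psi> x\<bar> \<le> B * indicator (ball 0 r) x" using kern_bound[OF k] by blast
  have r: "r > 0" using k unfolding kern_def by blast
  note [measurable] = kern_borel[OF k] Lploc_borel[OF g]
  define I where "I = integral\<^sup>L lborel \<psi>"
  define \<mu> where "\<mu> = measure lborel (ball (0::'a) r)"
  have mu: "\<mu> > 0" using measure_ball_pos[OF r] by (simp add: \<mu>_def)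
  define C where "C = B powr p * \<mu> powr p"
  define K :: real where "K = 2 powr p"
  define M where "M = measure lborel (ball (0::'a) R)"
  have KC: "K > 0" "C \<ge> 0" "M \<ge> 0" unfolding K_def C_def M_def by auto
  \<comment> \<open>The total factor with which \<eta> enters once the three parts of
    \<open>split\<close> are added up.\<close>
  define D where "D = K * (C + K * (1 + \<bar>I\<bar> powr p))"
  have D: "D > 0" unfolding D_def using KC powr_ge_zero[of "\<bar>I\<bar>" p] by (intro mult_pos_pos add_nonneg_pos add_pos_nonneg) auto
  define \<eta> where "\<eta> = e / (2 * D)"
  have eta: "\<eta> > 0" "D * \<eta> < e" unfolding \<eta>_def using e D by auto
  obtain c where c: "continuous_on UNIV c" "Ip p (ball 0 (R + r)) (\<lambda>x. g x - c x) < ennreal \<eta>"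
    using Lp_continuous_approx[OF p Lploc_borel[OF g] _ eta(1)] g unfolding Lploc_def by blast
  have [measurable]: "c \<in> borel_measurable borel" using c by (auto intro: borel_measurable_continuous_onI)
  have Lc: "Lploc p c" using c p by (intro Lploc_continuous) auto
  have Ld: "Lploc p (\<lambda>x. g x - c x)" using p by (intro Lploc_diff g Lc) auto
  \<comment> \<open>A deviation of \<open>c\<close> by \<open>s\<close> then contributes at most
    \<eta> over the ball of measure \<open>M\<close>; the summand 1 covers the case that
    \<open>M\<close> is zero.\<close>
  define s where "s = (\<eta> / (M + 1)) powr (1 / p) / (B * \<mu>)"
  have s: "s > 0" using eta KC B mu unfolding s_def by simp
  have "B * \<mu> * s = (\<eta> / (M + 1)) powr (1 / p)" unfolding s_def using B mu by simp
  then have sM: "(B * \<mu> * s) powr p * M \<le> \<eta>"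
    using p eta KC by (simp add: powr_powr field_simps mult_le_cancel_left1)
  have "uniformly_continuous_on (cball 0 (\<bar>R\<bar> + r)) c"
    by (intro compact_uniformly_continuous) (auto intro: continuous_on_subset[OF c(1)])
  then obtain d where d: "d > 0" "\<And>x y. x \<in> cball 0 (\<bar>R\<bar> + r) \<Longrightarrow> y \<in> cball 0 (\<bar>R\<bar> + r) \<Longrightarrow> dist y x < d \<Longrightarrow> dist (c y) (c x) < s"
    unfolding uniformly_continuous_on_def using s by metis
  have main: "Ip p (ball 0 R) (\<lambda>x. mol \<psi> g (x, t) - I * g x) < a" if t: "t \<noteq> 0" "\<bar>t\<bar> < min 1 (d / r)" for t
  proof -
    have tr: "\<bar>t\<bar> * r < d" "\<bar>t\<bar> * r \<le> r" using t r by (auto simp: field_simps mult_le_cancel_right1)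
    have split: "mol \<psi> g (x, t) - I * g x = mol \<psi> (\<lambda>x. g x - c x) (x, t) + ((mol \<psi> c (x, t) - I * c x) + I * (c x - g x))" for x
    proof -
      have "mol \<psi> (\<lambda>x. g x - c x) (x, t) = mol \<psi> g (x, t) - mol \<psi> c (x, t)"
        using mol_integrable[OF p k g t(1), of x] mol_integrable[OF p k Lc t(1), of x]
        by (simp add: mol_lborel right_diff_distrib)
      then show ?thesis by (simp add: algebra_simps)
    qed
    have "Ip p (ball 0 R) (\<lambda>x. mol \<psi> (\<lambda>x. g x - c x) (x, t)) \<le> ennreal C * Ip p (ball 0 (R + \<bar>t\<bar> * r)) (\<lambda>x. g x - c x)"
      unfolding C_def \<mu>_def by (rule mol_Ip_bound[OF p k B]) measurable
    also have "\<dots> \<le> ennreal C * Ip p (ball 0 (R + r)) (\<lambda>x. g x - c x)"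
      using tr by (intro mult_left_mono Ip_mono) auto
    also have "\<dots> \<le> ennreal C * ennreal \<eta>" using c by (intro mult_left_mono) auto
    finally have p1: "Ip p (ball 0 R) (\<lambda>x. mol \<psi> (\<lambda>x. g x - c x) (x, t)) \<le> ennreal C * ennreal \<eta>" .
    have "Ip p (ball 0 R) (\<lambda>x. mol \<psi> c (x, t) - I * c x) \<le> ennreal ((B * \<mu> * s) powr p * M)"
      unfolding M_def
    proof (rule Ip_bounded_finite(1))
      fix x :: 'a assume x: "x \<in> ball 0 R"
      show "\<bar>mol \<psi> c (x, t) - I * c x\<bar> \<le> B * \<mu> * s"
        unfolding I_def \<mu>_def
      proof (rule mol_continuous_near[OF k B c(1)])
        fix h :: 'a assume h: "norm h < r"
        have nt: "norm (t *\<^sub>R h) \<le> \<bar>t\<bar> * r" using h by (auto intro: mult_left_mono)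
        have "norm (x + t *\<^sub>R h) \<le> \<bar>R\<bar> + r" using norm_triangle_ineq[of x "t *\<^sub>R h"] nt tr x by simp
        moreover have "dist (x + t *\<^sub>R h) x < d" using nt tr by (simp add: dist_norm)
        ultimately have "dist (c (x + t *\<^sub>R h)) (c x) < s" using x r by (intro d(2)) auto
        then show "\<bar>c (x + t *\<^sub>R h) - c x\<bar> \<le> s" by (simp add: dist_real_def)
      qed (use t s in auto)
    qed (use p B mu s emeasure_ball_finite[of "0::'a" R] in auto)
    also have "\<dots> \<le> ennreal \<eta>" using sM by (rule ennreal_leI)
    finally have p2: "Ip p (ball 0 R) (\<lambda>x. mol \<psi> c (x, t) - I * c x) \<le> ennreal \<eta>" .
    have "Ip p (ball 0 R) (\<lambda>x. I * (c x - g x)) = ennreal (\<bar>I\<bar> powr p) * Ip p (ball 0 R) (\<lambda>x. c x - g x)"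
      by (rule Ip_cmult) measurable
    also have "Ip p (ball 0 R) (\<lambda>x. c x - g x) \<le> Ip p (ball 0 (R + r)) (\<lambda>x. g x - c x)"
      unfolding Ip_def using r by (intro nn_integral_mono) (auto simp: abs_minus_commute split: split_indicator)
    also have "\<dots> \<le> ennreal \<eta>" using c by simp
    finally have p3: "Ip p (ball 0 R) (\<lambda>x. I * (c x - g x)) \<le> ennreal (\<bar>I\<bar> powr p) * ennreal \<eta>"
      by (simp add: mult_left_mono)
    have "Ip p (ball 0 R) (\<lambda>x. mol \<psi> g (x, t) - I * g x)
      \<le> ennreal K * (Ip p (ball 0 R) (\<lambda>x. mol \<psi> (\<lambda>x. g x - c x) (x, t)) + Ip p (ball 0 R) (\<lambda>x. (mol \<psi> c (x, t) - I * c x) + I * (c x - g x)))"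
      unfolding split K_def using p by (intro Ip_add) auto
    also have "\<dots> \<le> ennreal K * (ennreal C * ennreal \<eta> + ennreal K * (ennreal \<eta> + ennreal (\<bar>I\<bar> powr p) * ennreal \<eta>))"
    proof (intro mult_left_mono add_mono p1)
      have "Ip p (ball 0 R) (\<lambda>x. (mol \<psi> c (x, t) - I * c x) + I * (c x - g x))
        \<le> ennreal K * (Ip p (ball 0 R) (\<lambda>x. mol \<psi> c (x, t) - I * c x) + Ip p (ball 0 R) (\<lambda>x. I * (c x - g x)))"
        unfolding K_def using p by (intro Ip_add) auto
      also have "\<dots> \<le> ennreal K * (ennreal \<eta> + ennreal (\<bar>I\<bar> powr p) * ennreal \<eta>)"
        by (intro mult_left_mono add_mono p2 p3) auto
      finally show "Ip p (ball 0 R) (\<lambda>x. (mol \<psi> c (x, t) - I * c x) + I * (c x - g x)) \<le> ennreal K * (ennreal \<eta> + ennreal (\<bar>I\<bar> powr p) * ennreal \<eta>)" .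
    qed auto
    also have "\<dots> = ennreal (K * (C * \<eta> + K * (\<eta> + \<bar>I\<bar> powr p * \<eta>)))"
      using KC eta by (simp add: ennreal_mult ennreal_plus)
    also have "K * (C * \<eta> + K * (\<eta> + \<bar>I\<bar> powr p * \<eta>)) = D * \<eta>" unfolding D_def by (simp add: algebra_simps)
    also have "ennreal (D * \<eta>) < ennreal e" using e(1) eta(2) by (rule ennreal_lessI)
    finally show ?thesis using e(2) by simp
  qed
  show "\<forall>\<^sub>F t in at 0. Ip p (ball 0 R) (\<lambda>x. mol \<psi> g (x, t) - integral\<^sup>L lborel \<psi> * g x) < a"
    unfolding eventually_at
    by (intro exI[of _ "min 1 (d / r)"]) (use main d r in \<open>auto simp: I_def\<close>)
qed simp

text \<open>The substitution y = x + t h moves the parameters out of \<open>g\<close>, which is only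
  measurable, into the kernel, where they can be differentiated.\<close>

lemma mol_change:
  fixes \<psi> g :: "'a::euclidean_space \<Rightarrow> real"
  assumes [measurable]: "\<psi> \<in> borel_measurable borel" "g \<in> borel_measurable borel" and t: "t > 0"
  shows "mol \<psi> g (x, t) = (\<integral>y. \<psi> ((1 / t) *\<^sub>R (y - x)) * g y \<partial>lborel) / t ^ DIM('a)"
  using lborel_affine_change(2)[of t "\<lambda>y. \<psi> ((1 / t) *\<^sub>R (y - x)) * g y" x] t
  by (simp add: mol_lborel)

section \<open>The fundamental lemma of the calculus of variations\<close>

lemma normalized_bump_exists:
  fixes r :: real assumes "r > 0"
  shows "\<exists>\<rho>::'a::euclidean_space \<Rightarrow> real. smooth_on UNIV \<rho> \<and> (\<forall>x. r \<le> norm x \<longrightarrow> \<rho> x = 0) \<and> kern r \<rho> \<and> integral\<^sup>L lborel \<rho> = 1"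
proof -
  obtain \<rho> :: "'a \<Rightarrow> real" where \<rho>: "smooth_on UNIV \<rho>" "\<And>x. 0 \<le> \<rho> x" "\<rho> 0 > 0" "\<And>x. norm x \<ge> r \<Longrightarrow> \<rho> x = 0"
    using smooth_bump_exists[OF assms, where 'a = 'a] by blast
  have k: "kern r \<rho>" using \<rho> assms smooth_on_continuous_on unfolding kern_def by blast
  have "continuous (at 0) \<rho>" using smooth_on_continuous_on[OF \<rho>(1)] by (simp add: continuous_on_eq_continuous_at)
  then obtain d where d: "d > 0" "\<And>x. dist x 0 < d \<Longrightarrow> dist (\<rho> x) (\<rho> 0) < \<rho> 0 / 2"
    using \<rho>(3) unfolding continuous_at_eps_delta by (metis dist_norm half_gt_zero real_norm_def)
  have low: "\<rho> 0 / 2 * indicator (ball 0 d) x \<le> \<rho> x" for x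
    using d(2)[of x] \<rho>(2)[of x] by (auto simp: indicator_def dist_real_def abs_if split: if_splits)
  have "0 < \<rho> 0 / 2 * measure lborel (ball (0::'a) d)" using \<rho>(3) measure_ball_pos[OF d(1), of "0::'a"] by simp
  also have "\<dots> = (\<integral>x. \<rho> 0 / 2 * indicator (ball (0::'a) d) x \<partial>lborel)" by simp
  also have "\<dots> \<le> integral\<^sup>L lborel \<rho>"
    using low kern_integrable[OF k] emeasure_ball_finite[of "0::'a" d] by (intro integral_mono) auto
  finally have I: "integral\<^sup>L lborel \<rho> > 0" .
  define \<sigma> where "\<sigma> x = (1 / integral\<^sup>L lborel \<rho>) * \<rho> x" for x
  have "smooth_on UNIV \<sigma>" unfolding \<sigma>_def by (intro smooth_on_mult smooth_on_const \<rho>) auto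
  moreover have "integral\<^sup>L lborel \<sigma> = 1" unfolding \<sigma>_def using I by simp
  ultimately show ?thesis using \<rho>(4) assms smooth_on_continuous_on[of UNIV \<sigma>]
    by (intro exI[of _ \<sigma>]) (auto simp: kern_def \<sigma>_def)
qed

lemma smooth_on_affine_compose:
  fixes \<psi> :: "'a::euclidean_space \<Rightarrow> real"
  assumes "smooth_on UNIV \<psi>" shows "smooth_on UNIV (\<lambda>y. \<psi> (c *\<^sub>R (y - x)))"
  by (rule smooth_on_compose[OF _ assms])
    (auto simp: inner_diff_left intro!: smooth_on_mult smooth_on_diff smooth_on_const smooth_on_inner)

lemma test_fun_rescale:
  fixes \<psi> :: "'a::euclidean_space \<Rightarrow> real"
  assumes "smooth_on UNIV \<psi>" "\<And>x. r \<le> norm x \<Longrightarrow> \<psi> x = 0" "t > 0" "cball x (t * r) \<subseteq> U"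
  shows "test_fun U (\<lambda>y. \<psi> ((1 / t) *\<^sub>R (y - x)))"
  unfolding test_fun_def smooth_iff
proof (intro conjI exI[of _ "cball x (t * r)"] allI impI)
  fix y assume "y \<notin> cball x (t * r)"
  moreover have "norm ((1 / t) *\<^sub>R (y - x)) = dist x y / t"
    using assms(3) by (simp add: dist_norm norm_minus_commute)
  ultimately have "r \<le> norm ((1 / t) *\<^sub>R (y - x))" using assms(3) by (simp add: pos_le_divide_eq mult.commute)
  then show "\<psi> ((1 / t) *\<^sub>R (y - x)) = 0" by (rule assms(2))
qed (use assms in \<open>auto intro: smooth_on_affine_compose\<close>)

text \<open>Rescaled bumps are test functions, so the small-scale averages of \<open>w\<close>
  vanish near each point of \<open>U\<close>; they also converge to \<open>w\<close> in L^1.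
  Lindelof's theorem leaves countably many such neighbourhoods.\<close>

theorem fundamental_lemma:
  fixes w :: "'a::euclidean_space \<Rightarrow> real"
  assumes U: "open U" and w: "L1_loc U w" and z: "\<And>\<phi>. test_fun U \<phi> \<Longrightarrow> (LINT x:U|lebesgue. w x * \<phi> x) = 0"
  shows "AE x in lborel. x \<in> U \<longrightarrow> w x = 0"
proof -
  obtain \<rho> :: "'a \<Rightarrow> real" where \<rho>: "smooth_on UNIV \<rho>" "\<And>x. 1 \<le> norm x \<Longrightarrow> \<rho> x = 0" "kern 1 \<rho>" "integral\<^sup>L lborel \<rho> = 1"
    using normalized_bump_exists[of 1, where 'a = 'a] by auto
  have local: "\<exists>r>0. AE x in lborel. x \<in> ball x0 r \<longrightarrow> w x = 0" if x0: "x0 \<in> U" for x0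
  proof -
    obtain r0 where r0: "r0 > 0" "cball x0 r0 \<subseteq> U" using U x0 open_contains_cball by blast
    define r where "r = r0 / 2"
    have r: "r > 0" "cball x0 (2 * r) \<subseteq> U" using r0 by (auto simp: r_def)
    define K where "K = cball x0 (2 * r)"
    have int: "integrable lebesgue (\<lambda>x. indicator K x *\<^sub>R w x)"
      using w r unfolding L1_loc_def set_integrable_def K_def by auto
    \<comment> \<open>The averages are handled for Borel functions, so \<open>w\<close> is cut off
      to a compact ball inside \<open>U\<close> and replaced by a representative.\<close>
    then obtain w2 where w2[measurable]: "w2 \<in> borel_measurable borel" and eq: "AE x in lborel. indicator K x *\<^sub>R w x = w2 x"
      using completion_ex_borel_measurable_real[of "\<lambda>x. indicator K x *\<^sub>R w x" lborel] by auto
    have eqL: "AE x in lebesgue. indicator K x *\<^sub>R w x = w2 x" using eq by (rule AE_completion)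
    have "integrable lebesgue w2"
      using int eqL by (subst integrable_cong_AE[of _ _ "\<lambda>x. indicator K x *\<^sub>R w x"]) (auto intro: measurable_completion)
    then have iw2: "integrable lborel w2" by (subst (asm) integrable_completion) auto
    have L: "Lploc 1 w2"
      unfolding Lploc_def
    proof (intro conjI allI w2)
      fix R
      have "Ip 1 (ball 0 R) w2 \<le> (\<integral>\<^sup>+x. ennreal (norm (w2 x)) \<partial>lborel)"
        unfolding Ip_def by (intro nn_integral_mono) (auto split: split_indicator)
      also have "\<dots> < \<infinity>" using iw2 by (simp add: integrable_iff_bounded)
      finally show "Ip 1 (ball 0 R) w2 < \<infinity>" .
    qed
    note [measurable] = kern_borel[OF \<rho>(3)]
    have mol0: "mol \<rho> w2 (x, t) = 0" if x: "x \<in> ball x0 r" and t: "0 < t" "t < r" for x t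
    proof -
      define \<phi> where "\<phi> y = \<rho> ((1 / t) *\<^sub>R (y - x))" for y
      have sub: "cball x (t * 1) \<subseteq> K"
      proof
        fix y assume "y \<in> cball x (t * 1)"
        then have "dist x0 y \<le> dist x0 x + t" using dist_triangle[of x0 y x] by simp
        then show "y \<in> K" using x t unfolding K_def by simp
      qed
      have tK: "test_fun U \<phi>" unfolding \<phi>_def by (rule test_fun_rescale[OF \<rho>(1,2) t(1)]) (use sub r in \<open>auto simp: K_def\<close>)
      have [measurable]: "\<phi> \<in> borel_measurable borel" unfolding \<phi>_def by measurable
      have offK: "\<phi> y = 0" if "y \<notin> K" for y
      proof -
        have "y \<notin> cball x t" using sub that by auto
        moreover have "norm ((1 / t) *\<^sub>R (y - x)) = dist x y / t"
          using t by (simp add: dist_norm norm_minus_commute)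
        ultimately have "1 \<le> norm ((1 / t) *\<^sub>R (y - x))" using t by (simp add: pos_le_divide_eq)
        then show ?thesis unfolding \<phi>_def by (rule \<rho>(2))
      qed
      have "(\<integral>y. \<phi> y * w2 y \<partial>lborel) = (\<integral>y. \<phi> y * w2 y \<partial>lebesgue)"
        by (rule integral_completion[symmetric]) measurable
      also have "\<dots> = (\<integral>y. \<phi> y * (indicator K y *\<^sub>R w y) \<partial>lebesgue)"
      proof (rule integral_cong_AE)
        show "(\<lambda>y. \<phi> y * w2 y) \<in> borel_measurable lebesgue" by (intro measurable_completion) measurable
        have "\<phi> \<in> borel_measurable lebesgue" by (intro measurable_completion) measurable
        then show "(\<lambda>y. \<phi> y * (indicator K y *\<^sub>R w y)) \<in> borel_measurable lebesgue"
          using borel_measurable_integrable[OF int] by (rule borel_measurable_times)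
        show "AE y in lebesgue. \<phi> y * w2 y = \<phi> y * (indicator K y *\<^sub>R w y)" using eqL by eventually_elim simp
      qed
      also have "\<dots> = (LINT y:U|lebesgue. w y * \<phi> y)"
        unfolding set_lebesgue_integral_def
        using offK r by (intro Bochner_Integration.integral_cong) (auto simp: indicator_def K_def)
      also have "\<dots> = 0" using z[OF tK] .
      finally show ?thesis using t by (simp add: mol_change \<phi>_def)
    qed
    have lim: "((\<lambda>t. Ip 1 (ball 0 (norm x0 + r)) (\<lambda>x. mol \<rho> w2 (x, t) - 1 * w2 x)) \<longlongrightarrow> 0) (at_right 0)"
      using mol_tendsto[OF _ \<rho>(3) L, of "norm x0 + r"] unfolding \<rho>(4) by (auto intro: tendsto_within_subset)
    have "Ip 1 (ball x0 r) w2 \<le> 0"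
    proof (rule tendsto_lowerbound[OF lim])
      show "\<forall>\<^sub>F t in at_right 0. Ip 1 (ball x0 r) w2 \<le> Ip 1 (ball 0 (norm x0 + r)) (\<lambda>x. mol \<rho> w2 (x, t) - 1 * w2 x)"
        unfolding eventually_at_right_field
      proof (intro exI[of _ r] conjI allI impI r(1))
        fix t assume t: "0 < t" "t < r"
        have "Ip 1 (ball x0 r) w2 = Ip 1 (ball x0 r) (\<lambda>x. mol \<rho> w2 (x, t) - 1 * w2 x)"
          unfolding Ip_def using mol0 t by (intro nn_integral_cong) (auto split: split_indicator)
        also have "\<dots> \<le> Ip 1 (ball 0 (norm x0 + r)) (\<lambda>x. mol \<rho> w2 (x, t) - 1 * w2 x)"
        proof (rule Ip_mono, rule subsetI)
          fix x assume "x \<in> ball x0 r"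
          then show "x \<in> ball 0 (norm x0 + r)" using norm_triangle_ineq2[of x x0] by (simp add: dist_norm norm_minus_commute)
        qed
        finally show "Ip 1 (ball x0 r) w2 \<le> Ip 1 (ball 0 (norm x0 + r)) (\<lambda>x. mol \<rho> w2 (x, t) - 1 * w2 x)" .
      qed
    qed simp
    then have "AE x in lborel. ennreal (\<bar>w2 x\<bar> powr 1) * indicator (ball x0 r) x = 0"
      unfolding Ip_def by (subst (asm) le_zero_eq, subst (asm) nn_integral_0_iff_AE) auto
    then have "AE x in lborel. x \<in> ball x0 r \<longrightarrow> w x = 0"
      using eq
    proof eventually_elim
      fix x assume a: "ennreal (\<bar>w2 x\<bar> powr 1) * indicator (ball x0 r) x = 0" "indicator K x *\<^sub>R w x = w2 x"
      show "x \<in> ball x0 r \<longrightarrow> w x = 0"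
        using a r by (auto simp: K_def indicator_def split: if_splits)
    qed
    then show ?thesis using r by blast
  qed
  then obtain rr where rr: "\<And>x0. x0 \<in> U \<Longrightarrow> rr x0 > 0" "\<And>x0. x0 \<in> U \<Longrightarrow> AE x in lborel. x \<in> ball x0 (rr x0) \<longrightarrow> w x = 0"
    by metis
  obtain F' where F': "F' \<subseteq> (\<lambda>x. ball x (rr x)) ` U" "countable F'" "\<Union>F' = \<Union>((\<lambda>x. ball x (rr x)) ` U)"
    using Lindelof[of "(\<lambda>x. ball x (rr x)) ` U"] by auto
  have "AE x in lborel. \<forall>S\<in>F'. x \<in> S \<longrightarrow> w x = 0"
    using F' rr by (subst AE_ball_countable) auto
  then show ?thesis
  proof eventually_elim
    fix x assume a: "\<forall>S\<in>F'. x \<in> S \<longrightarrow> w x = 0"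
    show "x \<in> U \<longrightarrow> w x = 0"
    proof
      assume "x \<in> U"
      then have "x \<in> \<Union>F'" unfolding F'(3) using rr(1)[of x] by (auto intro!: bexI[of _ x])
      then show "w x = 0" using a by blast
    qed
  qed
qed

section \<open>Uniqueness of weak derivatives and derivatives of averages\<close>

lemma set_integrable_L1_loc_times_test:
  fixes v :: "'a::euclidean_space \<Rightarrow> real"
  assumes v: "L1_loc U v" and phi: "test_fun U \<phi>"
  shows "set_integrable lebesgue U (\<lambda>x. v x * \<phi> x)"
proof -
  obtain K where K: "compact K" "K \<subseteq> U" "\<And>x. x \<notin> K \<Longrightarrow> \<phi> x = 0" and sm: "smooth_on UNIV \<phi>"
    using phi unfolding test_fun_def smooth_iff by blast
  have cont: "continuous_on UNIV \<phi>" using sm by (rule smooth_on_continuous_on)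
  have "bounded (\<phi> ` K)" using K cont by (intro compact_imp_bounded compact_continuous_image) (auto intro: continuous_on_subset)
  then obtain B where B: "B > 0" "\<And>x. x \<in> K \<Longrightarrow> norm (\<phi> x) \<le> B" unfolding bounded_pos by blast
  have int: "integrable lebesgue (\<lambda>x. indicator K x *\<^sub>R v x)" using v K unfolding L1_loc_def set_integrable_def by blast
  have m: "\<phi> \<in> borel_measurable lebesgue" using cont by (intro measurable_completion) (auto intro: borel_measurable_continuous_onI)
  have "integrable lebesgue (\<lambda>x. (indicator K x *\<^sub>R v x) * \<phi> x)"
  proof (rule Bochner_Integration.integrable_bound[where f = "\<lambda>x. B * (indicator K x *\<^sub>R v x)"])
    show "integrable lebesgue (\<lambda>x. B * (indicator K x *\<^sub>R v x))" using int by simp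
    show "(\<lambda>x. (indicator K x *\<^sub>R v x) * \<phi> x) \<in> borel_measurable lebesgue"
      using borel_measurable_integrable[OF int] m by (rule borel_measurable_times)
    show "AE x in lebesgue. norm ((indicator K x *\<^sub>R v x) * \<phi> x) \<le> norm (B * (indicator K x *\<^sub>R v x))"
    proof (rule AE_I2)
      fix x show "norm ((indicator K x *\<^sub>R v x) * \<phi> x) \<le> norm (B * (indicator K x *\<^sub>R v x))"
        using B(1) B(2)[of x] mult_right_mono[of "\<bar>\<phi> x\<bar>" B "\<bar>v x\<bar>"] by (cases "x \<in> K") (auto simp: abs_mult mult.commute)
    qed
  qed
  also have "(\<lambda>x. (indicator K x *\<^sub>R v x) * \<phi> x) = (\<lambda>x. indicator U x *\<^sub>R (v x * \<phi> x))"
    using K by (auto simp: indicator_def fun_eq_iff)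
  finally show ?thesis unfolding set_integrable_def .
qed

lemma L1_loc_diff: "L1_loc U v \<Longrightarrow> L1_loc U w \<Longrightarrow> L1_loc U (\<lambda>x. v x - w x)"
  unfolding L1_loc_def by (auto intro: set_integral_diff)

lemma L1_loc_eq_AE:
  assumes U: "open U" and v: "L1_loc U v" "L1_loc U w"
    and eq: "\<And>\<phi>. test_fun U \<phi> \<Longrightarrow> (LINT x:U|lebesgue. v x * \<phi> x) = (LINT x:U|lebesgue. w x * \<phi> x)"
  shows "AE x in lborel. x \<in> U \<longrightarrow> v x = w x"
proof -
  have "AE x in lborel. x \<in> U \<longrightarrow> v x - w x = 0"
  proof (rule fundamental_lemma[OF U L1_loc_diff[OF v]])
    fix \<phi> assume t: "test_fun U \<phi>"
    show "(LINT x:U|lebesgue. (v x - w x) * \<phi> x) = 0"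
      using set_integral_diff(2)[OF set_integrable_L1_loc_times_test[OF v(1) t] set_integrable_L1_loc_times_test[OF v(2) t]] eq[OF t]
      by (simp add: left_diff_distrib)
  qed
  then show ?thesis by eventually_elim simp
qed

lemma has_weak_pderiv_unique:
  assumes U: "open U" and "has_weak_pderiv U \<alpha> u v" "has_weak_pderiv U \<alpha> u w"
  shows "AE x in lborel. x \<in> U \<longrightarrow> v x = w x"
  using assms unfolding has_weak_pderiv_def by (intro L1_loc_eq_AE[OF U]) auto

lemma mi_of_Nil: "mi_of [] = (\<lambda>b. 0)"
  by (auto simp: mi_of_def fun_eq_iff)

lemma pderiv_mi_0: "smooth_on UNIV \<phi> \<Longrightarrow> pderiv_mi (\<lambda>b. 0) \<phi> = \<phi>"
  using pderiv_mi_mi_of[of \<phi> "[]"] by (simp add: mi_of_Nil)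

text \<open>For order zero \<open>weak_pderiv\<close> is \<open>u\<close> by convention, which has
  to be checked against the definition; in all other cases the choice operator delivers the
  claim.\<close>

lemma has_weak_pderiv_weak_pderiv:
  assumes "has_weak_pderiv U \<alpha> u v"
  shows "has_weak_pderiv U \<alpha> u (weak_pderiv U \<alpha> u)"
proof (cases "\<alpha> = (\<lambda>b. 0)")
  case True
  have "(LINT x:U|lebesgue. u x * pderiv_mi \<alpha> \<phi> x) = (- 1) ^ sum \<alpha> Basis * (LINT x:U|lebesgue. u x * \<phi> x)" if "test_fun U \<phi>" for \<phi>
    using that pderiv_mi_0[of \<phi>] True unfolding test_fun_def smooth_iff by simp
  then show ?thesis using assms True unfolding weak_pderiv_def has_weak_pderiv_def by simp
next
  case False
  then show ?thesis using someI[of "has_weak_pderiv U \<alpha> u" v, OF assms] unfolding weak_pderiv_def by simp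
qed

lemma weak_pderiv_AE:
  assumes "open U" "has_weak_pderiv U \<alpha> u v"
  shows "AE x in lborel. x \<in> U \<longrightarrow> weak_pderiv U \<alpha> u x = v x"
  using has_weak_pderiv_unique[OF assms(1) has_weak_pderiv_weak_pderiv[OF assms(2)] assms(2)] .

text \<open>The kernel is linearized in the parameter uniformly in the integration variable, by uniform
  continuity of its gradient on a compact set; no regularity of the density is needed.\<close>

lemma has_derivative_kernel_integral:
  fixes k :: "'e::euclidean_space \<Rightarrow> 'f::euclidean_space \<Rightarrow> real" and k' :: "'e \<Rightarrow> 'f \<Rightarrow> 'e"
  assumes \<delta>: "\<delta> > 0"
    and der: "\<And>z y. z \<in> cball z0 \<delta> \<Longrightarrow> ((\<lambda>z. k z y) has_derivative (\<lambda>v. v \<bullet> k' z y)) (at z)"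
    and cont: "continuous_on (cball z0 \<delta> \<times> cball 0 R) (\<lambda>(z, y). k' z y)"
    and supp: "\<And>z y. z \<in> cball z0 \<delta> \<Longrightarrow> R \<le> norm y \<Longrightarrow> k z y = 0" "\<And>y. R \<le> norm y \<Longrightarrow> k' z0 y = 0"
    and int: "\<And>z. z \<in> cball z0 \<delta> \<Longrightarrow> integrable lborel (\<lambda>y. k z y * g y)" "integrable lborel (\<lambda>y. g y *\<^sub>R k' z0 y)"
      "integrable lborel (\<lambda>y. indicator (ball 0 R) y *\<^sub>R g y)"
  shows "((\<lambda>z. \<integral>y. k z y * g y \<partial>lborel) has_derivative (\<lambda>v. v \<bullet> (\<integral>y. g y *\<^sub>R k' z0 y \<partial>lborel))) (at z0)"
  unfolding has_derivative_at_alt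
proof (intro conjI allI impI)
  fix e :: real assume e: "0 < e"
  define G where "G = (\<integral>y. \<bar>indicator (ball 0 R) y *\<^sub>R g y\<bar> \<partial>lborel)"
  have G: "G \<ge> 0" unfolding G_def by simp
  \<comment> \<open>The integral \<open>G\<close> of |g| may vanish, hence the denominator
    \<open>G + 1\<close>.\<close>
  define e' where "e' = e / (G + 1)"
  have e': "e' > 0" "e' * G \<le> e" using e G by (auto simp: e'_def field_simps)
  have "uniformly_continuous_on (cball z0 \<delta> \<times> cball 0 R) (\<lambda>(z, y). k' z y)"
    by (intro compact_uniformly_continuous cont compact_Times) auto
  then obtain d where d: "d > 0" "\<And>a b. a \<in> cball z0 \<delta> \<times> cball 0 R \<Longrightarrow> b \<in> cball z0 \<delta> \<times> cball 0 R \<Longrightarrow>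
      dist b a < d \<Longrightarrow> dist (case_prod k' b) (case_prod k' a) < e'"
    unfolding uniformly_continuous_on_def using e'(1) by metis
  show "\<exists>d>0. \<forall>z. norm (z - z0) < d \<longrightarrow> norm ((\<integral>y. k z y * g y \<partial>lborel) - (\<integral>y. k z0 y * g y \<partial>lborel) -
          (z - z0) \<bullet> (\<integral>y. g y *\<^sub>R k' z0 y \<partial>lborel)) \<le> e * norm (z - z0)"
  proof (intro exI[of _ "min d \<delta>"] conjI allI impI)
    fix z assume z: "norm (z - z0) < min d \<delta>"
    have z0d: "z0 \<in> cball z0 \<delta>" "z \<in> cball z0 \<delta>" using \<delta> z by (auto simp: dist_norm norm_minus_commute)
    define S where "S = cball z0 (norm (z - z0))"
    have SS: "S \<subseteq> cball z0 \<delta>" "S \<subseteq> ball z0 d" using z unfolding S_def by auto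
    have lin: "norm (k z y - k z0 y - (z - z0) \<bullet> k' z0 y) \<le> norm (z - z0) * e'" if y: "norm y < R" for y
    proof (rule differentiable_bound_linearization[where S = S and f' = "\<lambda>x v. v \<bullet> k' x y" and f = "\<lambda>z. k z y"])
      fix t :: real assume "t \<in> {0..1}"
      then show "z0 + t *\<^sub>R (z - z0) \<in> S" unfolding S_def by (auto simp: dist_norm mult_left_le_one_le)
    next
      fix x assume x: "x \<in> S"
      show "((\<lambda>z. k z y) has_derivative (\<lambda>v. v \<bullet> k' x y)) (at x within S)"
        using der[of x y] x SS has_derivative_at_withinI by blast
      have "dist (case_prod k' (x, y)) (case_prod k' (z0, y)) < e'"
        by (rule d(2)) (use x SS y z0d in \<open>auto simp: dist_Pair_Pair dist_commute\<close>)
      then have n: "norm (k' x y - k' z0 y) \<le> e'" by (simp add: dist_norm)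
      have "onorm (\<lambda>v. v \<bullet> (k' x y - k' z0 y)) \<le> e'"
      proof (rule onorm_le)
        fix v show "norm (v \<bullet> (k' x y - k' z0 y)) \<le> e' * norm v"
          using Cauchy_Schwarz_ineq2[of v "k' x y - k' z0 y"] mult_left_mono[OF n, of "norm v"] by (simp add: mult.commute)
      qed
      moreover have "(\<lambda>v. v \<bullet> k' x y) - (\<lambda>v. v \<bullet> k' z0 y) = (\<lambda>v. v \<bullet> (k' x y - k' z0 y))"
        by (auto simp: fun_eq_iff inner_diff_right)
      ultimately show "onorm ((\<lambda>v. v \<bullet> k' x y) - (\<lambda>v. v \<bullet> k' z0 y)) \<le> e'" by simp
    qed (simp add: S_def)
    have i3: "integrable lborel (\<lambda>y. (z - z0) \<bullet> (g y *\<^sub>R k' z0 y))" by (rule integrable_inner_right) (rule int(2))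
    have "(\<integral>y. k z y * g y \<partial>lborel) - (\<integral>y. k z0 y * g y \<partial>lborel) - (z - z0) \<bullet> (\<integral>y. g y *\<^sub>R k' z0 y \<partial>lborel)
      = (\<integral>y. k z y * g y - k z0 y * g y - (z - z0) \<bullet> (g y *\<^sub>R k' z0 y) \<partial>lborel)"
      using int(1)[OF z0d(1)] int(1)[OF z0d(2)] i3 by (simp add: integral_inner_right[OF int(2), symmetric])
    also have "norm \<dots> \<le> (\<integral>y. (norm (z - z0) * e') * \<bar>indicator (ball 0 R) y *\<^sub>R g y\<bar> \<partial>lborel)"
    proof (rule integral_norm_bound[THEN order_trans], rule integral_mono')
      show "integrable lborel (\<lambda>y. (norm (z - z0) * e') * \<bar>indicator (ball 0 R) y *\<^sub>R g y\<bar>)" using int(3) by (intro integrable_mult_right integrable_abs)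
      fix y
      show "norm (k z y * g y - k z0 y * g y - (z - z0) \<bullet> (g y *\<^sub>R k' z0 y)) \<le> (norm (z - z0) * e') * \<bar>indicator (ball 0 R) y *\<^sub>R g y\<bar>"
      proof (cases "norm y < R")
        case True
        have "k z y * g y - k z0 y * g y - (z - z0) \<bullet> (g y *\<^sub>R k' z0 y) = (k z y - k z0 y - (z - z0) \<bullet> k' z0 y) * g y"
          by (simp add: algebra_simps)
        then show ?thesis using True mult_right_mono[OF lin[OF True], of "\<bar>g y\<bar>"] by (simp add: abs_mult)
      next
        case False
        then show ?thesis using supp(1)[OF z0d(1), of y] supp(1)[OF z0d(2), of y] supp(2)[of y] by simp
      qed
    qed (use e' in auto)
    also have "\<dots> = norm (z - z0) * (e' * G)" unfolding G_def by simp
    also have "\<dots> \<le> e * norm (z - z0)" using mult_left_mono[OF e'(2), of "norm (z - z0)"] by (simp add: mult.commute)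
    finally show "norm ((\<integral>y. k z y * g y \<partial>lborel) - (\<integral>y. k z0 y * g y \<partial>lborel) -
          (z - z0) \<bullet> (\<integral>y. g y *\<^sub>R k' z0 y \<partial>lborel)) \<le> e * norm (z - z0)" .
  qed (use d \<delta> in auto)
qed (rule bounded_linear_inner_left)

section \<open>Smooth kernels and the derivatives of averages\<close>

definition skern :: "real \<Rightarrow> ('a::euclidean_space \<Rightarrow> real) \<Rightarrow> bool" where
  "skern r \<psi> \<longleftrightarrow> smooth_on UNIV \<psi> \<and> kern r \<psi>"

lemma skern_kern: "skern r \<psi> \<Longrightarrow> kern r \<psi>" unfolding skern_def by blast
lemma skern_pd:
  assumes "skern r \<psi>" "j \<in> Basis" shows "skern r (pd j \<psi>)"
proof -
  have sm: "smooth_on UNIV (pd j \<psi>)" using assms smooth_on_pd unfolding skern_def by blast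
  have cont: "continuous_on UNIV (pd j \<psi>)" using sm by (rule smooth_on_continuous_on)
  have out: "pd j \<psi> x = 0" if "r < norm x" for x
  proof -
    have "frechet_derivative \<psi> (at x) = frechet_derivative (\<lambda>_. 0) (at x)"
      by (rule frechet_derivative_cong_open[of "- cball 0 r"]) (use assms that in \<open>auto simp: skern_def kern_def\<close>)
    then show ?thesis by simp
  qed
  have r: "r > 0" using assms unfolding skern_def kern_def by blast
  \<comment> \<open>The open exterior of the ball is settled by \<open>out\<close>. On the sphere
    |x| = r the value is a limit from outside along the ray through \<open>x\<close>.\<close>
  have "pd j \<psi> x = 0" if "r \<le> norm x" for x
  proof (rule ccontr)
    assume ne: "pd j \<psi> x \<noteq> 0"
    have l1: "((\<lambda>e. pd j \<psi> ((1 + e) *\<^sub>R x)) \<longlongrightarrow> pd j \<psi> ((1 + 0) *\<^sub>R x)) (at_right 0)"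
      by (rule continuous_on_tendsto_compose[OF cont]) (intro tendsto_intros, auto)
    have l2: "((\<lambda>e. pd j \<psi> ((1 + e) *\<^sub>R x)) \<longlongrightarrow> 0) (at_right 0)"
    proof (rule tendsto_eventually)
      show "\<forall>\<^sub>F e in at_right 0. pd j \<psi> ((1 + e) *\<^sub>R x) = 0"
        unfolding eventually_at_right_field
      proof (intro exI[of _ 1] conjI allI impI)
        fix e :: real assume e: "0 < e" "e < 1"
        have "norm ((1 + e) *\<^sub>R x) = (1 + e) * norm x" using e by simp
        moreover have "0 < e * norm x" using e that r by (intro mult_pos_pos) linarith+
        ultimately have "norm x < norm ((1 + e) *\<^sub>R x)" by (simp add: distrib_right)
        then show "pd j \<psi> ((1 + e) *\<^sub>R x) = 0" using that by (intro out) simp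
      qed simp
    qed
    show False using tendsto_unique[OF _ l1 l2] ne by simp
  qed
  then show ?thesis using sm cont r unfolding skern_def kern_def by blast
qed

lemma skern_coord:
  assumes "skern r \<psi>" shows "skern r (\<lambda>h. (h \<bullet> j) * \<psi> h)"
proof -
  have "smooth_on UNIV (\<lambda>h. (h \<bullet> j) * \<psi> h)"
    using assms unfolding skern_def by (intro smooth_on_mult smooth_on_inner) auto
  then show ?thesis using assms smooth_on_continuous_on unfolding skern_def kern_def by fastforce
qed

lemma skern_add: "skern r \<psi> \<Longrightarrow> skern r \<theta> \<Longrightarrow> skern r (\<lambda>h. \<psi> h + \<theta> h)"
  unfolding skern_def kern_def by (auto intro: smooth_on_add continuous_intros)

lemma skern_cmult: "skern r \<psi> \<Longrightarrow> skern r (\<lambda>h. c * \<psi> h)"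
  unfolding skern_def kern_def by (auto intro!: smooth_on_mult smooth_on_const continuous_intros)

lemma mol_add:
  assumes "1 \<le> p" "kern r \<psi>" "kern r \<theta>" "Lploc p g" "snd z \<noteq> 0"
  shows "mol (\<lambda>h. \<psi> h + \<theta> h) g z = mol \<psi> g z + mol \<theta> g z"
proof -
  note [measurable] = kern_borel[OF assms(2)] kern_borel[OF assms(3)] Lploc_borel[OF assms(4)]
  show ?thesis
    using mol_integrable[OF assms(1,2,4,5), of "fst z"] mol_integrable[OF assms(1,3,4,5), of "fst z"]
    by (simp add: mol_lborel distrib_right)
qed

lemma pd_coord:
  assumes "smooth_on UNIV \<psi>" "j \<in> Basis"
  shows "pd j (\<lambda>h. (h \<bullet> j) * \<psi> h) h = \<psi> h + (h \<bullet> j) * pd j \<psi> h"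
proof -
  have "((\<lambda>h. h \<bullet> j) has_derivative (\<lambda>v. v \<bullet> j)) (at h)" by (auto intro!: derivative_eq_intros)
  then have "pd j (\<lambda>h. h \<bullet> j) h = 1" "(\<lambda>h. h \<bullet> j) differentiable (at h)"
    using assms(2) pd_eqI[of "\<lambda>h. h \<bullet> j"] by (auto simp: differentiable_def)
  then show ?thesis using pd_mult[of "\<lambda>h. h \<bullet> j" h \<psi> j] smooth_on_differentiable[OF assms(1)] by simp
qed

definition grad :: "('a::euclidean_space \<Rightarrow> real) \<Rightarrow> 'a \<Rightarrow> 'a" where
  "grad \<psi> h = (\<Sum>j\<in>Basis. pd j \<psi> h *\<^sub>R j)"

lemma inner_grad: "v \<bullet> grad \<psi> h = (\<Sum>j\<in>Basis. (v \<bullet> j) * pd j \<psi> h)"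
  unfolding grad_def by (simp add: inner_sum_right mult.commute)

lemma inner_grad_Basis: "j \<in> Basis \<Longrightarrow> j \<bullet> grad \<psi> h = pd j \<psi> h"
  unfolding inner_grad by (simp add: inner_Basis if_distrib[of "\<lambda>x. x * _"] cong: if_cong)

text \<open>Near a point with positive scale all kernels have their support in one ball and a
  jointly continuous gradient, so \<open>has_derivative_kernel_integral\<close> applies;
  \<open>k'\<close> is the gradient of \<psi>((y - x)/t) in (x, t).\<close>

lemma kernel_integral_derivative:
  fixes \<psi> g :: "'a::euclidean_space \<Rightarrow> real"
  assumes p: "1 \<le> p" and k: "skern r \<psi>" and g: "Lploc p g" and t0: "t0 > 0"
  defines "k' \<equiv> \<lambda>z y. let h = (1 / snd z) *\<^sub>R (y - fst z) in
      (- (1 / snd z) *\<^sub>R grad \<psi> h, - (1 / snd z) * (h \<bullet> grad \<psi> h))"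
  shows "((\<lambda>z. \<integral>y. \<psi> ((1 / snd z) *\<^sub>R (y - fst z)) * g y \<partial>lborel) has_derivative
      (\<lambda>v. v \<bullet> (\<integral>y. g y *\<^sub>R k' (x0, t0) y \<partial>lborel))) (at (x0, t0))"
    "integrable lborel (\<lambda>y. g y *\<^sub>R k' (x0, t0) y)"
proof -
  let ?h = "\<lambda>z y. (1 / snd z) *\<^sub>R (y - fst z)"
  have kk: "kern r \<psi>" and sm: "smooth_on UNIV \<psi>" using k unfolding skern_def by auto
  note [measurable] = kern_borel[OF kk] Lploc_borel[OF g]
  have r: "r > 0" using kk unfolding kern_def by blast
  \<comment> \<open>Within this distance the scale stays between t0/2 and 2 t0, so the ball of
    radius \<open>R\<close> contains the supports of all kernels concerned.\<close>
  define \<delta> where "\<delta> = t0 / 2"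
  define R where "R = norm x0 + \<delta> + 2 * t0 * r"
  have \<delta>: "\<delta> > 0" using t0 by (simp add: \<delta>_def)
  have near: "t0 / 2 \<le> snd z \<and> snd z \<le> 2 * t0 \<and> norm (fst z) \<le> norm x0 + \<delta>" if "z \<in> cball (x0, t0) \<delta>" for z :: "'a \<times> real"
  proof -
    have "dist t0 (snd z) \<le> \<delta>" using dist_snd_le[of "(x0, t0)" z] that by simp
    moreover have "dist x0 (fst z) \<le> \<delta>" using dist_fst_le[of "(x0, t0)" z] that by simp
    ultimately show ?thesis using norm_triangle_ineq2[of "fst z" x0] t0
      unfolding \<delta>_def dist_norm norm_minus_commute[of x0] real_norm_def abs_le_iff by linarith
  qed
  have far: "r \<le> norm (?h z y)" if z: "z \<in> cball (x0, t0) \<delta>" and y: "R \<le> norm y" for z y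
  proof -
    have "snd z * r \<le> 2 * t0 * r" using near[OF z] r by (intro mult_right_mono) auto
    also have "\<dots> \<le> norm (y - fst z)" using near[OF z] y norm_triangle_ineq2[of y "fst z"] unfolding R_def by simp
    finally show ?thesis using near[OF z] t0 by (simp add: pos_le_divide_eq mult.commute)
  qed
  have gz: "grad \<psi> h = 0" if "r \<le> norm h" for h
    unfolding grad_def using skern_pd[OF k] that unfolding skern_def kern_def by (intro sum.neutral) auto
  have cgrad: "continuous_on UNIV (grad \<psi>)" unfolding grad_def
    by (intro continuous_intros smooth_on_continuous_on smooth_on_pd sm)
  have contk: "continuous_on (cball (x0, t0) \<delta> \<times> UNIV) (\<lambda>(z, y). k' z y)"
  proof -
    have nz: "snd (fst u) \<noteq> 0" if "u \<in> cball (x0, t0) \<delta> \<times> UNIV" for u :: "('a \<times> real) \<times> 'a"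
      using near[of "fst u"] that t0 by auto
    have ch: "continuous_on (cball (x0, t0) \<delta> \<times> UNIV) (\<lambda>u. (1 / snd (fst u)) *\<^sub>R (snd u - fst (fst u)))"
      by (intro continuous_intros) (use nz in auto)
    have cg: "continuous_on (cball (x0, t0) \<delta> \<times> UNIV) (\<lambda>u. grad \<psi> ((1 / snd (fst u)) *\<^sub>R (snd u - fst (fst u))))"
      by (rule continuous_on_compose2[OF cgrad ch]) auto
    show ?thesis unfolding k'_def Let_def case_prod_beta
      by (intro continuous_intros cg ch) (use nz in auto)
  qed
  have contk0: "continuous_on UNIV (k' (x0, t0))"
  proof -
    have "continuous_on UNIV (\<lambda>y. case_prod k' ((x0, t0), y))"
      by (rule continuous_on_compose2[OF contk]) (use \<delta> in \<open>auto intro!: continuous_intros\<close>)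
    then show ?thesis by (simp add: case_prod_beta)
  qed
  have k'0: "k' (x0, t0) y = 0" if "R \<le> norm y" for y
    using far[of "(x0, t0)" y] that \<delta> gz by (simp add: k'_def Let_def zero_prod_def)
  have intg: "integrable lborel (\<lambda>y. indicator (ball 0 R) y *\<^sub>R g y)" by (rule Lploc_integrable[OF p g])
  show int2: "integrable lborel (\<lambda>y. g y *\<^sub>R k' (x0, t0) y)"
  proof -
    have "bounded (k' (x0, t0) ` cball 0 R)"
      by (intro compact_imp_bounded compact_continuous_image continuous_on_subset[OF contk0]) auto
    then obtain B where B: "B > 0" "\<And>y. y \<in> cball 0 R \<Longrightarrow> norm (k' (x0, t0) y) \<le> B" unfolding bounded_pos by blast
    have mk: "k' (x0, t0) \<in> borel_measurable borel" using contk0 by (rule borel_measurable_continuous_onI)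
    show ?thesis
    proof (rule Bochner_Integration.integrable_bound[where f = "\<lambda>y. B * (indicator (ball 0 R) y *\<^sub>R g y)"])
      show "(\<lambda>y. g y *\<^sub>R k' (x0, t0) y) \<in> borel_measurable lborel" using mk by measurable
      show "AE y in lborel. norm (g y *\<^sub>R k' (x0, t0) y) \<le> norm (B * (indicator (ball 0 R) y *\<^sub>R g y))"
      proof (rule AE_I2)
        fix y show "norm (g y *\<^sub>R k' (x0, t0) y) \<le> norm (B * (indicator (ball 0 R) y *\<^sub>R g y))"
          using B(1) B(2)[of y] k'0[of y] mult_left_mono[of "norm (k' (x0, t0) y)" B "\<bar>g y\<bar>"]
          by (cases "norm y < R") (auto simp: abs_mult mult.commute)
      qed
    qed (use intg in simp)
  qed
  have int1: "integrable lborel (\<lambda>y. \<psi> (?h z y) * g y)" if z: "z \<in> cball (x0, t0) \<delta>" for z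
  proof -
    obtain B where B: "B > 0" "\<And>x. \<bar>\<psi> x\<bar> \<le> B * indicator (ball 0 r) x" using kern_bound[OF kk] by blast
    show ?thesis
    proof (rule Bochner_Integration.integrable_bound[where f = "\<lambda>y. B * (indicator (ball 0 R) y *\<^sub>R g y)"])
      show "AE y in lborel. norm (\<psi> (?h z y) * g y) \<le> norm (B * (indicator (ball 0 R) y *\<^sub>R g y))"
      proof (rule AE_I2)
        fix y
        define h where "h = (1 / snd z) *\<^sub>R (y - fst z)"
        have "\<bar>\<psi> h\<bar> \<le> B" using B(2)[of h] B(1) by (cases "h \<in> ball 0 r") auto
        moreover have "\<psi> h = 0" if "\<not> norm y < R" using far[OF z, of y] that kk unfolding h_def kern_def by auto
        ultimately show "norm (\<psi> (?h z y) * g y) \<le> norm (B * (indicator (ball 0 R) y *\<^sub>R g y))"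
          unfolding h_def[symmetric] using B(1) by (cases "norm y < R") (auto simp: abs_mult mult_right_mono)
      qed
    qed (use intg in auto)
  qed
  show "((\<lambda>z. \<integral>y. \<psi> (?h z y) * g y \<partial>lborel) has_derivative
      (\<lambda>v. v \<bullet> (\<integral>y. g y *\<^sub>R k' (x0, t0) y \<partial>lborel))) (at (x0, t0))"
  proof (rule has_derivative_kernel_integral[where k = "\<lambda>z y. \<psi> (?h z y)" and k' = k' and R = R, OF \<delta>])
    fix z :: "'a \<times> real" and y assume z: "z \<in> cball (x0, t0) \<delta>"
    then have t: "snd z > 0" using near[OF z] t0 by linarith
    define h where "h = (1 / snd z) *\<^sub>R (y - fst z)"
    have d1: "((\<lambda>z. (1 / snd z) *\<^sub>R (y - fst z)) has_derivative (\<lambda>v. (1 / snd z) *\<^sub>R (- fst v) + (- (snd v / (snd z)^2)) *\<^sub>R (y - fst z))) (at z)"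
      using t by (auto intro!: derivative_eq_intros simp: power2_eq_square inverse_eq_divide field_simps)
    have d2: "(\<psi> has_derivative (\<lambda>v. v \<bullet> grad \<psi> h)) (at h)"
      using smooth_on_has_derivative[OF sm, of h] unfolding inner_grad by simp
    have "((\<lambda>z. \<psi> (?h z y)) has_derivative (\<lambda>v. ((1 / snd z) *\<^sub>R (- fst v) + (- (snd v / (snd z)^2)) *\<^sub>R (y - fst z)) \<bullet> grad \<psi> h)) (at z)"
      by (rule has_derivative_compose[OF d1 d2[unfolded h_def], folded h_def])
    moreover have "((1 / snd z) *\<^sub>R (- fst v) + (- (snd v / (snd z)^2)) *\<^sub>R (y - fst z)) \<bullet> grad \<psi> h = v \<bullet> k' z y" for v
    proof -
      have e: "(- (snd v / (snd z)^2)) *\<^sub>R (y - fst z) = (- (snd v / snd z)) *\<^sub>R h"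
        unfolding h_def by (simp add: power2_eq_square)
      have "v \<bullet> k' z y = - (1 / snd z) * (fst v \<bullet> grad \<psi> h) + snd v * (- (1 / snd z) * (h \<bullet> grad \<psi> h))"
        unfolding k'_def Let_def h_def[symmetric] by (simp add: inner_prod_def)
      also have "\<dots> = ((1 / snd z) *\<^sub>R (- fst v) + (- (snd v / snd z)) *\<^sub>R h) \<bullet> grad \<psi> h"
        by (simp add: inner_diff_left inner_add_left)
      finally show ?thesis unfolding e by simp
    qed
    ultimately show "((\<lambda>z. \<psi> (?h z y)) has_derivative (\<lambda>v. v \<bullet> k' z y)) (at z)" by simp
  next
    show "continuous_on (cball (x0, t0) \<delta> \<times> cball 0 R) (\<lambda>(z, y). k' z y)"
      by (rule continuous_on_subset[OF contk]) auto
    show "\<psi> (?h z y) = 0" if "z \<in> cball (x0, t0) \<delta>" "R \<le> norm y" for z y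
      using far[OF that] kk unfolding kern_def by auto
  qed (use k'0 int1 int2 intg in auto)
qed

lemma mol_sum:
  assumes "1 \<le> p" "\<And>i. i \<in> I \<Longrightarrow> kern r (\<psi> i)" "Lploc p g" "snd z \<noteq> 0"
  shows "mol (\<lambda>h. \<Sum>i\<in>I. \<psi> i h) g z = (\<Sum>i\<in>I. mol (\<psi> i) g z)"
proof -
  note [measurable] = kern_borel[OF assms(2)] Lploc_borel[OF assms(3)]
  have "mol (\<lambda>h. \<Sum>i\<in>I. \<psi> i h) g z = (\<integral>h. (\<Sum>i\<in>I. \<psi> i h * g (fst z + snd z *\<^sub>R h)) \<partial>lborel)"
    by (subst mol_lborel) (auto simp: sum_distrib_right)
  also have "\<dots> = (\<Sum>i\<in>I. mol (\<psi> i) g z)"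
    using mol_integrable[OF assms(1) assms(2) assms(3,4)] by (subst Bochner_Integration.integral_sum) (auto simp: mol_lborel)
  finally show ?thesis .
qed

text \<open>The factor t^(-n) of the substitution adds n \<psi> to h . grad \<psi> in the normal
  derivative; together they are the divergence of h \<psi>(h). So every derivative of an average is
  1/t times averages whose kernels are derivatives and therefore have mean zero.\<close>

theorem mol_derivative:
  fixes \<psi> g :: "'a::euclidean_space \<Rightarrow> real"
  assumes p: "1 \<le> p" and k: "skern r \<psi>" and g: "Lploc p g" and t: "snd z > 0"
  shows "mol \<psi> g differentiable (at z)"
    "j \<in> Basis \<Longrightarrow> pd (j, 0) (mol \<psi> g) z = - (1 / snd z) * mol (pd j \<psi>) g z"
    "pd (0, 1) (mol \<psi> g) z = - (1 / snd z) * (\<Sum>j\<in>Basis. mol (pd j (\<lambda>h. (h \<bullet> j) * \<psi> h)) g z)"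
proof -
  have kk: "kern r \<psi>" and sm: "smooth_on UNIV \<psi>" using k unfolding skern_def by auto
  note [measurable] = kern_borel[OF kk] Lploc_borel[OF g]
  define n where "n = DIM('a)"
  obtain x0 t0 where z: "z = (x0, t0)" and t0: "t0 > 0" using t by (cases z) auto
  define N where "N z = (\<integral>y. \<psi> ((1 / snd z) *\<^sub>R (y - fst z)) * g y \<partial>lborel)" for z
  define k' where "k' = (\<lambda>z y. let h = (1 / snd z) *\<^sub>R (y - fst z) in
      (- (1 / snd z) *\<^sub>R grad \<psi> h, - (1 / snd z) * (h \<bullet> grad \<psi> h)))"
  define D where "D = (\<integral>y. g y *\<^sub>R k' z y \<partial>lborel)"
  have iD: "integrable lborel (\<lambda>y. g y *\<^sub>R k' z y)" and dN: "(N has_derivative (\<lambda>v. v \<bullet> D)) (at z)"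
    using kernel_integral_derivative[OF p k g t0, of x0] unfolding N_def[abs_def] D_def k'_def z by auto
  have d: "((\<lambda>z. N z * (1 / snd z ^ n)) has_derivative (\<lambda>v. N z * (- (real n * snd v / snd z ^ (n + 1))) + (v \<bullet> D) * (1 / snd z ^ n))) (at z)"
  proof (rule has_derivative_mult[OF dN])
    obtain n' where "n = Suc n'" using DIM_positive[where 'a = 'a] unfolding n_def by (metis Suc_pred)
    then have "snd z ^ n * snd z ^ n = snd z ^ (n + 1) * snd z ^ (n - 1)" by simp
    then show "((\<lambda>z. 1 / snd z ^ n) has_derivative (\<lambda>v. - (real n * snd v / snd z ^ (n + 1)))) (at z)"
      using t by (auto intro!: derivative_eq_intros simp: divide_simps fun_eq_iff)
  qed
  have ev: "mol \<psi> g y = N y * (1 / snd y ^ n)" if "y \<in> {y. snd y > 0}" for y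
    using mol_change[of \<psi> g "snd y" "fst y"] that by (simp add: N_def n_def)
  have op: "open {y::'a \<times> real. snd y > 0}" by (intro open_Collect_less continuous_intros)
  have dm: "(mol \<psi> g has_derivative (\<lambda>v. N z * (- (real n * snd v / snd z ^ (n + 1))) + (v \<bullet> D) * (1 / snd z ^ n))) (at z)"
    by (rule has_derivative_transform_within_open[OF d op]) (use t ev in auto)
  show "mol \<psi> g differentiable (at z)" using dm unfolding differentiable_def by blast
  have kg: "kern r (\<lambda>h. \<Sum>j\<in>Basis. (h \<bullet> j) * pd j \<psi> h)"
  proof -
    have "kern r (\<lambda>h. (h \<bullet> j) * pd j \<psi> h)" if "j \<in> Basis" for j
      using skern_kern[OF skern_coord[OF skern_pd[OF k that]]] .
    then show ?thesis using kk unfolding kern_def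
      by (intro conjI continuous_on_sum allI impI sum.neutral ballI) auto
  qed
  have eqmol: "(\<integral>y. \<theta> ((1 / snd z) *\<^sub>R (y - fst z)) * g y \<partial>lborel) = snd z ^ n * mol \<theta> g z" if "kern r \<theta>" for \<theta>
    using mol_change[OF kern_borel[OF that], of g "snd z" "fst z"] t by (simp add: n_def)
  show "pd (j, 0) (mol \<psi> g) z = - (1 / snd z) * mol (pd j \<psi>) g z" if j: "j \<in> Basis"
  proof -
    have "(j, 0) \<bullet> D = (\<integral>y. (j, 0) \<bullet> (g y *\<^sub>R k' z y) \<partial>lborel)"
      unfolding D_def by (rule integral_inner_right[symmetric]) (rule iD)
    also have "\<dots> = (\<integral>y. - (1 / snd z) * (pd j \<psi> ((1 / snd z) *\<^sub>R (y - fst z)) * g y) \<partial>lborel)"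
      using j by (intro Bochner_Integration.integral_cong) (auto simp: k'_def Let_def inner_prod_def inner_grad_Basis)
    also have "\<dots> = - (1 / snd z) * (snd z ^ n * mol (pd j \<psi>) g z)"
      using eqmol[OF skern_kern[OF skern_pd[OF k j]]] by simp
    finally show ?thesis using pd_eqI[OF dm, of "(j, 0)"] t by simp
  qed
  have "(0, 1) \<bullet> D = (\<integral>y. (0, 1) \<bullet> (g y *\<^sub>R k' z y) \<partial>lborel)"
    unfolding D_def by (rule integral_inner_right[symmetric]) (rule iD)
  also have "\<dots> = (\<integral>y. - (1 / snd z) * ((\<lambda>h. \<Sum>j\<in>Basis. (h \<bullet> j) * pd j \<psi> h) ((1 / snd z) *\<^sub>R (y - fst z)) * g y) \<partial>lborel)"
    unfolding inner_grad[symmetric] by (intro Bochner_Integration.integral_cong) (auto simp: k'_def Let_def inner_prod_def)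
  also have "\<dots> = - (1 / snd z) * (\<integral>y. ((\<lambda>h. \<Sum>j\<in>Basis. (h \<bullet> j) * pd j \<psi> h) ((1 / snd z) *\<^sub>R (y - fst z)) * g y) \<partial>lborel)"
    by (rule integral_mult_right_zero)
  also have "\<dots> = - (1 / snd z) * (snd z ^ n * mol (\<lambda>h. \<Sum>j\<in>Basis. (h \<bullet> j) * pd j \<psi> h) g z)"
    using eqmol[OF kg] by simp
  finally have e2: "(0, 1) \<bullet> D = - (1 / snd z) * (snd z ^ n * mol (\<lambda>h. \<Sum>j\<in>Basis. (h \<bullet> j) * pd j \<psi> h) g z)" .
  have Nz: "N z = snd z ^ n * mol \<psi> g z" using ev[of z] t by simp
  have "pd (0, 1) (mol \<psi> g) z = - (1 / snd z) * (real n * mol \<psi> g z + mol (\<lambda>h. \<Sum>j\<in>Basis. (h \<bullet> j) * pd j \<psi> h) g z)"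
    using pd_eqI[OF dm, of "(0, 1)"] t unfolding e2 Nz by (simp add: field_simps)
  also have "real n * mol \<psi> g z + mol (\<lambda>h. \<Sum>j\<in>Basis. (h \<bullet> j) * pd j \<psi> h) g z
    = (\<Sum>j\<in>Basis. mol \<psi> g z + mol (\<lambda>h. (h \<bullet> j) * pd j \<psi> h) g z)"
    using mol_sum[OF p skern_kern[OF skern_coord[OF skern_pd[OF k]]] g, of Basis "\<lambda>j. j" z "\<lambda>j. j"] t
    by (simp add: sum.distrib n_def)
  also have "\<dots> = (\<Sum>j\<in>Basis. mol (pd j (\<lambda>h. (h \<bullet> j) * \<psi> h)) g z)"
  proof (rule sum.cong[OF refl])
    fix j :: 'a assume j: "j \<in> Basis"
    have "mol (pd j (\<lambda>h. (h \<bullet> j) * \<psi> h)) g z = mol (\<lambda>h. \<psi> h + (h \<bullet> j) * pd j \<psi> h) g z"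
      unfolding mol_def pd_coord[OF sm j] ..
    also have "\<dots> = mol \<psi> g z + mol (\<lambda>h. (h \<bullet> j) * pd j \<psi> h) g z"
      using mol_add[OF p kk skern_kern[OF skern_coord[OF skern_pd[OF k j]]] g] t by simp
    finally show "mol \<psi> g z + mol (\<lambda>h. (h \<bullet> j) * pd j \<psi> h) g z = mol (pd j (\<lambda>h. (h \<bullet> j) * \<psi> h)) g z" by simp
  qed
  finally show "pd (0, 1) (mol \<psi> g) z = - (1 / snd z) * (\<Sum>j\<in>Basis. mol (pd j (\<lambda>h. (h \<bullet> j) * \<psi> h)) g z)" .
qed

text \<open>One weak derivative at a time, as a relation between functions with integrals over
  \<open>lborel\<close>; chains of it take the place of weak derivatives for multi-indices in the
  estimates.\<close>

definition wrel :: "'a::euclidean_space \<Rightarrow> ('a \<Rightarrow> real) \<Rightarrow> ('a \<Rightarrow> real) \<Rightarrow> bool" where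
  "wrel j g g' \<longleftrightarrow> (\<forall>\<phi>. test_fun UNIV \<phi> \<longrightarrow>
     (\<integral>x. pd j \<phi> x * g x \<partial>lborel) = - (\<integral>x. \<phi> x * g' x \<partial>lborel))"

lemma pd_rescale:
  fixes \<psi> :: "'a::euclidean_space \<Rightarrow> real"
  assumes "smooth_on UNIV \<psi>"
  shows "pd j (\<lambda>y. \<psi> (c *\<^sub>R (y - x))) y = c * pd j \<psi> (c *\<^sub>R (y - x))"
proof -
  have d1: "((\<lambda>y. c *\<^sub>R (y - x)) has_derivative (\<lambda>v. c *\<^sub>R v)) (at y)" by (auto intro!: derivative_eq_intros)
  have df: "\<psi> differentiable (at (c *\<^sub>R (y - x)))" using smooth_on_differentiable[OF assms] by simp
  have "((\<lambda>y. \<psi> (c *\<^sub>R (y - x))) has_derivative (\<lambda>v. frechet_derivative \<psi> (at (c *\<^sub>R (y - x))) (c *\<^sub>R v))) (at y)"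
    by (rule has_derivative_compose[OF d1]) (use df frechet_derivative_works in blast)
  then show ?thesis using linear_cmul[OF linear_frechet_derivative[OF df]] by (simp add: pd_eqI)
qed

text \<open>For fixed (x, t) the rescaled kernel is itself a test function; the factor -t comes from
  the inner derivative 1/t.\<close>

lemma mol_weak:
  fixes \<psi> :: "'a::euclidean_space \<Rightarrow> real"
  assumes k: "skern r \<psi>" and w: "wrel j g g'" and [measurable]: "g \<in> borel_measurable borel" "g' \<in> borel_measurable borel" and t: "snd z > 0" and j: "j \<in> Basis"
  shows "mol (pd j \<psi>) g z = - snd z * mol \<psi> g' z"
proof -
  have kk: "kern r \<psi>" and sm: "smooth_on UNIV \<psi>" using k unfolding skern_def by auto
  obtain x0 t0 where z: "z = (x0, t0)" and t0: "t0 > 0" using t by (cases z) auto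
  have "test_fun UNIV (\<lambda>y. \<psi> ((1 / t0) *\<^sub>R (y - x0)))"
    by (rule test_fun_rescale[OF sm _ t0]) (use kk in \<open>auto simp: kern_def\<close>)
  then have "(\<integral>y. ((1 / t0) * pd j \<psi> ((1 / t0) *\<^sub>R (y - x0))) * g y \<partial>lborel) = - (\<integral>y. \<psi> ((1 / t0) *\<^sub>R (y - x0)) * g' y \<partial>lborel)"
    using w unfolding wrel_def pd_rescale[OF sm, symmetric] by blast
  then have "(\<integral>y. pd j \<psi> ((1 / t0) *\<^sub>R (y - x0)) * g y \<partial>lborel) = - t0 * (\<integral>y. \<psi> ((1 / t0) *\<^sub>R (y - x0)) * g' y \<partial>lborel)"
    using t0 by (simp add: mult.assoc field_simps)
  then show ?thesis
    using mol_change[OF kern_borel[OF skern_kern[OF skern_pd[OF k j]]] assms(3) t0, of x0] mol_change[OF kern_borel[OF kk] assms(4) t0, of x0]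
    by (simp add: z)
qed

section \<open>Kernels with vanishing moments\<close>

text \<open>Monomials are given by lists of directions, so multiplying the kernel by a coordinate,
  which is what a normal derivative does, lengthens the list by one. The empty list gives the
  mean.\<close>

definition zmom :: "nat \<Rightarrow> ('a::euclidean_space \<Rightarrow> real) \<Rightarrow> bool" where
  "zmom r \<psi> \<longleftrightarrow> (\<forall>js. set js \<subseteq> Basis \<and> length js \<le> r \<longrightarrow>
     (\<integral>h. prod_list (map ((\<bullet>) h) js) * \<psi> h \<partial>lborel) = 0)"

lemma zmom_mono: "zmom r \<psi> \<Longrightarrow> r' \<le> r \<Longrightarrow> zmom r' \<psi>"
  unfolding zmom_def by auto

lemma zmom_integral: "zmom r \<psi> \<Longrightarrow> integral\<^sup>L lborel \<psi> = 0"
  unfolding zmom_def by (auto dest: spec[of _ "[]"])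

lemma zmom_0_iff: "zmom 0 \<psi> \<longleftrightarrow> integral\<^sup>L lborel \<psi> = 0"
  unfolding zmom_def by auto

lemma zmom_coord:
  fixes \<psi> :: "'a::euclidean_space \<Rightarrow> real"
  shows "zmom (Suc r) \<psi> \<Longrightarrow> j \<in> Basis \<Longrightarrow> zmom r (\<lambda>h. (h \<bullet> j) * \<psi> h)"
  unfolding zmom_def
proof (intro allI impI)
  fix js :: "'a list" assume a: "\<forall>js. set js \<subseteq> Basis \<and> length js \<le> Suc r \<longrightarrow> (\<integral>h. prod_list (map ((\<bullet>) h) js) * \<psi> h \<partial>lborel) = 0"
    "j \<in> Basis" "set js \<subseteq> Basis \<and> length js \<le> r"
  then have "(\<integral>h. prod_list (map ((\<bullet>) h) (j # js)) * \<psi> h \<partial>lborel) = 0" by (intro a(1)[rule_format]) auto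
  then show "(\<integral>h. prod_list (map ((\<bullet>) h) js) * (h \<bullet> j * \<psi> h) \<partial>lborel) = 0"
    by (simp add: mult.commute mult.left_commute)
qed

lemma zmom_pd:
  assumes "skern r \<psi>" "j \<in> Basis" shows "zmom 0 (pd j \<psi>)"
  unfolding zmom_0_iff using assms by (intro integral_pd_zero(2)[where R = r]) (auto simp: skern_def kern_def)

lemma skern_prod_list:
  assumes "skern r \<psi>" shows "skern r (\<lambda>h. prod_list (map ((\<bullet>) h) js) * \<psi> h)"
proof (induction js)
  case (Cons j js)
  show ?case using skern_coord[OF Cons, of j] by (simp add: mult.assoc)
qed (use assms in simp)

text \<open>Richardson extrapolation in the scale removes the moments one order at a time.\<close>

lemma moment_kernel_exists:
  fixes r :: real assumes r: "r > 0"
  shows "\<exists>\<eta>::'a::euclidean_space \<Rightarrow> real. skern r \<eta> \<and> integral\<^sup>L lborel \<eta> = 1 \<and>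
    (\<forall>js. set js \<subseteq> Basis \<and> 1 \<le> length js \<and> length js \<le> M \<longrightarrow>
      (\<integral>h. prod_list (map ((\<bullet>) h) js) * \<eta> h \<partial>lborel) = 0)"
proof (induction M)
  case 0
  obtain \<rho> :: "'a \<Rightarrow> real" where "smooth_on UNIV \<rho>" "kern r \<rho>" "integral\<^sup>L lborel \<rho> = 1"
    using normalized_bump_exists[OF r, where 'a = 'a] by blast
  then show ?case by (intro exI[of _ \<rho>]) (auto simp: skern_def)
next
  case (Suc M)
  then obtain \<eta> :: "'a \<Rightarrow> real" where \<eta>: "skern r \<eta>" "integral\<^sup>L lborel \<eta> = 1"
    "\<And>js. set js \<subseteq> Basis \<Longrightarrow> 1 \<le> length js \<Longrightarrow> length js \<le> M \<Longrightarrow> (\<integral>h. prod_list (map ((\<bullet>) h) js) * \<eta> h \<partial>lborel) = 0"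
    by blast
  define n where "n = DIM('a)"
  define q where "q = Suc M"
  have q2: "(2::real) ^ q > 1" unfolding q_def by (rule one_less_power) auto
  define \<theta> where "\<theta> h = \<eta> (2 *\<^sub>R (h - 0))" for h
  have th: "skern r \<theta>"
    using \<eta>(1) r smooth_on_affine_compose[of \<eta> 2 0] smooth_on_continuous_on[of UNIV \<theta>]
    unfolding skern_def kern_def \<theta>_def by auto
  \<comment> \<open>\<open>2 ^ n * \<theta>\<close> is \<eta> at half scale, and its moments of
    order l are 2^(-l) times those of \<eta>. The weights 2^q and -1 cancel the order q = M + 1 and
    leave the vanishing lower moments at zero; the division by 2^q - 1 restores the mean
    one.\<close>
  define \<eta>' where "\<eta>' h = (1 / (2 ^ q - 1)) * (2 ^ q * 2 ^ n * \<theta> h + (- 1) * \<eta> h)" for h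
  have sk: "skern r \<eta>'" unfolding \<eta>'_def by (intro skern_cmult skern_add th \<eta>)
  define mom where "mom \<psi> js = (\<integral>h. prod_list (map ((\<bullet>) h) js) * \<psi> h \<partial>lborel)" for \<psi> :: "'a \<Rightarrow> real" and js
  have intm: "integrable lborel (\<lambda>h. prod_list (map ((\<bullet>) h) js) * \<psi> h)" if "skern r \<psi>" for \<psi> :: "'a \<Rightarrow> real" and js
    by (rule kern_integrable[OF skern_kern[OF skern_prod_list[OF that]]])
  have pl: "prod_list (map ((\<bullet>) (2 *\<^sub>R h)) js) = 2 ^ length js * prod_list (map ((\<bullet>) h) js)" for h :: 'a and js
    by (induction js) auto
  have sc: "2 ^ n * mom \<theta> js = mom \<eta> js / 2 ^ length js" for js
  proof -
    have "mom \<eta> js = 2 ^ n * (\<integral>h. prod_list (map ((\<bullet>) (2 *\<^sub>R h)) js) * \<eta> (2 *\<^sub>R h) \<partial>lborel)"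
      unfolding mom_def n_def
      using lborel_affine_change(2)[of 2 "\<lambda>h. prod_list (map ((\<bullet>) h) js) * \<eta> h" 0] kern_borel[OF skern_kern[OF skern_prod_list[OF \<eta>(1)]]]
      by simp
    also have "\<dots> = 2 ^ n * (2 ^ length js * mom \<theta> js)"
      unfolding mom_def pl \<theta>_def by (simp add: mult.assoc)
    finally show ?thesis by simp
  qed
  have mom': "mom \<eta>' js = (2 ^ q / 2 ^ length js - 1) / (2 ^ q - 1) * mom \<eta> js" for js
  proof -
    have "mom \<eta>' js = (\<integral>h. (1 / (2 ^ q - 1)) * (2 ^ q * 2 ^ n * (prod_list (map ((\<bullet>) h) js) * \<theta> h) - prod_list (map ((\<bullet>) h) js) * \<eta> h) \<partial>lborel)"
      unfolding mom_def \<eta>'_def by (intro Bochner_Integration.integral_cong) (auto simp: algebra_simps)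
    also have "\<dots> = (1 / (2 ^ q - 1)) * (2 ^ q * (2 ^ n * mom \<theta> js) - mom \<eta> js)"
      unfolding mom_def using intm[OF th, of js] intm[OF \<eta>(1), of js] by simp
    also have "\<dots> = (2 ^ q / 2 ^ length js - 1) / (2 ^ q - 1) * mom \<eta> js" unfolding sc using q2 by (simp add: field_simps)
    finally show ?thesis .
  qed
  have "integral\<^sup>L lborel \<eta>' = 1"
    using mom'[of "[]"] \<eta>(2) q2 unfolding mom_def by simp
  moreover have "mom \<eta>' js = 0" if "set js \<subseteq> Basis" "1 \<le> length js" "length js \<le> Suc M" for js
  proof (cases "length js = Suc M")
    case True then show ?thesis unfolding mom' q_def by simp
  next
    case False
    then have "mom \<eta> js = 0" unfolding mom_def using that by (intro \<eta>(3)) auto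
    then show ?thesis unfolding mom' by simp
  qed
  ultimately show ?case using sk unfolding mom_def by blast
qed

section \<open>Jets of weak derivatives and terms that vanish at the boundary\<close>

definition inc :: "'a \<Rightarrow> ('a \<Rightarrow> nat) \<Rightarrow> 'a \<Rightarrow> nat" where "inc j \<alpha> = \<alpha>(j := Suc (\<alpha> j))"

lemma mi_of_Cons: "mi_of (j # js) = inc j (mi_of js)"
  by (auto simp: mi_of_def inc_def fun_eq_iff)

lemma inc_multi_indices: "\<alpha> \<in> multi_indices n \<Longrightarrow> j \<in> Basis \<Longrightarrow> inc j \<alpha> \<in> multi_indices (Suc n)"
  by (erule multi_indices_list) (use mi_of_multi_indices[of "j # _"] in \<open>auto simp: mi_of_Cons\<close>)

text \<open>The jet of a function with \<open>s\<close> weak derivatives, each fixed as a Borel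
  function. Carrying the whole family lets the operators below be applied without choosing
  representatives again.\<close>

definition adm :: "real \<Rightarrow> nat \<Rightarrow> (('a::euclidean_space \<Rightarrow> nat) \<Rightarrow> 'a \<Rightarrow> real) \<Rightarrow> bool" where
  "adm p s g \<longleftrightarrow> (\<forall>n\<le>s. \<forall>\<alpha>\<in>multi_indices n. Lploc p (g \<alpha>)) \<and>
     (\<forall>n<s. \<forall>\<alpha>\<in>multi_indices n. \<forall>j\<in>Basis. wrel j (g \<alpha>) (g (inc j \<alpha>)))"

lemma adm_Lploc: "adm p s g \<Longrightarrow> \<alpha> \<in> multi_indices n \<Longrightarrow> n \<le> s \<Longrightarrow> Lploc p (g \<alpha>)"
  unfolding adm_def by blast

lemma adm_wrel: "adm p s g \<Longrightarrow> \<alpha> \<in> multi_indices n \<Longrightarrow> n < s \<Longrightarrow> j \<in> Basis \<Longrightarrow> wrel j (g \<alpha>) (g (inc j \<alpha>))"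
  unfolding adm_def by blast

text \<open>Terms that occur in derivatives of order \<open>\<ell>\<close> of \<open>t\<^sup>k \<integral> \<eta>(h) f(x + t h) dh\<close>, where
  \<open>e = k - \<ell>\<close> and \<open>f\<close> has \<open>s\<close> weak derivatives \<open>g \<alpha>\<close>. Derivatives are moved onto \<open>f\<close> as long as
  possible, and onto the kernel, at the cost of a factor \<open>1/t\<close>, after that.\<close>

inductive nullop :: "real \<Rightarrow> nat \<Rightarrow> int \<Rightarrow> ((('a::euclidean_space \<Rightarrow> nat) \<Rightarrow> 'a \<Rightarrow> real) \<Rightarrow> 'a \<times> real \<Rightarrow> real) \<Rightarrow> bool"
  for r s e where
  zero: "nullop r s e (\<lambda>g z. 0)"
| trm: "\<alpha> \<in> multi_indices n \<Longrightarrow> n \<le> s \<Longrightarrow> q - int n = e \<Longrightarrow> 0 \<le> q \<or> n = s \<Longrightarrow> skern r \<psi> \<Longrightarrow> zmom (s - n) \<psi> \<Longrightarrow>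
    nullop r s e (\<lambda>g z. c * snd z powi q * mol \<psi> (g \<alpha>) z)"
| add: "nullop r s e L \<Longrightarrow> nullop r s e L' \<Longrightarrow> nullop r s e (\<lambda>g z. L g z + L' g z)"

lemma nullop_sum: "(\<And>i. i \<in> I \<Longrightarrow> nullop r s e (L i)) \<Longrightarrow> nullop r s e (\<lambda>g z. \<Sum>i\<in>I. L i g z)"
  by (induction I rule: infinite_finite_induct) (auto intro: nullop.intros)

lemma Basis_prod_cases:
  assumes "b \<in> (Basis :: ('a::euclidean_space \<times> real) set)"
  obtains j where "j \<in> Basis" "b = (j, 0)" | "b = (0, 1)"
  using assms by (auto simp: Basis_prod_def)

lemma Basis_prod_tan: "j \<in> Basis \<Longrightarrow> (j, 0::real) \<in> Basis" and Basis_prod_nor: "(0::'a::euclidean_space, 1::real) \<in> Basis"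
  by (auto simp: Basis_prod_def)

lemma open_upper: "open {z::'a::euclidean_space \<times> real. 0 < snd z}"
  by (intro open_Collect_less continuous_intros)

lemma term_derivative:
  fixes F :: "'a::euclidean_space \<times> real \<Rightarrow> real"
  assumes F: "F differentiable (at z)" and z: "0 < snd z"
  shows "(\<lambda>z. c * snd z powi q * F z) differentiable (at z)"
    "pd b (\<lambda>z. c * snd z powi q * F z) z = c * snd z powi q * pd b F z + (c * real_of_int q * snd b) * snd z powi (q - 1) * F z"
proof -
  have d: "((\<lambda>z. c * snd z powi q * F z) has_derivative
     (\<lambda>v. (c * snd z powi q) * frechet_derivative F (at z) v + (c * (snd v * (of_int q * snd z powi (q - 1)))) * F z)) (at z)"
    using z by (intro has_derivative_mult F[unfolded frechet_derivative_works])
      (auto intro!: derivative_eq_intros)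
  show "(\<lambda>z. c * snd z powi q * F z) differentiable (at z)" using d unfolding differentiable_def by blast
  show "pd b (\<lambda>z. c * snd z powi q * F z) z = c * snd z powi q * pd b F z + (c * real_of_int q * snd b) * snd z powi (q - 1) * F z"
    unfolding pd_eqI[OF d] by simp
qed

text \<open>Below the top order the factor -1/t of \<open>mol_derivative\<close> cancels against the
  factor -t of \<open>mol_weak\<close>, and no negative power of t arises.\<close>

lemma mol_pd_unsaturated:
  fixes g :: "('a::euclidean_space \<Rightarrow> nat) \<Rightarrow> 'a \<Rightarrow> real"
  assumes p: "1 \<le> p" and g: "adm p s g" and k: "skern r \<psi>" and al: "\<alpha> \<in> multi_indices n" "n < s" and z: "0 < snd z"
  shows "j \<in> Basis \<Longrightarrow> pd (j, 0) (mol \<psi> (g \<alpha>)) z = mol \<psi> (g (inc j \<alpha>)) z"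
    "pd (0, 1) (mol \<psi> (g \<alpha>)) z = (\<Sum>j\<in>Basis. mol (\<lambda>h. (h \<bullet> j) * \<psi> h) (g (inc j \<alpha>)) z)"
proof -
  have L: "Lploc p (g \<alpha>)" using adm_Lploc[OF g al(1)] al(2) by simp
  have Li: "Lploc p (g (inc j \<alpha>))" if "j \<in> Basis" for j using adm_Lploc[OF g inc_multi_indices[OF al(1) that]] al(2) by simp
  have w: "mol (pd j \<theta>) (g \<alpha>) z = - snd z * mol \<theta> (g (inc j \<alpha>)) z" if "skern r \<theta>" "j \<in> Basis" for \<theta> j
    by (rule mol_weak[OF that(1) adm_wrel[OF g al that(2)] Lploc_borel[OF L] Lploc_borel[OF Li[OF that(2)]] z that(2)])
  show "j \<in> Basis \<Longrightarrow> pd (j, 0) (mol \<psi> (g \<alpha>)) z = mol \<psi> (g (inc j \<alpha>)) z"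
    using mol_derivative(2)[OF p k L z] w[OF k] z by simp
  have "pd (0, 1) (mol \<psi> (g \<alpha>)) z = - (1 / snd z) * (\<Sum>j\<in>Basis. - snd z * mol (\<lambda>h. (h \<bullet> j) * \<psi> h) (g (inc j \<alpha>)) z)"
    unfolding mol_derivative(3)[OF p k L z] by (intro arg_cong2[of _ _ _ _ "(*)"] sum.cong refl w skern_coord k)
  then show "pd (0, 1) (mol \<psi> (g \<alpha>)) z = (\<Sum>j\<in>Basis. mol (\<lambda>h. (h \<bullet> j) * \<psi> h) (g (inc j \<alpha>)) z)"
    using z by (simp add: sum_negf sum_distrib_left[symmetric])
qed

text \<open>The moment conditions \<open>zm\<close> and \<open>zt\<close> concern the kernels that
  result, so the lemma serves null terms as well as leading terms, whose kernel has mean one. At the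
  top order n = s the new kernels are derivatives and have mean zero anyway.\<close>

lemma mol_step:
  fixes \<psi> :: "'a::euclidean_space \<Rightarrow> real"
  assumes p: "1 \<le> p" and k: "skern r \<psi>" and al: "\<alpha> \<in> multi_indices n" "n \<le> s" and b: "b \<in> Basis"
    and q: "0 \<le> q \<or> n = s"
    and zm: "\<And>j. n < s \<Longrightarrow> j \<in> Basis \<Longrightarrow> b = (0, 1) \<Longrightarrow> zmom (s - Suc n) (\<lambda>h. (h \<bullet> j) * \<psi> h)"
    and zt: "n < s \<Longrightarrow> b \<noteq> (0, 1) \<Longrightarrow> zmom (s - Suc n) \<psi>"
  shows "\<exists>L. nullop r s (q - int n - 1) L \<and> (\<forall>g. adm p s g \<longrightarrow> (\<forall>z. 0 < snd z \<longrightarrow>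
     c * snd z powi q * pd b (mol \<psi> (g \<alpha>)) z = L g z))"
  using b
proof (cases rule: Basis_prod_cases)
  case (1 j)
  show ?thesis
  proof (cases "n < s")
    case True
    show ?thesis
    proof (intro exI conjI allI impI)
      show "nullop r s (q - int n - 1) (\<lambda>g z. c * snd z powi q * mol \<psi> (g (inc j \<alpha>)) z)"
        using True 1 q zt by (intro nullop.trm[OF inc_multi_indices[OF al(1)]] k) auto
    qed (use mol_pd_unsaturated(1)[OF p _ k al(1) True] 1 in auto)
  next
    case False
    then have n: "n = s" using al by simp
    show ?thesis
    proof (intro exI conjI allI impI)
      show "nullop r s (q - int n - 1) (\<lambda>g z. (- c) * snd z powi (q - 1) * mol (pd j \<psi>) (g \<alpha>) z)"
        using n zmom_pd[OF k 1(1)] by (intro nullop.trm[OF al] skern_pd[OF k 1(1)]) auto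
      fix g :: "('a \<Rightarrow> nat) \<Rightarrow> 'a \<Rightarrow> real" and z :: "'a \<times> real" assume g: "adm p s g" and z: "0 < snd z"
      show "c * snd z powi q * pd b (mol \<psi> (g \<alpha>)) z = (- c) * snd z powi (q - 1) * mol (pd j \<psi>) (g \<alpha>) z"
        using mol_derivative(2)[OF p k adm_Lploc[OF g al] z 1(1)] z unfolding 1(2) by (simp add: power_int_diff)
    qed
  qed
next
  case 2
  show ?thesis
  proof (cases "n < s")
    case True
    show ?thesis
    proof (intro exI conjI allI impI)
      show "nullop r s (q - int n - 1) (\<lambda>g z. \<Sum>j\<in>Basis. c * snd z powi q * mol (\<lambda>h. (h \<bullet> j) * \<psi> h) (g (inc j \<alpha>)) z)"
        using True 2 q zm by (intro nullop_sum nullop.trm[OF inc_multi_indices[OF al(1)]] skern_coord k) auto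
      fix g :: "('a \<Rightarrow> nat) \<Rightarrow> 'a \<Rightarrow> real" and z :: "'a \<times> real" assume g: "adm p s g" and z: "0 < snd z"
      show "c * snd z powi q * pd b (mol \<psi> (g \<alpha>)) z = (\<Sum>j\<in>Basis. c * snd z powi q * mol (\<lambda>h. (h \<bullet> j) * \<psi> h) (g (inc j \<alpha>)) z)"
        using mol_pd_unsaturated(2)[OF p g k al(1) True z] unfolding 2 by (simp add: sum_distrib_left)
    qed
  next
    case False
    then have n: "n = s" using al by simp
    show ?thesis
    proof (intro exI conjI allI impI)
      show "nullop r s (q - int n - 1) (\<lambda>g z. \<Sum>j\<in>Basis. (- c) * snd z powi (q - 1) * mol (pd j (\<lambda>h. (h \<bullet> j) * \<psi> h)) (g \<alpha>) z)"
        using n zmom_pd[OF skern_coord[OF k]] by (intro nullop_sum nullop.trm[OF al] skern_pd skern_coord k) auto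
      fix g :: "('a \<Rightarrow> nat) \<Rightarrow> 'a \<Rightarrow> real" and z :: "'a \<times> real" assume g: "adm p s g" and z: "0 < snd z"
      show "c * snd z powi q * pd b (mol \<psi> (g \<alpha>)) z = (\<Sum>j\<in>Basis. (- c) * snd z powi (q - 1) * mol (pd j (\<lambda>h. (h \<bullet> j) * \<psi> h)) (g \<alpha>) z)"
        using mol_derivative(3)[OF p k adm_Lploc[OF g al] z] z unfolding 2 by (simp add: power_int_diff sum_distrib_left sum_negf)
    qed
  qed
qed

text \<open>Product rule: one part differentiates the average (\<open>L1\<close>), the other the
  power of t (\<open>L2\<close>); either lowers the degree \<open>e\<close> by one.\<close>

lemma nullop_step:
  fixes L :: "(('a::euclidean_space \<Rightarrow> nat) \<Rightarrow> 'a \<Rightarrow> real) \<Rightarrow> 'a \<times> real \<Rightarrow> real"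
  assumes L: "nullop r s e L" and p: "1 \<le> p" and b: "b \<in> Basis"
  shows "\<exists>L'. nullop r s (e - 1) L' \<and> (\<forall>g. adm p s g \<longrightarrow> (\<forall>z. 0 < snd z \<longrightarrow>
     L g differentiable (at z) \<and> pd b (L g) z = L' g z))"
  using L
proof induction
  case zero
  show ?case by (intro exI[of _ "\<lambda>g z. 0"]) (auto intro: nullop.zero)
next
  case (add L1 L2)
  then obtain L1' L2' where "nullop r s (e - 1) L1'" "nullop r s (e - 1) L2'"
    "\<forall>g. adm p s g \<longrightarrow> (\<forall>z. 0 < snd z \<longrightarrow> L1 g differentiable (at z) \<and> pd b (L1 g) z = L1' g z)"
    "\<forall>g. adm p s g \<longrightarrow> (\<forall>z. 0 < snd z \<longrightarrow> L2 g differentiable (at z) \<and> pd b (L2 g) z = L2' g z)" by blast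
  then show ?case by (intro exI[of _ "\<lambda>g z. L1' g z + L2' g z"]) (auto intro: nullop.add simp: pd_add)
next
  case (trm \<alpha> n q \<psi> c)
  have zs: "zmom (s - Suc n) (\<lambda>h. (h \<bullet> j) * \<psi> h)" if "n < s" "j \<in> Basis" for j
    using zmom_coord[of "s - Suc n" \<psi> j] trm(6) that by (simp add: Suc_diff_Suc)
  have zs': "zmom (s - Suc n) \<psi>" using zmom_mono[OF trm(6)] by simp
  obtain L1 where L1: "nullop r s (q - int n - 1) L1" "\<And>g z. adm p s g \<Longrightarrow> 0 < snd z \<Longrightarrow> c * snd z powi q * pd b (mol \<psi> (g \<alpha>)) z = L1 g z"
    using mol_step[OF p trm(5,1,2) b trm(4), of c] zs zs' by blast
  define L2 where "L2 = (\<lambda>(g :: ('a \<Rightarrow> nat) \<Rightarrow> 'a \<Rightarrow> real) z. (c * real_of_int q * snd b) * snd z powi (q - 1) * mol \<psi> (g \<alpha>) z)"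
  \<comment> \<open>For q = 0 the coefficient vanishes. Otherwise either n = s or q >= 1, so that
    the exponent q - 1 is still admissible.\<close>
  have L2: "nullop r s (e - 1) L2"
  proof (cases "q = 0")
    case True
    then show ?thesis unfolding L2_def by (simp add: nullop.zero)
  next
    case False
    then show ?thesis unfolding L2_def using trm by (intro nullop.trm[of \<alpha> n]) auto
  qed
  show ?case
  proof (intro exI[of _ "\<lambda>g z. L1 g z + L2 g z"] conjI allI impI)
    show "nullop r s (e - 1) (\<lambda>g z. L1 g z + L2 g z)" using L1(1) L2 trm(3) by (intro nullop.add) auto
    fix g :: "('a \<Rightarrow> nat) \<Rightarrow> 'a \<Rightarrow> real" and z :: "'a \<times> real" assume g: "adm p s g" and z: "0 < snd z"
    have d: "mol \<psi> (g \<alpha>) differentiable (at z)" by (rule mol_derivative(1)[OF p trm(5) adm_Lploc[OF g trm(1,2)] z])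
    show "(\<lambda>z. c * snd z powi q * mol \<psi> (g \<alpha>) z) differentiable (at z)" by (rule term_derivative(1)[OF d z])
    show "pd b (\<lambda>z. c * snd z powi q * mol \<psi> (g \<alpha>) z) z = L1 g z + L2 g z"
      unfolding term_derivative(2)[OF d z] L1(2)[OF g z] L2_def ..
  qed
qed

section \<open>Leading terms of the derivatives of the extension\<close>

definition tang :: "('a \<times> real) list \<Rightarrow> ('a::euclidean_space) list" where
  "tang bs = map fst (filter (\<lambda>b. b \<noteq> (0, 1)) bs)"

definition nrm :: "('a::euclidean_space \<times> real) list \<Rightarrow> nat" where
  "nrm bs = count_list bs (0, 1)"

lemma tang_nrm_simps [simp]: "tang [] = []" "nrm [] = 0"
  "tang ((0, 1) # bs) = tang bs" "nrm ((0, 1) # bs) = Suc (nrm bs)"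
  "tang ((j, 0) # bs) = j # tang bs" "nrm ((j, 0) # bs) = nrm bs"
  by (auto simp: tang_def nrm_def)

lemma tang_Basis: "set bs \<subseteq> Basis \<Longrightarrow> set (tang bs) \<subseteq> Basis"
  by (auto simp: tang_def Basis_prod_def)

lemma nrm_tang_length: "set bs \<subseteq> (Basis :: ('a::euclidean_space \<times> real) set) \<Longrightarrow> nrm bs + length (tang bs) = length bs"
proof (induction bs)
  case (Cons b bs)
  then have "b \<in> Basis" by simp
  then show ?case using Cons by (cases rule: Basis_prod_cases) auto
qed simp

text \<open>What a derivative with n normal and \<open>js\<close> tangential directions would be if
  the average behaved like f itself: a monomial in t times an average with the original kernel. The
  value is zero once either order is exhausted.\<close>

definition mterm :: "('a::euclidean_space \<Rightarrow> real) \<Rightarrow> nat \<Rightarrow> nat \<Rightarrow> nat \<Rightarrow> 'a list \<Rightarrow> (('a \<Rightarrow> nat) \<Rightarrow> 'a \<Rightarrow> real) \<Rightarrow> 'a \<times> real \<Rightarrow> real" where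
  "mterm \<eta> s k n js g z = (if n \<le> k \<and> length js \<le> s
     then (1 / fact (k - n)) * snd z powi int (k - n) * mol \<eta> (g (mi_of js)) z else 0)"

definition mkernel :: "real \<Rightarrow> nat \<Rightarrow> ('a::euclidean_space \<Rightarrow> real) \<Rightarrow> bool" where
  "mkernel r M \<eta> \<longleftrightarrow> skern r \<eta> \<and> integral\<^sup>L lborel \<eta> = 1 \<and>
    (\<forall>js. set js \<subseteq> Basis \<and> 1 \<le> length js \<and> length js \<le> M \<longrightarrow>
      (\<integral>h. prod_list (map ((\<bullet>) h) js) * \<eta> h \<partial>lborel) = 0)"

lemma mkernel_coord:
  assumes "mkernel r M \<eta>" "j \<in> Basis" "Suc i \<le> M" shows "zmom i (\<lambda>h. (h \<bullet> j) * \<eta> h)"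
  unfolding zmom_def
proof (intro allI impI)
  fix js :: "'a list" assume js: "set js \<subseteq> Basis \<and> length js \<le> i"
  have all: "\<forall>js. set js \<subseteq> Basis \<and> 1 \<le> length js \<and> length js \<le> M \<longrightarrow>
      (\<integral>h. prod_list (map ((\<bullet>) h) js) * \<eta> h \<partial>lborel) = 0"
    using assms(1) unfolding mkernel_def by blast
  have "set (j # js) \<subseteq> Basis \<and> 1 \<le> length (j # js) \<and> length (j # js) \<le> M" using js assms by auto
  then have "(\<integral>h. prod_list (map ((\<bullet>) h) (j # js)) * \<eta> h \<partial>lborel) = 0" by (rule all[rule_format])
  then show "(\<integral>h. prod_list (map ((\<bullet>) h) js) * (h \<bullet> j * \<eta> h) \<partial>lborel) = 0"
    by (simp add: mult.commute mult.left_commute)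
qed

text \<open>A tangential derivative falls on f as long as f has one left, and a normal derivative of
  the power of t gives the next leading term. Everything else carries a kernel h_j \<eta>, killed by
  the moment conditions up to the order required, or a derivative of a kernel: a null term.\<close>

lemma mterm_step:
  fixes \<eta> :: "'a::euclidean_space \<Rightarrow> real" and k n :: nat
  assumes p: "1 \<le> p" and mk: "mkernel r M \<eta>" and s: "s \<le> M" and b: "b \<in> Basis" and js: "set js \<subseteq> Basis"
  defines "n' \<equiv> if b = (0, 1) then Suc n else n" and "js' \<equiv> if b = (0, 1) then js else fst b # js"
  shows "\<exists>L. nullop r s (int k - int (n + length js) - 1) L \<and> (\<forall>g. adm p s g \<longrightarrow> (\<forall>z. 0 < snd z \<longrightarrow>
     mterm \<eta> s k n js g differentiable (at z) \<and> pd b (mterm \<eta> s k n js g) z = mterm \<eta> s k n' js' g z + L g z))"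
proof (cases "n \<le> k \<and> length js \<le> s")
  case False
  then have 0: "mterm \<eta> s k n js g = (\<lambda>z. 0)" "mterm \<eta> s k n' js' g z = 0" for g z
    unfolding mterm_def n'_def js'_def by auto
  show ?thesis unfolding 0 by (intro exI[of _ "\<lambda>g z. 0"]) (auto intro: nullop.zero)
next
  case True
  have sk: "skern r \<eta>" using mk unfolding mkernel_def by blast
  define \<alpha> where "\<alpha> = mi_of js"
  define i where "i = length js"
  have al: "\<alpha> \<in> multi_indices i" "i \<le> s" using mi_of_multi_indices[OF js] True unfolding \<alpha>_def i_def by auto
  define c :: real where "c = 1 / fact (k - n)"
  define q where "q = int (k - n)"
  have m: "mterm \<eta> s k n js g = (\<lambda>z. c * snd z powi q * mol \<eta> (g \<alpha>) z)" for g
    using True unfolding mterm_def c_def q_def \<alpha>_def by auto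
  have e: "q - int i - 1 = int k - int (n + length js) - 1" using True unfolding q_def i_def by auto
  have zc: "zmom (s - Suc i) (\<lambda>h. (h \<bullet> j) * \<eta> h)" if "i < s" "j \<in> Basis" for j
    using mkernel_coord[OF mk that(2), of "s - Suc i"] that s by simp
  have d: "mterm \<eta> s k n js g differentiable (at z)"
    and pdm: "pd b (mterm \<eta> s k n js g) z = c * snd z powi q * pd b (mol \<eta> (g \<alpha>)) z + (c * real_of_int q * snd b) * snd z powi (q - 1) * mol \<eta> (g \<alpha>) z"
    if "adm p s g" "0 < snd z" for g z
    using term_derivative[OF mol_derivative(1)[OF p sk adm_Lploc[OF that(1) al] that(2)] that(2)] unfolding m by auto
  from b show ?thesis
  proof (cases rule: Basis_prod_cases)
    case (1 j)
    then have n': "n' = n" "js' = j # js" unfolding n'_def js'_def by auto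
    show ?thesis
    proof (cases "i < s")
      case i: True
      show ?thesis
      proof (intro exI[of _ "\<lambda>g z. 0"] conjI allI impI nullop.zero)
        fix g :: "('a \<Rightarrow> nat) \<Rightarrow> 'a \<Rightarrow> real" and z :: "'a \<times> real" assume g: "adm p s g" and z: "0 < snd z"
        have "mterm \<eta> s k n' js' g z = c * snd z powi q * mol \<eta> (g (inc j \<alpha>)) z"
          using True i unfolding mterm_def n' c_def q_def i_def \<alpha>_def by (simp add: mi_of_Cons)
        then show "pd b (mterm \<eta> s k n js g) z = mterm \<eta> s k n' js' g z + 0"
          unfolding pdm[OF g z] using 1 mol_pd_unsaturated(1)[OF p g sk al(1) i z 1(1)] by simp
      qed (use d in auto)
    next
      case i: False
      obtain L where L: "nullop r s (q - int i - 1) L" "\<And>g z. adm p s g \<Longrightarrow> 0 < snd z \<Longrightarrow> c * snd z powi q * pd b (mol \<eta> (g \<alpha>)) z = L g z"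
        using mol_step[OF p sk al b, of q c] i al by (auto simp: q_def)
      have "mterm \<eta> s k n' js' g z = 0" for g z using i unfolding mterm_def n' i_def by simp
      then show ?thesis using L d pdm 1 unfolding e by (intro exI[of _ L]) auto
    qed
  next
    case 2
    then have n': "n' = Suc n" "js' = js" unfolding n'_def js'_def by auto
    obtain L where L: "nullop r s (q - int i - 1) L" "\<And>g z. adm p s g \<Longrightarrow> 0 < snd z \<Longrightarrow> c * snd z powi q * pd b (mol \<eta> (g \<alpha>)) z = L g z"
      using mol_step[OF p sk al b, of q c] zc 2 by (auto simp: q_def)
    have "(c * real_of_int q * snd b) * snd z powi (q - 1) * mol \<eta> (g \<alpha>) z = mterm \<eta> s k n' js' g z" for g and z :: "'a \<times> real"
    proof (cases "n < k")
      case nk: True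
      then obtain i where i: "k - n = Suc i" by (metis Suc_diff_Suc)
      then have "k - Suc n = i" "c * real_of_int q = 1 / fact i" "q - 1 = int i"
        unfolding c_def q_def by (simp_all add: fact_Suc del: of_nat_Suc)
      then show ?thesis using 2 True nk unfolding mterm_def n' \<alpha>_def by simp
    next
      case False
      then show ?thesis using True unfolding mterm_def n' q_def by auto
    qed
    then show ?thesis using L d pdm unfolding e by (intro exI[of _ L]) auto
  qed
qed

text \<open>In each step null terms stay null terms (\<open>L1\<close>) and the leading term creates
  new ones (\<open>L2\<close>). The operator is obtained before the jet \<open>g\<close>, hence
  works for all jets.\<close>

theorem mterm_iter_pderiv:
  fixes \<eta> :: "'a::euclidean_space \<Rightarrow> real"
  assumes p: "1 \<le> p" and mk: "mkernel r M \<eta>" and s: "s \<le> M" and bs: "set bs \<subseteq> Basis"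
  shows "\<exists>L. nullop r s (int k - int (length bs)) L \<and> (\<forall>g. adm p s g \<longrightarrow> (\<forall>z. 0 < snd z \<longrightarrow>
     iter_pderiv bs (mterm \<eta> s k 0 [] g) differentiable (at z) \<and>
     iter_pderiv bs (mterm \<eta> s k 0 [] g) z = mterm \<eta> s k (nrm bs) (tang bs) g z + L g z))"
  using bs
proof (induction bs)
  case Nil
  show ?case
  proof (intro exI[of _ "\<lambda>g z. 0"] conjI nullop.zero allI impI)
    fix g :: "('a \<Rightarrow> nat) \<Rightarrow> 'a \<Rightarrow> real" and z :: "'a \<times> real" assume "adm p s g" "0 < snd z"
    then show "iter_pderiv [] (mterm \<eta> s k 0 [] g) differentiable (at z)"
      using mterm_step[OF p mk s Basis_prod_nor empty_subsetI[of Basis, folded list.set(1)], of k 0]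
      unfolding iter_pderiv.simps by blast
  qed simp
next
  case (Cons b bs)
  then have b: "b \<in> Basis" and bs: "set bs \<subseteq> Basis" by auto
  from Cons.IH[OF bs] obtain L where L: "nullop r s (int k - int (length bs)) L"
    and LL: "\<And>g z. adm p s g \<Longrightarrow> 0 < snd z \<Longrightarrow> iter_pderiv bs (mterm \<eta> s k 0 [] g) z = mterm \<eta> s k (nrm bs) (tang bs) g z + L g z" by blast
  obtain L1 where L1: "nullop r s (int k - int (length bs) - 1) L1"
    "\<And>g z. adm p s g \<Longrightarrow> 0 < snd z \<Longrightarrow> L g differentiable (at z) \<and> pd b (L g) z = L1 g z"
    using nullop_step[OF L p b] by blast
  have hb: "(if b = (0, 1) then Suc (nrm bs) else nrm bs) = nrm (b # bs)"
    "(if b = (0, 1) then tang bs else fst b # tang bs) = tang (b # bs)"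
    using b by (cases rule: Basis_prod_cases; auto)+
  obtain L2 where L2: "nullop r s (int k - int (length bs) - 1) L2"
    "\<And>g z. adm p s g \<Longrightarrow> 0 < snd z \<Longrightarrow> mterm \<eta> s k (nrm bs) (tang bs) g differentiable (at z) \<and>
       pd b (mterm \<eta> s k (nrm bs) (tang bs) g) z = mterm \<eta> s k (nrm (b # bs)) (tang (b # bs)) g z + L2 g z"
    using mterm_step[OF p mk s b tang_Basis[OF bs], of k "nrm bs"] unfolding nrm_tang_length[OF bs] hb by blast
  have e: "int k - int (length (b # bs)) = int k - int (length bs) - 1" by simp
  have step: "pd b (iter_pderiv bs (mterm \<eta> s k 0 [] g)) z = mterm \<eta> s k (nrm (b # bs)) (tang (b # bs)) g z + (L1 g z + L2 g z)"
    if g: "adm p s g" and z: "0 < snd z" for g z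
  proof -
    have "pd b (iter_pderiv bs (mterm \<eta> s k 0 [] g)) z = pd b (\<lambda>z. mterm \<eta> s k (nrm bs) (tang bs) g z + L g z) z"
      using frechet_derivative_cong_open[OF open_upper, of z] z LL[OF g] by (metis (no_types, lifting) mem_Collect_eq)
    also have "\<dots> = mterm \<eta> s k (nrm (b # bs)) (tang (b # bs)) g z + L2 g z + L1 g z"
      using L1(2)[OF g z] L2(2)[OF g z] by (simp add: pd_add)
    finally show ?thesis by simp
  qed
  let ?L = "\<lambda>g z. L1 g z + L2 g z"
  have nL: "nullop r s (int k - int (length (b # bs))) ?L" unfolding e by (intro nullop.add L1(1) L2(1))
  obtain L3 where L3: "\<And>g z. adm p s g \<Longrightarrow> 0 < snd z \<Longrightarrow> ?L g differentiable (at z)"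
    using nullop_step[OF nL p b] by blast
  have dm: "mterm \<eta> s k (nrm (b # bs)) (tang (b # bs)) g differentiable (at z)" if "adm p s g" "0 < snd z" for g z
    using mterm_step[OF p mk s b tang_Basis[OF Cons.prems], of k "nrm (b # bs)"] that by blast
  show ?case
  proof (intro exI[of _ ?L] conjI nL allI impI)
    fix g :: "('a \<Rightarrow> nat) \<Rightarrow> 'a \<Rightarrow> real" and z :: "'a \<times> real" assume g: "adm p s g" and z: "0 < snd z"
    have "(\<lambda>z. mterm \<eta> s k (nrm (b # bs)) (tang (b # bs)) g z + ?L g z) differentiable (at z)"
      by (intro differentiable_add dm[OF g z] L3[OF g z])
    then show "iter_pderiv (b # bs) (mterm \<eta> s k 0 [] g) differentiable (at z)"
      by (rule differentiable_cong_open[OF open_upper, rotated 2]) (use z step[OF g] in auto)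
    show "iter_pderiv (b # bs) (mterm \<eta> s k 0 [] g) z = mterm \<eta> s k (nrm (b # bs)) (tang (b # bs)) g z + ?L g z"
      using step[OF g z] by simp
  qed
qed

section \<open>Gagliardo estimates for averages\<close>

lemma fst_borel [measurable]: "fst \<in> borel_measurable (borel :: ('a::euclidean_space \<times> 'b::euclidean_space) measure)"
  and snd_borel [measurable]: "snd \<in> borel_measurable (borel :: ('a::euclidean_space \<times> 'b::euclidean_space) measure)"
  by (auto intro!: borel_measurable_continuous_onI continuous_intros)

lemma mol_measurable:
  assumes [measurable]: "\<psi> \<in> borel_measurable borel" "g \<in> borel_measurable borel"
  shows "mol \<psi> g \<in> borel_measurable borel"
proof -
  have "(\<lambda>z. \<integral>h. \<psi> h * g (fst z + snd z *\<^sub>R h) \<partial>lborel) \<in> borel_measurable borel"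
    by (rule lborel.borel_measurable_lebesgue_integral) measurable
  then show ?thesis using mol_lborel[OF assms] by (simp cong: measurable_cong)
qed

lemma Pair_borel [measurable]: "(\<lambda>x. (x, t)) \<in> borel_measurable (borel :: 'a::euclidean_space measure)" for t :: "'b::euclidean_space"
  by (auto intro!: borel_measurable_continuous_onI continuous_intros)

lemma slice_measurable:
  fixes F :: "'a::euclidean_space \<times> 'b::euclidean_space \<Rightarrow> real"
  assumes "F \<in> borel_measurable borel" shows "(\<lambda>x. F (x, t)) \<in> borel_measurable borel"
  using measurable_compose[OF Pair_borel assms] .

lemma power_int_measurable [measurable]: "(\<lambda>x::real. x powi q) \<in> borel_measurable borel"
  unfolding power_int_def by (cases "0 \<le> q") auto

lemma nullop_measurable:
  assumes "nullop r s e L" "adm p s g" shows "L g \<in> borel_measurable borel"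
  using assms(1)
proof induction
  case (trm \<alpha> n q \<psi> c)
  have [measurable]: "mol \<psi> (g \<alpha>) \<in> borel_measurable borel"
    by (rule mol_measurable[OF kern_borel[OF skern_kern[OF trm(5)]] Lploc_borel[OF adm_Lploc[OF assms(2) trm(1,2)]]])
  show ?case by measurable
qed auto

lemma mterm_measurable:
  assumes "skern r \<eta>" "adm p s g" "set js \<subseteq> Basis" shows "mterm \<eta> s k n js g \<in> borel_measurable borel"
proof (cases "n \<le> k \<and> length js \<le> s")
  case True
  then have [measurable]: "mol \<eta> (g (mi_of js)) \<in> borel_measurable borel"
    using adm_Lploc[OF assms(2) mi_of_multi_indices[OF assms(3)]] assms(1)
    by (intro mol_measurable kern_borel[OF skern_kern[OF assms(1)]] Lploc_borel) auto
  show ?thesis using True unfolding mterm_def[abs_def] by simp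
next
  case False
  then have "mterm \<eta> s k n js g = (\<lambda>z. 0)" by (auto simp: mterm_def fun_eq_iff)
  then show ?thesis by simp
qed

text \<open>Counterpart of \<open>gagliardo_energy\<close> for a single component; the dimension
  here is N - 1, so the exponent is p + N - 2.\<close>

definition gag :: "real \<Rightarrow> real \<Rightarrow> ('a::euclidean_space \<Rightarrow> real) \<Rightarrow> ennreal" where
  "gag a p f = (\<integral>\<^sup>+x. (\<integral>\<^sup>+h. ennreal (\<bar>f (x + h) - f x\<bar> powr p / norm h powr (p + real DIM('a) - 1)) * indicator (ball 0 a) h \<partial>lborel) \<partial>lborel)"

lemma nn_integral_power_tail:
  fixes \<beta> \<tau> :: real assumes \<beta>: "1 < \<beta>" and \<tau>: "0 < \<tau>"
  shows "(\<integral>\<^sup>+t. ennreal (t powr (- \<beta>)) * indicator {\<tau>..} t \<partial>lborel) = ennreal (\<tau> powr (1 - \<beta>) / (\<beta> - 1))"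
proof -
  have "(\<integral>\<^sup>+t. ennreal (t powr (- \<beta>)) * indicator {\<tau>..} t \<partial>lborel) = ennreal (0 - (- (\<tau> powr (1 - \<beta>) / (\<beta> - 1))))"
  proof (rule nn_integral_FTC_atLeast)
    fix t assume "\<tau> \<le> t"
    then have "t > 0" using \<tau> by simp
    then have "((\<lambda>t. - (t powr (1 - \<beta>) / (\<beta> - 1))) has_real_derivative - ((1 - \<beta>) * t powr (1 - \<beta> - 1) / (\<beta> - 1))) (at t)"
      by (intro DERIV_minus DERIV_cdivide has_real_derivative_powr)
    moreover have "1 - \<beta> = - (\<beta> - 1)" by simp
    then have "- ((1 - \<beta>) * t powr (1 - \<beta> - 1) / (\<beta> - 1)) = t powr (- \<beta>)" using \<beta> by (simp only: minus_mult_left[symmetric]) simp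
    ultimately show "((\<lambda>t. - (t powr (1 - \<beta>) / (\<beta> - 1))) has_real_derivative t powr (- \<beta>)) (at t)" by simp
  next
    have "((\<lambda>t. t powr (1 - \<beta>)) \<longlongrightarrow> 0) at_top"
      using tendsto_neg_powr[of "1 - \<beta>" "\<lambda>t. t" at_top] \<beta> by (simp add: filterlim_ident)
    then have "((\<lambda>t. - (t powr (1 - \<beta>) / (\<beta> - 1))) \<longlongrightarrow> - (0 / (\<beta> - 1))) at_top"
      by (intro tendsto_intros) (use \<beta> in auto)
    then show "((\<lambda>t. - (t powr (1 - \<beta>) / (\<beta> - 1))) \<longlongrightarrow> 0) at_top" by simp
  qed auto
  then show ?thesis by simp
qed

abbreviation layer :: "real \<Rightarrow> real set \<Rightarrow> (real \<Rightarrow> 'a::euclidean_space \<Rightarrow> real) \<Rightarrow> ennreal" where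
  "layer p I f \<equiv> (\<integral>\<^sup>+t. indicator I t * Ip p UNIV (f t) \<partial>lborel)"

abbreviation gags :: "real \<Rightarrow> real \<Rightarrow> nat \<Rightarrow> (('a::euclidean_space \<Rightarrow> nat) \<Rightarrow> 'a \<Rightarrow> real) \<Rightarrow> ennreal" where
  "gags a p s g \<equiv> (\<Sum>\<alpha>\<in>multi_indices s. gag a p (g \<alpha>))"

text \<open>As \<psi> has mean zero, f(x) may be subtracted from f(x + t h). Jensen and y = t h
  bound the p-th power by t^(-\<beta>) times an integral over |y| < r t. Integrating in t over t >
  |y|/r first leaves |y|^(1 - \<beta>), which is the Gagliardo weight; \<open>r * D \<le> a\<close>
  guarantees |y| < a.\<close>

lemma mol_gag_bound:
  fixes \<psi> :: "'a::euclidean_space \<Rightarrow> real"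
  assumes p: "1 \<le> p" and k: "kern r \<psi>" and z: "integral\<^sup>L lborel \<psi> = 0" and a: "r * D \<le> a"
  shows "\<exists>C>0. \<forall>f. Lploc p f \<longrightarrow>
    layer p {0<..<D} (\<lambda>t x. (1 / t) * mol \<psi> f (x, t)) \<le> ennreal C * gag a p f"
proof -
  have r: "r > 0" using k unfolding kern_def by blast
  obtain B where B: "B > 0" "\<And>x. \<bar>\<psi> x\<bar> \<le> B * indicator (ball 0 r) x" using kern_bound[OF k] by blast
  define \<mu> where "\<mu> = measure lborel (ball (0::'a) r)"
  define C1 where "C1 = B powr p * \<mu> powr (p - 1)"
  have mu: "\<mu> > 0" using measure_ball_pos[OF r] by (simp add: \<mu>_def)
  have C1: "C1 > 0" using B mu by (simp add: C1_def)
  define \<beta> where "\<beta> = p + real DIM('a)"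
  have "real DIM('a) \<ge> 1" using DIM_positive[where 'a = 'a] by (simp add: Suc_leI)
  then have beta: "\<beta> > 1" using p unfolding \<beta>_def by linarith
  define C2 where "C2 = r powr (\<beta> - 1) / (\<beta> - 1)"
  have C2: "C2 > 0" using r beta by (simp add: C2_def)
  show ?thesis
  proof (intro exI[of _ "C1 * C2"] conjI allI impI)
    fix f :: "'a \<Rightarrow> real" assume f: "Lploc p f"
    note [measurable] = kern_borel[OF k] Lploc_borel[OF f] mol_measurable[OF kern_borel[OF k] Lploc_borel[OF f]]
    define F where "F x y = ennreal (\<bar>f (x + y) - f x\<bar> powr p)" for x y
    let ?T = "\<lambda>x t. \<integral>\<^sup>+y. F x y * indicator (ball 0 (t * r)) y \<partial>lborel" and ?l = "\<lambda>t x. (1 / t) * mol \<psi> f (x, t)"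
    have [measurable]: "(\<lambda>u. F (h1 u) (h2 u)) \<in> borel_measurable M" if [measurable]: "h1 \<in> borel_measurable M" "h2 \<in> borel_measurable M" for h1 h2 and M :: "'c measure"
      unfolding F_def by measurable
    have pt: "ennreal (\<bar>(1 / t) * mol \<psi> f (x, t)\<bar> powr p) \<le> ennreal C1 * (\<integral>\<^sup>+y. ennreal (t powr (- \<beta>)) * F x y * indicator (ball 0 (t * r)) y \<partial>lborel)"
      if t: "0 < t" for t x
    proof -
      have i1: "integrable lborel (\<lambda>h. \<psi> h * f (x + t *\<^sub>R h))" by (rule mol_integrable[OF p k f]) (use t in simp)
      have i2: "integrable lborel (\<lambda>h. \<psi> h * f x)" using kern_integrable[OF k] by simp
      have "mol \<psi> f (x, t) = (\<integral>h. \<psi> h * (f (x + t *\<^sub>R h) - f x) \<partial>lborel)"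
        using i1 i2 z by (simp add: mol_lborel right_diff_distrib)
      then have "ennreal (\<bar>mol \<psi> f (x, t)\<bar> powr p) \<le> ennreal C1 * Ip p (ball 0 r) (\<lambda>h. f (x + t *\<^sub>R h) - f x)"
        using jensen_kernel[OF p, of "\<lambda>h. f (x + t *\<^sub>R h) - f x" \<psi> "ball 0 r" B] B emeasure_ball_finite[of "0::'a" r] mu
        by (simp add: C1_def \<mu>_def)
      also have "Ip p (ball 0 r) (\<lambda>h. f (x + t *\<^sub>R h) - f x) = (\<integral>\<^sup>+h. F x (0 + t *\<^sub>R h) * indicator (ball 0 (t * r)) (0 + t *\<^sub>R h) \<partial>lborel)"
        unfolding Ip_def F_def using t by (intro nn_integral_cong) (auto split: split_indicator)
      also have "\<dots> = ennreal (t powr (- real DIM('a))) * ?T x t"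
      proof -
        have "ennreal (t powr (- real DIM('a))) * ?T x t
          = (ennreal (t powr (- real DIM('a))) * ennreal (t ^ DIM('a))) * (\<integral>\<^sup>+h. F x (0 + t *\<^sub>R h) * indicator (ball 0 (t * r)) (0 + t *\<^sub>R h) \<partial>lborel)"
          using nn_integral_affine_change[of t "\<lambda>y. F x y * indicator (ball 0 (t * r)) y" 0] t by (simp add: mult.assoc)
        also have "ennreal (t powr (- real DIM('a))) * ennreal (t ^ DIM('a)) = 1"
          using t by (simp add: ennreal_mult[symmetric] powr_realpow[symmetric] powr_add[symmetric])
        finally show ?thesis by simp
      qed
      finally have m: "ennreal (\<bar>mol \<psi> f (x, t)\<bar> powr p) \<le> ennreal C1 * (ennreal (t powr (- real DIM('a))) * ?T x t)"
        by (simp add: mult_left_mono)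
      have "ennreal (\<bar>(1 / t) * mol \<psi> f (x, t)\<bar> powr p) = ennreal (t powr (- p)) * ennreal (\<bar>mol \<psi> f (x, t)\<bar> powr p)"
        using t by (simp add: abs_mult powr_mult powr_divide powr_minus_divide ennreal_mult[symmetric])
      also have "\<dots> \<le> ennreal (t powr (- p)) * (ennreal C1 * (ennreal (t powr (- real DIM('a))) * ?T x t))"
        by (intro mult_left_mono m) auto
      also have "\<dots> = ennreal C1 * ((ennreal (t powr (- p)) * ennreal (t powr (- real DIM('a)))) * ?T x t)"
        by (simp only: mult_ac)
      also have "ennreal (t powr (- p)) * ennreal (t powr (- real DIM('a))) = ennreal (t powr (- \<beta>))"
        by (simp add: ennreal_mult[symmetric] powr_add[symmetric] \<beta>_def)
      also have "ennreal (t powr (- \<beta>)) * ?T x t = (\<integral>\<^sup>+y. ennreal (t powr (- \<beta>)) * F x y * indicator (ball 0 (t * r)) y \<partial>lborel)"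
        by (subst nn_integral_cmult[symmetric]) (auto simp: mult.assoc)
      finally show ?thesis .
    qed
    \<comment> \<open>The integrand in all three variables; the condition |y| < t r is a measurable
      set of pairs (t, y), so the order of integration may be changed.\<close>
    define W where "W t x y = indicator {0<..<D} t * (ennreal (t powr (- \<beta>)) * F x y * indicator {u. norm (snd u) < fst u * r} (t, y))" for t :: real and x y :: 'a
    have [measurable]: "{u :: real \<times> 'a. norm (snd u) < fst u * r} \<in> sets borel" by measurable
    have [measurable]: "(\<lambda>u. W (h0 u) (h1 u) (h2 u)) \<in> borel_measurable M" if [measurable]: "h0 \<in> borel_measurable M" "h1 \<in> borel_measurable M" "h2 \<in> borel_measurable M" for h0 h1 h2 and M :: "'c measure"
      unfolding W_def by measurable
    have "layer p {0<..<D} ?l \<le> (\<integral>\<^sup>+t. (\<integral>\<^sup>+x. ennreal C1 * (\<integral>\<^sup>+y. W t x y \<partial>lborel) \<partial>lborel) \<partial>lborel)"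
    proof (rule nn_integral_mono)
      fix t :: real
      show "indicator {0<..<D} t * Ip p UNIV (\<lambda>x. (1 / t) * mol \<psi> f (x, t)) \<le> (\<integral>\<^sup>+x. ennreal C1 * (\<integral>\<^sup>+y. W t x y \<partial>lborel) \<partial>lborel)"
      proof (cases "t \<in> {0<..<D}")
        case True
        have Wt: "W t x y = ennreal (t powr (- \<beta>)) * F x y * indicator (ball 0 (t * r)) y" for x y
          unfolding W_def using True by (simp split: split_indicator)
        have "Ip p UNIV (\<lambda>x. (1 / t) * mol \<psi> f (x, t)) \<le> (\<integral>\<^sup>+x. ennreal C1 * (\<integral>\<^sup>+y. ennreal (t powr (- \<beta>)) * F x y * indicator (ball 0 (t * r)) y \<partial>lborel) \<partial>lborel)"
          unfolding Ip_def by (intro nn_integral_mono) (use pt True in simp)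
        also have "\<dots> = (\<integral>\<^sup>+x. ennreal C1 * (\<integral>\<^sup>+y. W t x y \<partial>lborel) \<partial>lborel)"
          unfolding Wt ..
        finally show ?thesis using True by simp
      qed simp
    qed
    also have "\<dots> = ennreal C1 * (\<integral>\<^sup>+t. (\<integral>\<^sup>+x. (\<integral>\<^sup>+y. W t x y \<partial>lborel) \<partial>lborel) \<partial>lborel)"
      by (simp add: nn_integral_cmult)
    also have "(\<integral>\<^sup>+t. (\<integral>\<^sup>+x. (\<integral>\<^sup>+y. W t x y \<partial>lborel) \<partial>lborel) \<partial>lborel) = (\<integral>\<^sup>+x. (\<integral>\<^sup>+t. (\<integral>\<^sup>+y. W t x y \<partial>lborel) \<partial>lborel) \<partial>lborel)"
      by (rule lborel_pair.Fubini') measurable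
    also have "\<dots> = (\<integral>\<^sup>+x. (\<integral>\<^sup>+y. (\<integral>\<^sup>+t. W t x y \<partial>lborel) \<partial>lborel) \<partial>lborel)"
      by (intro nn_integral_cong lborel_pair.Fubini') measurable
    also have "\<dots> \<le> (\<integral>\<^sup>+x. (\<integral>\<^sup>+y. ennreal C2 * (ennreal (\<bar>f (x + y) - f x\<bar> powr p / norm y powr (\<beta> - 1)) * indicator (ball 0 a) y) \<partial>lborel) \<partial>lborel)"
    proof (intro nn_integral_mono)
      fix x y :: 'a
      show "(\<integral>\<^sup>+t. W t x y \<partial>lborel) \<le> ennreal C2 * (ennreal (\<bar>f (x + y) - f x\<bar> powr p / norm y powr (\<beta> - 1)) * indicator (ball 0 a) y)"
      proof (cases "y = 0")
        case True
        then show ?thesis unfolding W_def F_def by simp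
      next
        case False
        define \<tau> where "\<tau> = norm y / r"
        have tau: "\<tau> > 0" using False r by (simp add: \<tau>_def)
        have "W t x y \<le> F x y * indicator (ball 0 a) y * (ennreal (t powr (- \<beta>)) * indicator {\<tau>..} t)" for t
        proof (cases "t \<in> {0<..<D} \<and> norm y < t * r")
          case True
          then have "t * r \<le> D * r" using r by (intro mult_right_mono) auto
          then have "norm y < a" using True a by (simp add: mult.commute)
          moreover have "\<tau> \<le> t" using True r by (simp add: \<tau>_def field_simps)
          ultimately show ?thesis using True unfolding W_def by (simp add: mult.commute)
        next
          case False
          then have "W t x y = 0" unfolding W_def by (auto split: split_indicator)
          then show ?thesis by simp
        qed
        then have "(\<integral>\<^sup>+t. W t x y \<partial>lborel) \<le> (\<integral>\<^sup>+t. F x y * indicator (ball 0 a) y * (ennreal (t powr (- \<beta>)) * indicator {\<tau>..} t) \<partial>lborel)"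
          by (rule nn_integral_mono)
        also have "\<dots> = F x y * indicator (ball 0 a) y * ennreal (\<tau> powr (1 - \<beta>) / (\<beta> - 1))"
          unfolding nn_integral_power_tail[OF beta tau, symmetric] by (rule nn_integral_cmult) simp
        also have "\<tau> powr (1 - \<beta>) / (\<beta> - 1) = C2 / norm y powr (\<beta> - 1)"
        proof -
          have "1 - \<beta> = - (\<beta> - 1)" by simp
          then have "\<tau> powr (1 - \<beta>) = r powr (\<beta> - 1) / norm y powr (\<beta> - 1)"
            using r False by (simp only: powr_minus) (simp add: \<tau>_def powr_divide)
          then show ?thesis unfolding C2_def by simp
        qed
        also have "F x y * indicator (ball 0 a) y * ennreal (C2 / norm y powr (\<beta> - 1)) = ennreal C2 * (ennreal (\<bar>f (x + y) - f x\<bar> powr p / norm y powr (\<beta> - 1)) * indicator (ball 0 a) y)"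
          unfolding F_def using C2 by (auto simp: ennreal_mult[symmetric] split: split_indicator)
        finally show ?thesis .
      qed
    qed
    also have "\<dots> = ennreal C2 * gag a p f"
      unfolding gag_def \<beta>_def by (simp add: nn_integral_cmult)
    finally show "layer p {0<..<D} ?l \<le> ennreal (C1 * C2) * gag a p f"
      using C1 C2 by (simp add: ennreal_mult mult.assoc mult_left_mono)
  qed (use C1 C2 in simp)
qed

lemma Ip_slice_measurable:
  fixes F :: "'a::euclidean_space \<times> real \<Rightarrow> real"
  assumes [measurable]: "F \<in> borel_measurable borel" "A \<in> sets borel"
  shows "(\<lambda>t. Ip p A (\<lambda>x. F (x, t))) \<in> borel_measurable borel"
proof -
  have [measurable]: "F \<in> borel_measurable (borel \<Otimes>\<^sub>M borel)" using assms(1) by (simp add: borel_prod)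
  have "(\<lambda>t. \<integral>\<^sup>+x. ennreal (\<bar>F (x, t)\<bar> powr p) * indicator A x \<partial>lborel) \<in> borel_measurable borel"
    by (rule lborel.borel_measurable_nn_integral) measurable
  then show ?thesis unfolding Ip_def .
qed

text \<open>In the critical degree -1 - s only n = s and q = -1 are admissible: a top order function
  with mean-zero kernel and a single factor 1/t, as in \<open>mol_gag_bound\<close>.\<close>

lemma nullop_energy:
  fixes L :: "(('a::euclidean_space \<Rightarrow> nat) \<Rightarrow> 'a \<Rightarrow> real) \<Rightarrow> 'a \<times> real \<Rightarrow> real"
  assumes L: "nullop r s e L" and e: "e = - 1 - int s" and p: "1 \<le> p" and a: "r * D \<le> a"
  shows "\<exists>C\<ge>0. \<forall>g. adm p s g \<longrightarrow> layer p {0<..<D} (\<lambda>t x. L g (x, t))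
    \<le> ennreal C * gags a p s g"
  using L
proof induction
  case zero
  show ?case using p by (intro exI[of _ 0]) (auto simp: Ip_def)
next
  case (trm \<alpha> n q \<psi> c)
  have nq: "n = s" "q = -1" using trm e by auto
  have k: "kern r \<psi>" using trm(5) by (rule skern_kern)
  obtain C where C: "C > 0" "\<And>f. Lploc p f \<Longrightarrow> layer p {0<..<D} (\<lambda>t x. (1 / t) * mol \<psi> f (x, t)) \<le> ennreal C * gag a p f"
    using mol_gag_bound[OF p k zmom_integral[OF trm(6)] a] by blast
  show ?case
  proof (intro exI[of _ "\<bar>c\<bar> powr p * C"] conjI allI impI)
    fix g :: "('a \<Rightarrow> nat) \<Rightarrow> 'a \<Rightarrow> real" assume g: "adm p s g"
    have f: "Lploc p (g \<alpha>)" by (rule adm_Lploc[OF g trm(1,2)])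
    note [measurable] = mol_measurable[OF kern_borel[OF k] Lploc_borel[OF f]]
    have [measurable]: "(\<lambda>z. (1 / snd z) * mol \<psi> (g \<alpha>) z) \<in> borel_measurable borel" by measurable
    have m: "(\<lambda>t. Ip p UNIV (\<lambda>x. (1 / t) * mol \<psi> (g \<alpha>) (x, t))) \<in> borel_measurable borel"
      using Ip_slice_measurable[of "\<lambda>z. (1 / snd z) * mol \<psi> (g \<alpha>) z" UNIV p] by simp
    have "layer p {0<..<D} (\<lambda>t x. c * snd (x, t) powi q * mol \<psi> (g \<alpha>) (x, t))
      = (\<integral>\<^sup>+t. ennreal (\<bar>c\<bar> powr p) * (indicator {0<..<D} t * Ip p UNIV (\<lambda>x. (1 / t) * mol \<psi> (g \<alpha>) (x, t))) \<partial>lborel)"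
    proof (rule nn_integral_cong)
      fix t :: real
      have "(\<lambda>x. (1 / t) * mol \<psi> (g \<alpha>) (x, t)) \<in> borel_measurable borel"
        using slice_measurable[of "mol \<psi> (g \<alpha>)" t] by measurable
      then have "Ip p UNIV (\<lambda>x. c * ((1 / t) * mol \<psi> (g \<alpha>) (x, t))) = ennreal (\<bar>c\<bar> powr p) * Ip p UNIV (\<lambda>x. (1 / t) * mol \<psi> (g \<alpha>) (x, t))"
        by (intro Ip_cmult) auto
      then show "indicator {0<..<D} t * Ip p UNIV (\<lambda>x. c * snd (x, t) powi q * mol \<psi> (g \<alpha>) (x, t)) = ennreal (\<bar>c\<bar> powr p) * (indicator {0<..<D} t * Ip p UNIV (\<lambda>x. (1 / t) * mol \<psi> (g \<alpha>) (x, t)))"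
        unfolding nq by (simp add: power_int_minus divide_inverse mult.assoc mult.left_commute)
    qed
    also have "\<dots> = ennreal (\<bar>c\<bar> powr p) * layer p {0<..<D} (\<lambda>t x. (1 / t) * mol \<psi> (g \<alpha>) (x, t))"
      using m by (intro nn_integral_cmult) measurable
    also have "\<dots> \<le> ennreal (\<bar>c\<bar> powr p) * (ennreal C * gag a p (g \<alpha>))"
      by (intro mult_left_mono C f) auto
    also have "\<dots> = ennreal (\<bar>c\<bar> powr p * C) * gag a p (g \<alpha>)" using C(1) by (simp add: ennreal_mult mult.assoc)
    also have "\<dots> \<le> ennreal (\<bar>c\<bar> powr p * C) * gags a p s g"
      using trm(1) unfolding nq by (intro mult_left_mono member_le_sum) (auto simp: finite_multi_indices)
    finally show "layer p {0<..<D} (\<lambda>t x. c * snd (x, t) powi q * mol \<psi> (g \<alpha>) (x, t))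
       \<le> ennreal (\<bar>c\<bar> powr p * C) * gags a p s g" .
  qed (use C in simp)
next
  case (add L1 L2)
  then obtain C1 C2 where C: "C1 \<ge> 0" "C2 \<ge> 0"
    "\<And>g. adm p s g \<Longrightarrow> layer p {0<..<D} (\<lambda>t x. L1 g (x, t)) \<le> ennreal C1 * gags a p s g"
    "\<And>g. adm p s g \<Longrightarrow> layer p {0<..<D} (\<lambda>t x. L2 g (x, t)) \<le> ennreal C2 * gags a p s g"
    by blast
  show ?case
  proof (intro exI[of _ "2 powr p * (C1 + C2)"] conjI allI impI)
    fix g :: "('a \<Rightarrow> nat) \<Rightarrow> 'a \<Rightarrow> real" assume g: "adm p s g"
    note [measurable] = nullop_measurable[OF add(1) g] nullop_measurable[OF add(2) g]
    note [measurable] = slice_measurable[OF nullop_measurable[OF add(1) g]] slice_measurable[OF nullop_measurable[OF add(2) g]]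
      Ip_slice_measurable[OF nullop_measurable[OF add(1) g], of UNIV p] Ip_slice_measurable[OF nullop_measurable[OF add(2) g], of UNIV p]
    have "layer p {0<..<D} (\<lambda>t x. L1 g (x, t) + L2 g (x, t))
      \<le> (\<integral>\<^sup>+t. ennreal (2 powr p) * (indicator {0<..<D} t * Ip p UNIV (\<lambda>x. L1 g (x, t)) + indicator {0<..<D} t * Ip p UNIV (\<lambda>x. L2 g (x, t))) \<partial>lborel)"
    proof (rule nn_integral_mono)
      fix t :: real
      have "Ip p UNIV (\<lambda>x. L1 g (x, t) + L2 g (x, t)) \<le> ennreal (2 powr p) * (Ip p UNIV (\<lambda>x. L1 g (x, t)) + Ip p UNIV (\<lambda>x. L2 g (x, t)))"
        using p by (intro Ip_add) auto
      then show "indicator {0<..<D} t * Ip p UNIV (\<lambda>x. L1 g (x, t) + L2 g (x, t)) \<le> ennreal (2 powr p) * (indicator {0<..<D} t * Ip p UNIV (\<lambda>x. L1 g (x, t)) + indicator {0<..<D} t * Ip p UNIV (\<lambda>x. L2 g (x, t)))"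
        by (auto split: split_indicator)
    qed
    also have "\<dots> = ennreal (2 powr p) * (layer p {0<..<D} (\<lambda>t x. L1 g (x, t)) + layer p {0<..<D} (\<lambda>t x. L2 g (x, t)))"
      by (subst nn_integral_cmult) (auto simp: nn_integral_add)
    also have "\<dots> \<le> ennreal (2 powr p) * (ennreal C1 * gags a p s g + ennreal C2 * gags a p s g)"
      by (intro mult_left_mono add_mono C g) auto
    also have "\<dots> = ennreal (2 powr p * (C1 + C2)) * gags a p s g"
      using C by (simp add: ennreal_mult ennreal_plus distrib_right mult.assoc)
    finally show "layer p {0<..<D} (\<lambda>t x. L1 g (x, t) + L2 g (x, t)) \<le> ennreal (2 powr p * (C1 + C2)) * gags a p s g" .
  qed (use C in simp)
qed

section \<open>Local bounds on slices and limits at the boundary\<close>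

lemma term_slice_Ip:
  fixes f :: "'a::euclidean_space \<Rightarrow> real"
  assumes "kern r \<psi>" "Lploc p f" and [measurable]: "A \<in> sets borel"
  shows "Ip p A (\<lambda>x. c * snd (x, t) powi q * mol \<psi> f (x, t)) = ennreal (\<bar>c * t powi q\<bar> powr p) * Ip p A (\<lambda>x. mol \<psi> f (x, t))"
  using slice_measurable[OF mol_measurable[OF kern_borel[OF assms(1)] Lploc_borel[OF assms(2)]], of t]
  by (simp add: Ip_cmult)

lemma mol_term_bounded:
  fixes f :: "'a::euclidean_space \<Rightarrow> real"
  assumes p: "1 \<le> p" and k: "kern r \<psi>" and f: "Lploc p f" and q: "0 \<le> q"
  shows "\<exists>K<\<infinity>. \<forall>t. 0 < t \<and> t < D \<longrightarrow> Ip p (ball 0 R) (\<lambda>x. c * snd (x, t) powi q * mol \<psi> f (x, t)) \<le> K"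
proof -
  obtain B where B: "B > 0" "\<And>x. \<bar>\<psi> x\<bar> \<le> B * indicator (ball 0 r) x" using kern_bound[OF k] by blast
  have r: "r > 0" using k unfolding kern_def by blast
  define K where "K = ennreal ((\<bar>c\<bar> * \<bar>D\<bar> ^ nat q) powr p) * (ennreal (B powr p * measure lborel (ball (0::'a) r) powr p) * Ip p (ball 0 (R + \<bar>D\<bar> * r)) f)"
  show ?thesis
  proof (intro exI[of _ K] conjI allI impI)
    show "K < \<infinity>" using f unfolding K_def Lploc_def by (auto simp: ennreal_mult_less_top)
    fix t assume t: "0 < t \<and> t < D"
    have "Ip p (ball 0 R) (\<lambda>x. mol \<psi> f (x, t)) \<le> ennreal (B powr p * measure lborel (ball (0::'a) r) powr p) * Ip p (ball 0 (R + \<bar>t\<bar> * r)) f"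
      by (rule mol_Ip_bound[OF p k B Lploc_borel[OF f]])
    also have "\<dots> \<le> ennreal (B powr p * measure lborel (ball (0::'a) r) powr p) * Ip p (ball 0 (R + \<bar>D\<bar> * r)) f"
      using t r by (intro mult_left_mono Ip_mono) (auto intro!: subset_ball mult_right_mono)
    finally have 1: "Ip p (ball 0 R) (\<lambda>x. mol \<psi> f (x, t)) \<le> ennreal (B powr p * measure lborel (ball (0::'a) r) powr p) * Ip p (ball 0 (R + \<bar>D\<bar> * r)) f" .
    have "\<bar>c * t powi q\<bar> \<le> \<bar>c\<bar> * \<bar>D\<bar> ^ nat q"
      using q t unfolding power_int_def by (auto simp: abs_mult intro!: mult_left_mono power_mono)
    then have 2: "ennreal (\<bar>c * t powi q\<bar> powr p) \<le> ennreal ((\<bar>c\<bar> * \<bar>D\<bar> ^ nat q) powr p)"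
      using p by (intro ennreal_leI powr_mono2) auto
    show "Ip p (ball 0 R) (\<lambda>x. c * snd (x, t) powi q * mol \<psi> f (x, t)) \<le> K"
      unfolding K_def by (subst term_slice_Ip[OF k f]) (auto intro!: mult_mono 1 2)
  qed
qed

lemma bounded_add:
  fixes F G :: "'a::euclidean_space \<times> real \<Rightarrow> real"
  assumes p: "0 \<le> p" and m: "F \<in> borel_measurable borel" "G \<in> borel_measurable borel"
    and F: "\<exists>K<\<infinity>. \<forall>t. 0 < t \<and> t < D \<longrightarrow> Ip p (ball 0 R) (\<lambda>x. F (x, t)) \<le> K"
    and G: "\<exists>K<\<infinity>. \<forall>t. 0 < t \<and> t < D \<longrightarrow> Ip p (ball 0 R) (\<lambda>x. G (x, t)) \<le> K"
  shows "\<exists>K<\<infinity>. \<forall>t. 0 < t \<and> t < D \<longrightarrow> Ip p (ball 0 R) (\<lambda>x. F (x, t) + G (x, t)) \<le> K"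
proof -
  obtain K1 K2 where K: "K1 < \<infinity>" "K2 < \<infinity>" "\<And>t. 0 < t \<Longrightarrow> t < D \<Longrightarrow> Ip p (ball 0 R) (\<lambda>x. F (x, t)) \<le> K1"
    "\<And>t. 0 < t \<Longrightarrow> t < D \<Longrightarrow> Ip p (ball 0 R) (\<lambda>x. G (x, t)) \<le> K2" using F G by blast
  show ?thesis
  proof (intro exI[of _ "ennreal (2 powr p) * (K1 + K2)"] conjI allI impI)
    show "ennreal (2 powr p) * (K1 + K2) < \<infinity>" using K by (auto simp: ennreal_mult_less_top)
    fix t assume t: "0 < t \<and> t < D"
    have "Ip p (ball 0 R) (\<lambda>x. F (x, t) + G (x, t)) \<le> ennreal (2 powr p) * (Ip p (ball 0 R) (\<lambda>x. F (x, t)) + Ip p (ball 0 R) (\<lambda>x. G (x, t)))"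
      using p by (intro Ip_add slice_measurable m) auto
    also have "\<dots> \<le> ennreal (2 powr p) * (K1 + K2)" using t by (intro mult_left_mono add_mono K) auto
    finally show "Ip p (ball 0 R) (\<lambda>x. F (x, t) + G (x, t)) \<le> ennreal (2 powr p) * (K1 + K2)" .
  qed
qed

text \<open>Under the degree condition every power of t is nonnegative: q = e + n, and for n < s the
  admissibility itself requires q >= 0.\<close>

lemma nullop_bounded:
  assumes L: "nullop r s e L" and e: "0 \<le> e + int s" and p: "1 \<le> p" and g: "adm p s g"
  shows "\<exists>K<\<infinity>. \<forall>t. 0 < t \<and> t < D \<longrightarrow> Ip p (ball 0 R) (\<lambda>x. L g (x, t)) \<le> K"
  using L
proof induction
  case zero show ?case by (intro exI[of _ 0]) (auto simp: Ip_def)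
next
  case (trm \<alpha> n q \<psi> c)
  then have "0 \<le> q" using e by auto
  then show ?case using mol_term_bounded[OF p skern_kern[OF trm(5)] adm_Lploc[OF g trm(1,2)]] by blast
next
  case (add L1 L2)
  then show ?case using p by (intro bounded_add nullop_measurable[OF _ g]) auto
qed

lemma Ip_tendsto_add:
  fixes F G :: "'b \<Rightarrow> 'a::euclidean_space \<Rightarrow> real"
  assumes p: "0 \<le> p" and A: "A \<in> sets borel" and m: "\<And>t. F t \<in> borel_measurable borel" "\<And>t. G t \<in> borel_measurable borel"
    and F: "((\<lambda>t. Ip p A (F t)) \<longlongrightarrow> 0) net" and G: "((\<lambda>t. Ip p A (G t)) \<longlongrightarrow> 0) net"
  shows "((\<lambda>t. Ip p A (\<lambda>x. F t x + G t x)) \<longlongrightarrow> 0) net"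
proof (rule tendsto_sandwich[OF _ _ tendsto_const])
  show "\<forall>\<^sub>F t in net. Ip p A (\<lambda>x. F t x + G t x) \<le> ennreal (2 powr p) * (Ip p A (F t) + Ip p A (G t))"
    using p A m by (intro always_eventually allI Ip_add) auto
  have "((\<lambda>t. ennreal (2 powr p) * (Ip p A (F t) + Ip p A (G t))) \<longlongrightarrow> ennreal (2 powr p) * (0 + 0)) net"
    by (intro ennreal_tendsto_cmult tendsto_add F G) auto
  then show "((\<lambda>t. ennreal (2 powr p) * (Ip p A (F t) + Ip p A (G t))) \<longlongrightarrow> 0) net" by simp
qed simp

lemma Ip_tendsto_bound:
  assumes "\<forall>\<^sub>F t in net. F t \<le> ennreal c * G t" "(G \<longlongrightarrow> 0) net"
  shows "(F \<longlongrightarrow> (0::ennreal)) net"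
proof (rule tendsto_sandwich[OF _ assms(1) tendsto_const])
  have "((\<lambda>t. ennreal c * G t) \<longlongrightarrow> ennreal c * 0) net" by (intro ennreal_tendsto_cmult assms(2)) auto
  then show "((\<lambda>t. ennreal c * G t) \<longlongrightarrow> 0) net" by simp
qed simp

text \<open>The powers of t are bounded near 0, and averages with a kernel of mean zero tend to
  zero.\<close>

lemma nullop_tendsto:
  assumes L: "nullop r s e L" and e: "0 \<le> e + int s" and p: "1 \<le> p" and g: "adm p s g"
  shows "((\<lambda>t. Ip p (ball 0 R) (\<lambda>x. L g (x, t))) \<longlongrightarrow> 0) (at_right 0)"
  using L
proof induction
  case zero show ?case by (simp add: Ip_def)
next
  case (trm \<alpha> n q \<psi> c)
  then have q: "0 \<le> q" using e by auto
  have k: "kern r \<psi>" and f: "Lploc p (g \<alpha>)" using skern_kern[OF trm(5)] adm_Lploc[OF g trm(1,2)] by auto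
  have "((\<lambda>t. Ip p (ball 0 R) (\<lambda>x. mol \<psi> (g \<alpha>) (x, t))) \<longlongrightarrow> 0) (at_right 0)"
    using mol_tendsto[OF p k f, of R] zmom_integral[OF trm(6)] by (auto intro: tendsto_within_subset)
  then show ?case
  proof (rule Ip_tendsto_bound[rotated])
    show "\<forall>\<^sub>F t in at_right 0. Ip p (ball 0 R) (\<lambda>x. c * snd (x, t) powi q * mol \<psi> (g \<alpha>) (x, t)) \<le> ennreal (\<bar>c\<bar> powr p) * Ip p (ball 0 R) (\<lambda>x. mol \<psi> (g \<alpha>) (x, t))"
      unfolding eventually_at_right_field
    proof (intro exI[of _ 1] conjI allI impI)
      fix t :: real assume t: "0 < t" "t < 1"
      have "\<bar>c * t powi q\<bar> \<le> \<bar>c\<bar> * 1"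
        using q t unfolding power_int_def abs_mult by (intro mult_left_mono) (auto intro: power_le_one)
      then have "\<bar>c * t powi q\<bar> powr p \<le> \<bar>c\<bar> powr p" using p by (intro powr_mono2) auto
      then show "Ip p (ball 0 R) (\<lambda>x. c * snd (x, t) powi q * mol \<psi> (g \<alpha>) (x, t)) \<le> ennreal (\<bar>c\<bar> powr p) * Ip p (ball 0 R) (\<lambda>x. mol \<psi> (g \<alpha>) (x, t))"
        by (subst term_slice_Ip[OF k f]) (auto intro!: mult_right_mono ennreal_leI)
    qed simp
  qed
next
  case (add L1 L2)
  then show ?case using p slice_measurable[OF nullop_measurable[OF _ g]] by (intro Ip_tendsto_add) auto
qed

text \<open>For n = k the kernel of mean one reproduces the function in the limit; for n < k a
  positive power of t remains, and the other terms are zero.\<close>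

lemma mterm_tendsto:
  assumes p: "1 \<le> p" and mk: "mkernel r M \<eta>" and g: "adm p s g" and js: "set js \<subseteq> Basis" "n = k \<Longrightarrow> length js \<le> s"
  shows "((\<lambda>t. Ip p (ball 0 R) (\<lambda>x. mterm \<eta> s k n js g (x, t) - (if n = k then g (mi_of js) x else 0))) \<longlongrightarrow> 0) (at_right 0)"
proof -
  have k: "kern r \<eta>" and I: "integral\<^sup>L lborel \<eta> = 1" using mk unfolding mkernel_def skern_def by auto
  show ?thesis
  proof (cases "n \<le> k \<and> length js \<le> s")
    case False
    then have z0: "mterm \<eta> s k n js g z - (if n = k then g (mi_of js) x else 0) = 0" for x z using js(2) unfolding mterm_def by auto
    show ?thesis unfolding z0 Ip_def by simp
  next
    case True
    define f where "f = g (mi_of js)"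
    have f: "Lploc p f" unfolding f_def using adm_Lploc[OF g mi_of_multi_indices[OF js(1)]] True by blast
    have lim: "((\<lambda>t. Ip p (ball 0 R) (\<lambda>x. mol \<eta> f (x, t) - f x)) \<longlongrightarrow> 0) (at_right 0)"
      using mol_tendsto[OF p k f, of R] unfolding I by (auto intro: tendsto_within_subset)
    show ?thesis
    proof (cases "n = k")
      case nk: True
      then show ?thesis using True lim unfolding mterm_def f_def by simp
    next
      case False
      obtain K where K: "K < \<infinity>" "\<And>t. 0 < t \<Longrightarrow> t < 1 \<Longrightarrow> Ip p (ball 0 R) (\<lambda>x. 1 * snd (x, t) powi 0 * mol \<eta> f (x, t)) \<le> K"
        using mol_term_bounded[OF p k f, of 0 1 R 1] by auto
      define c :: real where "c = 1 / fact (k - n)"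
      obtain i where i: "k - n = Suc i" using False True by (metis Suc_diff_Suc le_neq_implies_less)
      have "((\<lambda>t::real. c * t ^ (k - n)) \<longlongrightarrow> c * 0 ^ (k - n)) (at_right 0)" by (intro tendsto_intros)
      then have "((\<lambda>t::real. ennreal (\<bar>c * t ^ (k - n)\<bar> powr p)) \<longlongrightarrow> 0) (at_right 0)"
        using p i by (intro tendsto_ennreal_powr_0) auto
      then have l: "((\<lambda>t::real. K * ennreal (\<bar>c * t ^ (k - n)\<bar> powr p)) \<longlongrightarrow> K * 0) (at_right 0)"
        using K(1) by (intro ennreal_tendsto_cmult) auto
      have "((\<lambda>t. Ip p (ball 0 R) (\<lambda>x. mterm \<eta> s k n js g (x, t))) \<longlongrightarrow> 0) (at_right 0)"
      proof (rule tendsto_sandwich[OF _ _ tendsto_const])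
        show "((\<lambda>t::real. K * ennreal (\<bar>c * t ^ (k - n)\<bar> powr p)) \<longlongrightarrow> 0) (at_right 0)" using l by simp
        show "\<forall>\<^sub>F t in at_right 0. Ip p (ball 0 R) (\<lambda>x. mterm \<eta> s k n js g (x, t)) \<le> K * ennreal (\<bar>c * t ^ (k - n)\<bar> powr p)"
          unfolding eventually_at_right_field
        proof (intro exI[of _ 1] conjI allI impI)
          fix t :: real assume t: "0 < t" "t < 1"
          have "Ip p (ball 0 R) (\<lambda>x. mterm \<eta> s k n js g (x, t)) = Ip p (ball 0 R) (\<lambda>x. c * snd (x, t) powi int (k - n) * mol \<eta> f (x, t))"
            using True unfolding mterm_def c_def f_def by simp
          also have "\<dots> = ennreal (\<bar>c * t powi int (k - n)\<bar> powr p) * Ip p (ball 0 R) (\<lambda>x. mol \<eta> f (x, t))"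
            by (rule term_slice_Ip[OF k f]) simp
          also have "\<dots> \<le> ennreal (\<bar>c * t powi int (k - n)\<bar> powr p) * K"
            using K(2)[OF t] by (intro mult_left_mono) auto
          finally show "Ip p (ball 0 R) (\<lambda>x. mterm \<eta> s k n js g (x, t)) \<le> K * ennreal (\<bar>c * t ^ (k - n)\<bar> powr p)"
            by (simp add: mult.commute)
        qed simp
      qed simp
      then show ?thesis using False by simp
    qed
  qed
qed

lemma mterm_bounded:
  assumes p: "1 \<le> p" and mk: "mkernel r M \<eta>" and g: "adm p s g" and js: "set js \<subseteq> Basis"
  shows "\<exists>K<\<infinity>. \<forall>t. 0 < t \<and> t < D \<longrightarrow> Ip p (ball 0 R) (\<lambda>x. mterm \<eta> s k n js g (x, t)) \<le> K"
proof (cases "n \<le> k \<and> length js \<le> s")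
  case False
  then have "mterm \<eta> s k n js g z = 0" for z unfolding mterm_def by auto
  then show ?thesis by (intro exI[of _ 0]) (auto simp: Ip_def)
next
  case True
  have "kern r \<eta>" using mk unfolding mkernel_def skern_def by auto
  then show ?thesis
    using mol_term_bounded[OF p _ adm_Lploc[OF g mi_of_multi_indices[OF js]], of r \<eta> "int (k - n)" D R "1 / fact (k - n)"] True
    unfolding mterm_def by simp
qed

section \<open>Extension to a half-space\<close>

lemma iter_pderiv_sum:
  assumes S: "open S" and I: "finite I" and f: "\<And>i. i \<in> I \<Longrightarrow> smooth_on S (f i)" and bs: "set bs \<subseteq> Basis" and x: "x \<in> S"
  shows "iter_pderiv bs (\<lambda>x. \<Sum>i\<in>I. f i x) x = (\<Sum>i\<in>I. iter_pderiv bs (f i) x)"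
  using bs x
proof (induction bs arbitrary: x)
  case (Cons b bs)
  then have bs: "set bs \<subseteq> Basis" by auto
  have d: "((\<lambda>x. \<Sum>i\<in>I. iter_pderiv bs (f i) x) has_derivative (\<lambda>v. \<Sum>i\<in>I. frechet_derivative (iter_pderiv bs (f i)) (at x) v)) (at x)"
  proof (rule has_derivative_sum)
    fix i assume "i \<in> I"
    then show "(iter_pderiv bs (f i) has_derivative frechet_derivative (iter_pderiv bs (f i)) (at x)) (at x)"
      using f bs Cons.prems unfolding smooth_on_def frechet_derivative_works[symmetric] by blast
  qed
  have "iter_pderiv (b # bs) (\<lambda>x. \<Sum>i\<in>I. f i x) x = pd b (\<lambda>x. \<Sum>i\<in>I. iter_pderiv bs (f i) x) x"
    using frechet_derivative_cong_open[OF S Cons.prems(2), of "iter_pderiv bs (\<lambda>x. \<Sum>i\<in>I. f i x)"] Cons.IH[OF bs] by simp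
  then show ?case using pd_eqI[OF d] by simp
qed simp

lemma iter_pderiv_lincomb:
  assumes S: "open S" and f: "smooth_on S f" "smooth_on S g" and bs: "set bs \<subseteq> Basis" and x: "x \<in> S"
  shows "iter_pderiv bs (\<lambda>x. c * f x + d * g x) x = c * iter_pderiv bs f x + d * iter_pderiv bs g x"
  using bs x
proof (induction bs arbitrary: x)
  case (Cons b bs)
  then have bs: "set bs \<subseteq> Basis" by auto
  have d: "((\<lambda>x. c * iter_pderiv bs f x + d * iter_pderiv bs g x) has_derivative
     (\<lambda>v. c * frechet_derivative (iter_pderiv bs f) (at x) v + d * frechet_derivative (iter_pderiv bs g) (at x) v)) (at x)"
    using f bs Cons.prems unfolding smooth_on_def
    by (intro has_derivative_add has_derivative_mult_right) (auto simp: frechet_derivative_works[symmetric])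
  have "iter_pderiv (b # bs) (\<lambda>x. c * f x + d * g x) x = pd b (\<lambda>x. c * iter_pderiv bs f x + d * iter_pderiv bs g x) x"
    using frechet_derivative_cong_open[OF S Cons.prems(2), of "iter_pderiv bs (\<lambda>x. c * f x + d * g x)"] Cons.IH[OF bs] by simp
  then show ?case using pd_eqI[OF d] by simp
qed simp

abbreviation upper :: "('a::euclidean_space \<times> real) set" where "upper \<equiv> {z. 0 < snd z}"

type_synonym 'a jets = "nat \<Rightarrow> ('a \<Rightarrow> nat) \<Rightarrow> 'a \<Rightarrow> real"

text \<open>Through the empty list in \<open>mterm\<close> only the entries for the multi-index 0
  are used. The extension therefore does not depend on how the weak derivatives in the jet were
  chosen.\<close>

definition ext :: "('a::euclidean_space \<Rightarrow> real) \<Rightarrow> nat \<Rightarrow> 'a jets \<Rightarrow> 'a \<times> real \<Rightarrow> real" where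
  "ext \<eta> m G z = (\<Sum>k<m. mterm \<eta> (m - 1 - k) k 0 [] (G k) z)"

definition admd :: "real \<Rightarrow> nat \<Rightarrow> ('a::euclidean_space) jets \<Rightarrow> bool" where
  "admd p m G \<longleftrightarrow> (\<forall>k<m. adm p (m - 1 - k) (G k))"

lemma mterm_smooth:
  fixes \<eta> :: "'a::euclidean_space \<Rightarrow> real"
  assumes p: "1 \<le> p" and mk: "mkernel r M \<eta>" and s: "s \<le> M" and g: "adm p s g"
  shows "smooth_on upper (mterm \<eta> s k 0 [] g)"
  unfolding smooth_on_def
proof (intro allI impI ballI)
  fix bs :: "('a \<times> real) list" and z :: "'a \<times> real" assume bs: "set bs \<subseteq> Basis" and z: "z \<in> upper"
  show "iter_pderiv bs (mterm \<eta> s k 0 [] g) differentiable at z"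
    using mterm_iter_pderiv[OF p mk s bs, of k] g z unfolding mem_Collect_eq by blast
qed

lemma ext_smooth:
  assumes p: "1 \<le> p" and mk: "mkernel r (m - 1) \<eta>" and G: "admd p m G"
  shows "smooth_on upper (ext \<eta> m G)"
  unfolding ext_def[abs_def] using G unfolding admd_def
  by (intro smooth_on_sum open_upper mterm_smooth[OF p mk]) auto

text \<open>The null operators are obtained before \<open>G\<close> is fixed; this is what makes the
  constant in the energy estimate independent of the data.\<close>

lemma ext_repr:
  fixes \<eta> :: "'a::euclidean_space \<Rightarrow> real"
  assumes p: "1 \<le> p" and mk: "mkernel r (m - 1) \<eta>" and bs: "set bs \<subseteq> Basis"
  obtains L where "\<And>k. k < m \<Longrightarrow> nullop r (m - 1 - k) (int k - int (length bs)) (L k)"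
    "\<And>G z. admd p m G \<Longrightarrow> 0 < snd z \<Longrightarrow> iter_pderiv bs (ext \<eta> m G) z =
       (\<Sum>k<m. mterm \<eta> (m - 1 - k) k (nrm bs) (tang bs) (G k) z + L k (G k) z)"
proof -
  define P where "P k L \<longleftrightarrow> nullop r (m - 1 - k) (int k - int (length bs)) L \<and>
      (\<forall>g. adm p (m - 1 - k) g \<longrightarrow> (\<forall>z. 0 < snd z \<longrightarrow> iter_pderiv bs (mterm \<eta> (m - 1 - k) k 0 [] g) z
         = mterm \<eta> (m - 1 - k) k (nrm bs) (tang bs) g z + L g z))" for k and L :: "(('a \<Rightarrow> nat) \<Rightarrow> 'a \<Rightarrow> real) \<Rightarrow> 'a \<times> real \<Rightarrow> real"
  have "\<exists>L. P k L" for k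
  proof -
    have "m - 1 - k \<le> m - 1" by simp
    from mterm_iter_pderiv[OF p mk this bs, of k] show ?thesis unfolding P_def by blast
  qed
  then obtain L where L: "\<And>k. P k (L k)" by metis
  show thesis
  proof (rule that)
    show "nullop r (m - 1 - k) (int k - int (length bs)) (L k)" for k using L[of k] unfolding P_def by blast
    fix G :: "'a jets" and z :: "'a \<times> real" assume G: "admd p m G" and z: "0 < snd z"
    have "iter_pderiv bs (ext \<eta> m G) z = (\<Sum>k<m. iter_pderiv bs (mterm \<eta> (m - 1 - k) k 0 [] (G k)) z)"
      unfolding ext_def[abs_def] using z G unfolding admd_def
      by (intro iter_pderiv_sum[OF open_upper] mterm_smooth[OF p mk] bs) auto
    also have "\<dots> = (\<Sum>k<m. mterm \<eta> (m - 1 - k) k (nrm bs) (tang bs) (G k) z + L k (G k) z)"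
    proof (rule sum.cong[OF refl])
      fix k assume "k \<in> {..<m}"
      then have "adm p (m - 1 - k) (G k)" using G unfolding admd_def by simp
      then show "iter_pderiv bs (mterm \<eta> (m - 1 - k) k 0 [] (G k)) z = mterm \<eta> (m - 1 - k) k (nrm bs) (tang bs) (G k) z + L k (G k) z"
        using L[of k] z unfolding P_def by blast
    qed
    finally show "iter_pderiv bs (ext \<eta> m G) z = (\<Sum>k<m. mterm \<eta> (m - 1 - k) k (nrm bs) (tang bs) (G k) z + L k (G k) z)" .
  qed
qed

text \<open>At order m no leading term is left, and the degree k - m of the null terms is critical
  for s = m - 1 - k.\<close>

theorem ext_energy:
  fixes \<eta> :: "'a::euclidean_space \<Rightarrow> real"
  assumes p: "1 \<le> p" and mk: "mkernel r (m - 1) \<eta>" and bs: "set bs \<subseteq> Basis" "length bs = m" and a: "r * D \<le> a"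
  shows "\<exists>C\<ge>0. \<forall>G. admd p m G \<longrightarrow> layer p {0<..<D} (\<lambda>t x. iter_pderiv bs (ext \<eta> m G) (x, t))
    \<le> ennreal C * (\<Sum>k<m. \<Sum>\<alpha>\<in>multi_indices (m - 1 - k). gag a p (G k \<alpha>))"
proof -
  obtain L where L: "\<And>k. k < m \<Longrightarrow> nullop r (m - 1 - k) (int k - int (length bs)) (L k)"
    and LL: "\<And>G z. admd p m G \<Longrightarrow> 0 < snd z \<Longrightarrow> iter_pderiv bs (ext \<eta> m G) z =
       (\<Sum>k<m. mterm \<eta> (m - 1 - k) k (nrm bs) (tang bs) (G k) z + L k (G k) z)"
    using ext_repr[OF p mk bs(1)] by blast
  \<comment> \<open>The normal and tangential orders add up to m, which exceeds k + (m - 1 -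
    k).\<close>
  have m0: "mterm \<eta> (m - 1 - k) k (nrm bs) (tang bs) g z = 0" if "k < m" for k g z
  proof -
    have "\<not> (nrm bs \<le> k \<and> length (tang bs) \<le> m - 1 - k)"
      using nrm_tang_length[OF bs(1)] bs(2) that by linarith
    then show ?thesis unfolding mterm_def by (simp only: if_False)
  qed
  define P where "P k C \<longleftrightarrow> C \<ge> 0 \<and> (\<forall>g. adm p (m - 1 - k) g \<longrightarrow> layer p {0<..<D} (\<lambda>t x. L k g (x, t))
    \<le> ennreal C * (\<Sum>\<alpha>\<in>multi_indices (m - 1 - k). gag a p (g \<alpha>)))" for k and C :: real
  have "\<exists>C. P k C" if "k < m" for k
    using nullop_energy[OF L[OF that] _ p a] that bs(2) unfolding P_def by auto
  then obtain C where C: "\<And>k. k < m \<Longrightarrow> P k (C k)" by metis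
  define C0 where "C0 = real m powr p * (\<Sum>k<m. C k)"
  have Cn: "C k \<ge> 0" if "k < m" for k using C[OF that] unfolding P_def by blast
  show ?thesis
  proof (intro exI[of _ C0] conjI allI impI)
    show "C0 \<ge> 0" unfolding C0_def using Cn by (intro mult_nonneg_nonneg sum_nonneg) auto
    fix G :: "'a jets" assume G: "admd p m G"
    then have Gk: "adm p (m - 1 - k) (G k)" if "k < m" for k using that unfolding admd_def by blast
    define E where "E k = (\<Sum>\<alpha>\<in>multi_indices (m - 1 - k). gag a p (G k \<alpha>))" for k
    have ms: "(\<lambda>x. L k (G k) (x, t)) \<in> borel_measurable borel" if "k < m" for k t
      by (rule slice_measurable[OF nullop_measurable[OF L[OF that] Gk[OF that]]])
    have mI: "(\<lambda>t. Ip p UNIV (\<lambda>x. L k (G k) (x, t))) \<in> borel_measurable borel" if "k < m" for k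
      by (rule Ip_slice_measurable[OF nullop_measurable[OF L[OF that] Gk[OF that]]]) simp
    have "layer p {0<..<D} (\<lambda>t x. iter_pderiv bs (ext \<eta> m G) (x, t))
      \<le> (\<integral>\<^sup>+t. ennreal (real m powr p) * (\<Sum>k<m. indicator {0<..<D} t * Ip p UNIV (\<lambda>x. L k (G k) (x, t))) \<partial>lborel)"
    proof (rule nn_integral_mono)
      fix t :: real
      show "indicator {0<..<D} t * Ip p UNIV (\<lambda>x. iter_pderiv bs (ext \<eta> m G) (x, t)) \<le> ennreal (real m powr p) * (\<Sum>k<m. indicator {0<..<D} t * Ip p UNIV (\<lambda>x. L k (G k) (x, t)))"
      proof (cases "t \<in> {0<..<D}")
        case True
        have "Ip p UNIV (\<lambda>x. iter_pderiv bs (ext \<eta> m G) (x, t)) = Ip p UNIV (\<lambda>x. \<Sum>k<m. L k (G k) (x, t))"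
          using True m0 by (intro Ip_cong) (auto simp: LL[OF G] intro!: sum.cong)
        also have "\<dots> \<le> ennreal (real (card {..<m}) powr p) * (\<Sum>k<m. Ip p UNIV (\<lambda>x. L k (G k) (x, t)))"
          using p ms by (intro Ip_sum) auto
        finally show ?thesis using True by simp
      qed simp
    qed
    also have "\<dots> = ennreal (real m powr p) * (\<Sum>k<m. layer p {0<..<D} (\<lambda>t x. L k (G k) (x, t)))"
    proof -
      have mI': "(\<lambda>t. indicator {0<..<D} t * Ip p UNIV (\<lambda>x. L k (G k) (x, t))) \<in> borel_measurable lborel" if "k \<in> {..<m}" for k
        using mI[of k] that by simp
      show ?thesis
        by (subst nn_integral_cmult, rule borel_measurable_sum, erule mI', subst nn_integral_sum, erule mI', rule refl)
    qed
    also have "\<dots> \<le> ennreal (real m powr p) * (\<Sum>k<m. ennreal (C k) * (\<Sum>k<m. E k))"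
    proof (intro mult_left_mono sum_mono)
      fix k assume "k \<in> {..<m}"
      then have k: "k < m" by simp
      have "layer p {0<..<D} (\<lambda>t x. L k (G k) (x, t)) \<le> ennreal (C k) * E k"
        using C[OF k] Gk[OF k] unfolding P_def E_def by blast
      also have "\<dots> \<le> ennreal (C k) * (\<Sum>k<m. E k)" using k by (intro mult_left_mono member_le_sum) auto
      finally show "layer p {0<..<D} (\<lambda>t x. L k (G k) (x, t)) \<le> ennreal (C k) * (\<Sum>k<m. E k)" .
    qed auto
    also have "\<dots> = ennreal C0 * (\<Sum>k<m. E k)"
    proof -
      have "(\<Sum>k<m. ennreal (C k)) = ennreal (\<Sum>k<m. C k)" using Cn by (intro sum_ennreal) auto
      moreover have "0 \<le> (\<Sum>k<m. C k)" using Cn by (intro sum_nonneg) auto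
      ultimately show ?thesis
        unfolding C0_def by (simp add: ennreal_mult sum_distrib_right[symmetric] mult.assoc)
    qed
    finally show "layer p {0<..<D} (\<lambda>t x. iter_pderiv bs (ext \<eta> m G) (x, t)) \<le> ennreal C0 * (\<Sum>k<m. E k)" .
  qed
qed

lemma bounded_sum:
  fixes F :: "'i \<Rightarrow> 'a::euclidean_space \<times> real \<Rightarrow> real"
  assumes p: "0 \<le> p" and I: "finite I"
    and "\<And>i. i \<in> I \<Longrightarrow> F i \<in> borel_measurable borel"
    and "\<And>i. i \<in> I \<Longrightarrow> \<exists>K<\<infinity>. \<forall>t. 0 < t \<and> t < D \<longrightarrow> Ip p (ball 0 R) (\<lambda>x. F i (x, t)) \<le> K"
  shows "\<exists>K<\<infinity>. \<forall>t. 0 < t \<and> t < D \<longrightarrow> Ip p (ball 0 R) (\<lambda>x. \<Sum>i\<in>I. F i (x, t)) \<le> K"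
  using I assms(3,4)
proof (induction I rule: finite_induct)
  case empty
  show ?case by (intro exI[of _ 0]) (auto simp: Ip_def)
next
  case (insert i I)
  have "\<exists>K<\<infinity>. \<forall>t. 0 < t \<and> t < D \<longrightarrow> Ip p (ball 0 R) (\<lambda>x. F i (x, t) + (\<lambda>z. \<Sum>i\<in>I. F i z) (x, t)) \<le> K"
    using insert by (intro bounded_add p) auto
  then show ?case using insert by simp
qed

theorem ext_bounded:
  fixes \<eta> :: "'a::euclidean_space \<Rightarrow> real"
  assumes p: "1 \<le> p" and mk: "mkernel r (m - 1) \<eta>" and bs: "set bs \<subseteq> Basis" "length bs < m" and G: "admd p m G"
  shows "\<exists>K<\<infinity>. \<forall>t. 0 < t \<and> t < D \<longrightarrow> Ip p (ball 0 R) (\<lambda>x. iter_pderiv bs (ext \<eta> m G) (x, t)) \<le> K"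
proof -
  obtain L where L: "\<And>k. k < m \<Longrightarrow> nullop r (m - 1 - k) (int k - int (length bs)) (L k)"
    and LL: "\<And>G z. admd p m G \<Longrightarrow> 0 < snd z \<Longrightarrow> iter_pderiv bs (ext \<eta> m G) z =
       (\<Sum>k<m. mterm \<eta> (m - 1 - k) k (nrm bs) (tang bs) (G k) z + L k (G k) z)"
    using ext_repr[OF p mk bs(1)] by blast
  have Gk: "adm p (m - 1 - k) (G k)" if "k < m" for k using that G unfolding admd_def by blast
  have sk: "skern r \<eta>" using mk unfolding mkernel_def by blast
  have "\<exists>K<\<infinity>. \<forall>t. 0 < t \<and> t < D \<longrightarrow> Ip p (ball 0 R) (\<lambda>x. \<Sum>k<m. mterm \<eta> (m - 1 - k) k (nrm bs) (tang bs) (G k) (x, t) + L k (G k) (x, t)) \<le> K"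
  proof (rule bounded_sum[where F = "\<lambda>k z. mterm \<eta> (m - 1 - k) k (nrm bs) (tang bs) (G k) z + L k (G k) z"])
    fix k assume "k \<in> {..<m}"
    then have k: "k < m" by simp
    note mm = mterm_measurable[OF sk Gk[OF k] tang_Basis[OF bs(1)]] nullop_measurable[OF L[OF k] Gk[OF k]]
    show "(\<lambda>z. mterm \<eta> (m - 1 - k) k (nrm bs) (tang bs) (G k) z + L k (G k) z) \<in> borel_measurable borel"
      using mm by (intro borel_measurable_add) auto
    show "\<exists>K<\<infinity>. \<forall>t. 0 < t \<and> t < D \<longrightarrow> Ip p (ball 0 R) (\<lambda>x. mterm \<eta> (m - 1 - k) k (nrm bs) (tang bs) (G k) (x, t) + L k (G k) (x, t)) \<le> K"
      using p k bs(2) by (intro bounded_add mm mterm_bounded[OF p mk Gk[OF k] tang_Basis[OF bs(1)]] nullop_bounded[OF L[OF k] _ p Gk[OF k]]) auto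
  qed (use p in auto)
  moreover have "Ip p (ball 0 R) (\<lambda>x. iter_pderiv bs (ext \<eta> m G) (x, t)) = Ip p (ball 0 R) (\<lambda>x. \<Sum>k<m. mterm \<eta> (m - 1 - k) k (nrm bs) (tang bs) (G k) (x, t) + L k (G k) (x, t))" if "0 < t" for t
    using that by (intro Ip_cong) (simp add: LL[OF G])
  ultimately show ?thesis by auto
qed

lemma Ip_tendsto_sum:
  fixes F :: "'i \<Rightarrow> 'b \<Rightarrow> 'a::euclidean_space \<Rightarrow> real"
  assumes p: "0 \<le> p" and A: "A \<in> sets borel" and I: "finite I"
    and "\<And>i t. i \<in> I \<Longrightarrow> F i t \<in> borel_measurable borel" "\<And>i. i \<in> I \<Longrightarrow> ((\<lambda>t. Ip p A (F i t)) \<longlongrightarrow> 0) net"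
  shows "((\<lambda>t. Ip p A (\<lambda>x. \<Sum>i\<in>I. F i t x)) \<longlongrightarrow> 0) net"
  using I assms(4,5)
proof (induction I rule: finite_induct)
  case empty
  show ?case by (simp add: Ip_def)
next
  case (insert i I)
  then have "((\<lambda>t. Ip p A (\<lambda>x. F i t x + (\<Sum>i\<in>I. F i t x))) \<longlongrightarrow> 0) net"
    by (intro Ip_tendsto_add p A) auto
  then show ?case using insert by simp
qed

text \<open>Null terms vanish in the limit, and among the leading terms only the one with k =
  \<open>nrm bs\<close> has a nonzero limit.\<close>

theorem ext_tendsto:
  fixes \<eta> :: "'a::euclidean_space \<Rightarrow> real"
  assumes p: "1 \<le> p" and mk: "mkernel r (m - 1) \<eta>" and bs: "set bs \<subseteq> Basis" "length bs < m" and G: "admd p m G"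
  shows "((\<lambda>t. Ip p (ball 0 R) (\<lambda>x. iter_pderiv bs (ext \<eta> m G) (x, t) - G (nrm bs) (mi_of (tang bs)) x)) \<longlongrightarrow> 0) (at_right 0)"
proof -
  let ?e = "\<lambda>t x. iter_pderiv bs (ext \<eta> m G) (x, t) - G (nrm bs) (mi_of (tang bs)) x"
  obtain L where L: "\<And>k. k < m \<Longrightarrow> nullop r (m - 1 - k) (int k - int (length bs)) (L k)"
    and LL: "\<And>G z. admd p m G \<Longrightarrow> 0 < snd z \<Longrightarrow> iter_pderiv bs (ext \<eta> m G) z =
       (\<Sum>k<m. mterm \<eta> (m - 1 - k) k (nrm bs) (tang bs) (G k) z + L k (G k) z)"
    using ext_repr[OF p mk bs(1)] by blast
  have Gk: "adm p (m - 1 - k) (G k)" if "k < m" for k using that G unfolding admd_def by blast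
  have sk: "skern r \<eta>" using mk unfolding mkernel_def by blast
  have nt: "nrm bs + length (tang bs) < m" using nrm_tang_length[OF bs(1)] bs(2) by simp
  \<comment> \<open>The limit distributed over the summands, so that convergence can be shown term
    by term.\<close>
  define H where "H k = (\<lambda>x. if nrm bs = k then G k (mi_of (tang bs)) x else 0)" for k
  have Hb: "H k \<in> borel_measurable borel" if "k < m" for k
  proof (cases "nrm bs = k")
    case True
    then show ?thesis unfolding H_def
      using Lploc_borel[OF adm_Lploc[OF Gk[OF that] mi_of_multi_indices[OF tang_Basis[OF bs(1)]]]] nt by simp
  qed (simp add: H_def)
  have Hs: "(\<Sum>k<m. H k x) = G (nrm bs) (mi_of (tang bs)) x" for x
    unfolding H_def using nt by (simp add: sum.delta)
  define F where "F k t x = (mterm \<eta> (m - 1 - k) k (nrm bs) (tang bs) (G k) (x, t) - H k x) + L k (G k) (x, t)" for k t x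
  have "((\<lambda>t. Ip p (ball 0 R) (\<lambda>x. \<Sum>k<m. F k t x)) \<longlongrightarrow> 0) (at_right 0)"
  proof (rule Ip_tendsto_sum)
    fix k t assume "k \<in> {..<m}"
    then have k: "k < m" by simp
    note [measurable] = slice_measurable[OF mterm_measurable[OF sk Gk[OF k] tang_Basis[OF bs(1)]]] slice_measurable[OF nullop_measurable[OF L[OF k] Gk[OF k]]] Hb[OF k]
    show "F k t \<in> borel_measurable borel" unfolding F_def by measurable
  next
    fix k assume "k \<in> {..<m}"
    then have k: "k < m" by simp
    note [measurable] = slice_measurable[OF mterm_measurable[OF sk Gk[OF k] tang_Basis[OF bs(1)]]] slice_measurable[OF nullop_measurable[OF L[OF k] Gk[OF k]]] Hb[OF k]
    have mm: "(\<lambda>x. mterm \<eta> (m - 1 - k) k (nrm bs) (tang bs) (G k) (x, t) - H k x) \<in> borel_measurable borel"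
      "(\<lambda>x. L k (G k) (x, t)) \<in> borel_measurable borel" for t
      by measurable
    have "((\<lambda>t. Ip p (ball 0 R) (\<lambda>x. mterm \<eta> (m - 1 - k) k (nrm bs) (tang bs) (G k) (x, t) - H k x)) \<longlongrightarrow> 0) (at_right 0)"
      unfolding H_def by (rule mterm_tendsto[OF p mk Gk[OF k] tang_Basis[OF bs(1)]]) (use nt in auto)
    moreover have "((\<lambda>t. Ip p (ball 0 R) (\<lambda>x. L k (G k) (x, t))) \<longlongrightarrow> 0) (at_right 0)"
      using k bs(2) by (intro nullop_tendsto[OF L[OF k] _ p Gk[OF k]]) auto
    ultimately show "((\<lambda>t. Ip p (ball 0 R) (F k t)) \<longlongrightarrow> 0) (at_right 0)"
      unfolding F_def using p by (intro Ip_tendsto_add mm) auto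
  qed (use p in auto)
  then show ?thesis
  proof (rule Lim_transform_eventually)
    show "\<forall>\<^sub>F t in at_right 0. Ip p (ball 0 R) (\<lambda>x. \<Sum>k<m. F k t x) = Ip p (ball 0 R) (?e t)"
      unfolding eventually_at_right_field
    proof (intro exI[of _ 1] conjI allI impI)
      fix t :: real assume t: "0 < t" "t < 1"
      show "Ip p (ball 0 R) (\<lambda>x. \<Sum>k<m. F k t x) = Ip p (ball 0 R) (?e t)"
      proof (rule Ip_cong)
        fix x :: 'a
        show "(\<Sum>k<m. F k t x) = ?e t x"
          using LL[OF G, of "(x, t)"] t unfolding F_def Hs[symmetric] by (simp add: sum.distrib sum_subtractf)
      qed
    qed simp
  qed
qed

text \<open>Each normal derivative contributes a factor c. Used with c = -1 for the reflection to
  the upper face and with 0 < c < 1 for the contraction in the trace argument.\<close>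

lemma iter_pderiv_reflect:
  fixes F :: "'a::euclidean_space \<times> real \<Rightarrow> real"
  assumes S: "open S" and F: "smooth_on S F" and bs: "set bs \<subseteq> Basis" and z: "(fst z, c * snd z + b) \<in> S"
  shows "iter_pderiv bs (\<lambda>z. F (fst z, c * snd z + b)) z = c ^ nrm bs * iter_pderiv bs F (fst z, c * snd z + b)"
  using bs z
proof (induction bs arbitrary: z)
  case (Cons bb bs)
  then have bs: "set bs \<subseteq> Basis" and bb: "bb \<in> Basis" by auto
  define A where "A = (\<lambda>z::'a \<times> real. (fst z, c * snd z + b))"
  have dA: "(A has_derivative (\<lambda>v. (fst v, c * snd v))) (at z)" unfolding A_def by (auto intro!: derivative_eq_intros)
  have "continuous_on UNIV A" unfolding A_def by (intro continuous_intros)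
  then have oS: "open (A -` S)" using S by (simp add: open_vimage)
  define H where "H = iter_pderiv bs F"
  have dH: "H differentiable (at (A z))" using F bs Cons.prems unfolding smooth_on_def H_def A_def by blast
  have "((\<lambda>z. H (A z)) has_derivative (\<lambda>v. frechet_derivative H (at (A z)) (fst v, c * snd v))) (at z)"
    by (rule has_derivative_compose[OF dA]) (use dH frechet_derivative_works in blast)
  then have d: "((\<lambda>z. c ^ nrm bs * H (A z)) has_derivative (\<lambda>v. c ^ nrm bs * frechet_derivative H (at (A z)) (fst v, c * snd v))) (at z)"
    by (rule has_derivative_mult_right)
  have "iter_pderiv (bb # bs) (\<lambda>z. F (fst z, c * snd z + b)) z = pd bb (\<lambda>z. c ^ nrm bs * H (A z)) z"
    using frechet_derivative_cong_open[OF oS, of z "iter_pderiv bs (\<lambda>z. F (fst z, c * snd z + b))" "\<lambda>z. c ^ nrm bs * H (A z)"] Cons.IH[OF bs] Cons.prems(2)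
    unfolding A_def H_def by simp
  also have "\<dots> = c ^ nrm bs * frechet_derivative H (at (A z)) (fst bb, c * snd bb)" by (rule pd_eqI[OF d])
  also have "\<dots> = c ^ nrm (bb # bs) * pd bb H (A z)"
    using bb
  proof (cases rule: Basis_prod_cases)
    case 2
    have "frechet_derivative H (at (A z)) (0, c) = c * frechet_derivative H (at (A z)) (0, 1)"
      using linear_cmul[OF linear_frechet_derivative[OF dH], of c "(0, 1)"] by simp
    then show ?thesis using 2 by simp
  qed simp
  finally show ?case unfolding H_def A_def by simp
qed simp

section \<open>Taylor expansion and a Poincare inequality in the normal variable\<close>

text \<open>Fundamental theorem of calculus, then Jensen on an interval of length b - a.\<close>

lemma ftc_jensen:
  fixes F F' :: "real \<Rightarrow> real"
  assumes p: "1 \<le> p" and e: "a < b" and d: "\<And>t. a \<le> t \<Longrightarrow> t \<le> b \<Longrightarrow> (F has_real_derivative F' t) (at t)"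
    and c: "continuous_on {a..b} F'"
  shows "ennreal (\<bar>F b - F a\<bar> powr p) \<le> ennreal ((b - a) powr (p - 1)) * (\<integral>\<^sup>+t. ennreal (\<bar>F' t\<bar> powr p) * indicator {a..b} t \<partial>lborel)"
proof -
  define f where "f t = indicator {a..b} t *\<^sub>R F' t" for t
  have [measurable]: "f \<in> borel_measurable borel"
    unfolding f_def[abs_def] by (rule borel_measurable_continuous_on_indicator[OF _ c]) simp
  have "(\<integral>t. indicator {a..b} t * f t \<partial>lborel) = (\<integral>t. indicator {a..b} t *\<^sub>R F' t \<partial>lborel)"
    by (intro Bochner_Integration.integral_cong) (auto simp: f_def indicator_def)
  also have "\<dots> = F b - F a"
    using e d c by (intro integral_FTC_Icc)
      (auto simp: has_real_derivative_iff_has_vector_derivative[symmetric] intro: has_field_derivative_at_within)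
  finally have "ennreal (\<bar>F b - F a\<bar> powr p) \<le> ennreal (1 powr p * measure lborel {a..b} powr (p - 1)) * Ip p {a..b} f"
    using jensen_kernel[OF p, of f "indicator {a..b}" "{a..b}" 1] e by auto
  also have "Ip p {a..b} f = (\<integral>\<^sup>+t. ennreal (\<bar>F' t\<bar> powr p) * indicator {a..b} t \<partial>lborel)"
    unfolding Ip_def f_def by (intro nn_integral_cong) (auto split: split_indicator)
  finally show ?thesis using e by simp
qed

text \<open>The functions of interest are smooth on an open set and arbitrary elsewhere; extension
  by zero gives Borel functions on the whole space.\<close>

definition on_meas :: "'a::euclidean_space set \<Rightarrow> ('a \<Rightarrow> real) \<Rightarrow> bool" where
  "on_meas S F \<longleftrightarrow> (\<lambda>z. if z \<in> S then F z else 0) \<in> borel_measurable borel"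

lemma on_meas_continuous: "open S \<Longrightarrow> continuous_on S F \<Longrightarrow> on_meas S F"
  unfolding on_meas_def by (rule borel_measurable_continuous_on_if) auto

lemma on_meas_subset: "on_meas S F \<Longrightarrow> A \<in> sets borel \<Longrightarrow> A \<subseteq> S \<Longrightarrow> on_meas A F"
proof -
  assume a: "on_meas S F" "A \<in> sets borel" "A \<subseteq> S"
  have "(\<lambda>z. if z \<in> A then (if z \<in> S then F z else 0) else 0) \<in> borel_measurable borel"
    using a(1,2) unfolding on_meas_def by measurable
  also have "(\<lambda>z. if z \<in> A then (if z \<in> S then F z else 0) else 0) = (\<lambda>z. if z \<in> A then F z else 0)" using a(3) by (auto simp: fun_eq_iff)
  finally show "on_meas A F" unfolding on_meas_def .
qed

section \<open>Norms over subsets, slices and Fubini\<close>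

lemma Ip_cut: "Ip p S F = Ip p S (\<lambda>z. if z \<in> S then F z else 0)"
  by (rule Ip_cong) simp

lemma Ip_add_on:
  assumes "0 \<le> p" "A \<in> sets borel" "on_meas A f" "on_meas A g"
  shows "Ip p A (\<lambda>x. f x + g x) \<le> ennreal (2 powr p) * (Ip p A f + Ip p A g)"
proof -
  have "Ip p A (\<lambda>x. f x + g x) = Ip p A (\<lambda>x. (if x \<in> A then f x else 0) + (if x \<in> A then g x else 0))"
    by (rule Ip_cong) simp
  also have "\<dots> \<le> ennreal (2 powr p) * (Ip p A (\<lambda>x. if x \<in> A then f x else 0) + Ip p A (\<lambda>x. if x \<in> A then g x else 0))"
    using assms unfolding on_meas_def by (intro Ip_add) auto
  finally show ?thesis unfolding Ip_cut[symmetric] .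
qed

lemma Ip_sum_on:
  assumes "0 \<le> p" "A \<in> sets borel" "finite I" "\<And>i. i \<in> I \<Longrightarrow> on_meas A (f i)"
  shows "Ip p A (\<lambda>x. \<Sum>i\<in>I. f i x) \<le> ennreal (real (card I) powr p) * (\<Sum>i\<in>I. Ip p A (f i))"
proof -
  have "Ip p A (\<lambda>x. \<Sum>i\<in>I. f i x) = Ip p A (\<lambda>x. \<Sum>i\<in>I. (if x \<in> A then f i x else 0))"
    by (rule Ip_cong) simp
  also have "\<dots> \<le> ennreal (real (card I) powr p) * (\<Sum>i\<in>I. Ip p A (\<lambda>x. if x \<in> A then f i x else 0))"
    using assms unfolding on_meas_def by (intro Ip_sum) auto
  finally show ?thesis unfolding Ip_cut[symmetric] .
qed

lemma Ip_mult_bound: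
  assumes p: "0 \<le> p" and A: "A \<in> sets borel" "on_meas A g" and f: "\<And>x. x \<in> A \<Longrightarrow> \<bar>f x\<bar> \<le> K"
  shows "Ip p A (\<lambda>x. f x * g x) \<le> ennreal (\<bar>K\<bar> powr p) * Ip p A g"
proof -
  have "Ip p A (\<lambda>x. f x * g x) \<le> Ip p A (\<lambda>x. K * (if x \<in> A then g x else 0))"
  proof (rule Ip_le[OF p])
    fix x assume x: "x \<in> A"
    have "\<bar>f x\<bar> \<le> \<bar>K\<bar>" using f[OF x] by linarith
    then show "\<bar>f x * g x\<bar> \<le> \<bar>K * (if x \<in> A then g x else 0)\<bar>"
      using x by (simp add: abs_mult mult_right_mono)
  qed
  also have "\<dots> = ennreal (\<bar>K\<bar> powr p) * Ip p A (\<lambda>x. if x \<in> A then g x else 0)"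
    using A unfolding on_meas_def by (intro Ip_cmult) auto
  finally show ?thesis unfolding Ip_cut[symmetric] .
qed

lemma Ip_product:
  fixes F :: "'a::euclidean_space \<times> real \<Rightarrow> real"
  assumes A: "A \<in> sets borel" and B: "B \<in> sets borel" and m: "on_meas (A \<times> B) F"
  shows "Ip p (A \<times> B) F = (\<integral>\<^sup>+s. indicator B s * Ip p A (\<lambda>x. F (x, s)) \<partial>lborel)"
    "Ip p (A \<times> B) F = (\<integral>\<^sup>+x. indicator A x * (\<integral>\<^sup>+s. ennreal (\<bar>F (x, s)\<bar> powr p) * indicator B s \<partial>lborel) \<partial>lborel)"
proof -
  let ?J = "(\<integral>\<^sup>+x. indicator A x * (\<integral>\<^sup>+s. ennreal (\<bar>F (x, s)\<bar> powr p) * indicator B s \<partial>lborel) \<partial>lborel)"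
  define G where "G z = ennreal (\<bar>if z \<in> A \<times> B then F z else 0\<bar> powr p)" for z
  have "G \<in> borel_measurable borel" unfolding G_def using m unfolding on_meas_def by measurable
  then have mG: "G \<in> borel_measurable (lborel \<Otimes>\<^sub>M lborel)" by (simp add: lborel_prod)
  have "Ip p (A \<times> B) F = (\<integral>\<^sup>+z. G z \<partial>lborel)"
    unfolding Ip_def G_def by (intro nn_integral_cong) (auto split: split_indicator)
  also have "\<dots> = (\<integral>\<^sup>+z. G z \<partial>(lborel \<Otimes>\<^sub>M lborel))" by (simp add: lborel_prod)
  finally have eq: "Ip p (A \<times> B) F = (\<integral>\<^sup>+z. G z \<partial>(lborel \<Otimes>\<^sub>M lborel))" .
  have g: "G (x, s) = ennreal (\<bar>F (x, s)\<bar> powr p) * indicator A x * indicator B s" for x s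
    unfolding G_def by (auto split: split_indicator)
  have "Ip p (A \<times> B) F = (\<integral>\<^sup>+s. \<integral>\<^sup>+x. G (x, s) \<partial>lborel \<partial>lborel)"
    unfolding eq by (rule lborel_pair.nn_integral_snd[symmetric, OF mG])
  also have "\<dots> = (\<integral>\<^sup>+s. indicator B s * Ip p A (\<lambda>x. F (x, s)) \<partial>lborel)"
    unfolding g Ip_def by (intro nn_integral_cong) (auto split: split_indicator)
  finally show "Ip p (A \<times> B) F = (\<integral>\<^sup>+s. indicator B s * Ip p A (\<lambda>x. F (x, s)) \<partial>lborel)" .
  have "Ip p (A \<times> B) F = (\<integral>\<^sup>+x. \<integral>\<^sup>+s. G (x, s) \<partial>lborel \<partial>lborel)"
    unfolding eq by (rule lborel.nn_integral_fst[symmetric, OF mG])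
  also have "\<dots> = ?J"
    unfolding g by (intro nn_integral_cong) (auto split: split_indicator)
  finally show "Ip p (A \<times> B) F = ?J" .
qed

lemma Ip_UNIV_le:
  assumes f: "f \<in> borel_measurable borel" and K: "\<And>R. 0 < R \<Longrightarrow> Ip p (ball 0 R) f \<le> K"
  shows "Ip p UNIV f \<le> K"
proof -
  have eq: "(SUP n. ennreal (\<bar>f x\<bar> powr p) * indicator (ball 0 (real n)) x) = ennreal (\<bar>f x\<bar> powr p) * indicator UNIV x" for x
  proof (rule antisym)
    obtain n where "norm x < real n" using reals_Archimedean2 by blast
    then show "ennreal (\<bar>f x\<bar> powr p) * indicator UNIV x \<le> (SUP n. ennreal (\<bar>f x\<bar> powr p) * indicator (ball 0 (real n)) x)"
      by (intro SUP_upper2[of n]) auto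
  qed (auto intro!: SUP_least split: split_indicator)
  have "Ip p UNIV f = (SUP n. Ip p (ball 0 (real n)) f)"
    unfolding Ip_def eq[symmetric] using f
    by (intro nn_integral_monotone_convergence_SUP) (auto simp: incseq_def le_fun_def split: split_indicator)
  also have "\<dots> \<le> K"
  proof (rule SUP_least)
    fix n :: nat show "Ip p (ball 0 (real n)) f \<le> K"
      using K[of "real n"] by (cases "n = 0") (auto simp: Ip_def)
  qed
  finally show ?thesis .
qed

lemma slice_on_meas:
  fixes F :: "'a::euclidean_space \<times> real \<Rightarrow> real"
  assumes "on_meas (UNIV \<times> B) F" "t \<in> B" shows "(\<lambda>x. F (x, t)) \<in> borel_measurable borel"
  using slice_measurable[OF assms(1)[unfolded on_meas_def], of t] assms(2) by simp

text \<open>Integration from \<epsilon> to \<tau> as \<epsilon> tends to 0. The initial slice is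
  small only over balls, so the bound is shown on every ball first, with a right-hand side free of
  \<open>R\<close>.\<close>

lemma slice_growth:
  fixes F F' :: "'a::euclidean_space \<times> real \<Rightarrow> real"
  assumes p: "1 \<le> p" and \<tau>: "0 < \<tau>"
    and m: "on_meas (UNIV \<times> {0<..}) F" "on_meas (UNIV \<times> {0<..}) F'"
    and d: "\<And>x t. 0 < t \<Longrightarrow> ((\<lambda>t. F (x, t)) has_real_derivative F' (x, t)) (at t)"
    and c: "\<And>x. continuous_on {0<..} (\<lambda>t. F' (x, t))"
    and lim: "\<And>R. ((\<lambda>t. Ip p (ball 0 R) (\<lambda>x. F (x, t))) \<longlongrightarrow> 0) (at_right 0)"
  shows "Ip p UNIV (\<lambda>x. F (x, \<tau>)) \<le> ennreal (2 powr p * \<tau> powr (p - 1)) * layer p {0<..\<tau>} (\<lambda>t x. F' (x, t))"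
proof (rule Ip_UNIV_le)
  have sl: "(\<lambda>x. F (x, t)) \<in> borel_measurable borel" if "0 < t" for t using slice_on_meas[OF m(1)] that by simp
  show "(\<lambda>x. F (x, \<tau>)) \<in> borel_measurable borel" using sl \<tau> .
  fix R :: real
  let ?J = "\<lambda>x \<epsilon>. \<integral>\<^sup>+t. ennreal (\<bar>F' (x, t)\<bar> powr p) * indicator {\<epsilon>..\<tau>} t \<partial>lborel"
  define E where "E = ennreal (\<tau> powr (p - 1)) * layer p {0<..\<tau>} (\<lambda>t x. F' (x, t))"
  have est: "Ip p (ball 0 R) (\<lambda>x. F (x, \<tau>)) \<le> ennreal (2 powr p) * (E + Ip p (ball 0 R) (\<lambda>x. F (x, \<epsilon>)))" if \<epsilon>: "0 < \<epsilon>" "\<epsilon> < \<tau>" for \<epsilon>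
  proof -
    have mF': "on_meas (UNIV \<times> {\<epsilon>..\<tau>}) F'"
      by (rule on_meas_subset[OF m(2)]) (use \<epsilon> in \<open>auto intro!: borel_closed closed_Times\<close>)
    have "Ip p (ball 0 R) (\<lambda>x. F (x, \<tau>) - F (x, \<epsilon>)) \<le> (\<integral>\<^sup>+x. ennreal (\<tau> powr (p - 1)) * (indicator UNIV x * ?J x \<epsilon>) \<partial>lborel)"
      unfolding Ip_def
    proof (rule nn_integral_mono)
      fix x :: 'a
      have "ennreal (\<bar>F (x, \<tau>) - F (x, \<epsilon>)\<bar> powr p) \<le> ennreal ((\<tau> - \<epsilon>) powr (p - 1)) * ?J x \<epsilon>"
        using \<epsilon> by (intro ftc_jensen[OF p] d continuous_on_subset[OF c]) auto
      also have "\<dots> \<le> ennreal (\<tau> powr (p - 1)) * ?J x \<epsilon>"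
        using \<epsilon> p by (intro mult_right_mono ennreal_leI powr_mono2) auto
      finally show "ennreal (\<bar>F (x, \<tau>) - F (x, \<epsilon>)\<bar> powr p) * indicator (ball 0 R) x \<le> ennreal (\<tau> powr (p - 1)) * (indicator UNIV x * ?J x \<epsilon>)"
        by (auto split: split_indicator)
    qed
    also have "\<dots> = ennreal (\<tau> powr (p - 1)) * (\<integral>\<^sup>+x. indicator UNIV x * ?J x \<epsilon> \<partial>lborel)"
    proof (rule nn_integral_cmult)
      have [measurable]: "(\<lambda>z. if z \<in> UNIV \<times> {\<epsilon>..\<tau>} then F' z else 0) \<in> borel_measurable (borel \<Otimes>\<^sub>M borel)" using mF' unfolding on_meas_def by (simp add: borel_prod)
      have "(\<lambda>x. (\<integral>\<^sup>+t. ennreal (\<bar>if (x, t) \<in> UNIV \<times> {\<epsilon>..\<tau>} then F' (x, t) else 0\<bar> powr p) * indicator {\<epsilon>..\<tau>} t \<partial>lborel)) \<in> borel_measurable lborel"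
        by (rule lborel.borel_measurable_nn_integral) measurable
      also have "(\<lambda>x. (\<integral>\<^sup>+t. ennreal (\<bar>if (x, t) \<in> UNIV \<times> {\<epsilon>..\<tau>} then F' (x, t) else 0\<bar> powr p) * indicator {\<epsilon>..\<tau>} t \<partial>lborel)) = (\<lambda>x. indicator UNIV x * ?J x \<epsilon>)"
        by (auto simp: fun_eq_iff intro!: nn_integral_cong split: split_indicator)
      finally show "(\<lambda>x. indicator UNIV x * ?J x \<epsilon>) \<in> borel_measurable lborel" .
    qed
    also have "\<dots> = ennreal (\<tau> powr (p - 1)) * (\<integral>\<^sup>+t. indicator {\<epsilon>..\<tau>} t * Ip p UNIV (\<lambda>x. F' (x, t)) \<partial>lborel)"
      using Ip_product[OF _ _ mF', of p] by auto
    also have "\<dots> \<le> E"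
      unfolding E_def using \<epsilon> by (intro mult_left_mono nn_integral_mono) (auto split: split_indicator)
    finally have 1: "Ip p (ball 0 R) (\<lambda>x. F (x, \<tau>) - F (x, \<epsilon>)) \<le> E" .
    have "Ip p (ball 0 R) (\<lambda>x. F (x, \<tau>)) = Ip p (ball 0 R) (\<lambda>x. (F (x, \<tau>) - F (x, \<epsilon>)) + F (x, \<epsilon>))" by simp
    also have "\<dots> \<le> ennreal (2 powr p) * (Ip p (ball 0 R) (\<lambda>x. F (x, \<tau>) - F (x, \<epsilon>)) + Ip p (ball 0 R) (\<lambda>x. F (x, \<epsilon>)))"
      using p \<tau> \<epsilon> by (intro Ip_add borel_measurable_diff sl) auto
    also have "\<dots> \<le> ennreal (2 powr p) * (E + Ip p (ball 0 R) (\<lambda>x. F (x, \<epsilon>)))" by (intro mult_left_mono add_right_mono 1) auto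
    finally show ?thesis .
  qed
  have "((\<lambda>\<epsilon>. ennreal (2 powr p) * (E + Ip p (ball 0 R) (\<lambda>x. F (x, \<epsilon>)))) \<longlongrightarrow> ennreal (2 powr p) * (E + 0)) (at_right 0)"
    by (intro ennreal_tendsto_cmult tendsto_add tendsto_const lim) auto
  then have "Ip p (ball 0 R) (\<lambda>x. F (x, \<tau>)) \<le> ennreal (2 powr p) * (E + 0)"
    by (rule tendsto_lowerbound) (auto simp: eventually_at_right_field intro!: exI[of _ \<tau>] \<tau> est)
  then show "Ip p (ball 0 R) (\<lambda>x. F (x, \<tau>)) \<le> ennreal (2 powr p * \<tau> powr (p - 1)) * layer p {0<..\<tau>} (\<lambda>t x. F' (x, t))"
    unfolding E_def by (simp add: ennreal_mult mult.assoc)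
qed

section \<open>Taylor expansion at the boundary\<close>

abbreviation eN :: "'a::euclidean_space \<times> real" where "eN \<equiv> (0, 1)"

lemma tang_nrm_append [simp]: "tang (as @ bs) = tang as @ tang bs" "nrm (as @ bs) = nrm as + nrm bs"
  by (auto simp: tang_def nrm_def)

lemma tang_nrm_replicate [simp]: "tang (replicate j eN) = []" "nrm (replicate j eN) = j"
  by (induction j) auto

lemma smooth_on_normal_derivative:
  fixes F :: "'a::euclidean_space \<times> real \<Rightarrow> real"
  assumes "smooth_on S F" "(x, t) \<in> S"
  shows "((\<lambda>t. F (x, t)) has_real_derivative pd eN F (x, t)) (at t)"
proof -
  have "((\<lambda>s. F ((x, 0) + s *\<^sub>R eN)) has_real_derivative pd eN F ((x, 0) + t *\<^sub>R eN)) (at t)"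
    by (rule smooth_on_line_derivative[OF assms(1)]) (use assms(2) in simp)
  then show ?thesis by simp
qed

lemma upper_Times: "upper = UNIV \<times> {0<..}" by auto

text \<open>Induction on the number of normal derivatives missing to order m. The normal derivative
  of the remainder is the remainder of one order less for the normal derivative, and the remainder
  vanishes at t = 0. Each integration gains \<tau>^p, except the one that meets the energy of the
  layer, which gains \<tau>^(p - 1).\<close>

theorem ext_taylor:
  fixes \<eta> :: "'a::euclidean_space \<Rightarrow> real"
  assumes p: "1 \<le> p" and mk: "mkernel r (m - 1) \<eta>" and bs: "set bs \<subseteq> Basis" and G: "admd p m G"
    and l: "length bs + i = m" "0 < i" and \<tau>: "0 < \<tau>" "\<tau> < D"
  defines "g \<equiv> \<lambda>k. G (nrm bs + k) (mi_of (tang bs))"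
  shows "Ip p UNIV (\<lambda>x. iter_pderiv bs (ext \<eta> m G) (x, \<tau>) - (\<Sum>k<i. \<tau> ^ k / fact k * g k x))
    \<le> ennreal (2 powr (p * real i) * \<tau> powr (real i * p - 1)) *
      layer p {0<..<D} (\<lambda>t x. iter_pderiv (replicate i eN @ bs) (ext \<eta> m G) (x, t))"
  using bs l \<tau> unfolding g_def
proof (induction i arbitrary: bs \<tau>)
  case (Suc i)
  define V where "V = ext \<eta> m G"
  have V: "smooth_on upper V" unfolding V_def by (rule ext_smooth[OF p mk G])
  define bs' where "bs' = eN # bs"
  have bs': "set bs' \<subseteq> Basis" "length bs' + i = m" using Suc.prems Basis_prod_nor unfolding bs'_def by auto
  define g where "g k = G (nrm bs + k) (mi_of (tang bs))" for k
  let ?s = "\<lambda>t x. \<Sum>k<i. - (t ^ Suc k / fact (Suc k)) * g (Suc k) x" and ?v = "\<lambda>t x. if 0 < t then iter_pderiv bs V (x, t) - g 0 x else 0" and ?c = "2 powr (p * real i) * \<tau> powr (real i * p - 1)"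
  have g': "G (nrm bs' + k) (mi_of (tang bs')) = g (Suc k)" for k unfolding bs'_def g_def by simp
  have nt: "nrm bs + length (tang bs) = length bs" by (rule nrm_tang_length[OF Suc.prems(1)])
  have gb: "Lploc p (g k)" if "k < Suc i" for k
  proof -
    have "nrm bs + k < m" using nt Suc.prems that by linarith
    then have "adm p (m - 1 - (nrm bs + k)) (G (nrm bs + k))" using G unfolding admd_def by blast
    moreover have "length (tang bs) \<le> m - 1 - (nrm bs + k)" using nt Suc.prems that by linarith
    ultimately show ?thesis unfolding g_def by (rule adm_Lploc[OF _ mi_of_multi_indices[OF tang_Basis[OF Suc.prems(1)]]])
  qed
  define E where "E = layer p {0<..<D} (\<lambda>t x. iter_pderiv (replicate (Suc i) eN @ bs) V (x, t))"
  define F where "F z = iter_pderiv bs V z - (\<Sum>k<Suc i. snd z ^ k / fact k * g k (fst z))" for z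
  define F' where "F' z = iter_pderiv bs' V z - (\<Sum>k<i. snd z ^ k / fact k * g (Suc k) (fst z))" for z
  have mV: "on_meas (UNIV \<times> {0<..}) (iter_pderiv cs V)" if "set cs \<subseteq> Basis" for cs
    using on_meas_continuous[OF open_upper smooth_on_continuous_on_iter[OF V that]] by (simp add: upper_Times)
  have mP: "(\<lambda>z. \<Sum>k<n. snd z ^ k / fact k * g (k + j) (fst z)) \<in> borel_measurable (borel :: ('a \<times> real) measure)" if "n + j \<le> Suc i" for n j
  proof (rule borel_measurable_sum)
    fix k assume "k \<in> {..<n}"
    then have [measurable]: "g (k + j) \<in> borel_measurable borel" using that by (intro Lploc_borel[OF gb]) auto
    show "(\<lambda>z. snd z ^ k / fact k * g (k + j) (fst z)) \<in> borel_measurable (borel :: ('a \<times> real) measure)" by measurable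
  qed
  have om: "on_meas (UNIV \<times> {0<..}) (\<lambda>z. iter_pderiv cs V z - P z)" if "set cs \<subseteq> Basis" "P \<in> borel_measurable borel" for cs and P :: "'a \<times> real \<Rightarrow> real"
  proof -
    have [measurable]: "UNIV \<times> {0::real<..} \<in> sets (borel :: ('a \<times> real) measure)" by (intro borel_open open_Times) auto
    have "(\<lambda>z. (if z \<in> UNIV \<times> {0<..} then iter_pderiv cs V z else 0) - (if z \<in> UNIV \<times> {0<..} then P z else 0)) \<in> borel_measurable borel"
      using mV[OF that(1)] that(2) unfolding on_meas_def by measurable
    also have "(\<lambda>z. (if z \<in> UNIV \<times> {0<..} then iter_pderiv cs V z else 0) - (if z \<in> UNIV \<times> {0<..} then P z else 0)) = (\<lambda>z. if z \<in> UNIV \<times> {0<..} then iter_pderiv cs V z - P z else 0)"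
      by auto
    finally show ?thesis unfolding on_meas_def .
  qed
  have mF: "on_meas (UNIV \<times> {0<..}) F" unfolding F_def using om[OF Suc.prems(1) mP[of "Suc i" 0]] by simp
  have mF': "on_meas (UNIV \<times> {0<..}) F'" unfolding F'_def using om[OF bs'(1) mP[of i 1]] by simp
  have dF: "((\<lambda>t. F (x, t)) has_real_derivative F' (x, t)) (at t)" if "0 < t" for x t
  proof -
    have d1: "((\<lambda>t. iter_pderiv bs V (x, t)) has_real_derivative iter_pderiv bs' V (x, t)) (at t)"
      unfolding bs'_def iter_pderiv.simps
      by (rule smooth_on_normal_derivative[OF smooth_on_iter[OF V Suc.prems(1)]]) (use that in simp)
    have d2: "((\<lambda>t. \<Sum>k<Suc i. t ^ k / fact k * g k x) has_real_derivative (\<Sum>k<Suc i. (real k * t ^ (k - 1)) / fact k * g k x)) (at t)"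
      by (auto intro!: derivative_eq_intros sum.cong)
    have "(\<Sum>k<Suc i. (real k * t ^ (k - 1)) / fact k * g k x) = (\<Sum>k<i. (real (Suc k) * t ^ k) / fact (Suc k) * g (Suc k) x)"
      by (subst sum.lessThan_Suc_shift) simp
    also have "\<dots> = (\<Sum>k<i. t ^ k / fact k * g (Suc k) x)"
      by (intro sum.cong refl) (simp add: fact_Suc del: of_nat_Suc)
    finally show ?thesis using DERIV_diff[OF d1 d2] unfolding F_def F'_def by simp
  qed
  have cF': "continuous_on {0<..} (\<lambda>t. F' (x, t))" for x
  proof -
    have "continuous_on {0<..} (\<lambda>t. iter_pderiv bs' V (x, t))"
      by (rule continuous_on_compose2[OF smooth_on_continuous_on_iter[OF V bs'(1)]]) (auto intro!: continuous_intros)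
    then show ?thesis unfolding F'_def by (auto intro!: continuous_intros)
  qed
  have limF: "((\<lambda>t. Ip p (ball 0 R) (\<lambda>x. F (x, t))) \<longlongrightarrow> 0) (at_right 0)" for R
  proof -
    have l1: "((\<lambda>t. Ip p (ball 0 R) (\<lambda>x. iter_pderiv bs V (x, t) - g 0 x)) \<longlongrightarrow> 0) (at_right 0)"
      using ext_tendsto[OF p mk Suc.prems(1) _ G, of R] Suc.prems(2) unfolding V_def g_def by simp
    have l2: "((\<lambda>t. Ip p (ball 0 R) (?s t)) \<longlongrightarrow> 0) (at_right 0)"
    proof (rule Ip_tendsto_sum)
      fix k assume "k \<in> {..<i}"
      then have gk: "Lploc p (g (Suc k))" using gb by simp
      show "(\<lambda>x. - (t ^ Suc k / fact (Suc k)) * g (Suc k) x) \<in> borel_measurable borel" for t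
        using Lploc_borel[OF gk] by simp
      have "((\<lambda>t::real. - (t ^ Suc k / fact (Suc k))) \<longlongrightarrow> - (0 ^ Suc k / fact (Suc k))) (at_right 0)" by (intro tendsto_intros) auto
      then have "((\<lambda>t::real. ennreal (\<bar>- (t ^ Suc k / fact (Suc k))\<bar> powr p)) \<longlongrightarrow> 0) (at_right 0)"
        using p by (intro tendsto_ennreal_powr_0) auto
      then have "((\<lambda>t::real. Ip p (ball 0 R) (g (Suc k)) * ennreal (\<bar>- (t ^ Suc k / fact (Suc k))\<bar> powr p)) \<longlongrightarrow> Ip p (ball 0 R) (g (Suc k)) * 0) (at_right 0)"
        using gk unfolding Lploc_def by (intro ennreal_tendsto_cmult) auto
      moreover have "Ip p (ball 0 R) (\<lambda>x. - (t ^ Suc k / fact (Suc k)) * g (Suc k) x) = Ip p (ball 0 R) (g (Suc k)) * ennreal (\<bar>- (t ^ Suc k / fact (Suc k))\<bar> powr p)" for t :: real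
        using Lploc_borel[OF gk] by (subst Ip_cmult) (auto simp: mult.commute)
      ultimately show "((\<lambda>t. Ip p (ball 0 R) (\<lambda>x. - (t ^ Suc k / fact (Suc k)) * g (Suc k) x)) \<longlongrightarrow> 0) (at_right 0)" by simp
    qed (use p in auto)
    \<comment> \<open>The constant term of the Taylor polynomial is the trace and belongs to the
      derivative; all other terms carry a positive power of t.\<close>
    have e: "F (x, t) = ?v t x + ?s t x" if "0 < t" for x t
      using that unfolding F_def by (subst sum.lessThan_Suc_shift) (simp add: sum_negf)
    have l1': "((\<lambda>t. Ip p (ball 0 R) (?v t)) \<longlongrightarrow> 0) (at_right 0)"
      by (rule Lim_transform_eventually[OF l1]) (auto simp: eventually_at_right_field intro!: exI[of _ 1])
    have "((\<lambda>t. Ip p (ball 0 R) (\<lambda>x. ?v t x + ?s t x)) \<longlongrightarrow> 0) (at_right 0)"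
    proof (rule Ip_tendsto_add[OF _ _ _ _ l1' l2])
      fix t :: real
      show "(?v t) \<in> borel_measurable borel"
        using slice_on_meas[OF mV[OF Suc.prems(1)], of t] Lploc_borel[OF gb, of 0] by (cases "0 < t") auto
      show "(?s t) \<in> borel_measurable borel"
        using Lploc_borel[OF gb] by (intro borel_measurable_sum) simp
    qed (use p in auto)
    then show ?thesis
    proof (rule Lim_transform_eventually)
      show "\<forall>\<^sub>F t in at_right 0. Ip p (ball 0 R) (\<lambda>x. ?v t x + ?s t x) = Ip p (ball 0 R) (\<lambda>x. F (x, t))"
        unfolding eventually_at_right_field
      proof (intro exI[of _ 1] conjI allI impI)
        fix y :: real assume "0 < y" "y < 1"
        then show "Ip p (ball 0 R) (\<lambda>x. (if 0 < y then iter_pderiv bs V (x, y) - g 0 x else 0) + (\<Sum>k<i. - (y ^ Suc k / fact (Suc k)) * g (Suc k) x)) = Ip p (ball 0 R) (\<lambda>x. F (x, y))"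
          by (intro Ip_cong) (rule e[symmetric])
      qed simp
    qed
  qed
  have growth: "Ip p UNIV (\<lambda>x. F (x, \<tau>)) \<le> ennreal (2 powr p * \<tau> powr (p - 1)) * layer p {0<..\<tau>} (\<lambda>t x. F' (x, t))"
    by (rule slice_growth[OF p Suc.prems(4) mF mF' dF cF' limF])
  have rep: "replicate i eN @ bs' = replicate (Suc i) eN @ bs" unfolding bs'_def by (simp add: replicate_app_Cons_same)
  \<comment> \<open>For i = 0 the integrand is the derivative of order m, controlled only after
    integration over the layer; for i > 0 the induction hypothesis bounds single slices.\<close>
  have "layer p {0<..\<tau>} (\<lambda>t x. F' (x, t)) \<le> ennreal (2 powr (p * real i) * \<tau> powr (real i * p)) * E"
  proof (cases "i = 0")
    case True
    have "layer p {0<..\<tau>} (\<lambda>t x. F' (x, t)) \<le> E"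
      unfolding E_def F'_def using True Suc.prems(5) by (intro nn_integral_mono) (auto simp: bs'_def split: split_indicator)
    then show ?thesis using True Suc.prems(4) by simp
  next
    case False
    have "layer p {0<..\<tau>} (\<lambda>t x. F' (x, t)) \<le> (\<integral>\<^sup>+t. ennreal (?c) * E * indicator {0<..\<tau>} t \<partial>lborel)"
    proof (rule nn_integral_mono)
      fix t :: real
      show "indicator {0<..\<tau>} t * Ip p UNIV (\<lambda>x. F' (x, t)) \<le> ennreal (?c) * E * indicator {0<..\<tau>} t"
      proof (cases "t \<in> {0<..\<tau>}")
        case True
        \<comment> \<open>The exponent is nonnegative, so the bound for the slice at t is largest at
          t = \<tau>.\<close>
        have ip: "0 \<le> real i * p - 1" using False p mult_mono[of 1 "real i" 1 p] by simp
        have "Ip p UNIV (\<lambda>x. F' (x, t)) \<le> ennreal (2 powr (p * real i) * t powr (real i * p - 1)) * E"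
          using Suc.IH[OF bs', of t] False True Suc.prems(5) unfolding F'_def V_def[symmetric] g' rep E_def[symmetric] by simp
        also have "\<dots> \<le> ennreal (?c) * E"
          using True ip by (intro mult_right_mono ennreal_leI mult_left_mono powr_mono2) auto
        finally show ?thesis using True by simp
      qed simp
    qed
    also have "\<dots> = ennreal (?c) * E * ennreal \<tau>"
      using Suc.prems(4) by (simp add: nn_integral_cmult)
    also have "\<dots> = ennreal (?c * \<tau>) * E"
      using Suc.prems(4) by (simp add: ennreal_mult mult_ac)
    also have "?c * \<tau> = 2 powr (p * real i) * \<tau> powr (real i * p)"
      using Suc.prems(4) by (simp add: powr_diff)
    finally show ?thesis .
  qed
  then have "Ip p UNIV (\<lambda>x. F (x, \<tau>)) \<le> ennreal (2 powr p * \<tau> powr (p - 1)) * (ennreal (2 powr (p * real i) * \<tau> powr (real i * p)) * E)"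
    by (rule order_trans[OF growth mult_left_mono]) simp
  also have "\<dots> = ennreal (2 powr p * \<tau> powr (p - 1) * (2 powr (p * real i) * \<tau> powr (real i * p))) * E"
    by (simp add: ennreal_mult mult.assoc)
  also have "2 powr p * \<tau> powr (p - 1) * (2 powr (p * real i) * \<tau> powr (real i * p)) = 2 powr (p * real (Suc i)) * \<tau> powr (real (Suc i) * p - 1)"
  proof -
    have "p * real (Suc i) = p + p * real i" "real (Suc i) * p - 1 = (p - 1) + real i * p" by (simp_all add: algebra_simps)
    then show ?thesis by (simp only: powr_add mult_ac)
  qed
  finally show ?case unfolding F_def E_def V_def g_def by simp
qed simp

section \<open>Poincare inequality on a slab and the Leibniz rule\<close>

abbreviation slab :: "real \<Rightarrow> real \<Rightarrow> ('a::euclidean_space \<times> real) set" where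
  "slab b0 b1 \<equiv> UNIV \<times> {b0<..<b1}"

lemma open_slab: "open (slab b0 b1)"
  by (intro open_Times) auto

text \<open>Every slice differs from the one at height \<open>c\<close> by a normal integral of the
  derivative. Integration over the height costs one factor b1 - b0, which completes the factor of
  the derivative to the power p.\<close>

lemma slab_poincare:
  fixes F :: "'a::euclidean_space \<times> real \<Rightarrow> real"
  assumes p: "1 \<le> p" and F: "smooth_on (slab b0 b1) F" and c: "b0 < c" "c < b1"
  shows "Ip p (slab b0 b1) F \<le> ennreal (2 powr p) *
    (ennreal (b1 - b0) * Ip p UNIV (\<lambda>x. F (x, c)) + ennreal ((b1 - b0) powr p) * Ip p (slab b0 b1) (pd eN F))"
proof -
  define B where "B = {b0<..<b1}"
  define \<delta> where "\<delta> = b1 - b0"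
  have \<delta>: "\<delta> > 0" using c by (simp add: \<delta>_def)
  define F' where "F' = pd eN F"
  have sF': "smooth_on (slab b0 b1) F'" unfolding F'_def by (rule smooth_on_pd[OF F Basis_prod_nor])
  have cF': "continuous_on (slab b0 b1) F'" by (rule smooth_on_continuous_on[OF sF'])
  have om: "on_meas (slab b0 b1) F" "on_meas (slab b0 b1) F'"
    by (intro on_meas_continuous open_slab smooth_on_continuous_on F sF')+
  have d: "((\<lambda>t. F (x, t)) has_real_derivative F' (x, t)) (at t)" if "t \<in> B" for x t
    unfolding F'_def by (rule smooth_on_normal_derivative[OF F]) (use that in \<open>simp add: B_def\<close>)
  have cs: "continuous_on B (\<lambda>t. F' (x, t))" for x
    unfolding B_def by (rule continuous_on_compose2[OF cF']) (auto intro!: continuous_intros)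
  define N where "N x = (\<integral>\<^sup>+t. ennreal (\<bar>F' (x, t)\<bar> powr p) * indicator B t \<partial>lborel)" for x
  have one: "ennreal (\<bar>F (x, s) - F (x, c)\<bar> powr p) \<le> ennreal (\<delta> powr (p - 1)) * N x" if s: "s \<in> B" for x s
  proof -
    have gen: "ennreal (\<bar>F (x, v) - F (x, u)\<bar> powr p) \<le> ennreal (\<delta> powr (p - 1)) * N x" if uv: "u < v" "u \<in> B" "v \<in> B" for u v
    proof -
      have sub: "{u..v} \<subseteq> B" using uv unfolding B_def by auto
      have "ennreal (\<bar>F (x, v) - F (x, u)\<bar> powr p) \<le> ennreal ((v - u) powr (p - 1)) * (\<integral>\<^sup>+t. ennreal (\<bar>F' (x, t)\<bar> powr p) * indicator {u..v} t \<partial>lborel)"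
        using sub uv by (intro ftc_jensen[OF p] d continuous_on_subset[OF cs]) auto
      also have "\<dots> \<le> ennreal (\<delta> powr (p - 1)) * N x"
        unfolding N_def using sub uv p by (intro mult_mono nn_integral_mono ennreal_leI powr_mono2)
          (auto simp: B_def \<delta>_def split: split_indicator)
      finally show ?thesis .
    qed
    have cB: "c \<in> B" using c by (simp add: B_def)
    consider "s < c" | "s = c" | "c < s" by linarith
    then show ?thesis
    proof cases
      case 1 then show ?thesis using gen[OF 1 s cB] by (simp add: abs_minus_commute)
    qed (use gen[OF _ cB s] p in auto)
  qed
  have [measurable]: "(\<lambda>z. if z \<in> slab b0 b1 then F' z else 0) \<in> borel_measurable (borel \<Otimes>\<^sub>M borel)"
    using om(2) unfolding on_meas_def by (simp add: borel_prod)
  have mN: "N \<in> borel_measurable borel"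
  proof -
    have "(\<lambda>x. (\<integral>\<^sup>+t. ennreal (\<bar>if (x, t) \<in> slab b0 b1 then F' (x, t) else 0\<bar> powr p) * indicator B t \<partial>lborel)) \<in> borel_measurable borel"
      unfolding B_def by (rule lborel.borel_measurable_nn_integral) measurable
    also have "(\<lambda>x. (\<integral>\<^sup>+t. ennreal (\<bar>if (x, t) \<in> slab b0 b1 then F' (x, t) else 0\<bar> powr p) * indicator B t \<partial>lborel)) = N"
      unfolding N_def B_def by (auto simp: fun_eq_iff intro!: nn_integral_cong split: split_indicator)
    finally show ?thesis .
  qed
  have mc: "(\<lambda>x. F (x, c)) \<in> borel_measurable borel" using slice_on_meas[OF om(1), of c] c by simp
  define H where "H = Ip p UNIV (\<lambda>x. F (x, c)) + ennreal (\<delta> powr (p - 1)) * (\<integral>\<^sup>+x. N x \<partial>lborel)"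
  have "Ip p (slab b0 b1) F = (\<integral>\<^sup>+s. indicator B s * Ip p UNIV (\<lambda>x. F (x, s)) \<partial>lborel)"
    unfolding B_def by (rule Ip_product(1)[OF _ _ om(1)]) auto
  also have "\<dots> \<le> (\<integral>\<^sup>+s. ennreal (2 powr p) * H * indicator B s \<partial>lborel)"
  proof (rule nn_integral_mono)
    fix s :: real
    show "indicator B s * Ip p UNIV (\<lambda>x. F (x, s)) \<le> ennreal (2 powr p) * H * indicator B s"
    proof (cases "s \<in> B")
      case True
      have "Ip p UNIV (\<lambda>x. F (x, s)) \<le> (\<integral>\<^sup>+x. ennreal (2 powr p) * (ennreal (\<bar>F (x, c)\<bar> powr p) * indicator UNIV x + ennreal (\<delta> powr (p - 1)) * N x) \<partial>lborel)"
        unfolding Ip_def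
      proof (rule nn_integral_mono)
        fix x :: 'a
        have "ennreal (\<bar>F (x, s)\<bar> powr p) \<le> ennreal (2 powr p * (\<bar>F (x, c)\<bar> powr p + \<bar>F (x, s) - F (x, c)\<bar> powr p))"
          using powr_add_le[of p "F (x, c)" "F (x, s) - F (x, c)"] p by (intro ennreal_leI) simp
        also have "\<dots> = ennreal (2 powr p) * (ennreal (\<bar>F (x, c)\<bar> powr p) + ennreal (\<bar>F (x, s) - F (x, c)\<bar> powr p))"
          by (simp add: ennreal_mult ennreal_plus)
        also have "\<dots> \<le> ennreal (2 powr p) * (ennreal (\<bar>F (x, c)\<bar> powr p) + ennreal (\<delta> powr (p - 1)) * N x)"
          by (intro mult_left_mono add_left_mono one[OF True]) auto
        finally show "ennreal (\<bar>F (x, s)\<bar> powr p) * indicator UNIV x \<le> ennreal (2 powr p) * (ennreal (\<bar>F (x, c)\<bar> powr p) * indicator UNIV x + ennreal (\<delta> powr (p - 1)) * N x)"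
          by simp
      qed
      also have "\<dots> = ennreal (2 powr p) * H"
        unfolding H_def Ip_def using mc mN by (simp add: nn_integral_cmult nn_integral_add)
      finally show ?thesis using True by simp
    qed simp
  qed
  also have "\<dots> = ennreal (2 powr p) * H * ennreal \<delta>"
    using c unfolding B_def \<delta>_def by (simp add: nn_integral_cmult)
  also have "\<dots> = ennreal (2 powr p) * (ennreal \<delta> * Ip p UNIV (\<lambda>x. F (x, c)) + ennreal (\<delta> powr (p - 1) * \<delta>) * (\<integral>\<^sup>+x. N x \<partial>lborel))"
    unfolding H_def using \<delta> by (simp add: ennreal_mult distrib_left distrib_right mult_ac)
  also have "\<delta> powr (p - 1) * \<delta> = \<delta> powr p" using \<delta> by (simp add: powr_diff)
  also have "(\<integral>\<^sup>+x. N x \<partial>lborel) = Ip p (slab b0 b1) F'"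
    unfolding N_def B_def by (subst Ip_product(2)[OF _ _ om(2)]) auto
  finally show ?thesis unfolding \<delta>_def F'_def .
qed

text \<open>The normal derivatives added in steps i < j are paid for on the slice at
  \<open>c\<close>, the one with j steps over the whole slab; a slice term keeps the additional
  factor b1 - b0.\<close>

lemma slab_poincare_iter:
  fixes w :: "'a::euclidean_space \<times> real \<Rightarrow> real"
  assumes p: "1 \<le> p" and w: "smooth_on (slab b0 b1) w" and bs: "set bs \<subseteq> Basis" and c: "b0 < c" "c < b1"
  shows "Ip p (slab b0 b1) (iter_pderiv bs w) \<le> ennreal (2 powr (p * real j)) *
    (ennreal ((b1 - b0) powr (real j * p)) * Ip p (slab b0 b1) (iter_pderiv (replicate j eN @ bs) w) +
     (\<Sum>i<j. ennreal ((b1 - b0) powr (real i * p + 1)) * Ip p UNIV (\<lambda>x. iter_pderiv (replicate i eN @ bs) w (x, c))))"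
  using bs
proof (induction j arbitrary: bs)
  case 0
  then show ?case using c by simp
next
  case (Suc j)
  define \<delta> where "\<delta> = b1 - b0"
  have \<delta>: "\<delta> > 0" using c by (simp add: \<delta>_def)
  define bs' where "bs' = eN # bs"
  have bs': "set bs' \<subseteq> Basis" using Suc.prems Basis_prod_nor unfolding bs'_def by auto
  have rep: "replicate i eN @ bs' = replicate (Suc i) eN @ bs" for i unfolding bs'_def by (simp add: replicate_app_Cons_same)
  define X where "X i = Ip p UNIV (\<lambda>x. iter_pderiv (replicate i eN @ bs) w (x, c))" for i
  define Y where "Y = Ip p (slab b0 b1) (iter_pderiv (replicate (Suc j) eN @ bs) w)"
  have "Ip p (slab b0 b1) (iter_pderiv bs w) \<le> ennreal (2 powr p) * (ennreal \<delta> * X 0 + ennreal (\<delta> powr p) * Ip p (slab b0 b1) (iter_pderiv bs' w))"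
    using slab_poincare[OF p smooth_on_iter[OF w Suc.prems] c] unfolding \<delta>_def X_def bs'_def by simp
  also have "\<dots> \<le> ennreal (2 powr p) * (ennreal \<delta> * X 0 + ennreal (\<delta> powr p) * (ennreal (2 powr (p * real j)) * (ennreal (\<delta> powr (real j * p)) * Y + (\<Sum>i<j. ennreal (\<delta> powr (real i * p + 1)) * X (Suc i)))))"
    using Suc.IH[OF bs'] unfolding rep \<delta>_def[symmetric] X_def[symmetric] Y_def[symmetric]
    by (intro mult_left_mono add_left_mono) auto
  \<comment> \<open>The first term is enlarged by the factor 2^(pj) >= 1, so that this factor can be
    taken out of the sum.\<close>
  also have "\<dots> \<le> ennreal (2 powr p) * (ennreal (2 powr (p * real j)) * (ennreal \<delta> * X 0) + ennreal (\<delta> powr p) * (ennreal (2 powr (p * real j)) * (ennreal (\<delta> powr (real j * p)) * Y + (\<Sum>i<j. ennreal (\<delta> powr (real i * p + 1)) * X (Suc i)))))"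
  proof (intro mult_left_mono add_right_mono)
    have "1 \<le> ennreal (2 powr (p * real j))" using p by (simp add: ge_one_powr_ge_zero)
    then show "ennreal \<delta> * X 0 \<le> ennreal (2 powr (p * real j)) * (ennreal \<delta> * X 0)"
      using mult_right_mono[of 1 "ennreal (2 powr (p * real j))" "ennreal \<delta> * X 0"] by simp
  qed auto
  also have "\<dots> = ennreal (2 powr p) * ennreal (2 powr (p * real j)) * (ennreal (\<delta> powr p) * ennreal (\<delta> powr (real j * p)) * Y + (ennreal \<delta> * X 0 + (\<Sum>i<j. (ennreal (\<delta> powr p) * ennreal (\<delta> powr (real i * p + 1))) * X (Suc i))))"
    by (simp add: distrib_left sum_distrib_left mult_ac add_ac)
  also have "ennreal (2 powr p) * ennreal (2 powr (p * real j)) = ennreal (2 powr (p * real (Suc j)))"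
    by (simp add: ennreal_mult[symmetric] powr_add[symmetric] algebra_simps)
  also have "ennreal (\<delta> powr p) * ennreal (\<delta> powr (real j * p)) = ennreal (\<delta> powr (real (Suc j) * p))"
    by (simp add: ennreal_mult[symmetric] powr_add[symmetric] algebra_simps)
  also have "ennreal \<delta> * X 0 + (\<Sum>i<j. (ennreal (\<delta> powr p) * ennreal (\<delta> powr (real i * p + 1))) * X (Suc i)) = (\<Sum>i<Suc j. ennreal (\<delta> powr (real i * p + 1)) * X i)"
  proof -
    have e: "ennreal (\<delta> powr p) * ennreal (\<delta> powr (real i * p + 1)) = ennreal (\<delta> powr (real (Suc i) * p + 1))" for i
      by (simp add: ennreal_mult[symmetric] powr_add[symmetric] algebra_simps)
    show ?thesis unfolding e by (subst sum.lessThan_Suc_shift) (use \<delta> in simp)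
  qed
  finally show ?case unfolding \<delta>_def X_def Y_def .
qed

text \<open>The Leibniz rule for a factor that depends on the normal variable only: a pair \<open>(j, cs)\<close>
  stands for the product of the \<open>j\<close>-th derivative of that factor and the derivative \<open>cs\<close> of the other.\<close>

primrec leib :: "('a::euclidean_space \<times> real) list \<Rightarrow> (nat \<times> ('a \<times> real) list) list" where
  "leib [] = [(0, [])]"
| "leib (b # bs) = map (\<lambda>(j, cs). (j, b # cs)) (leib bs) @ (if b = eN then map (\<lambda>(j, cs). (Suc j, cs)) (leib bs) else [])"

lemma leib_props:
  "(j, cs) \<in> set (leib bs) \<Longrightarrow> set bs \<subseteq> Basis \<Longrightarrow> set cs \<subseteq> Basis \<and> j + length cs = length bs"
proof (induction bs arbitrary: j cs)
  case (Cons b bs)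
  then consider cs' where "cs = b # cs'" "(j, cs') \<in> set (leib bs)" | j' where "j = Suc j'" "(j', cs) \<in> set (leib bs)"
    by (auto split: if_splits)
  then show ?case
    using Cons.IH[of j "tl cs"] Cons.IH[of "j - 1" cs] Cons.prems(2) by cases auto
qed simp

lemma pd_sum_list:
  assumes "\<And>i. i \<in> set is \<Longrightarrow> f i differentiable (at x)"
  shows "(\<lambda>x. \<Sum>i\<leftarrow>is. f i x) differentiable (at x) \<and> pd b (\<lambda>x. \<Sum>i\<leftarrow>is. f i x) x = (\<Sum>i\<leftarrow>is. pd b (f i) x)"
  using assms by (induction "is") (auto simp: pd_add)

lemma leibniz:
  fixes X :: "nat \<Rightarrow> 'a::euclidean_space \<times> real \<Rightarrow> real"
  assumes S: "open S" and w: "smooth_on S w" and X: "\<And>j z. z \<in> S \<Longrightarrow> X j differentiable (at z)"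
    "\<And>j z. z \<in> S \<Longrightarrow> pd eN (X j) z = X (Suc j) z" "\<And>j b z. z \<in> S \<Longrightarrow> b \<in> Basis \<Longrightarrow> b \<noteq> eN \<Longrightarrow> pd b (X j) z = 0"
    and bs: "set bs \<subseteq> Basis" and z: "z \<in> S"
  shows "iter_pderiv bs (\<lambda>z. X 0 z * w z) z = (\<Sum>(j, cs)\<leftarrow>leib bs. X j z * iter_pderiv cs w z)"
  using bs z
proof (induction bs arbitrary: z)
  case (Cons b bs)
  then have b: "b \<in> Basis" and bs: "set bs \<subseteq> Basis" by auto
  define f where "f = (\<lambda>(j, cs) z. X j z * iter_pderiv cs w z)"
  have d: "f i differentiable (at z)" if "i \<in> set (leib bs)" for i
  proof -
    obtain j cs where i: "i = (j, cs)" by force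
    have "iter_pderiv cs w differentiable (at z)"
      using leib_props[of j cs bs] that bs i w Cons.prems(2) unfolding smooth_on_def by blast
    then show ?thesis unfolding i f_def using X(1)[OF Cons.prems(2)] by auto
  qed
  have pdf: "pd b (f (j, cs)) z = X j z * iter_pderiv (b # cs) w z + (if b = eN then X (Suc j) z * iter_pderiv cs w z else 0)"
    if "(j, cs) \<in> set (leib bs)" for j cs
  proof -
    have "iter_pderiv cs w differentiable (at z)"
      using leib_props[of j cs bs] that bs w Cons.prems(2) unfolding smooth_on_def by blast
    then show ?thesis unfolding f_def using pd_mult[of "X j" z "iter_pderiv cs w" b] X(1-3)[OF Cons.prems(2)] b by auto
  qed
  have "iter_pderiv (b # bs) (\<lambda>z. X 0 z * w z) z = pd b (\<lambda>z. \<Sum>i\<leftarrow>leib bs. f i z) z"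
    using frechet_derivative_cong_open[OF S Cons.prems(2), of "iter_pderiv bs (\<lambda>z. X 0 z * w z)"] Cons.IH[OF bs]
    by (simp add: f_def case_prod_beta)
  also have "\<dots> = (\<Sum>i\<leftarrow>leib bs. pd b (f i) z)" using pd_sum_list[of "leib bs" f z b] d by blast
  also have "\<dots> = (\<Sum>(j, cs)\<leftarrow>leib bs. X j z * iter_pderiv (b # cs) w z + (if b = eN then X (Suc j) z * iter_pderiv cs w z else 0))"
    using pdf by (intro arg_cong[where f = sum_list] map_cong refl) auto
  also have "\<dots> = (\<Sum>(j, cs)\<leftarrow>leib (b # bs). X j z * iter_pderiv cs w z)"
  proof -
    have "(\<Sum>(j, cs)\<leftarrow>l. X j z * iter_pderiv (b # cs) w z + (if b = eN then X (Suc j) z * iter_pderiv cs w z else 0))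
      = (\<Sum>(j, cs)\<leftarrow>map (\<lambda>(j, cs). (j, b # cs)) l @ (if b = eN then map (\<lambda>(j, cs). (Suc j, cs)) l else []). X j z * iter_pderiv cs w z)" for l
      by (cases "b = eN"; induction l) (auto simp: add_ac)
    then show ?thesis by simp
  qed
  finally show ?case .
qed simp

lemma Ip_sum_list_on:
  assumes "0 \<le> p" "A \<in> sets borel" "\<And>i. i \<in> set is \<Longrightarrow> on_meas A (f i)"
  shows "Ip p A (\<lambda>x. \<Sum>i\<leftarrow>is. f i x) \<le> ennreal (real (length is) powr p) * (\<Sum>i\<leftarrow>is. Ip p A (f i))"
  using Ip_sum_on[OF assms(1,2), of "{0..<length is}" "\<lambda>k. f (is ! k)"] assms(3)
  by (simp add: sum_list_sum_nth)

text \<open>Fatou's lemma for the nonnegative functions 2^p (|F_n|^p + |f|^p) - |F_n - f|^p: since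
  asymptotically the integrals of |F_n|^p do not exceed that of |f|^p, nothing is left for |F_n -
  f|^p.\<close>

lemma Ip_scheffe:
  fixes F :: "nat \<Rightarrow> 'a::euclidean_space \<Rightarrow> real"
  assumes p: "1 \<le> p" and A: "A \<in> sets borel" and m: "\<And>n. on_meas A (F n)" "on_meas A f"
    and fin: "Ip p A f < \<infinity>" and lim: "\<And>x. x \<in> A \<Longrightarrow> (\<lambda>n. F n x) \<longlonglongrightarrow> f x"
    and c: "c \<longlonglongrightarrow> 1" "\<And>n. Ip p A (F n) \<le> ennreal (c n) * Ip p A f"
  shows "(\<lambda>n. Ip p A (\<lambda>x. F n x - f x)) \<longlonglongrightarrow> 0"
proof -
  define F0 where "F0 n x = (if x \<in> A then F n x else 0)" for n x
  define f0 where "f0 x = (if x \<in> A then f x else 0)" for x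
  have mm[measurable]: "F0 n \<in> borel_measurable borel" "f0 \<in> borel_measurable borel" for n
    using m unfolding on_meas_def F0_def[abs_def] f0_def[abs_def] by auto
  define K :: real where "K = 2 powr p"
  have K: "K > 0" by (simp add: K_def)
  define h where "h n x = ennreal (K * (\<bar>F0 n x\<bar> powr p + \<bar>f0 x\<bar> powr p) - \<bar>F0 n x - f0 x\<bar> powr p)" for n x
  let ?H = "\<lambda>n. \<integral>\<^sup>+x. h n x \<partial>lborel"
  have hge: "0 \<le> K * (\<bar>F0 n x\<bar> powr p + \<bar>f0 x\<bar> powr p) - \<bar>F0 n x - f0 x\<bar> powr p" for n x
    using powr_add_le[of p "F0 n x" "- f0 x"] p unfolding K_def by simp
  define I where "I = Ip p A f"
  obtain i where i: "I = ennreal i" "i \<ge> 0" using fin unfolding I_def by (cases "Ip p A f") auto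
  have IF: "Ip p A (F n) = (\<integral>\<^sup>+x. ennreal (\<bar>F0 n x\<bar> powr p) \<partial>lborel)" for n
    unfolding Ip_def F0_def using p by (intro nn_integral_cong) (auto split: split_indicator)
  have If: "I = (\<integral>\<^sup>+x. ennreal (\<bar>f0 x\<bar> powr p) \<partial>lborel)"
    unfolding I_def Ip_def f0_def using p by (intro nn_integral_cong) (auto split: split_indicator)
  have Id: "Ip p A (\<lambda>x. F n x - f x) = (\<integral>\<^sup>+x. ennreal (\<bar>F0 n x - f0 x\<bar> powr p) \<partial>lborel)" for n
    unfolding Ip_def F0_def f0_def using p by (intro nn_integral_cong) (auto split: split_indicator)
  define a where "a n = Ip p A (\<lambda>x. F n x - f x)" for n
  have tot: "?H n + a n \<le> ennreal (K * (\<bar>c n\<bar> + 1) * i)" for n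
  proof -
    have "?H n + a n = (\<integral>\<^sup>+x. h n x + ennreal (\<bar>F0 n x - f0 x\<bar> powr p) \<partial>lborel)"
      unfolding a_def Id h_def by (subst nn_integral_add) auto
    also have "\<dots> = (\<integral>\<^sup>+x. ennreal K * (ennreal (\<bar>F0 n x\<bar> powr p) + ennreal (\<bar>f0 x\<bar> powr p)) \<partial>lborel)"
      unfolding h_def using hge K by (intro nn_integral_cong) (simp add: ennreal_plus[symmetric] ennreal_mult[symmetric] del: ennreal_plus)
    also have "\<dots> = ennreal K * (Ip p A (F n) + I)"
      unfolding IF If by (subst nn_integral_cmult) (auto simp: nn_integral_add)
    also have "\<dots> \<le> ennreal K * (ennreal \<bar>c n\<bar> * I + I)"
      using order_trans[OF c(2)[of n] mult_right_mono[OF ennreal_leI[OF abs_ge_self[of "c n"]]]] unfolding I_def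
      by (intro mult_left_mono add_right_mono) auto
    also have "\<dots> = ennreal (K * (\<bar>c n\<bar> + 1) * i)"
      unfolding i(1) using K i(2) by (simp add: ennreal_mult[symmetric] ennreal_plus[symmetric] algebra_simps del: ennreal_plus)
    finally show ?thesis .
  qed
  have fatou: "ennreal (2 * K * i) \<le> liminf (\<lambda>n. ?H n)"
  proof -
    have hl: "(\<lambda>n. h n x) \<longlonglongrightarrow> ennreal (K * (\<bar>f0 x\<bar> powr p + \<bar>f0 x\<bar> powr p) - \<bar>f0 x - f0 x\<bar> powr p)" for x
    proof -
      have l: "(\<lambda>n. F0 n x) \<longlonglongrightarrow> f0 x" using lim unfolding F0_def f0_def by auto
      have l1: "(\<lambda>n. \<bar>F0 n x\<bar> powr p) \<longlonglongrightarrow> \<bar>f0 x\<bar> powr p"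
        using p by (intro tendsto_powr' tendsto_intros l) auto
      have l2: "(\<lambda>n. \<bar>F0 n x - f0 x\<bar> powr p) \<longlonglongrightarrow> \<bar>f0 x - f0 x\<bar> powr p"
        using p by (intro tendsto_powr' tendsto_intros l) auto
      show ?thesis unfolding h_def by (intro tendsto_ennrealI tendsto_diff tendsto_mult tendsto_add tendsto_const l1 l2)
    qed
    have "ennreal (2 * K * i) = ennreal (2 * K) * I" unfolding i(1) using K i(2) by (simp add: ennreal_mult)
    also have "\<dots> = (\<integral>\<^sup>+x. ennreal (2 * K) * ennreal (\<bar>f0 x\<bar> powr p) \<partial>lborel)"
      unfolding If by (rule nn_integral_cmult[symmetric]) simp
    also have "\<dots> = (\<integral>\<^sup>+x. liminf (\<lambda>n. h n x) \<partial>lborel)"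
    proof (rule nn_integral_cong)
      fix x
      have "liminf (\<lambda>n. h n x) = ennreal (K * (\<bar>f0 x\<bar> powr p + \<bar>f0 x\<bar> powr p) - \<bar>f0 x - f0 x\<bar> powr p)"
        using hl[of x] by (intro lim_imp_Liminf) auto
      then show "ennreal (2 * K) * ennreal (\<bar>f0 x\<bar> powr p) = liminf (\<lambda>n. h n x)"
        using K p by (simp add: ennreal_mult[symmetric])
    qed
    also have "\<dots> \<le> liminf (\<lambda>n. ?H n)"
      by (rule nn_integral_liminf) (simp add: h_def)
    finally show ?thesis .
  qed
  show ?thesis
  proof (rule order_tendstoI)
    fix e :: ennreal assume "0 < e"
    then obtain \<epsilon> where \<epsilon>: "\<epsilon> > 0" "ennreal \<epsilon> < e" using ennreal_pos_between by blast
    have "(\<lambda>n. K * (\<bar>c n\<bar> + 1) * i) \<longlonglongrightarrow> K * (\<bar>1\<bar> + 1) * i" by (intro tendsto_intros c)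
    then have ev1: "\<forall>\<^sub>F n in sequentially. K * (\<bar>c n\<bar> + 1) * i < 2 * K * i + \<epsilon> / 3"
      using \<epsilon> by (intro order_tendstoD(2)) auto
    \<comment> \<open>The case distinction keeps 2 K i - \<epsilon>/3 nonnegative, as
      \<open>ennreal\<close> would cut it off at 0.\<close>
    have ev2: "\<forall>\<^sub>F n in sequentially. ennreal (2 * K * i) \<le> ?H n + ennreal (\<epsilon> / 3)"
    proof (cases "2 * K * i \<le> \<epsilon> / 3")
      case True
      then have "ennreal (2 * K * i) \<le> y + ennreal (\<epsilon> / 3)" for y
        using add_increasing[of y "ennreal (2 * K * i)" "ennreal (\<epsilon> / 3)"] ennreal_leI[OF True] by simp
      then show ?thesis by simp
    next
      case False
      then have "ennreal (2 * K * i - \<epsilon> / 3) < ennreal (2 * K * i)" using \<epsilon> by (simp add: ennreal_less_iff)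
      then have "ennreal (2 * K * i - \<epsilon> / 3) < liminf (\<lambda>n. ?H n)" using fatou by (rule less_le_trans)
      then have "\<forall>\<^sub>F n in sequentially. ennreal (2 * K * i - \<epsilon> / 3) < ?H n"
        using less_LiminfD by blast
      then show ?thesis
      proof eventually_elim
        fix n assume "ennreal (2 * K * i - \<epsilon> / 3) < ?H n"
        then have "ennreal (2 * K * i - \<epsilon> / 3) + ennreal (\<epsilon> / 3) \<le> ?H n + ennreal (\<epsilon> / 3)"
          by (intro add_right_mono) simp
        then show "ennreal (2 * K * i) \<le> ?H n + ennreal (\<epsilon> / 3)"
          using False \<epsilon> by (simp add: ennreal_plus[symmetric] del: ennreal_plus)
      qed
    qed
    show "\<forall>\<^sub>F n in sequentially. Ip p A (\<lambda>x. F n x - f x) < e"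
      using ev1 ev2
    proof eventually_elim
      fix n assume 1: "K * (\<bar>c n\<bar> + 1) * i < 2 * K * i + \<epsilon> / 3" and 2: "ennreal (2 * K * i) \<le> ?H n + ennreal (\<epsilon> / 3)"
      have "?H n + a n < \<infinity>" using tot[of n] by (rule le_less_trans) simp
      then obtain H a' where H: "?H n = ennreal H" "H \<ge> 0" and a': "a n = ennreal a'" "a' \<ge> 0"
        by (cases "?H n"; cases "a n") auto
      have "H + a' \<le> K * (\<bar>c n\<bar> + 1) * i"
        using tot[of n] H a' K i(2) by (simp add: ennreal_plus[symmetric] del: ennreal_plus)
      moreover have "2 * K * i \<le> H + \<epsilon> / 3"
        using 2 H \<epsilon> by (simp add: ennreal_plus[symmetric] del: ennreal_plus)
      ultimately have "a' < \<epsilon>" using 1 \<epsilon> by linarith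
      then have "a n < ennreal \<epsilon>" using a' \<epsilon> by (simp add: ennreal_less_iff)
      then show "Ip p A (\<lambda>x. F n x - f x) < e" using \<epsilon>(2) unfolding a_def by simp
    qed
  qed simp
qed

section \<open>Traces\<close>

lemma Ip_lebesgue: "(\<integral>\<^sup>+x\<in>U. ennreal (\<bar>u x\<bar> powr p) \<partial>lebesgue) = Ip p U u"
  unfolding Ip_def nn_integral_completion ..

lemma has_weak_pderiv_cong_AE:
  fixes u v w :: "'a::euclidean_space \<Rightarrow> real"
  assumes h: "has_weak_pderiv U (mi_of bs) u w" and bs: "set bs \<subseteq> Basis" and v: "L1_loc U v"
    and ae: "AE x in lborel. x \<in> U \<longrightarrow> v x = u x"
  shows "has_weak_pderiv U (mi_of bs) v w"
  unfolding has_weak_pderiv_def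
proof (intro conjI allI impI v)
  show "L1_loc U w" using h unfolding has_weak_pderiv_def by blast
  fix \<phi> assume t: "test_fun U \<phi>"
  have sm: "smooth_on UNIV \<phi>" using t unfolding test_fun_def smooth_iff by blast
  have t': "test_fun U (pderiv_mi (mi_of bs) \<phi>)" unfolding pderiv_mi_mi_of[OF sm bs] by (rule test_fun_iter[OF t bs])
  have u: "L1_loc U u" using h unfolding has_weak_pderiv_def by blast
  have "(LINT x:U|lebesgue. v x * pderiv_mi (mi_of bs) \<phi> x) = (LINT x:U|lebesgue. u x * pderiv_mi (mi_of bs) \<phi> x)"
    unfolding set_lebesgue_integral_def
  proof (rule integral_cong_AE)
    show "AE x in lebesgue. indicator U x *\<^sub>R (v x * pderiv_mi (mi_of bs) \<phi> x) = indicator U x *\<^sub>R (u x * pderiv_mi (mi_of bs) \<phi> x)"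
      using AE_completion[OF ae] by eventually_elim (auto simp: indicator_def)
  qed (use set_integrable_L1_loc_times_test[OF v t'] set_integrable_L1_loc_times_test[OF u t'] in \<open>auto simp: set_integrable_def\<close>)
  then show "(LINT x:U|lebesgue. v x * pderiv_mi (mi_of bs) \<phi> x) = (- 1) ^ sum (mi_of bs) Basis * (LINT x:U|lebesgue. w x * \<phi> x)"
    using h t unfolding has_weak_pderiv_def by simp
qed

lemma L1_loc_subset: "L1_loc U u \<Longrightarrow> V \<subseteq> U \<Longrightarrow> L1_loc V u"
  unfolding L1_loc_def by blast

lemma smooth_on_affine_snd: "smooth_on UNIV (\<lambda>z::'a::euclidean_space \<times> real. c * snd z + b)"
proof -
  have "smooth_on UNIV (\<lambda>z::'a \<times> real. c * (z \<bullet> (0, 1)) + b)"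
    by (intro smooth_on_add smooth_on_mult smooth_on_const smooth_on_inner) auto
  then show ?thesis by (simp add: inner_prod_def)
qed

lemma smooth_on_compose_snd:
  assumes "smooth_on UNIV \<kappa>" shows "smooth_on UNIV (\<lambda>z::'a::euclidean_space \<times> real. \<kappa> (c * snd z + b))"
  by (rule smooth_on_compose[OF _ assms]) (auto intro: smooth_on_affine_snd)

lemma smooth_on_normal_affine:
  fixes F :: "'a::euclidean_space \<times> real \<Rightarrow> real"
  assumes S: "open S" and F: "smooth_on S F"
  shows "smooth_on ((\<lambda>z. (fst z, c * snd z + b)) -` S) (\<lambda>z. F (fst z, c * snd z + b))"
proof (rule smooth_on_compose[OF _ F])
  show "open ((\<lambda>z::'a \<times> real. (fst z, c * snd z + b)) -` S)"
    using S by (intro open_vimage) (auto intro!: continuous_intros)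
  fix i :: "'a \<times> real" assume "i \<in> Basis"
  then show "smooth_on ((\<lambda>z. (fst z, c * snd z + b)) -` S) (\<lambda>z. (fst z, c * snd z + b) \<bullet> i)"
  proof (cases rule: Basis_prod_cases)
    case (1 j)
    have "smooth_on UNIV (\<lambda>z::'a \<times> real. z \<bullet> (j, 0))" by (rule smooth_on_inner) simp
    then show ?thesis using 1 smooth_on_subset by (fastforce simp: inner_prod_def)
  next
    case 2
    then show ?thesis using smooth_on_subset[OF smooth_on_affine_snd[where 'a = 'a, of c b]] by (simp add: inner_prod_def)
  qed
qed auto

lemma open_cyl: "open (ball (0::'a::euclidean_space) R \<times> {b0<..<b1::real})"
  by (intro open_Times) auto

text \<open>The contraction maps the slab into itself, and the substitution enlarges the integral by
  at most 1/l, which tends to 1. Pointwise convergence comes from continuity in the open slab, so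
  \<open>Ip_scheffe\<close> applies.\<close>

lemma dilation_tendsto:
  fixes H :: "'a::euclidean_space \<times> real \<Rightarrow> real"
  assumes p: "1 \<le> p" and H: "continuous_on (slab b0 b1) H" and b: "b0 < b1"
    and fin: "Ip p (ball 0 R \<times> {b0<..<b1}) H < \<infinity>"
    and l: "\<And>n. 0 < l n" "\<And>n. l n < 1" "l \<longlonglongrightarrow> 1"
  shows "(\<lambda>n. Ip p (ball 0 R \<times> {b0<..<b1}) (\<lambda>z. l n ^ k * H (fst z, l n * snd z + (1 - l n) * ((b0 + b1) / 2)) - H z)) \<longlonglongrightarrow> 0"
proof -
  define B where "B = {b0<..<b1}"
  define U where "U = ball (0::'a) R \<times> B"
  define mid where "mid = (b0 + b1) / 2"
  let ?d = "\<lambda>n z :: 'a \<times> real. (fst z, l n * snd z + (1 - l n) * mid)"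
  have oU: "open U" and US: "U \<subseteq> slab b0 b1" unfolding U_def B_def using open_cyl by auto
  have inB: "l n * s + (1 - l n) * mid \<in> B" if "s \<in> {b0..b1}" for n s
  proof -
    have "mid < b1" "b0 < mid" using b unfolding mid_def by auto
    then have "(1 - l n) * mid < (1 - l n) * b1" "(1 - l n) * b0 < (1 - l n) * mid" using l(2)[of n] by auto
    moreover have "l n * s \<le> l n * b1" "l n * b0 \<le> l n * s" using l(1)[of n] that by auto
    ultimately show ?thesis unfolding B_def by (simp add: algebra_simps)
  qed
  have cA: "continuous_on U (\<lambda>z. H (?d n z))" for n
  proof (rule continuous_on_compose2[OF H])
    show "(\<lambda>z. (?d n z)) ` U \<subseteq> slab b0 b1"
      using inB unfolding U_def B_def by auto
  qed (intro continuous_intros)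
  have HU: "on_meas U H" by (rule on_meas_continuous[OF oU continuous_on_subset[OF H US]])
  have "(\<lambda>n. Ip p U (\<lambda>z. l n ^ k * H (?d n z) - H z)) \<longlonglongrightarrow> 0"
  proof (rule Ip_scheffe[OF p])
    show "U \<in> sets borel" using oU by (rule borel_open)
    show "on_meas U (\<lambda>z. l n ^ k * H (?d n z))" for n
      by (intro on_meas_continuous oU continuous_intros cA)
    show "on_meas U H" by (rule HU)
    show "Ip p U H < \<infinity>" using fin unfolding U_def B_def .
    show "(\<lambda>n. l n ^ k * H (?d n z)) \<longlonglongrightarrow> H z" if z: "z \<in> U" for z
    proof -
      have "(\<lambda>n. (?d n z)) \<longlonglongrightarrow> (fst z, 1 * snd z + (1 - 1) * mid)"
        by (intro tendsto_intros l)
      then have c: "(\<lambda>n. (?d n z)) \<longlonglongrightarrow> z" by simp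
      have "(\<lambda>n. H (?d n z)) \<longlonglongrightarrow> H z"
        by (rule continuous_on_tendsto_compose[OF H c]) (use z US inB in \<open>auto simp: U_def B_def intro!: always_eventually\<close>)
      then have "(\<lambda>n. l n ^ k * H (?d n z)) \<longlonglongrightarrow> 1 ^ k * H z" by (intro tendsto_intros l)
      then show ?thesis by simp
    qed
    show "(\<lambda>n. 1 / l n) \<longlonglongrightarrow> 1" using tendsto_divide[OF tendsto_const[of 1] l(3)] by simp
    fix n
    define f where "f y = indicator B y * Ip p (ball 0 R) (\<lambda>x. H (x, y))" for y
    have fb: "f \<in> borel_measurable borel"
    proof -
      have "f = (\<lambda>y. indicator B y * Ip p (ball 0 R) (\<lambda>x. if (x, y) \<in> U then H (x, y) else 0))"
        unfolding f_def U_def by (auto simp: fun_eq_iff Ip_def intro!: nn_integral_cong split: split_indicator)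
      moreover have "(\<lambda>y. Ip p (ball 0 R) (\<lambda>x. if (x, y) \<in> U then H (x, y) else 0)) \<in> borel_measurable borel"
        by (rule Ip_slice_measurable[OF HU[unfolded on_meas_def]]) simp
      ultimately show ?thesis unfolding B_def by simp
    qed
    have Ul: "Ip p U G = (\<integral>\<^sup>+s. indicator B s * Ip p (ball 0 R) (\<lambda>x. G (x, s)) \<partial>lborel)" if "continuous_on U G" for G
      using Ip_product(1)[of "ball (0::'a) R" B G p] on_meas_continuous[OF oU that] unfolding U_def B_def by simp
    have "Ip p U (\<lambda>z. l n ^ k * H (?d n z)) \<le> Ip p U (\<lambda>z. H (?d n z))"
    proof (rule Ip_le)
      fix z show "\<bar>l n ^ k * H (?d n z)\<bar> \<le> \<bar>H (?d n z)\<bar>"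
        using l(1)[of n] l(2)[of n] mult_left_le_one_le[of "\<bar>H (?d n z)\<bar>" "l n ^ k"]
        by (simp add: abs_mult power_le_one)
    qed (use p in simp)
    also have "\<dots> = (\<integral>\<^sup>+s. indicator B s * Ip p (ball 0 R) (\<lambda>x. H (x, l n * s + (1 - l n) * mid)) \<partial>lborel)"
      using Ul[OF cA] by simp
    also have "\<dots> \<le> (\<integral>\<^sup>+s. f ((1 - l n) * mid + l n *\<^sub>R s) \<partial>lborel)"
      unfolding f_def using inB by (intro nn_integral_mono) (auto simp: B_def add.commute split: split_indicator)
    also have "\<dots> = ennreal (1 / l n) * (ennreal (l n) * (\<integral>\<^sup>+s. f ((1 - l n) * mid + l n *\<^sub>R s) \<partial>lborel))"
      using l(1)[of n] by (simp add: mult.assoc[symmetric] ennreal_mult[symmetric])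
    also have "ennreal (l n) * (\<integral>\<^sup>+s. f ((1 - l n) * mid + l n *\<^sub>R s) \<partial>lborel) = (\<integral>\<^sup>+y. f y \<partial>lborel)"
      using nn_integral_affine_change[of "l n" f "(1 - l n) * mid"] fb l(1)[of n] by simp
    also have "(\<integral>\<^sup>+y. f y \<partial>lborel) = Ip p U H"
      unfolding f_def by (rule Ul[symmetric, OF continuous_on_subset[OF H US]])
    finally show "Ip p U (\<lambda>z. l n ^ k * H (?d n z)) \<le> ennreal (1 / l n) * Ip p U H" .
  qed
  then show ?thesis unfolding U_def B_def mid_def .
qed

text \<open>Contracting the normal variable towards the middle of the slab makes the function smooth on a
  neighbourhood of the closed slab.\<close>

lemma contracted_extension:
  fixes F :: "'a::euclidean_space \<times> real \<Rightarrow> real"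
  assumes F: "smooth_on (slab b0 b1) F" and b: "b0 < b1" and l: "0 < l" "l < 1"
  shows "\<exists>\<phi>. smooth_on UNIV \<phi> \<and> (\<forall>z. snd z \<in> {b0..b1} \<longrightarrow> \<phi> z = F (fst z, l * snd z + (1 - l) * ((b0 + b1) / 2)))"
proof -
  obtain \<kappa> :: "real \<Rightarrow> real" where \<kappa>: "smooth_on UNIV \<kappa>" "\<And>x. x \<le> 0 \<Longrightarrow> \<kappa> x = 0" "\<And>x. 1 \<le> x \<Longrightarrow> \<kappa> x = 1"
    using smooth_step_exists by blast
  define mid where "mid = (b0 + b1) / 2"
  define A where "A = (\<lambda>z::'a \<times> real. (fst z, l * snd z + (1 - l) * mid))"
  define h where "h = (b1 - b0) / 2"
  have h: "h > 0" "b0 = mid - h" "b1 = mid + h" using b by (auto simp: h_def mid_def field_simps)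
  \<comment> \<open>The contracted function lives on a slab of half height h/l > h. Half of the gap
    leaves room for a cutoff outside the closed slab.\<close>
  define e where "e = (h / l - h) / 2"
  have hl: "h < h / l" using h(1) l by (simp add: field_simps)
  have e0: "e > 0" unfolding e_def using hl by simp
  have "h + (q - h) / 2 < q" if "h < q" for q :: real using that by (simp add: field_simps)
  from this[OF hl] have "h + e < h / l" unfolding e_def .
  note e = e0 this
  define V where "V = A -` slab b0 b1"
  have oV: "open V" unfolding V_def A_def by (intro open_vimage open_slab) (auto intro!: continuous_intros)
  have sA: "smooth_on V (\<lambda>z. F (A z))" unfolding V_def A_def by (rule smooth_on_normal_affine[OF open_slab F])
  have inV: "z \<in> V" if "snd z \<in> {b0 - e..b1 + e}" for z
  proof -
    have "\<bar>snd z - mid\<bar> \<le> h + e" using that h by (auto simp: abs_le_iff)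
    then have "\<bar>snd z - mid\<bar> < h / l" using e by linarith
    then have "\<bar>l * (snd z - mid)\<bar> < h" using l by (simp add: abs_mult pos_less_divide_eq mult.commute)
    then show ?thesis unfolding V_def A_def using h by (auto simp: abs_less_iff algebra_simps)
  qed
  define \<theta> where "\<theta> z = \<kappa> ((1 / e) * snd z + (1 - b0 / e)) * \<kappa> ((- 1 / e) * snd z + (1 + b1 / e))" for z :: "'a \<times> real"
  have s\<theta>: "smooth_on UNIV \<theta>" unfolding \<theta>_def by (intro smooth_on_mult smooth_on_compose_snd \<kappa>) auto
  have \<theta>1: "\<theta> z = 1" if "snd z \<in> {b0..b1}" for z
  proof -
    have "1 \<le> (1 / e) * snd z + (1 - b0 / e)" "1 \<le> (- 1 / e) * snd z + (1 + b1 / e)"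
      using that e(1) by (auto simp: field_simps)
    then show ?thesis unfolding \<theta>_def using \<kappa>(3) by simp
  qed
  have \<theta>0: "\<theta> z = 0" if "snd z \<notin> {b0 - e..b1 + e}" for z
  proof -
    have "(1 / e) * snd z + (1 - b0 / e) = (snd z - (b0 - e)) / e" "(- 1 / e) * snd z + (1 + b1 / e) = (b1 + e - snd z) / e"
      using e(1) by (simp_all add: field_simps)
    then have "(1 / e) * snd z + (1 - b0 / e) \<le> 0 \<or> (- 1 / e) * snd z + (1 + b1 / e) \<le> 0"
      using that e(1) by (auto simp: divide_le_0_iff not_le)
    then show ?thesis unfolding \<theta>_def using \<kappa>(2) by auto
  qed
  have "smooth_on UNIV (\<lambda>z. if z \<in> V then F (A z) * \<theta> z else 0)"
  proof (rule smooth_on_zero_extend[OF oV sA s\<theta>])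
    show "closed (UNIV \<times> {b0 - e..b1 + e} :: ('a \<times> real) set)" by (intro closed_Times) auto
    show "UNIV \<times> {b0 - e..b1 + e} \<subseteq> V" using inV by auto
    show "\<theta> z = 0" if "z \<notin> UNIV \<times> {b0 - e..b1 + e}" for z using \<theta>0[of z] that by (cases z) auto
  qed
  moreover have "(if z \<in> V then F (A z) * \<theta> z else 0) = F (fst z, l * snd z + (1 - l) * ((b0 + b1) / 2))" if "snd z \<in> {b0..b1}" for z
    using inV[of z] \<theta>1[OF that] that e(1) unfolding A_def mid_def by auto
  ultimately show ?thesis by (intro exI[of _ "\<lambda>z. if z \<in> V then F (A z) * \<theta> z else 0"]) auto
qed

text \<open>The approximating functions are contractions of \<open>F\<close>. On the face their
  values are interior slices of \<open>F\<close>, which tend to \<open>g\<close> by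
  \<open>lim\<close>; their distance to \<open>F\<close> in W^1,p tends to 0 by
  \<open>dilation_tendsto\<close> for the function and its first derivatives.\<close>

theorem has_trace_smooth:
  fixes F v :: "(real^'n) \<times> real \<Rightarrow> real"
  assumes p: "1 \<le> p" and b: "bm < bp" and bb: "bb \<in> {bm, bp}" and F: "smooth_on (slab bm bp) F"
    and fin: "\<And>R bs. 0 < R \<Longrightarrow> set bs \<subseteq> Basis \<Longrightarrow> length bs \<le> 1 \<Longrightarrow> Ip p (ball 0 R \<times> {bm<..<bp}) (iter_pderiv bs F) < \<infinity>"
    and v: "L1_loc (slab bm bp) v" "AE x in lborel. x \<in> slab bm bp \<longrightarrow> v x = F x"
    and g: "Lp_loc p UNIV g"
    and lim: "\<And>R. ((\<lambda>s. Ip p (ball 0 R) (\<lambda>x. F (x, s) - g x)) \<longlongrightarrow> 0) (at bb within {bm<..<bp})"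
  shows "has_trace p bm bp bb v g"
  unfolding has_trace_def Let_def
proof (intro conjI allI impI g)
  fix R :: real assume R: "0 < R"
  define U where "U = ball (0::real^'n) R \<times> {bm<..<bp}"
  have oU: "open U" and US: "U \<subseteq> slab bm bp" unfolding U_def using open_cyl by auto
  have Us: "U \<in> sets lebesgue" using oU by (intro sets_completionI_sets) auto
  have vU: "L1_loc U v" by (rule L1_loc_subset[OF v(1) US])
  have aeU: "AE x in lborel. x \<in> U \<longrightarrow> v x = F x" using v(2) by eventually_elim (use US in auto)
  have FU: "smooth_on U F" by (rule smooth_on_subset[OF F US])
  show "sobolev 1 p (ball 0 R \<times> {bm<..<bp}) v"
    unfolding sobolev_def U_def[symmetric]
  proof (intro allI impI ballI)
    fix i :: nat and \<alpha> :: "(real^'n) \<times> real \<Rightarrow> nat" assume i: "i \<le> 1" and al: "\<alpha> \<in> multi_indices i"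
    from al obtain bs where bs: "set bs \<subseteq> Basis" "length bs = i" "\<alpha> = mi_of bs" by (rule multi_indices_list)
    have "has_weak_pderiv U \<alpha> v (iter_pderiv bs F)"
      unfolding bs(3) by (rule has_weak_pderiv_cong_AE[OF smooth_on_has_weak_pderiv[OF oU FU bs(1)] bs(1) vU aeU])
    moreover have "Lp p U (iter_pderiv bs F)"
      unfolding Lp_def Ip_lebesgue
      using fin[OF R bs(1)] bs(2) i unfolding U_def[symmetric]
      by (auto intro!: continuous_imp_measurable_on_sets_lebesgue smooth_on_continuous_on_iter[OF FU bs(1)] Us)
    ultimately show "\<exists>w. has_weak_pderiv U \<alpha> v w \<and> Lp p U w" by blast
  qed
  \<comment> \<open>The shift by 2 keeps the factors strictly between 0 and 1 from n = 0 on.\<close>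
  define l where "l n = 1 - 1 / (real n + 2)" for n
  have l: "0 < l n" "l n < 1" for n unfolding l_def by (auto simp: field_simps)
  have "l \<longlonglongrightarrow> 1 - 0" unfolding l_def
  proof (intro tendsto_diff tendsto_const)
    have "(\<lambda>n. 1 / real (n + 2)) \<longlonglongrightarrow> 0" using LIMSEQ_ignore_initial_segment[OF lim_1_over_n, of 2] by simp
    then show "(\<lambda>n. 1 / (real n + 2)) \<longlonglongrightarrow> 0" by (simp add: add.commute)
  qed
  then have l1: "l \<longlonglongrightarrow> 1" by simp
  define mid where "mid = (bm + bp) / 2"
  obtain \<phi> where \<phi>: "\<And>n. smooth_on UNIV (\<phi> n)" "\<And>n z. snd z \<in> {bm..bp} \<Longrightarrow> \<phi> n z = F (fst z, l n * snd z + (1 - l n) * mid)"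
    using contracted_extension[OF F b l] unfolding mid_def by metis
  have inB: "l n * s + (1 - l n) * mid \<in> {bm<..<bp}" if "s \<in> {bm..bp}" for n s
  proof -
    have "mid < bp" "bm < mid" using b unfolding mid_def by auto
    then have "(1 - l n) * mid < (1 - l n) * bp" "(1 - l n) * bm < (1 - l n) * mid" using l(2)[of n] by auto
    moreover have "l n * s \<le> l n * bp" "l n * bm \<le> l n * s" using l(1)[of n] that by auto
    ultimately show ?thesis by (simp add: algebra_simps)
  qed
  show "\<exists>\<phi>. (\<forall>j. smooth (\<phi> j)) \<and>
     (\<lambda>j. W1p_norm_pow p (ball 0 R \<times> {bm<..<bp}) (\<lambda>x. \<phi> j x - v x)) \<longlonglongrightarrow> 0 \<and>
     (\<lambda>j. \<integral>\<^sup>+x'\<in>ball 0 R. ennreal (\<bar>\<phi> j (x', bb) - g x'\<bar> powr p) \<partial>lebesgue) \<longlonglongrightarrow> 0"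
  proof (intro exI[of _ \<phi>] conjI allI)
    show "smooth (\<phi> n)" for n using \<phi>(1) by (simp add: smooth_iff)
    show "(\<lambda>j. W1p_norm_pow p (ball 0 R \<times> {bm<..<bp}) (\<lambda>x. \<phi> j x - v x)) \<longlonglongrightarrow> 0"
      unfolding W1p_norm_pow_def U_def[symmetric] Ip_lebesgue
    proof (intro tendsto_null_sum)
      fix i :: nat and \<alpha> :: "(real^'n) \<times> real \<Rightarrow> nat" assume i: "i \<in> {..1}" and "\<alpha> \<in> multi_indices i"
      then obtain bs where bs: "set bs \<subseteq> Basis" "length bs = i" "\<alpha> = mi_of bs" by (elim multi_indices_list)
      have eq: "Ip p U (weak_pderiv U \<alpha> (\<lambda>x. \<phi> n x - v x)) =
        Ip p U (\<lambda>z. l n ^ nrm bs * iter_pderiv bs F (fst z, l n * snd z + (1 - l n) * mid) - iter_pderiv bs F z)" for n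
      proof (rule Ip_cong_AE)
        have \<phi>U: "smooth_on U (\<phi> n)" by (rule smooth_on_subset[OF \<phi>(1)]) simp
        have dU: "smooth_on U (\<lambda>x. \<phi> n x - F x)" by (intro smooth_on_diff oU \<phi>U FU)
        have "has_weak_pderiv U \<alpha> (\<lambda>x. \<phi> n x - v x) (iter_pderiv bs (\<lambda>x. \<phi> n x - F x))"
          unfolding bs(3)
        proof (rule has_weak_pderiv_cong_AE[OF smooth_on_has_weak_pderiv[OF oU dU bs(1)] bs(1)])
          show "L1_loc U (\<lambda>x. \<phi> n x - v x)"
            by (intro L1_loc_diff vU L1_loc_continuous_on smooth_on_continuous_on \<phi>U)
          show "AE x in lborel. x \<in> U \<longrightarrow> \<phi> n x - v x = \<phi> n x - F x" using aeU by eventually_elim simp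
        qed
        from weak_pderiv_AE[OF oU this]
        show "AE x in lborel. x \<in> U \<longrightarrow> weak_pderiv U \<alpha> (\<lambda>x. \<phi> n x - v x) x =
           l n ^ nrm bs * iter_pderiv bs F (fst x, l n * snd x + (1 - l n) * mid) - iter_pderiv bs F x"
        proof eventually_elim
          fix x assume h: "x \<in> U \<longrightarrow> weak_pderiv U \<alpha> (\<lambda>x. \<phi> n x - v x) x = iter_pderiv bs (\<lambda>x. \<phi> n x - F x) x"
          show "x \<in> U \<longrightarrow> weak_pderiv U \<alpha> (\<lambda>x. \<phi> n x - v x) x =
             l n ^ nrm bs * iter_pderiv bs F (fst x, l n * snd x + (1 - l n) * mid) - iter_pderiv bs F x"
          proof
            assume x: "x \<in> U"
            then have sx: "snd x \<in> {bm..bp}" unfolding U_def by auto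
            have "iter_pderiv bs (\<lambda>x. \<phi> n x - F x) x = iter_pderiv bs (\<lambda>x. 1 * \<phi> n x + (- 1) * F x) x" by simp
            also have "\<dots> = iter_pderiv bs (\<phi> n) x - iter_pderiv bs F x"
              by (subst iter_pderiv_lincomb[OF oU \<phi>U FU bs(1) x]) simp
            also have "iter_pderiv bs (\<phi> n) x = iter_pderiv bs (\<lambda>z. F (fst z, l n * snd z + (1 - l n) * mid)) x"
              by (rule iter_pderiv_cong[OF oU _ x]) (use \<phi>(2) in \<open>auto simp: U_def\<close>)
            also have "\<dots> = l n ^ nrm bs * iter_pderiv bs F (fst x, l n * snd x + (1 - l n) * mid)"
              by (rule iter_pderiv_reflect[OF open_slab F bs(1)]) (use inB[OF sx] in auto)
            finally show "weak_pderiv U \<alpha> (\<lambda>x. \<phi> n x - v x) x =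
               l n ^ nrm bs * iter_pderiv bs F (fst x, l n * snd x + (1 - l n) * mid) - iter_pderiv bs F x" using h x by simp
          qed
        qed
      qed
      show "(\<lambda>j. Ip p U (weak_pderiv U \<alpha> (\<lambda>x. \<phi> j x - v x))) \<longlonglongrightarrow> 0"
        unfolding eq unfolding U_def mid_def
        by (rule dilation_tendsto[OF p smooth_on_continuous_on_iter[OF F bs(1)] b fin[OF R bs(1)] l l1]) (use bs(2) i in auto)
    qed
    have bbB: "bb \<in> {bm..bp}" using bb b by auto
    have "(\<lambda>n. Ip p (ball 0 R) (\<lambda>x. F (x, l n * bb + (1 - l n) * mid) - g x)) \<longlonglongrightarrow> 0"
    proof (rule filterlim_compose[OF lim])
      have ne: "l n * bb + (1 - l n) * mid \<noteq> bb" for n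
        using inB[OF bbB, of n] bb by (metis empty_iff greaterThanLessThan_iff insert_iff less_irrefl)
      have "(\<lambda>n. l n * bb + (1 - l n) * mid) \<longlonglongrightarrow> 1 * bb + (1 - 1) * mid" by (intro tendsto_intros l1)
      then show "filterlim (\<lambda>n. l n * bb + (1 - l n) * mid) (at bb within {bm<..<bp}) sequentially"
        unfolding filterlim_at using inB[OF bbB] ne by simp
    qed
    then show "(\<lambda>j. \<integral>\<^sup>+x'\<in>ball 0 R. ennreal (\<bar>\<phi> j (x', bb) - g x'\<bar> powr p) \<partial>lebesgue) \<longlonglongrightarrow> 0"
      unfolding Ip_lebesgue using \<phi>(2)[of "(_, bb)"] bbB by simp
  qed
qed

section \<open>Extensions from the two faces\<close>

text \<open>\<sigma> is the direction of the inward normal, so that \<sigma> (x_N - b) is the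
  distance to the face.\<close>

definition face :: "real \<Rightarrow> real \<Rightarrow> real \<Rightarrow> real \<Rightarrow> bool" where
  "face \<sigma> b b0 b1 \<longleftrightarrow> \<sigma> = 1 \<and> b = b0 \<or> \<sigma> = - 1 \<and> b = b1"

text \<open>Derivatives of order k along the inward normal differ from those along x_N by
  \<sigma>^k.\<close>

definition sdata :: "real \<Rightarrow> 'a jets \<Rightarrow> 'a jets" where
  "sdata \<sigma> G k \<alpha> x = \<sigma> ^ k * G k \<alpha> x"

definition vf :: "real \<Rightarrow> real \<Rightarrow> ('a::euclidean_space \<Rightarrow> real) \<Rightarrow> nat \<Rightarrow> 'a jets \<Rightarrow> 'a \<times> real \<Rightarrow> real" where
  "vf \<sigma> b \<eta> m G z = ext \<eta> m (sdata \<sigma> G) (fst z, \<sigma> * snd z + (- \<sigma> * b))"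

definition Esum :: "real \<Rightarrow> real \<Rightarrow> nat \<Rightarrow> ('a::euclidean_space) jets \<Rightarrow> ennreal" where
  "Esum a p m G = (\<Sum>k<m. \<Sum>\<alpha>\<in>multi_indices (m - 1 - k). gag a p (G k \<alpha>))"

lemma face_sign: "face \<sigma> b b0 b1 \<Longrightarrow> \<bar>\<sigma>\<bar> = 1" "face \<sigma> b b0 b1 \<Longrightarrow> \<sigma> * \<sigma> = 1" "face \<sigma> b b0 b1 \<Longrightarrow> \<sigma> \<noteq> 0"
  unfolding face_def by auto

lemma sign_power: "\<bar>\<sigma>\<bar> = 1 \<Longrightarrow> \<bar>\<sigma> ^ k\<bar> = (1::real)"
  by (simp add: power_abs)

lemma sign_power_mult: "\<bar>\<sigma>\<bar> = 1 \<Longrightarrow> \<sigma> ^ k * \<sigma> ^ k = (1::real)"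
  by (metis abs_mult_self_eq mult_1 sign_power)

lemma Lploc_cmult: "Lploc p f \<Longrightarrow> Lploc p (\<lambda>x. c * f x)"
  unfolding Lploc_def by (auto simp: Ip_cmult ennreal_mult_less_top)

lemma wrel_cmult: "wrel j g g' \<Longrightarrow> wrel j (\<lambda>x. c * g x) (\<lambda>x. c * g' x)"
  unfolding wrel_def by (simp add: mult.left_commute[of _ c])

lemma admd_sdata: "admd p m G \<Longrightarrow> admd p m (sdata \<sigma> G)"
  unfolding admd_def adm_def sdata_def[abs_def] by (auto intro: Lploc_cmult wrel_cmult)

lemma Esum_sdata:
  assumes "\<bar>\<sigma>\<bar> = 1" shows "Esum a p m (sdata \<sigma> G) = Esum a p m G"
proof -
  have "\<bar>\<sigma> ^ k * u - \<sigma> ^ k * v\<bar> = \<bar>u - v\<bar>" for k and u v :: real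
    using sign_power[OF assms, of k] by (metis abs_mult mult_1 right_diff_distrib)
  then show ?thesis unfolding Esum_def gag_def sdata_def by simp
qed

lemma face_image:
  assumes "face \<sigma> b b0 b1" "s \<in> {b0<..<b1}" shows "\<sigma> * s + (- \<sigma> * b) \<in> {0<..<b1 - b0}"
  using assms unfolding face_def by auto

context
  fixes \<eta> :: "'a::euclidean_space \<Rightarrow> real" and p r :: real and m :: nat
  assumes p: "1 \<le> p" and mk: "mkernel r (m - 1) \<eta>"
begin

lemma vf_smooth:
  assumes G: "admd p m G" and f: "face \<sigma> b b0 b1"
  shows "smooth_on (slab b0 b1) (vf \<sigma> b \<eta> m G)"
proof -
  have "smooth_on ((\<lambda>z. (fst z, \<sigma> * snd z + (- \<sigma> * b))) -` upper) (vf \<sigma> b \<eta> m G)"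
    unfolding vf_def by (rule smooth_on_normal_affine[OF open_upper ext_smooth[OF p mk admd_sdata[OF G]]])
  then show ?thesis by (rule smooth_on_subset) (use face_image[OF f] in auto)
qed

lemma vf_iter:
  assumes G: "admd p m G" and f: "face \<sigma> b b0 b1" and bs: "set bs \<subseteq> Basis" and s: "s \<in> {b0<..<b1}"
  shows "iter_pderiv bs (vf \<sigma> b \<eta> m G) (x, s) = \<sigma> ^ nrm bs * iter_pderiv bs (ext \<eta> m (sdata \<sigma> G)) (x, \<sigma> * s + (- \<sigma> * b))"
  using iter_pderiv_reflect[OF open_upper ext_smooth[OF p mk admd_sdata[OF G]] bs, of "(x, s)" \<sigma> "- \<sigma> * b"] face_image[OF f s]
  unfolding vf_def[abs_def] by simp

lemma vf_slice:
  assumes G: "admd p m G" and f: "face \<sigma> b b0 b1" and bs: "set bs \<subseteq> Basis" and s: "s \<in> {b0<..<b1}"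
  shows "Ip p A (\<lambda>x. iter_pderiv bs (vf \<sigma> b \<eta> m G) (x, s)) = Ip p A (\<lambda>x. iter_pderiv bs (ext \<eta> m (sdata \<sigma> G)) (x, \<sigma> * s + (- \<sigma> * b)))"
  unfolding Ip_def vf_iter[OF G f bs s] by (simp add: abs_mult sign_power[OF face_sign(1)[OF f]])

lemma vf_cyl:
  assumes G: "admd p m G" and f: "face \<sigma> b b0 b1" and bs: "set bs \<subseteq> Basis" and A: "open A"
  shows "Ip p (A \<times> {b0<..<b1}) (iter_pderiv bs (vf \<sigma> b \<eta> m G)) =
    (\<integral>\<^sup>+s. indicator {b0<..<b1} s * Ip p A (\<lambda>x. iter_pderiv bs (ext \<eta> m (sdata \<sigma> G)) (x, \<sigma> * s + (- \<sigma> * b))) \<partial>lborel)"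
proof -
  have "open (A \<times> {b0<..<b1})" using A by (intro open_Times) auto
  then have "on_meas (A \<times> {b0<..<b1}) (iter_pderiv bs (vf \<sigma> b \<eta> m G))"
    by (rule on_meas_continuous) (auto intro: continuous_on_subset[OF smooth_on_continuous_on_iter[OF vf_smooth[OF G f] bs]])
  then have "Ip p (A \<times> {b0<..<b1}) (iter_pderiv bs (vf \<sigma> b \<eta> m G)) = (\<integral>\<^sup>+s. indicator {b0<..<b1} s * Ip p A (\<lambda>x. iter_pderiv bs (vf \<sigma> b \<eta> m G) (x, s)) \<partial>lborel)"
    using A by (intro Ip_product(1)) auto
  also have "\<dots> = (\<integral>\<^sup>+s. indicator {b0<..<b1} s * Ip p A (\<lambda>x. iter_pderiv bs (ext \<eta> m (sdata \<sigma> G)) (x, \<sigma> * s + (- \<sigma> * b))) \<partial>lborel)"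
    using vf_slice[OF G f bs] by (intro nn_integral_cong) (auto split: split_indicator)
  finally show ?thesis .
qed

definition En :: "real \<Rightarrow> ('a \<times> real) list \<Rightarrow> 'a jets \<Rightarrow> ennreal" where
  "En D bs G = layer p {0<..<D} (\<lambda>t x. iter_pderiv bs (ext \<eta> m G) (x, t))"

text \<open>The substitution t = \<sigma> (s - b) maps the slab into the layer 0 < t < D.\<close>

lemma vf_energy:
  assumes G: "admd p m G" and f: "face \<sigma> b b0 b1" and bs: "set bs \<subseteq> Basis" and D: "b1 - b0 \<le> D"
  shows "Ip p (slab b0 b1) (iter_pderiv bs (vf \<sigma> b \<eta> m G)) \<le> En D bs (sdata \<sigma> G)"
proof -
  define H where "H = iter_pderiv bs (ext \<eta> m (sdata \<sigma> G))"
  define h where "h t = indicator {0<..<D} t * Ip p UNIV (\<lambda>x. H (x, t))" for t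
  have cH: "continuous_on upper H" unfolding H_def by (rule smooth_on_continuous_on_iter[OF ext_smooth[OF p mk admd_sdata[OF G]] bs])
  have "h \<in> borel_measurable borel"
  proof -
    have "(\<lambda>t. Ip p UNIV (\<lambda>x. if (x, t) \<in> upper then H (x, t) else 0)) \<in> borel_measurable borel"
      by (rule Ip_slice_measurable[OF on_meas_continuous[OF open_upper cH, unfolded on_meas_def]]) simp
    moreover have "h = (\<lambda>t. indicator {0<..<D} t * Ip p UNIV (\<lambda>x. if (x, t) \<in> upper then H (x, t) else 0))"
      unfolding h_def by (auto simp: fun_eq_iff split: split_indicator)
    ultimately show ?thesis by simp
  qed
  then have sub: "(\<integral>\<^sup>+t. h t \<partial>lborel) = (\<integral>\<^sup>+s. h (- \<sigma> * b + \<sigma> *\<^sub>R s) \<partial>lborel)"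
    using nn_integral_affine_change[of \<sigma> h "- \<sigma> * b"] face_sign[OF f] by simp
  have "Ip p (slab b0 b1) (iter_pderiv bs (vf \<sigma> b \<eta> m G)) = (\<integral>\<^sup>+s. indicator {b0<..<b1} s * Ip p UNIV (\<lambda>x. H (x, \<sigma> * s + (- \<sigma> * b))) \<partial>lborel)"
    unfolding H_def by (rule vf_cyl[OF G f bs]) simp
  also have "\<dots> \<le> (\<integral>\<^sup>+s. h (- \<sigma> * b + \<sigma> *\<^sub>R s) \<partial>lborel)"
  proof (rule nn_integral_mono)
    fix s :: real
    show "indicator {b0<..<b1} s * Ip p UNIV (\<lambda>x. H (x, \<sigma> * s + (- \<sigma> * b))) \<le> h (- \<sigma> * b + \<sigma> *\<^sub>R s)"
      unfolding h_def using face_image[OF f, of s] D by (cases "s \<in> {b0<..<b1}") (auto simp: add.commute)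
  qed
  also have "\<dots> = (\<integral>\<^sup>+t. h t \<partial>lborel)" by (rule sub[symmetric])
  also have "\<dots> = En D bs (sdata \<sigma> G)" unfolding h_def En_def H_def ..
  finally show ?thesis .
qed

text \<open>Signs leave the Gagliardo terms unchanged, so one constant serves both faces.\<close>

lemma En_bound:
  assumes bs: "set bs \<subseteq> Basis" "length bs = m" and a: "r * D \<le> a"
  shows "\<exists>C\<ge>0. \<forall>G \<sigma>. admd p m G \<longrightarrow> \<bar>\<sigma>\<bar> = 1 \<longrightarrow> En D bs (sdata \<sigma> G) \<le> ennreal C * Esum a p m G"
proof -
  obtain C where C: "C \<ge> 0" "\<And>G. admd p m G \<Longrightarrow> En D bs G \<le> ennreal C * Esum a p m G"
    using ext_energy[OF p mk bs a] unfolding En_def Esum_def by blast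
  have "En D bs (sdata \<sigma> G) \<le> ennreal C * Esum a p m G" if "admd p m G" "\<bar>\<sigma>\<bar> = 1" for G \<sigma>
    using C(2)[OF admd_sdata[OF that(1), of \<sigma>]] unfolding Esum_sdata[OF that(2)] .
  then show ?thesis using C(1) by blast
qed

text \<open>Order m is covered by the energy over the whole slab, lower orders by the bounds on
  slices over a ball.\<close>

lemma vf_finite:
  assumes G: "admd p m G" and f: "face \<sigma> b b0 b1" and bs: "set bs \<subseteq> Basis" "length bs \<le> m"
    and a: "r * (b1 - b0) \<le> a" and E: "Esum a p m G < \<infinity>"
  shows "Ip p (ball 0 R \<times> {b0<..<b1}) (iter_pderiv bs (vf \<sigma> b \<eta> m G)) < \<infinity>"
proof (cases "length bs = m")
  case True
  obtain C where C: "En (b1 - b0) bs (sdata \<sigma> G) \<le> ennreal C * Esum a p m G"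
    using En_bound[OF bs(1) True a] G face_sign(1)[OF f] by blast
  have "Ip p (ball 0 R \<times> {b0<..<b1}) (iter_pderiv bs (vf \<sigma> b \<eta> m G)) \<le> Ip p (slab b0 b1) (iter_pderiv bs (vf \<sigma> b \<eta> m G))"
    by (rule Ip_mono) auto
  also have "\<dots> \<le> ennreal C * Esum a p m G" using vf_energy[OF G f bs(1) order_refl] C by (rule order_trans)
  also have "\<dots> < \<infinity>" using E by (simp add: ennreal_mult_less_top)
  finally show ?thesis .
next
  case False
  then have l: "length bs < m" using bs by simp
  obtain K where K: "K < \<infinity>" "\<And>t. 0 < t \<Longrightarrow> t < b1 - b0 \<Longrightarrow> Ip p (ball 0 R) (\<lambda>x. iter_pderiv bs (ext \<eta> m (sdata \<sigma> G)) (x, t)) \<le> K"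
    using ext_bounded[OF p mk bs(1) l admd_sdata[OF G]] by blast
  have "Ip p (ball 0 R \<times> {b0<..<b1}) (iter_pderiv bs (vf \<sigma> b \<eta> m G)) \<le> (\<integral>\<^sup>+s. K * indicator {b0<..<b1} s \<partial>lborel)"
    unfolding vf_cyl[OF G f bs(1) open_ball]
  proof (rule nn_integral_mono)
    fix s :: real
    show "indicator {b0<..<b1} s * Ip p (ball 0 R) (\<lambda>x. iter_pderiv bs (ext \<eta> m (sdata \<sigma> G)) (x, \<sigma> * s + (- \<sigma> * b))) \<le> K * indicator {b0<..<b1} s"
      using K(2)[of "\<sigma> * s + (- \<sigma> * b)"] face_image[OF f, of s] by (auto split: split_indicator)
  qed
  also have "\<dots> < \<infinity>" using K(1) by (cases "b0 < b1") (auto simp: nn_integral_cmult ennreal_mult_less_top)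
  finally show ?thesis .
qed

lemma vf_face_limit:
  assumes G: "admd p m G" and f: "face \<sigma> b b0 b1" and bs: "set bs \<subseteq> Basis" "length bs < m" and b01: "b0 < b1"
  shows "((\<lambda>s. Ip p (ball 0 R) (\<lambda>x. iter_pderiv bs (vf \<sigma> b \<eta> m G) (x, s) - G (nrm bs) (mi_of (tang bs)) x)) \<longlongrightarrow> 0) (at b within {b0<..<b1})"
proof -
  have fl: "filterlim (\<lambda>s. \<sigma> * s + (- \<sigma> * b)) (at_right 0) (at b within {b0<..<b1})"
    unfolding filterlim_at
  proof (intro conjI)
    show "\<forall>\<^sub>F s in at b within {b0<..<b1}. \<sigma> * s + (- \<sigma> * b) \<in> {0<..} \<and> \<sigma> * s + (- \<sigma> * b) \<noteq> 0"
      unfolding eventually_at_filter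
    proof (intro always_eventually allI impI)
      fix s assume "s \<in> {b0<..<b1}"
      then show "\<sigma> * s + (- \<sigma> * b) \<in> {0<..} \<and> \<sigma> * s + (- \<sigma> * b) \<noteq> 0" using face_image[OF f, of s] by auto
    qed
    have "((\<lambda>s. \<sigma> * s + (- \<sigma> * b)) \<longlongrightarrow> \<sigma> * b + (- \<sigma> * b)) (at b within {b0<..<b1})" by (intro tendsto_intros)
    then show "((\<lambda>s. \<sigma> * s + (- \<sigma> * b)) \<longlongrightarrow> 0) (at b within {b0<..<b1})" by simp
  qed
  have "((\<lambda>s. Ip p (ball 0 R) (\<lambda>x. iter_pderiv bs (ext \<eta> m (sdata \<sigma> G)) (x, \<sigma> * s + (- \<sigma> * b)) - sdata \<sigma> G (nrm bs) (mi_of (tang bs)) x)) \<longlongrightarrow> 0) (at b within {b0<..<b1})"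
    by (rule filterlim_compose[OF ext_tendsto[OF p mk bs admd_sdata[OF G]] fl])
  then show ?thesis
  proof (rule Lim_transform_eventually)
    have eq: "Ip p (ball 0 R) (\<lambda>x. iter_pderiv bs (ext \<eta> m (sdata \<sigma> G)) (x, \<sigma> * s + (- \<sigma> * b)) - sdata \<sigma> G (nrm bs) (mi_of (tang bs)) x) =
       Ip p (ball 0 R) (\<lambda>x. iter_pderiv bs (vf \<sigma> b \<eta> m G) (x, s) - G (nrm bs) (mi_of (tang bs)) x)" if s: "s \<in> {b0<..<b1}" for s
    proof -
      have "\<bar>u - \<sigma> ^ k * v\<bar> = \<bar>\<sigma> ^ k * u - v\<bar>" for u v :: real and k
      proof -
        have "\<bar>\<sigma> ^ k * (\<sigma> ^ k * u - v)\<bar> = \<bar>\<sigma> ^ k * u - v\<bar>" by (simp add: abs_mult sign_power[OF face_sign(1)[OF f]])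
        moreover have "\<sigma> ^ k * (\<sigma> ^ k * u - v) = u - \<sigma> ^ k * v"
          using sign_power_mult[OF face_sign(1)[OF f], of k] by (simp add: right_diff_distrib mult.assoc[symmetric])
        ultimately show ?thesis by simp
      qed
      then show ?thesis unfolding Ip_def vf_iter[OF G f bs(1) s] sdata_def by simp
    qed
    show "\<forall>\<^sub>F s in at b within {b0<..<b1}. Ip p (ball 0 R) (\<lambda>x. iter_pderiv bs (ext \<eta> m (sdata \<sigma> G)) (x, \<sigma> * s + (- \<sigma> * b)) - sdata \<sigma> G (nrm bs) (mi_of (tang bs)) x) =
       Ip p (ball 0 R) (\<lambda>x. iter_pderiv bs (vf \<sigma> b \<eta> m G) (x, s) - G (nrm bs) (mi_of (tang bs)) x)"
      unfolding eventually_at_filter using eq by (intro always_eventually) auto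
  qed
qed

text \<open>The midplane has distance (b1 - b0)/2 from either face, which is the \<tau> of
  \<open>ext_taylor\<close>; the signs from the reflection and from \<open>sdata\<close> combine to
  \<sigma>^k.\<close>

lemma vf_mid:
  assumes G: "admd p m G" and f: "face \<sigma> b b0 b1" and bs: "set bs \<subseteq> Basis" and l: "length bs + i = m" "0 < i"
    and b01: "b0 < b1" "b1 - b0 \<le> D"
  shows "Ip p UNIV (\<lambda>x. iter_pderiv bs (vf \<sigma> b \<eta> m G) (x, (b0 + b1) / 2) - (\<Sum>k<i. ((b1 - b0) / 2) ^ k / fact k * (\<sigma> ^ k * G (nrm bs + k) (mi_of (tang bs)) x)))
    \<le> ennreal (2 powr (p * real i) * ((b1 - b0) / 2) powr (real i * p - 1)) * En D (replicate i eN @ bs) (sdata \<sigma> G)"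
proof -
  define \<tau> where "\<tau> = (b1 - b0) / 2"
  have \<tau>: "0 < \<tau>" "\<tau> < D" using b01 by (auto simp: \<tau>_def)
  have s: "(b0 + b1) / 2 \<in> {b0<..<b1}" using b01 by auto
  have ms: "\<sigma> * ((b0 + b1) / 2) + (- \<sigma> * b) = \<tau>" using f unfolding face_def \<tau>_def by (auto simp: field_simps)
  have pw: "\<sigma> ^ nrm bs * \<sigma> ^ (nrm bs + k) = \<sigma> ^ k" for k
    using sign_power_mult[OF face_sign(1)[OF f], of "nrm bs"] by (simp add: power_add mult.assoc[symmetric])
  have eq: "iter_pderiv bs (vf \<sigma> b \<eta> m G) (x, (b0 + b1) / 2) - (\<Sum>k<i. \<tau> ^ k / fact k * (\<sigma> ^ k * G (nrm bs + k) (mi_of (tang bs)) x))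
     = \<sigma> ^ nrm bs * (iter_pderiv bs (ext \<eta> m (sdata \<sigma> G)) (x, \<tau>) - (\<Sum>k<i. \<tau> ^ k / fact k * sdata \<sigma> G (nrm bs + k) (mi_of (tang bs)) x))" for x
  proof -
    have "\<sigma> ^ nrm bs * (\<Sum>k<i. \<tau> ^ k / fact k * sdata \<sigma> G (nrm bs + k) (mi_of (tang bs)) x) = (\<Sum>k<i. \<tau> ^ k / fact k * ((\<sigma> ^ nrm bs * \<sigma> ^ (nrm bs + k)) * G (nrm bs + k) (mi_of (tang bs)) x))"
      unfolding sdata_def sum_distrib_left by (simp only: mult_ac times_divide_eq_right)
    then show ?thesis unfolding vf_iter[OF G f bs s] ms pw by (simp add: right_diff_distrib)
  qed
  have "Ip p UNIV (\<lambda>x. iter_pderiv bs (vf \<sigma> b \<eta> m G) (x, (b0 + b1) / 2) - (\<Sum>k<i. \<tau> ^ k / fact k * (\<sigma> ^ k * G (nrm bs + k) (mi_of (tang bs)) x)))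
    = Ip p UNIV (\<lambda>x. iter_pderiv bs (ext \<eta> m (sdata \<sigma> G)) (x, \<tau>) - (\<Sum>k<i. \<tau> ^ k / fact k * sdata \<sigma> G (nrm bs + k) (mi_of (tang bs)) x))"
    unfolding Ip_def eq by (simp add: abs_mult sign_power[OF face_sign(1)[OF f]])
  also have "\<dots> \<le> ennreal (2 powr (p * real i) * \<tau> powr (real i * p - 1)) * En D (replicate i eN @ bs) (sdata \<sigma> G)"
    unfolding En_def by (rule ext_taylor[OF p mk bs admd_sdata[OF G] l \<tau>])
  finally show ?thesis unfolding \<tau>_def .
qed

text \<open>One component of Q, for n = \<open>nrm bs\<close> and i the tangential order of
  \<open>bs\<close>: the Taylor polynomial from the upper face minus the one from the lower face, at
  the midplane. The signs agree, since (-1)^k (f^+ + (-1)^(k+1) f^-) = (-1)^k f^+ - f^-.\<close>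

definition Qdiff :: "real \<Rightarrow> real \<Rightarrow> 'a jets \<Rightarrow> 'a jets \<Rightarrow> ('a \<times> real) list \<Rightarrow> 'a \<Rightarrow> real" where
  "Qdiff b0 b1 Gm Gp bs x = (\<Sum>k<m - length bs. ((b1 - b0) / 2) ^ k / fact k * ((- 1) ^ k * Gp (nrm bs + k) (mi_of (tang bs)) x - Gm (nrm bs + k) (mi_of (tang bs)) x))"

definition wdiff :: "real \<Rightarrow> real \<Rightarrow> 'a jets \<Rightarrow> 'a jets \<Rightarrow> 'a \<times> real \<Rightarrow> real" where
  "wdiff b0 b1 Gm Gp z = vf (- 1) b1 \<eta> m Gp z - vf 1 b0 \<eta> m Gm z"

lemma wdiff_smooth:
  assumes "admd p m Gm" "admd p m Gp" shows "smooth_on (slab b0 b1) (wdiff b0 b1 Gm Gp)"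
  unfolding wdiff_def[abs_def] using assms
  by (intro smooth_on_diff open_slab vf_smooth) (auto simp: face_def)

lemma wdiff_iter:
  assumes "admd p m Gm" "admd p m Gp" "set bs \<subseteq> Basis" "z \<in> slab b0 b1"
  shows "iter_pderiv bs (wdiff b0 b1 Gm Gp) z = iter_pderiv bs (vf (- 1) b1 \<eta> m Gp) z - iter_pderiv bs (vf 1 b0 \<eta> m Gm) z"
  using iter_pderiv_lincomb[OF open_slab vf_smooth[OF assms(2), of "- 1" b1 b0 b1] vf_smooth[OF assms(1), of 1 b0 b0 b1] assms(3,4), of 1 "- 1"]
  unfolding wdiff_def[abs_def] by (simp add: face_def)

text \<open>\<open>T\<close> stands for the right-hand side of the theorem up to constants. The
  analysis below uses the data only through these bounds; the sums over orders and multi-indices are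
  dealt with separately.\<close>

definition dominated :: "real \<Rightarrow> real \<Rightarrow> real \<Rightarrow> 'a jets \<Rightarrow> 'a jets \<Rightarrow> ennreal \<Rightarrow> bool" where
  "dominated a b0 b1 Gm Gp T \<longleftrightarrow> admd p m Gm \<and> admd p m Gp \<and>
     (\<forall>bs. set bs \<subseteq> Basis \<longrightarrow> length bs < m \<longrightarrow>
        ennreal ((b1 - b0) powr ((real (length bs) - real m) * p + 1)) * Ip p UNIV (Qdiff b0 b1 Gm Gp bs) \<le> T) \<and>
     Esum a p m Gm + Esum a p m Gp \<le> T"

text \<open>The power \<open>(b1 - b0) powr (real j * p)\<close> is what j derivatives of the cutoff
  will cost. It is gained by j Poincare steps from the midplane, where \<open>vf_mid\<close> for
  both faces reduces the difference to \<open>Qdiff\<close> and two Taylor errors.\<close>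

lemma wdiff_estimate:
  assumes cs: "set cs \<subseteq> Basis" "j + length cs = m" and a: "r * D \<le> a"
  shows "\<exists>C\<ge>0. \<forall>b0 b1 Gm Gp T. b0 < b1 \<longrightarrow> b1 - b0 \<le> D \<longrightarrow> dominated a b0 b1 Gm Gp T \<longrightarrow>
    Ip p (slab b0 b1) (iter_pderiv cs (wdiff b0 b1 Gm Gp)) \<le> ennreal ((b1 - b0) powr (real j * p)) * (ennreal C * T)"
proof -
  \<comment> \<open>The derivative reached after j normal steps; it has order m, where the Gagliardo
    integrals are in control.\<close>
  define ns where "ns = replicate j eN @ cs"
  have ns: "set ns \<subseteq> Basis" "length ns = m" using cs Basis_prod_nor unfolding ns_def by auto
  obtain C1 where C1: "C1 \<ge> 0" "\<And>G \<sigma>. admd p m G \<Longrightarrow> \<bar>\<sigma>\<bar> = 1 \<Longrightarrow> En D ns (sdata \<sigma> G) \<le> ennreal C1 * Esum a p m G"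
    using En_bound[OF ns a] by blast
  \<comment> \<open>Constant for one midplane value: the outer 2^p splits off \<open>Qdiff\<close>,
    the inner one separates the two Taylor errors, and 2^(pj) C1 bounds these.\<close>
  define C2 where "C2 = 2 powr p * (1 + 2 powr p * (2 powr (p * real j) * C1))"
  define C where "C = 2 powr (p * real j) * (2 powr p * C1 + real j * C2)"
  have C2: "C2 \<ge> 0" using C1 unfolding C2_def by auto
  show ?thesis
  proof (intro exI[of _ C] conjI allI impI)
    show "C \<ge> 0" using C1 C2 unfolding C_def by auto
    fix b0 b1 Gm Gp T assume b: "b0 < b1" "b1 - b0 \<le> D" and dom: "dominated a b0 b1 Gm Gp T"
    define \<delta> where "\<delta> = b1 - b0"
    have \<delta>: "\<delta> > 0" "\<delta> \<le> D" using b by (auto simp: \<delta>_def)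
    have Gm: "admd p m Gm" and Gp: "admd p m Gp" and E: "Esum a p m Gm + Esum a p m Gp \<le> T"
      and QQ: "\<And>bs. set bs \<subseteq> Basis \<Longrightarrow> length bs < m \<Longrightarrow> ennreal (\<delta> powr ((real (length bs) - real m) * p + 1)) * Ip p UNIV (Qdiff b0 b1 Gm Gp bs) \<le> T"
      using dom unfolding dominated_def \<delta>_def by auto
    let ?S = "slab b0 b1 :: ('a \<times> real) set" and ?c = "(b0 + b1) / 2" and ?e = "ennreal (\<delta> powr (real j * p))" and ?K = "ennreal (2 powr p)"
    let ?q = "\<lambda>i. ennreal (\<delta> powr (real i * p + 1))" and ?Q = "\<lambda>bs. Ip p UNIV (Qdiff b0 b1 Gm Gp bs)"
    let ?vp = "vf (- 1) b1 \<eta> m Gp" and ?vm = "vf 1 b0 \<eta> m Gm"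
    define w where "w = wdiff b0 b1 Gm Gp"
    have sw: "smooth_on ?S w" unfolding w_def by (rule wdiff_smooth[OF Gm Gp])
    have f: "face (- 1) b1 b0 b1" "face 1 b0 b0 b1" by (auto simp: face_def)
    have EE: "En D ns (sdata (- 1) Gp) + En D ns (sdata 1 Gm) \<le> ennreal C1 * T"
    proof -
      have "En D ns (sdata (- 1) Gp) + En D ns (sdata 1 Gm) \<le> ennreal C1 * Esum a p m Gp + ennreal C1 * Esum a p m Gm"
        by (intro add_mono C1 Gp Gm) auto
      also have "\<dots> \<le> ennreal C1 * T" using E by (simp add: distrib_left[symmetric] add.commute mult_left_mono)
      finally show ?thesis .
    qed
    have sv: "smooth_on ?S ?vp" "smooth_on ?S ?vm"
      by (rule vf_smooth[OF Gp f(1)], rule vf_smooth[OF Gm f(2)])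
    have om: "on_meas ?S (iter_pderiv ds F)" if "smooth_on ?S F" "set ds \<subseteq> Basis" for ds F
      by (rule on_meas_continuous[OF open_slab smooth_on_continuous_on_iter[OF that]])
    have bS: "?S \<in> sets (borel :: ('a \<times> real) measure)" by (rule borel_open[OF open_slab])
    have top: "Ip p ?S (iter_pderiv ns w) \<le> ennreal (2 powr p * C1) * T"
    proof -
      have "Ip p ?S (iter_pderiv ns w) = Ip p ?S (\<lambda>z. iter_pderiv ns ?vp z + (- 1) * iter_pderiv ns ?vm z)"
        unfolding w_def by (rule Ip_cong) (simp add: wdiff_iter[OF Gm Gp ns(1)])
      also have "\<dots> \<le> ?K * (Ip p ?S (iter_pderiv ns ?vp) + Ip p ?S (\<lambda>z. (- 1) * iter_pderiv ns ?vm z))"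
        using p by (intro Ip_add_on bS om sv ns on_meas_continuous[OF open_slab] continuous_intros smooth_on_continuous_on_iter) auto
      also have "Ip p ?S (\<lambda>z. (- 1) * iter_pderiv ns ?vm z) = Ip p ?S (iter_pderiv ns ?vm)"
        unfolding Ip_def by simp
      also have "?K * (Ip p ?S (iter_pderiv ns ?vp) + Ip p ?S (iter_pderiv ns ?vm))
        \<le> ?K * (ennreal C1 * T)"
        by (intro mult_left_mono order_trans[OF add_mono EE] vf_energy[OF Gp f(1) ns(1) b(2)] vf_energy[OF Gm f(2) ns(1) b(2)]) auto
      finally show ?thesis using C1 by (simp add: ennreal_mult mult.assoc)
    qed
    have mid: "?q i * Ip p UNIV (\<lambda>x. iter_pderiv (replicate i eN @ cs) w (x, ?c)) \<le> ?e * (ennreal C2 * T)"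
      if i: "i < j" for i
    proof -
      define bs where "bs = replicate i eN @ cs"
      define i' where "i' = j - i"
      have bs: "set bs \<subseteq> Basis" "length bs + i' = m" "0 < i'" using cs Basis_prod_nor i unfolding bs_def i'_def by auto
      have rep: "replicate i' eN @ bs = ns" unfolding bs_def ns_def i'_def using i by (simp add: replicate_add[symmetric])
      have ml: "m - length bs = i'" using bs by simp
      define P where "P \<sigma> G x = (\<Sum>k<i'. (\<delta> / 2) ^ k / fact k * (\<sigma> ^ k * G (nrm bs + k) (mi_of (tang bs)) x))" for \<sigma> :: real and G :: "'a jets" and x
      define Au where "Au x = iter_pderiv bs ?vp (x, ?c) - P (- 1) Gp x" for x
      define Al where "Al x = iter_pderiv bs ?vm (x, ?c) - P 1 Gm x" for x
      define Cm where "Cm = 2 powr (p * real i') * (\<delta> / 2) powr (real i' * p - 1)"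
      have AuB: "Ip p UNIV Au \<le> ennreal Cm * En D ns (sdata (- 1) Gp)"
        unfolding Au_def P_def Cm_def \<delta>_def rep[symmetric] by (rule vf_mid[OF Gp f(1) bs(1,2,3) b])
      have AlB: "Ip p UNIV Al \<le> ennreal Cm * En D ns (sdata 1 Gm)"
        unfolding Al_def P_def Cm_def \<delta>_def rep[symmetric] by (rule vf_mid[OF Gm f(2) bs(1,2,3) b])
      have ms: "?c \<in> {b0<..<b1}" using b by auto
      have nt: "nrm bs + length (tang bs) = length bs" by (rule nrm_tang_length[OF bs(1)])
      have gB: "G (nrm bs + k) (mi_of (tang bs)) \<in> borel_measurable borel" if "admd p m G" "k < i'" for G k
      proof -
        have "nrm bs + k < m" "length (tang bs) \<le> m - 1 - (nrm bs + k)" using nt bs that by linarith+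
        then show ?thesis using that(1) unfolding admd_def
          by (intro Lploc_borel adm_Lploc[OF _ mi_of_multi_indices[OF tang_Basis[OF bs(1)]]]) auto
      qed
      have PB: "P \<sigma> G \<in> borel_measurable borel" if "admd p m G" for \<sigma> G
        unfolding P_def using gB[OF that] by (intro borel_measurable_sum) simp
      have slB: "(\<lambda>x. iter_pderiv bs F (x, ?c)) \<in> borel_measurable borel" if "smooth_on ?S F" for F
        by (rule slice_on_meas[OF om[OF that bs(1)] ms])
      have AB: "Au \<in> borel_measurable borel" "Al \<in> borel_measurable borel"
        unfolding Au_def Al_def using slB[OF sv(1)] slB[OF sv(2)] PB[OF Gp] PB[OF Gm] by (auto intro: borel_measurable_diff)
      have Qeq: "Qdiff b0 b1 Gm Gp bs x = P (- 1) Gp x - P 1 Gm x" for x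
        unfolding Qdiff_def P_def ml \<delta>_def[symmetric] by (simp add: sum_subtractf[symmetric] right_diff_distrib)
      have QB: "Qdiff b0 b1 Gm Gp bs \<in> borel_measurable borel"
        using borel_measurable_diff[OF PB[OF Gp, of "- 1"] PB[OF Gm, of 1]] Qeq by (simp cong: measurable_cong)
      have "Ip p UNIV (\<lambda>x. iter_pderiv bs w (x, ?c)) = Ip p UNIV (\<lambda>x. Qdiff b0 b1 Gm Gp bs x + (Au x - Al x))"
        unfolding w_def Qeq Au_def Al_def using ms by (intro Ip_cong) (simp add: wdiff_iter[OF Gm Gp bs(1)])
      also have "\<dots> \<le> ?K * (?Q bs + Ip p UNIV (\<lambda>x. Au x - Al x))"
        using p by (intro Ip_add QB borel_measurable_diff AB) auto
      also have "\<dots> \<le> ?K * (?Q bs + ?K * (Ip p UNIV Au + Ip p UNIV Al))"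
        using p by (intro mult_left_mono add_left_mono Ip_diff AB) auto
      also have "\<dots> \<le> ?K * (?Q bs + ?K * (ennreal Cm * (ennreal C1 * T)))"
      proof (intro mult_left_mono add_left_mono)
        have "Ip p UNIV Au + Ip p UNIV Al \<le> ennreal Cm * (En D ns (sdata (- 1) Gp) + En D ns (sdata 1 Gm))"
          using add_mono[OF AuB AlB] by (simp add: distrib_left)
        also have "\<dots> \<le> ennreal Cm * (ennreal C1 * T)" by (intro mult_left_mono EE) simp
        finally show "Ip p UNIV Au + Ip p UNIV Al \<le> ennreal Cm * (ennreal C1 * T)" .
      qed auto
      finally have m1: "Ip p UNIV (\<lambda>x. iter_pderiv bs w (x, ?c)) \<le> ?K * (?Q bs + ?K * (ennreal Cm * (ennreal C1 * T)))" .
      \<comment> \<open>Here length bs - m = i - j, so \<delta>^(ip + 1) is \<delta>^(jp) times the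
        weight prescribed in \<open>dominated\<close>.\<close>
      have e1: "?q i * ?Q bs \<le> ?e * T"
      proof -
        have "real (length bs) - real m = real i - real j" using bs(2) i unfolding i'_def by linarith
        then have "real i = real j + (real (length bs) - real m)" by linarith
        then have "real i * p + 1 = (real j + (real (length bs) - real m)) * p + 1" by (rule arg_cong)
        then have "real i * p + 1 = real j * p + ((real (length bs) - real m) * p + 1)" by (simp only: distrib_right add.assoc)
        then have "?q i = ?e * ennreal (\<delta> powr ((real (length bs) - real m) * p + 1))"
          by (simp add: powr_add ennreal_mult[symmetric])
        then show ?thesis using mult_left_mono[OF QQ[OF bs(1)], of "?e"] bs by (simp add: mult.assoc)
      qed
      \<comment> \<open>The exponents ip + 1 and (j - i)p - 1 add up to jp. As the second is
        nonnegative, \<delta>/2 may be replaced by \<delta>.\<close>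
      have e2: "\<delta> powr (real i * p + 1) * Cm \<le> \<delta> powr (real j * p) * 2 powr (p * real j)"
      proof -
        have ip: "0 \<le> real i' * p - 1" using bs(3) p mult_mono[of 1 "real i'" 1 p] by simp
        have "(\<delta> / 2) powr (real i' * p - 1) \<le> \<delta> powr (real i' * p - 1)" using \<delta> ip by (intro powr_mono2) auto
        moreover have "2 powr (p * real i') \<le> 2 powr (p * real j)" using p unfolding i'_def by (intro powr_mono mult_left_mono) auto
        ultimately have "Cm \<le> 2 powr (p * real j) * \<delta> powr (real i' * p - 1)" unfolding Cm_def by (intro mult_mono) auto
        then have "\<delta> powr (real i * p + 1) * Cm \<le> \<delta> powr (real i * p + 1) * (2 powr (p * real j) * \<delta> powr (real i' * p - 1))"
          by (rule mult_left_mono) simp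
        also have "\<dots> = \<delta> powr ((real i * p + 1) + (real i' * p - 1)) * 2 powr (p * real j)" by (simp only: powr_add mult_ac)
        also have "(real i * p + 1) + (real i' * p - 1) = real j * p" unfolding i'_def using i by (simp add: of_nat_diff algebra_simps)
        finally show ?thesis .
      qed
      have "?q i * Ip p UNIV (\<lambda>x. iter_pderiv bs w (x, ?c))
        \<le> ?q i * (?K * (?Q bs + ?K * (ennreal Cm * (ennreal C1 * T))))"
        by (intro mult_left_mono m1) simp
      also have "\<dots> = ?K * (?q i * ?Q bs + ?K * (ennreal (\<delta> powr (real i * p + 1) * Cm) * (ennreal C1 * T)))"
        unfolding Cm_def by (simp add: distrib_left ennreal_mult mult_ac)
      also have "\<dots> \<le> ?K * (?e * T + ?K * (ennreal (\<delta> powr (real j * p) * 2 powr (p * real j)) * (ennreal C1 * T)))"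
        by (intro mult_left_mono add_mono e1 mult_right_mono ennreal_leI e2) auto
      also have "\<dots> = ?e * (ennreal C2 * T)"
        unfolding C2_def using C1 by (simp add: distrib_left distrib_right ennreal_mult ennreal_plus mult_ac)
      finally show ?thesis unfolding bs_def .
    qed
    have "Ip p ?S (iter_pderiv cs w) \<le> ennreal (2 powr (p * real j)) *
      (?e * Ip p ?S (iter_pderiv ns w) +
       (\<Sum>i<j. ?q i * Ip p UNIV (\<lambda>x. iter_pderiv (replicate i eN @ cs) w (x, ?c))))"
      unfolding \<delta>_def ns_def by (rule slab_poincare_iter[OF p sw cs(1)]) (use b in auto)
    also have "\<dots> \<le> ennreal (2 powr (p * real j)) * (?e * (ennreal (2 powr p * C1) * T) + (\<Sum>i<j. ?e * (ennreal C2 * T)))"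
      by (intro mult_left_mono add_mono top sum_mono mid) auto
    also have "\<dots> = ?e * (ennreal C * T)"
      unfolding C_def using C1 C2 by (simp add: distrib_left distrib_right ennreal_mult ennreal_plus mult_ac ennreal_of_nat_eq_real_of_nat)
    finally show "Ip p (slab b0 b1) (iter_pderiv cs (wdiff b0 b1 Gm Gp)) \<le> ennreal ((b1 - b0) powr (real j * p)) * (ennreal C * T)"
      unfolding \<delta>_def w_def .
  qed
qed

end

section \<open>Gluing the two extensions\<close>

text \<open>Constant on both outer thirds of the unit interval, so that near a face the glued
  function coincides with one extension. It is chosen once and for all, hence the bounds of its
  derivatives depend on the order alone.\<close>

definition hstep :: "real \<Rightarrow> real" where
  "hstep = (SOME \<kappa>. smooth_on UNIV \<kappa> \<and> (\<forall>x\<le>1/3. \<kappa> x = 0) \<and> (\<forall>x\<ge>2/3. \<kappa> x = 1))"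

lemma hstep: "smooth_on UNIV hstep" "x \<le> 1/3 \<Longrightarrow> hstep x = 0" "2/3 \<le> x \<Longrightarrow> hstep x = 1"
proof -
  obtain \<kappa> :: "real \<Rightarrow> real" where \<kappa>: "smooth_on UNIV \<kappa>" "\<And>x. x \<le> 0 \<Longrightarrow> \<kappa> x = 0" "\<And>x. 1 \<le> x \<Longrightarrow> \<kappa> x = 1"
    using smooth_step_exists by blast
  have "smooth_on UNIV (\<lambda>x. \<kappa> (3 * x - 1))"
    by (rule smooth_on_compose[OF _ \<kappa>(1)])
      (auto intro!: smooth_on_diff smooth_on_const smooth_on_linear[of _ "\<lambda>x. 3 * x"] bounded_linear_mult_right)
  then have "smooth_on UNIV (\<lambda>x. \<kappa> (3 * x - 1)) \<and> (\<forall>x\<le>1/3. \<kappa> (3 * x - 1) = 0) \<and> (\<forall>x\<ge>2/3. \<kappa> (3 * x - 1) = 1)"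
    using \<kappa> by auto
  from someI[of "\<lambda>\<kappa>. smooth_on UNIV \<kappa> \<and> (\<forall>x\<le>1/3. \<kappa> x = 0) \<and> (\<forall>x\<ge>2/3. \<kappa> x = 1)", OF this]
  have "smooth_on UNIV hstep \<and> (\<forall>x\<le>1/3. hstep x = 0) \<and> (\<forall>x\<ge>2/3. hstep x = 1)" unfolding hstep_def .
  then show "smooth_on UNIV hstep" "x \<le> 1/3 \<Longrightarrow> hstep x = 0" "2/3 \<le> x \<Longrightarrow> hstep x = 1" by auto
qed

text \<open>The normal derivatives of the rescaled cutoff as a sequence in closed form: this is the
  input of \<open>leibniz\<close>, and it displays the cost (b1 - b0)^(-j).\<close>

definition Xf :: "real \<Rightarrow> real \<Rightarrow> nat \<Rightarrow> 'a::euclidean_space \<times> real \<Rightarrow> real" where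
  "Xf b0 b1 j z = (1 / (b1 - b0)) ^ j * iter_pderiv (replicate j 1) hstep ((1 / (b1 - b0)) * snd z + (- b0 / (b1 - b0)))"

lemma Xf_has_derivative:
  fixes z :: "'a::euclidean_space \<times> real"
  shows "(Xf b0 b1 j has_derivative (\<lambda>v. snd v * Xf b0 b1 (Suc j) z)) (at z)"
proof -
  define c where "c = 1 / (b1 - b0)"
  define H where "H = iter_pderiv (replicate j 1) hstep"
  define y where "y = c * snd z + (- b0 / (b1 - b0))"
  have sH: "smooth_on UNIV H" unfolding H_def by (rule smooth_on_iter[OF hstep(1)]) auto
  have "(H has_derivative (\<lambda>v. v * pd 1 H y)) (at y)"
    using smooth_on_has_derivative[OF sH, of y] by simp
  moreover have "((\<lambda>z :: 'a \<times> real. c * snd z + (- b0 / (b1 - b0))) has_derivative (\<lambda>v. c * snd v)) (at z)"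
    by (rule has_derivative_eq_rhs[OF has_derivative_add[OF has_derivative_mult_right[OF has_derivative_snd[OF has_derivative_ident]] has_derivative_const]]) simp
  ultimately have "((\<lambda>z. H (c * snd z + (- b0 / (b1 - b0)))) has_derivative (\<lambda>v. (c * snd v) * pd 1 H y)) (at z)"
    unfolding y_def using has_derivative_compose by blast
  then have d: "((\<lambda>z. c ^ j * H (c * snd z + (- b0 / (b1 - b0)))) has_derivative (\<lambda>v. c ^ j * ((c * snd v) * pd 1 H y))) (at z)"
    by (rule has_derivative_mult_right)
  have e: "Xf b0 b1 j = (\<lambda>z :: 'a \<times> real. c ^ j * H (c * snd z + (- b0 / (b1 - b0))))" by (rule ext) (simp add: Xf_def c_def H_def)
  have "Xf b0 b1 (Suc j) z = c ^ Suc j * pd 1 H y" by (simp add: Xf_def c_def H_def y_def)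
  then have "(\<lambda>v :: 'a \<times> real. snd v * Xf b0 b1 (Suc j) z) = (\<lambda>v. c ^ j * ((c * snd v) * pd 1 H y))" by (simp add: mult_ac)
  with d show ?thesis unfolding e by (simp only:)
qed

lemma Xf_props:
  "Xf b0 b1 j differentiable (at z)" "pd eN (Xf b0 b1 j) z = Xf b0 b1 (Suc j) z"
  "b \<in> Basis \<Longrightarrow> b \<noteq> eN \<Longrightarrow> pd b (Xf b0 b1 j) z = 0"
proof -
  show "Xf b0 b1 j differentiable (at z)" using Xf_has_derivative differentiableI by blast
  show "pd eN (Xf b0 b1 j) z = Xf b0 b1 (Suc j) z" by (simp add: pd_eqI[OF Xf_has_derivative])
  show "b \<in> Basis \<Longrightarrow> b \<noteq> eN \<Longrightarrow> pd b (Xf b0 b1 j) z = 0"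
    by (erule Basis_prod_cases) (auto simp: pd_eqI[OF Xf_has_derivative])
qed

lemma Xf_smooth: "smooth_on UNIV (Xf b0 b1 j)"
proof (rule smooth_on_coinduct[where P = "\<lambda>f. (\<exists>j. f = Xf b0 b1 j) \<or> f = (\<lambda>z. 0)"])
  fix f :: "'a \<times> real \<Rightarrow> real" assume "(\<exists>j. f = Xf b0 b1 j) \<or> f = (\<lambda>z. 0)"
  then consider j where "f = Xf b0 b1 j" | "f = (\<lambda>z. 0)" by blast
  then show "(\<forall>x\<in>UNIV. f differentiable at x) \<and> (\<forall>b\<in>Basis. \<exists>g. ((\<exists>j. g = Xf b0 b1 j) \<or> g = (\<lambda>z. 0)) \<and> (\<forall>x\<in>UNIV. pd b f x = g x))"
  proof cases
    case 1
    have "\<exists>g. ((\<exists>j. g = Xf b0 b1 j) \<or> g = (\<lambda>z. 0)) \<and> (\<forall>x\<in>UNIV. pd b f x = g x)" if "b \<in> Basis" for b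
      using Xf_props(2)[of b0 b1 j] Xf_props(3)[OF that, of b0 b1 j] unfolding 1 by (cases "b = eN") auto
    then show ?thesis using Xf_props(1) 1 by blast
  qed auto
qed auto

lemma Xf_bound:
  "\<exists>K\<ge>0. \<forall>b0 b1 z. b0 < b1 \<longrightarrow> z \<in> slab b0 b1 \<longrightarrow> \<bar>Xf b0 b1 j (z :: 'a::euclidean_space \<times> real)\<bar> \<le> K * (1 / (b1 - b0)) ^ j"
proof -
  define H where "H = iter_pderiv (replicate j 1) hstep"
  have "smooth_on UNIV H" unfolding H_def by (rule smooth_on_iter[OF hstep(1)]) auto
  then have "compact (H ` {0..1})"
    by (intro compact_continuous_image continuous_on_subset[OF smooth_on_continuous_on]) auto
  then have "bounded (H ` {0..1})" by (rule compact_imp_bounded)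
  then obtain K where K: "K > 0" "\<And>y. y \<in> {0..1} \<Longrightarrow> norm (H y) \<le> K" unfolding bounded_pos by blast
  have "\<bar>Xf b0 b1 j z\<bar> \<le> K * (1 / (b1 - b0)) ^ j" if "b0 < b1" "z \<in> slab b0 b1" for b0 b1 and z :: "'a \<times> real"
  proof -
    have "(1 / (b1 - b0)) * snd z + (- b0 / (b1 - b0)) = (snd z - b0) / (b1 - b0)" by (simp add: diff_divide_distrib)
    moreover have "(snd z - b0) / (b1 - b0) \<in> {0..1}" using that by auto
    ultimately have "\<bar>H ((1 / (b1 - b0)) * snd z + (- b0 / (b1 - b0)))\<bar> \<le> K" using K(2) by (metis real_norm_def)
    then show ?thesis unfolding Xf_def H_def[symmetric] using that by (simp add: abs_mult power_abs divide_right_mono)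
  qed
  then show ?thesis using K(1) by (intro exI[of _ K]) auto
qed

lemma Xf_0_near:
  assumes "b0 < b1"
  shows "snd z \<le> b0 + (b1 - b0) / 3 \<Longrightarrow> Xf b0 b1 0 z = 0" "b1 - (b1 - b0) / 3 \<le> snd z \<Longrightarrow> Xf b0 b1 0 z = 1"
proof -
  have e: "(1 / (b1 - b0)) * snd z + (- b0 / (b1 - b0)) = (snd z - b0) / (b1 - b0)" by (simp add: diff_divide_distrib)
  show "Xf b0 b1 0 z = 0" if "snd z \<le> b0 + (b1 - b0) / 3"
  proof -
    have "(snd z - b0) / (b1 - b0) \<le> 1/3" by (subst pos_divide_le_eq) (use that assms in linarith)+
    then show ?thesis unfolding Xf_def e using hstep(2) by simp
  qed
  show "Xf b0 b1 0 z = 1" if "b1 - (b1 - b0) / 3 \<le> snd z"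
  proof -
    have "2/3 \<le> (snd z - b0) / (b1 - b0)" using that assms by (simp add: field_simps)
    then show ?thesis unfolding Xf_def e using hstep(3) by simp
  qed
qed

definition ufun :: "('a::euclidean_space \<Rightarrow> real) \<Rightarrow> nat \<Rightarrow> real \<Rightarrow> real \<Rightarrow> 'a jets \<Rightarrow> 'a jets \<Rightarrow> 'a \<times> real \<Rightarrow> real" where
  "ufun \<eta> m b0 b1 Gm Gp z = vf 1 b0 \<eta> m Gm z + Xf b0 b1 0 z * wdiff \<eta> m b0 b1 Gm Gp z"

context
  fixes \<eta> :: "'a::euclidean_space \<Rightarrow> real" and p r :: real and m :: nat
  assumes p: "1 \<le> p" and mk: "mkernel r (m - 1) \<eta>"
begin

lemma ufun_smooth:
  assumes "admd p m Gm" "admd p m Gp" shows "smooth_on (slab b0 b1) (ufun \<eta> m b0 b1 Gm Gp)"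
  unfolding ufun_def[abs_def]
  by (intro smooth_on_add smooth_on_mult open_slab vf_smooth[OF p mk] wdiff_smooth[OF p mk] assms smooth_on_subset[OF Xf_smooth])
    (auto simp: face_def)

abbreviation xw :: "real \<Rightarrow> real \<Rightarrow> 'a jets \<Rightarrow> 'a jets \<Rightarrow> nat \<Rightarrow> ('a \<times> real) list \<Rightarrow> 'a \<times> real \<Rightarrow> real" where
  "xw b0 b1 Gm Gp j cs z \<equiv> Xf b0 b1 j z * iter_pderiv cs (wdiff \<eta> m b0 b1 Gm Gp) z"

lemma ufun_iter:
  assumes G: "admd p m Gm" "admd p m Gp" and bs: "set bs \<subseteq> Basis" and z: "z \<in> slab b0 b1"
  shows "iter_pderiv bs (ufun \<eta> m b0 b1 Gm Gp) z = iter_pderiv bs (vf 1 b0 \<eta> m Gm) z +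
    (\<Sum>(j, cs)\<leftarrow>leib bs. xw b0 b1 Gm Gp j cs z)"
proof -
  have f: "face 1 b0 b0 b1" by (simp add: face_def)
  have sw: "smooth_on (slab b0 b1) (wdiff \<eta> m b0 b1 Gm Gp)" by (rule wdiff_smooth[OF p mk G])
  have sX: "smooth_on (slab b0 b1) (\<lambda>z. Xf b0 b1 0 z * wdiff \<eta> m b0 b1 Gm Gp z)"
    by (intro smooth_on_mult open_slab sw smooth_on_subset[OF Xf_smooth]) auto
  have "iter_pderiv bs (ufun \<eta> m b0 b1 Gm Gp) z = iter_pderiv bs (vf 1 b0 \<eta> m Gm) z + iter_pderiv bs (\<lambda>z. Xf b0 b1 0 z * wdiff \<eta> m b0 b1 Gm Gp z) z"
    using iter_pderiv_lincomb[OF open_slab vf_smooth[OF p mk G(1) f] sX bs z, of 1 1] unfolding ufun_def[abs_def] by simp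
  also have "iter_pderiv bs (\<lambda>z. Xf b0 b1 0 z * wdiff \<eta> m b0 b1 Gm Gp z) z = (\<Sum>(j, cs)\<leftarrow>leib bs. xw b0 b1 Gm Gp j cs z)"
    by (rule leibniz[OF open_slab sw _ _ _ bs z, where X = "Xf b0 b1"]) (rule Xf_props; assumption?)+
  finally show ?thesis .
qed

text \<open>The open set \<open>A\<close> is general because the estimate is used on the full slab
  for the energy and on cylinders for local finiteness.\<close>

lemma ufun_Ip:
  assumes G: "admd p m Gm" "admd p m Gp" and bs: "set bs \<subseteq> Basis" and A: "open A" "A \<subseteq> slab b0 b1"
  shows "Ip p A (iter_pderiv bs (ufun \<eta> m b0 b1 Gm Gp)) \<le> ennreal (2 powr p) * (Ip p A (iter_pderiv bs (vf 1 b0 \<eta> m Gm)) +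
    ennreal (real (length (leib bs)) powr p) * (\<Sum>(j, cs)\<leftarrow>leib bs. Ip p A (\<lambda>z. xw b0 b1 Gm Gp j cs z)))"
proof -
  let ?S = "ennreal (real (length (leib bs)) powr p) * (\<Sum>(j, cs)\<leftarrow>leib bs. Ip p A (\<lambda>z. xw b0 b1 Gm Gp j cs z))"
  have f: "face 1 b0 b0 b1" by (simp add: face_def)
  have sw: "smooth_on A (wdiff \<eta> m b0 b1 Gm Gp)" by (rule smooth_on_subset[OF wdiff_smooth[OF p mk G] A(2)])
  have cv: "continuous_on A (iter_pderiv bs (vf 1 b0 \<eta> m Gm))"
    by (intro smooth_on_continuous_on_iter[OF smooth_on_subset[OF vf_smooth[OF p mk G(1) f] A(2)] bs])
  have ct: "continuous_on A (\<lambda>z. xw b0 b1 Gm Gp j cs z)" if "(j, cs) \<in> set (leib bs)" for j cs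
    using leib_props[OF that bs] by (intro continuous_intros smooth_on_continuous_on_iter[OF sw] continuous_on_subset[OF smooth_on_continuous_on[OF Xf_smooth]]) auto
  have cs': "continuous_on A (\<lambda>z. \<Sum>(j, cs)\<leftarrow>l. xw b0 b1 Gm Gp j cs z)" if "set l \<subseteq> set (leib bs)" for l
    using that by (induction l) (auto intro!: continuous_intros ct)
  have "Ip p A (iter_pderiv bs (ufun \<eta> m b0 b1 Gm Gp)) = Ip p A (\<lambda>z. iter_pderiv bs (vf 1 b0 \<eta> m Gm) z +
    (\<Sum>(j, cs)\<leftarrow>leib bs. xw b0 b1 Gm Gp j cs z))"
    by (rule Ip_cong) (rule ufun_iter[OF G bs], use A(2) in auto)
  also have "\<dots> \<le> ennreal (2 powr p) * (Ip p A (iter_pderiv bs (vf 1 b0 \<eta> m Gm)) + Ip p A (\<lambda>z. \<Sum>(j, cs)\<leftarrow>leib bs. xw b0 b1 Gm Gp j cs z))"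
    using p by (intro Ip_add_on on_meas_continuous A(1) cv cs' borel_open) auto
  also have "\<dots> \<le> ennreal (2 powr p) * (Ip p A (iter_pderiv bs (vf 1 b0 \<eta> m Gm)) +
    ?S)"
  proof (intro mult_left_mono add_left_mono)
    show "Ip p A (\<lambda>z. \<Sum>(j, cs)\<leftarrow>leib bs. xw b0 b1 Gm Gp j cs z)
      \<le> ?S"
    proof -
      have "on_meas A ((\<lambda>(j, cs) z. xw b0 b1 Gm Gp j cs z) x)" if "x \<in> set (leib bs)" for x
        using on_meas_continuous[OF A(1) ct[of "fst x" "snd x"]] that by (simp add: case_prod_beta)
      from Ip_sum_list_on[of p A "leib bs" "\<lambda>(j, cs) z. xw b0 b1 Gm Gp j cs z", OF _ _ this] show ?thesis using p A(1) by (simp add: case_prod_unfold)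
    qed
  qed auto
  finally show ?thesis .
qed

lemma Xf_mult_Ip:
  fixes w :: "'a \<times> real \<Rightarrow> real"
  assumes K: "\<And>z :: 'a \<times> real. z \<in> slab b0 b1 \<Longrightarrow> \<bar>Xf b0 b1 j z\<bar> \<le> K * (1 / (b1 - b0)) ^ j" "0 \<le> K" and b: "b0 < b1"
    and A: "open A" "A \<subseteq> slab b0 b1" and w: "continuous_on A w"
  shows "Ip p A (\<lambda>z. Xf b0 b1 j z * w z) \<le> ennreal (K powr p * (b1 - b0) powr (- (real j * p))) * Ip p A w"
proof -
  have KA: "\<bar>Xf b0 b1 j z\<bar> \<le> K * (1 / (b1 - b0)) ^ j" if "z \<in> A" for z by (rule K(1)) (use A(2) that in blast)
  have "Ip p A (\<lambda>z. Xf b0 b1 j z * w z) \<le> ennreal (\<bar>K * (1 / (b1 - b0)) ^ j\<bar> powr p) * Ip p A w"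
    using p by (intro Ip_mult_bound on_meas_continuous w borel_open A(1) KA) auto
  also have "\<bar>K * (1 / (b1 - b0)) ^ j\<bar> powr p = K powr p * (b1 - b0) powr (- (real j * p))"
  proof -
    have "(1 / (b1 - b0)) ^ j = (b1 - b0) powr (- real j)"
      using b by (simp add: powr_minus powr_realpow power_one_over inverse_eq_divide)
    then show ?thesis using K(2) b by (simp add: powr_mult powr_powr)
  qed
  finally show ?thesis .
qed

text \<open>In each Leibniz term the factor (b1 - b0)^(-jp) of the cutoff cancels the gain in
  \<open>wdiff_estimate\<close>, so the constant depends on the bound \<open>D\<close> but not on
  the individual strip.\<close>

lemma ufun_energy:
  assumes bs: "set bs \<subseteq> Basis" "length bs = m" and a: "r * D \<le> a"
  shows "\<exists>C\<ge>0. \<forall>b0 b1 Gm Gp T. b0 < b1 \<longrightarrow> b1 - b0 \<le> D \<longrightarrow> dominated p m a b0 b1 Gm Gp T \<longrightarrow>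
    Ip p (slab b0 b1) (iter_pderiv bs (ufun \<eta> m b0 b1 Gm Gp)) \<le> ennreal C * T"
proof -
  obtain C1 where C1: "C1 \<ge> 0" "\<And>G \<sigma>. admd p m G \<Longrightarrow> \<bar>\<sigma>\<bar> = 1 \<Longrightarrow> En \<eta> p m D bs (sdata \<sigma> G) \<le> ennreal C1 * Esum a p m G"
    using En_bound[OF p mk bs a] by blast
  obtain K where K: "\<And>j. 0 \<le> K j" "\<And>j b0 b1 z. b0 < b1 \<Longrightarrow> z \<in> slab b0 b1 \<Longrightarrow> \<bar>Xf b0 b1 j (z :: 'a \<times> real)\<bar> \<le> K j * (1 / (b1 - b0)) ^ j"
    using Xf_bound[where 'a = 'a] by metis
  have "\<exists>C\<ge>0. \<forall>b0 b1 Gm Gp T. b0 < b1 \<longrightarrow> b1 - b0 \<le> D \<longrightarrow> dominated p m a b0 b1 Gm Gp T \<longrightarrow>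
    Ip p (slab b0 b1) (iter_pderiv cs (wdiff \<eta> m b0 b1 Gm Gp)) \<le> ennreal ((b1 - b0) powr (real j * p)) * (ennreal C * T)"
    if "(j, cs) \<in> set (leib bs)" for j cs
    using wdiff_estimate[OF p mk _ _ a, of cs j] leib_props[OF that bs(1)] bs(2) by blast
  then obtain CC where CC: "\<And>j cs. (j, cs) \<in> set (leib bs) \<Longrightarrow> 0 \<le> CC j cs"
    "\<And>j cs b0 b1 Gm Gp T. (j, cs) \<in> set (leib bs) \<Longrightarrow> b0 < b1 \<Longrightarrow> b1 - b0 \<le> D \<Longrightarrow> dominated p m a b0 b1 Gm Gp T \<Longrightarrow>
      Ip p (slab b0 b1) (iter_pderiv cs (wdiff \<eta> m b0 b1 Gm Gp)) \<le> ennreal ((b1 - b0) powr (real j * p)) * (ennreal (CC j cs) * T)"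
    by metis
  define C2 where "C2 = (\<Sum>(j, cs)\<in>set (leib bs). K j powr p * CC j cs)"
  define len where "len = real (length (leib bs))"
  have C2n: "0 \<le> K j powr p * CC j cs" if "(j, cs) \<in> set (leib bs)" for j cs using CC(1)[OF that] by simp
  have C2: "C2 \<ge> 0" unfolding C2_def using C2n by (intro sum_nonneg) auto
  define C where "C = 2 powr p * (C1 + len powr p * (len * C2))"
  show ?thesis
  proof (intro exI[of _ C] conjI allI impI)
    show "C \<ge> 0" unfolding C_def len_def using C1 C2 by auto
    fix b0 b1 T and Gm Gp :: "'a jets" assume b: "b0 < b1" "b1 - b0 \<le> D" and dom: "dominated p m a b0 b1 Gm Gp T"
    let ?u = "ufun \<eta> m b0 b1 Gm Gp"
    have G: "admd p m Gm" "admd p m Gp" and S: "Esum a p m Gm + Esum a p m Gp \<le> T" using dom unfolding dominated_def[OF p mk] by auto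
    have E: "Esum a p m Gm \<le> T" by (rule order_trans[OF _ S]) simp
    have f: "face 1 b0 b0 b1" by (simp add: face_def)
    have v: "Ip p (slab b0 b1) (iter_pderiv bs (vf 1 b0 \<eta> m Gm)) \<le> ennreal C1 * T"
    proof -
      have "Ip p (slab b0 b1) (iter_pderiv bs (vf 1 b0 \<eta> m Gm)) \<le> En \<eta> p m D bs (sdata 1 Gm)" by (rule vf_energy[OF p mk G(1) f bs(1) b(2)])
      also have "\<dots> \<le> ennreal C1 * Esum a p m Gm" by (rule C1(2)[OF G(1)]) simp
      also have "\<dots> \<le> ennreal C1 * T" by (intro mult_left_mono E) simp
      finally show ?thesis .
    qed
    have t: "Ip p (slab b0 b1) (\<lambda>z. xw b0 b1 Gm Gp j cs z) \<le> ennreal C2 * T" if jc: "(j, cs) \<in> set (leib bs)" for j cs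
    proof -
      have "set cs \<subseteq> Basis" using leib_props[OF jc bs(1)] by blast
      then have "Ip p (slab b0 b1) (\<lambda>z. xw b0 b1 Gm Gp j cs z)
        \<le> ennreal (K j powr p * (b1 - b0) powr (- (real j * p))) * Ip p (slab b0 b1) (iter_pderiv cs (wdiff \<eta> m b0 b1 Gm Gp))"
        by (intro Xf_mult_Ip K(2)[OF b(1)] K(1) b(1) open_slab order_refl smooth_on_continuous_on_iter wdiff_smooth[OF p mk G]) auto
      also have "\<dots> \<le> ennreal (K j powr p * (b1 - b0) powr (- (real j * p))) * (ennreal ((b1 - b0) powr (real j * p)) * (ennreal (CC j cs) * T))"
        by (intro mult_left_mono CC(2)[OF jc b dom]) simp
      also have "\<dots> = ennreal ((K j powr p * CC j cs) * ((b1 - b0) powr (- (real j * p)) * (b1 - b0) powr (real j * p))) * T"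
        using CC(1)[OF jc] by (simp add: ennreal_mult mult_ac)
      also have "(b1 - b0) powr (- (real j * p)) * (b1 - b0) powr (real j * p) = 1" using b by (simp add: powr_add[symmetric])
      also have "ennreal ((K j powr p * CC j cs) * 1) * T \<le> ennreal C2 * T"
      proof (intro mult_right_mono ennreal_leI)
        show "K j powr p * CC j cs * 1 \<le> C2"
          unfolding C2_def using member_le_sum[OF jc, of "\<lambda>(j, cs). K j powr p * CC j cs"] C2n by auto
      qed simp
      finally show ?thesis .
    qed
    have "(\<Sum>(j, cs)\<leftarrow>leib bs. Ip p (slab b0 b1) (\<lambda>z. xw b0 b1 Gm Gp j cs z)) \<le> (\<Sum>x\<leftarrow>leib bs. ennreal C2 * T)"
      using t by (intro sum_list_mono) auto
    also have "\<dots> = ennreal (len * C2) * T"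
      unfolding len_def using C2 by (simp add: sum_list_triv ennreal_mult mult.assoc ennreal_of_nat_eq_real_of_nat)
    finally have s: "(\<Sum>(j, cs)\<leftarrow>leib bs. Ip p (slab b0 b1) (\<lambda>z. xw b0 b1 Gm Gp j cs z)) \<le> ennreal (len * C2) * T" .
    have "Ip p (slab b0 b1) (iter_pderiv bs ?u) \<le> ennreal (2 powr p) * (ennreal C1 * T + ennreal (len powr p) * (ennreal (len * C2) * T))"
      by (rule order_trans[OF ufun_Ip[OF G bs(1) open_slab order_refl]], unfold len_def[symmetric])
        (intro mult_left_mono add_mono v s; simp)
    also have "\<dots> = ennreal C * T"
      unfolding C_def len_def using C1 C2 by (simp add: ennreal_mult ennreal_plus distrib_left distrib_right mult_ac)
    finally show "Ip p (slab b0 b1) (iter_pderiv bs ?u) \<le> ennreal C * T" .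
  qed
qed

text \<open>For the traces: derivatives of every order up to m are p-integrable on bounded
  cylinders, where lower orders are covered too.\<close>

lemma ufun_finite:
  assumes G: "admd p m Gm" "admd p m Gp" and E: "Esum a p m Gm < \<infinity>" "Esum a p m Gp < \<infinity>"
    and bs: "set bs \<subseteq> Basis" "length bs \<le> m" and a: "r * (b1 - b0) \<le> a" and b: "b0 < b1"
  shows "Ip p (ball 0 R \<times> {b0<..<b1}) (iter_pderiv bs (ufun \<eta> m b0 b1 Gm Gp)) < \<infinity>"
proof -
  let ?vm = "vf 1 b0 \<eta> m Gm" and ?vp = "vf (- 1) b1 \<eta> m Gp"
  define A where "A = ball (0::'a) R \<times> {b0<..<b1}"
  have A: "open A" "A \<subseteq> slab b0 b1" unfolding A_def using open_cyl by auto
  have f: "face (- 1) b1 b0 b1" "face 1 b0 b0 b1" by (auto simp: face_def)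
  have fin: "Ip p A (iter_pderiv cs ?vm) < \<infinity>" "Ip p A (iter_pderiv cs ?vp) < \<infinity>"
    if "set cs \<subseteq> Basis" "length cs \<le> m" for cs
    unfolding A_def using vf_finite[OF p mk G(1) f(2) that a E(1)] vf_finite[OF p mk G(2) f(1) that a E(2)] by auto
  have wf: "Ip p A (\<lambda>z. xw b0 b1 Gm Gp j cs z) < \<infinity>" if jc: "(j, cs) \<in> set (leib bs)" for j cs
  proof -
    have cs: "set cs \<subseteq> Basis" "length cs \<le> m" using leib_props[OF jc bs(1)] bs(2) by auto
    obtain K where K: "0 \<le> K" "\<And>b0 b1 z. b0 < b1 \<Longrightarrow> z \<in> slab b0 b1 \<Longrightarrow> \<bar>Xf b0 b1 j (z :: 'a \<times> real)\<bar> \<le> K * (1 / (b1 - b0)) ^ j"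
      using Xf_bound[where 'a = 'a, of j] by blast
    have cv: "continuous_on A (iter_pderiv cs ?vp)" "continuous_on A (iter_pderiv cs ?vm)"
      by (intro smooth_on_continuous_on_iter[OF smooth_on_subset[OF vf_smooth[OF p mk G(2) f(1)] A(2)] cs(1)])
        (intro smooth_on_continuous_on_iter[OF smooth_on_subset[OF vf_smooth[OF p mk G(1) f(2)] A(2)] cs(1)])
    have "Ip p A (\<lambda>z. xw b0 b1 Gm Gp j cs z) \<le> ennreal (K powr p * (b1 - b0) powr (- (real j * p))) * Ip p A (iter_pderiv cs (wdiff \<eta> m b0 b1 Gm Gp))"
      by (intro Xf_mult_Ip K(2)[OF b] K(1) b A smooth_on_continuous_on_iter[OF _ cs(1)] smooth_on_subset[OF wdiff_smooth[OF p mk G] A(2)])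
    also have "Ip p A (iter_pderiv cs (wdiff \<eta> m b0 b1 Gm Gp)) = Ip p A (\<lambda>z. iter_pderiv cs ?vp z + (- 1) * iter_pderiv cs ?vm z)"
      using A(2) by (intro Ip_cong) (auto simp: wdiff_iter[OF p mk G cs(1)])
    also have "\<dots> \<le> ennreal (2 powr p) * (Ip p A (iter_pderiv cs ?vp) + Ip p A (\<lambda>z. (- 1) * iter_pderiv cs ?vm z))"
      using p A by (intro Ip_add_on on_meas_continuous continuous_intros cv borel_open) auto
    also have "Ip p A (\<lambda>z. (- 1) * iter_pderiv cs ?vm z) = Ip p A (iter_pderiv cs ?vm)"
      unfolding Ip_def by simp
    finally have le: "Ip p A (\<lambda>z. xw b0 b1 Gm Gp j cs z) \<le>
      ennreal (K powr p * (b1 - b0) powr (- (real j * p))) * (ennreal (2 powr p) * (Ip p A (iter_pderiv cs ?vp) + Ip p A (iter_pderiv cs ?vm)))"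
      by (simp add: mult_left_mono)
    then show ?thesis using fin[OF cs] by (auto intro!: le_less_trans[OF le] simp: ennreal_mult_less_top)
  qed
  have "(\<Sum>(j, cs)\<leftarrow>l. Ip p A (\<lambda>z. xw b0 b1 Gm Gp j cs z)) < \<infinity>" if "set l \<subseteq> set (leib bs)" for l
    using that wf by (induction l) auto
  then have "(\<Sum>(j, cs)\<leftarrow>leib bs. Ip p A (\<lambda>z. xw b0 b1 Gm Gp j cs z)) < \<infinity>" by blast
  then show ?thesis
    unfolding A_def[symmetric] using fin(1)[OF bs]
    by (auto intro!: le_less_trans[OF ufun_Ip[OF G bs(1) A]] simp: ennreal_mult_less_top)
qed

text \<open>Near a face the cutoff is constant, so all derivatives of the glued function are those
  of the extension from that face.\<close>

lemma ufun_face_limit: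
  assumes G: "admd p m Gm" "admd p m Gp" and bs: "set bs \<subseteq> Basis" "length bs < m" and b: "b0 < b1"
  shows "((\<lambda>s. Ip p (ball 0 R) (\<lambda>x. iter_pderiv bs (ufun \<eta> m b0 b1 Gm Gp) (x, s) - Gm (nrm bs) (mi_of (tang bs)) x)) \<longlongrightarrow> 0) (at b0 within {b0<..<b1})"
    "((\<lambda>s. Ip p (ball 0 R) (\<lambda>x. iter_pderiv bs (ufun \<eta> m b0 b1 Gm Gp) (x, s) - Gp (nrm bs) (mi_of (tang bs)) x)) \<longlongrightarrow> 0) (at b1 within {b0<..<b1})"
proof -
  let ?u = "ufun \<eta> m b0 b1 Gm Gp"
  have f: "face (- 1) b1 b0 b1" "face 1 b0 b0 b1" by (auto simp: face_def)
  define \<delta> where "\<delta> = (b1 - b0) / 3"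
  have \<delta>: "\<delta> > 0" using b by (simp add: \<delta>_def)
  have X: "Xf b0 b1 0 (x, s) = 0" if "s < b0 + \<delta>" for x :: 'a and s using Xf_0_near(1)[OF b, of "(x, s)"] that by (simp add: \<delta>_def)
  have X': "Xf b0 b1 0 (x, s) = 1" if "b1 - \<delta> < s" for x :: 'a and s using Xf_0_near(2)[OF b, of "(x, s)"] that by (simp add: \<delta>_def)
  have loc: "iter_pderiv bs ?u (x, s) = iter_pderiv bs (vf 1 b0 \<eta> m Gm) (x, s)" if "s < b0 + \<delta>" for x s
    by (rule iter_pderiv_cong[of "{z. snd z < b0 + \<delta>}"])
      (use that X in \<open>auto simp: ufun_def intro!: open_Collect_less continuous_intros\<close>)
  have loc': "iter_pderiv bs ?u (x, s) = iter_pderiv bs (vf (- 1) b1 \<eta> m Gp) (x, s)" if "b1 - \<delta> < s" for x s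
    by (rule iter_pderiv_cong[of "{z. b1 - \<delta> < snd z}"])
      (use that X' in \<open>auto simp: ufun_def wdiff_def[OF p mk] intro!: open_Collect_less continuous_intros\<close>)
  show "((\<lambda>s. Ip p (ball 0 R) (\<lambda>x. iter_pderiv bs ?u (x, s) - Gm (nrm bs) (mi_of (tang bs)) x)) \<longlongrightarrow> 0) (at b0 within {b0<..<b1})"
  proof (rule Lim_transform_eventually[OF vf_face_limit[OF p mk G(1) f(2) bs b]])
    have "\<forall>\<^sub>F s in at b0 within {b0<..<b1}. s < b0 + \<delta>"
      using \<delta> by (auto simp: eventually_at dist_real_def intro!: exI[of _ \<delta>])
    then show "\<forall>\<^sub>F s in at b0 within {b0<..<b1}. Ip p (ball 0 R) (\<lambda>x. iter_pderiv bs (vf 1 b0 \<eta> m Gm) (x, s) - Gm (nrm bs) (mi_of (tang bs)) x) =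
       Ip p (ball 0 R) (\<lambda>x. iter_pderiv bs ?u (x, s) - Gm (nrm bs) (mi_of (tang bs)) x)"
      by eventually_elim (simp add: loc)
  qed
  show "((\<lambda>s. Ip p (ball 0 R) (\<lambda>x. iter_pderiv bs ?u (x, s) - Gp (nrm bs) (mi_of (tang bs)) x)) \<longlongrightarrow> 0) (at b1 within {b0<..<b1})"
  proof (rule Lim_transform_eventually[OF vf_face_limit[OF p mk G(2) f(1) bs b]])
    have "\<forall>\<^sub>F s in at b1 within {b0<..<b1}. b1 - \<delta> < s"
      using \<delta> by (auto simp: eventually_at dist_real_def intro!: exI[of _ \<delta>])
    then show "\<forall>\<^sub>F s in at b1 within {b0<..<b1}. Ip p (ball 0 R) (\<lambda>x. iter_pderiv bs (vf (- 1) b1 \<eta> m Gp) (x, s) - Gp (nrm bs) (mi_of (tang bs)) x) =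
       Ip p (ball 0 R) (\<lambda>x. iter_pderiv bs ?u (x, s) - Gp (nrm bs) (mi_of (tang bs)) x)"
      by eventually_elim (simp add: loc')
  qed
qed

end

section \<open>Weak boundary data\<close>

text \<open>Any Borel function in the class of \<open>W\<close> will do, because averages and
  \<open>Ip\<close> depend on the class only.\<close>

definition brep :: "('a::euclidean_space \<Rightarrow> real) \<Rightarrow> 'a \<Rightarrow> real" where
  "brep W = (SOME g. g \<in> borel_measurable borel \<and> (AE x in lborel. W x = g x))"

lemma brep:
  assumes "W \<in> borel_measurable lebesgue"
  shows "brep W \<in> borel_measurable borel" "AE x in lborel. W x = brep W x"
proof -
  obtain g where "g \<in> borel_measurable borel \<and> (AE x in lborel. W x = g x)"
    using completion_ex_borel_measurable_real[OF assms] by auto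
  from someI[of "\<lambda>g. g \<in> borel_measurable borel \<and> (AE x in lborel. W x = g x)", OF this]
  show "brep W \<in> borel_measurable borel" "AE x in lborel. W x = brep W x" unfolding brep_def by auto
qed

lemma brep_integral:
  assumes W: "W \<in> borel_measurable lebesgue" and f [measurable]: "f \<in> borel_measurable borel"
  shows "(LINT x:UNIV|lebesgue. W x * f x) = (\<integral>x. f x * brep W x \<partial>lborel)"
proof -
  note [measurable] = brep(1)[OF W]
  have l: "f \<in> borel_measurable lebesgue" "brep W \<in> borel_measurable lebesgue"
    by (rule measurable_completion; measurable)+
  have "(\<integral>x. W x * f x \<partial>lebesgue) = (\<integral>x. f x * brep W x \<partial>lebesgue)"
    using AE_completion[OF brep(2)[OF W]] by (intro integral_cong_AE borel_measurable_times W l) auto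
  also have "\<dots> = (\<integral>x. f x * brep W x \<partial>lborel)" by (rule integral_completion) measurable
  finally show ?thesis by (simp add: set_lebesgue_integral_def)
qed

text \<open>Pointwise limit of the restrictions to growing balls.\<close>

lemma borel_measurable_lebesgue_local:
  fixes W :: "'a::euclidean_space \<Rightarrow> real"
  assumes "\<And>n::nat. (\<lambda>x. indicator (cball 0 (real n)) x *\<^sub>R W x) \<in> borel_measurable lebesgue"
  shows "W \<in> borel_measurable lebesgue"
proof (rule borel_measurable_LIMSEQ_real[OF _ assms])
  fix x :: 'a
  obtain n where n: "norm x \<le> real n" using real_arch_simple by blast
  have "indicator (cball 0 (real k)) x *\<^sub>R W x = W x" if "k \<ge> n" for k
    using n that by (simp add: indicator_def)
  then show "(\<lambda>i. indicator (cball 0 (real i)) x *\<^sub>R W x) \<longlonglongrightarrow> W x"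
    by (intro tendsto_eventually eventually_sequentiallyI)
qed

lemma L1_loc_measurable: "L1_loc UNIV W \<Longrightarrow> W \<in> borel_measurable lebesgue"
  by (rule borel_measurable_lebesgue_local) (simp add: L1_loc_def set_integrable_def borel_measurable_integrable)

lemma Lp_loc_D:
  assumes "Lp_loc p UNIV W"
  shows "W \<in> borel_measurable lebesgue" "Ip p (ball 0 R) W < \<infinity>"
proof -
  have L: "Lp p (cball 0 R) W" for R using assms unfolding Lp_loc_def by simp
  have "(\<lambda>x. if x \<in> cball 0 R then W x else 0) \<in> borel_measurable lebesgue" for R
    using L[of R] unfolding Lp_def by (subst borel_measurable_if) auto
  moreover have "(\<lambda>x. indicator (cball 0 R) x *\<^sub>R W x) = (\<lambda>x. if x \<in> cball 0 R then W x else 0)" for R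
    by (simp add: indicator_def fun_eq_iff)
  ultimately have "(\<lambda>x. indicator (cball 0 R) x *\<^sub>R W x) \<in> borel_measurable lebesgue" for R by (simp only:)
  then show "W \<in> borel_measurable lebesgue" by (rule borel_measurable_lebesgue_local)
  have "Ip p (ball 0 R) W \<le> Ip p (cball 0 R) W" by (rule Ip_mono) auto
  also have "\<dots> < \<infinity>" using L[of R] unfolding Lp_def Ip_lebesgue by simp
  finally show "Ip p (ball 0 R) W < \<infinity>" .
qed

lemma Ip_brep: "W \<in> borel_measurable lebesgue \<Longrightarrow> Ip p A (brep W) = Ip p A W"
  by (rule Ip_cong_AE) (use brep(2) in \<open>force elim: eventually_mono\<close>)

text \<open>The regularity conditions on the data of a single face; Q couples the two faces and is
  kept apart.\<close>

definition fdata :: "real \<Rightarrow> nat \<Rightarrow> (nat \<Rightarrow> 'a::euclidean_space \<Rightarrow> real) \<Rightarrow> bool" where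
  "fdata p m f \<longleftrightarrow> (\<forall>k\<le>m - 2. sobolev_loc (m - 1 - k) p UNIV (f k)) \<and> Lp_loc p UNIV (f (m - 1))"

definition bdata :: "(nat \<Rightarrow> 'a::euclidean_space \<Rightarrow> real) \<Rightarrow> 'a jets" where
  "bdata f k \<alpha> = brep (weak_pderiv UNIV \<alpha> (f k))"

lemma multi_indices_0: "\<alpha> \<in> multi_indices 0 \<Longrightarrow> \<alpha> = (\<lambda>b. 0)"
  unfolding multi_indices_def by (auto simp: fun_eq_iff)

lemma fdata_weak_pderiv:
  assumes f: "fdata p m f" and k: "k < m" and a: "\<alpha> \<in> multi_indices n" "n \<le> m - 1 - k"
  shows "weak_pderiv UNIV \<alpha> (f k) \<in> borel_measurable lebesgue" "Ip p (ball 0 R) (weak_pderiv UNIV \<alpha> (f k)) < \<infinity>"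
proof -
  have "weak_pderiv UNIV \<alpha> (f k) \<in> borel_measurable lebesgue \<and> Ip p (ball 0 R) (weak_pderiv UNIV \<alpha> (f k)) < \<infinity>"
  proof (cases "k \<le> m - 2")
    case True
    then obtain v where v: "has_weak_pderiv UNIV \<alpha> (f k) v" "Lp_loc p UNIV v"
      using f a unfolding fdata_def sobolev_loc_def by blast
    have "Ip p (ball 0 R) (weak_pderiv UNIV \<alpha> (f k)) = Ip p (ball 0 R) v"
      using weak_pderiv_AE[OF open_UNIV v(1)] by (intro Ip_cong_AE) auto
    then show ?thesis
      using has_weak_pderiv_weak_pderiv[OF v(1)] L1_loc_measurable Lp_loc_D(2)[OF v(2)] unfolding has_weak_pderiv_def by auto
  next
    \<comment> \<open>Here k = m - 1, which leaves order zero only, and the datum is merely locally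
      in L^p.\<close>
    case False
    then have e: "k = m - 1" "n = 0" using k a(2) by auto
    then have "\<alpha> = (\<lambda>b. 0)" using a(1) multi_indices_0 by blast
    then show ?thesis using f Lp_loc_D unfolding fdata_def e weak_pderiv_def by auto
  qed
  then show "weak_pderiv UNIV \<alpha> (f k) \<in> borel_measurable lebesgue" "Ip p (ball 0 R) (weak_pderiv UNIV \<alpha> (f k)) < \<infinity>" by auto
qed

lemma fdata_has_weak_pderiv:
  assumes "fdata p m f" "k < m" "\<alpha> \<in> multi_indices n" "n \<le> m - 1 - k" "k \<le> m - 2"
  shows "has_weak_pderiv UNIV \<alpha> (f k) (weak_pderiv UNIV \<alpha> (f k))"
  using assms has_weak_pderiv_weak_pderiv unfolding fdata_def sobolev_loc_def by blast

text \<open>The derivative \<alpha> of f_k tested with \<open>pd j \<phi>\<close> and the derivative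
  \<alpha> + e_j tested with \<phi> lead to the same integral of f_k, since classical derivatives
  commute. Comparing the signs gives the one-step relation.\<close>

lemma bdata_admd:
  fixes f :: "nat \<Rightarrow> 'a::euclidean_space \<Rightarrow> real"
  assumes f: "fdata p m f" shows "admd p m (bdata f)"
  unfolding admd_def adm_def
proof (intro allI impI conjI ballI)
  fix k n and \<alpha> :: "'a \<Rightarrow> nat" assume k: "k < m" and n: "n \<le> m - 1 - k" and a: "\<alpha> \<in> multi_indices n"
  note w = fdata_weak_pderiv[OF f k a n]
  show "Lploc p (bdata f k \<alpha>)"
    unfolding Lploc_def bdata_def using brep(1)[OF w(1)] w(2) by (simp add: Ip_brep[OF w(1)])
next
  fix k n and j :: 'a and \<alpha> :: "'a \<Rightarrow> nat" assume k: "k < m" and n: "n < m - 1 - k" and a: "\<alpha> \<in> multi_indices n" and j: "j \<in> Basis"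
  have k2: "k \<le> m - 2" and n': "n \<le> m - 1 - k" "Suc n \<le> m - 1 - k" using n by auto
  note ai = inc_multi_indices[OF a j]
  show "wrel j (bdata f k \<alpha>) (bdata f k (inc j \<alpha>))"
    unfolding wrel_def
  proof (intro allI impI)
    fix \<phi> :: "'a \<Rightarrow> real" assume t: "test_fun UNIV \<phi>"
    have tj: "test_fun UNIV (pd j \<phi>)" by (rule test_fun_pd[OF t j])
    have s: "smooth_on UNIV \<phi>" "smooth_on UNIV (pd j \<phi>)" using t tj unfolding test_fun_def smooth_iff by auto
    have b: "\<phi> \<in> borel_measurable borel" "pd j \<phi> \<in> borel_measurable borel"
      using s by (auto intro!: borel_measurable_continuous_onI smooth_on_continuous_on)
    obtain bs where bs: "set bs \<subseteq> Basis" "length bs = n" "\<alpha> = mi_of bs" using multi_indices_list[OF a] .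
    have "pderiv_mi \<alpha> (pd j \<phi>) = iter_pderiv (bs @ [j]) \<phi>"
      unfolding bs(3) pderiv_mi_mi_of[OF s(2) bs(1)] by (simp add: iter_pderiv_append)
    also have "\<dots> = iter_pderiv (j # bs) \<phi>" using bs(1) j by (intro iter_pderiv_mset_cong s(1)) auto
    also have "\<dots> = pderiv_mi (inc j \<alpha>) \<phi>"
      unfolding bs(3) mi_of_Cons[symmetric] using pderiv_mi_mi_of[OF s(1), of "j # bs"] bs(1) j by simp
    finally have e: "pderiv_mi \<alpha> (pd j \<phi>) = pderiv_mi (inc j \<alpha>) \<phi>" .
    have S: "sum \<alpha> Basis = n" "sum (inc j \<alpha>) Basis = Suc n" using a ai unfolding multi_indices_def by auto
    have w: "(LINT x:UNIV|lebesgue. f k x * pderiv_mi \<beta> \<psi> x) = (- 1) ^ sum \<beta> Basis * (LINT x:UNIV|lebesgue. weak_pderiv UNIV \<beta> (f k) x * \<psi> x)"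
      if "test_fun UNIV \<psi>" "has_weak_pderiv UNIV \<beta> (f k) (weak_pderiv UNIV \<beta> (f k))" for \<beta> \<psi>
      using that unfolding has_weak_pderiv_def by blast
    have "(- 1) ^ n * (LINT x:UNIV|lebesgue. weak_pderiv UNIV \<alpha> (f k) x * pd j \<phi> x) =
      (- 1) ^ Suc n * (LINT x:UNIV|lebesgue. weak_pderiv UNIV (inc j \<alpha>) (f k) x * \<phi> x)"
      using w[OF tj fdata_has_weak_pderiv[OF f k a n'(1) k2]] w[OF t fdata_has_weak_pderiv[OF f k ai n'(2) k2]]
      unfolding S e by (rule trans[OF sym])
    then have "(LINT x:UNIV|lebesgue. weak_pderiv UNIV \<alpha> (f k) x * pd j \<phi> x) = - (LINT x:UNIV|lebesgue. weak_pderiv UNIV (inc j \<alpha>) (f k) x * \<phi> x)"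
      by (cases "even n") simp_all
    then show "(\<integral>x. pd j \<phi> x * bdata f k \<alpha> x \<partial>lborel) = - (\<integral>x. \<phi> x * bdata f k (inc j \<alpha>) x \<partial>lborel)"
      unfolding bdata_def using brep_integral[OF fdata_weak_pderiv(1)[OF f k a n'(1)] b(2)] brep_integral[OF fdata_weak_pderiv(1)[OF f k ai n'(2)] b(1)]
      by simp
  qed
qed

lemma AE_affine:
  fixes P :: "'a::euclidean_space \<Rightarrow> bool"
  assumes P: "AE y in lborel. P y" and c: "c \<noteq> 0"
  shows "AE h in lborel. P (x + c *\<^sub>R h)"
proof -
  obtain N where N: "{y. \<not> P y} \<subseteq> N" "emeasure lborel N = 0" "N \<in> sets borel" using AE_E[OF P] by auto
  have [measurable]: "N \<in> sets borel" by (rule N(3))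
  have "ennreal (\<bar>c\<bar> ^ DIM('a)) * (\<integral>\<^sup>+h. indicator N (x + c *\<^sub>R h) \<partial>lborel) = (\<integral>\<^sup>+y. indicator N y \<partial>lborel)"
    by (rule nn_integral_affine_change[OF c, symmetric]) measurable
  also have "\<dots> = 0" using N by simp
  finally have "(\<integral>\<^sup>+h. indicator N (x + c *\<^sub>R h) \<partial>lborel) = 0" using c by simp
  then have "AE h in lborel. indicator N (x + c *\<^sub>R h) = (0::ennreal)"
    by (subst (asm) nn_integral_0_iff_AE) auto
  then show ?thesis by eventually_elim (use N(1) in \<open>auto simp: indicator_def split: if_splits\<close>)
qed

section \<open>Comparison with the quantities in the statement\<close>

lemma abs_le_L2_set: "finite A \<Longrightarrow> i \<in> A \<Longrightarrow> \<bar>f i\<bar> \<le> L2_set f A"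
  using member_le_L2_set[of A i "\<lambda>i. \<bar>f i\<bar>"] by (simp add: L2_set_def)

text \<open>A component is at most the Euclidean norm of the vector. The Borel representative agrees
  with the weak derivative at almost every x and, for fixed x, at x + h for almost every h.\<close>

lemma gag_bdata_le:
  fixes f :: "nat \<Rightarrow> real^'n \<Rightarrow> real"
  assumes p: "1 \<le> p" and f: "fdata p m f" and k: "k < m" and a: "\<alpha> \<in> multi_indices (m - 1 - k)"
  shows "gag a p (bdata f k \<alpha>) \<le> gagliardo_energy a p (m - k - 1) (f k)"
proof -
  let ?L = "\<lambda>x h. L2_set (\<lambda>\<alpha>. weak_pderiv UNIV \<alpha> (f k) (x + h) - weak_pderiv UNIV \<alpha> (f k) x) (multi_indices (m - 1 - k))" and ?G = "\<lambda>x h. \<bar>bdata f k \<alpha> (x + h) - bdata f k \<alpha> x\<bar>"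
  have m: "m - k - 1 = m - 1 - k" by simp
  have ae: "AE x in lborel. weak_pderiv UNIV \<alpha> (f k) x = bdata f k \<alpha> x"
    unfolding bdata_def by (rule brep(2)[OF fdata_weak_pderiv(1)[OF f k a order_refl]])
  have sh: "AE h in lborel. weak_pderiv UNIV \<alpha> (f k) (x + h) = bdata f k \<alpha> (x + h)" for x
    using AE_affine[OF ae, of 1 x] by simp
  show ?thesis
    unfolding gag_def gagliardo_energy_def nn_integral_completion m
  proof (rule nn_integral_mono_AE)
    show "AE x in lborel. (\<integral>\<^sup>+h. ennreal (?G x h powr p / norm h powr (p + real DIM(real^'n) - 1)) * indicator (ball 0 a) h \<partial>lborel) \<le>
      (\<integral>\<^sup>+h\<in>ball 0 a. ennreal (?L x h powr p / norm h powr (p + real (CARD('n) + 1) - 2)) \<partial>lborel)"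
      using ae
    proof eventually_elim
      case (elim x)
      show ?case
      proof (rule nn_integral_mono_AE)
        show "AE h in lborel. ennreal (?G x h powr p / norm h powr (p + real DIM(real^'n) - 1)) * indicator (ball 0 a) h \<le>
          ennreal (?L x h powr p / norm h powr (p + real (CARD('n) + 1) - 2)) * indicator (ball 0 a) h"
          using sh[of x]
        proof eventually_elim
          case h: (elim h)
          have "?G x h \<le> ?L x h"
            using abs_le_L2_set[OF finite_multi_indices a, of "\<lambda>\<alpha>. weak_pderiv UNIV \<alpha> (f k) (x + h) - weak_pderiv UNIV \<alpha> (f k) x"] h elim by simp
          moreover have "p + real DIM(real^'n) - 1 = p + real (CARD('n) + 1) - 2" by simp
          ultimately show ?case using p
            by (intro mult_right_mono ennreal_leI) (auto intro!: divide_right_mono powr_mono2)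
        qed
      qed
    qed
  qed
qed

lemma Esum_bdata_le:
  fixes f :: "nat \<Rightarrow> real^'n \<Rightarrow> real"
  assumes p: "1 \<le> p" and f: "fdata p m f" and m: "0 < m"
  shows "Esum a p m (bdata f) \<le> ennreal (\<Sum>k<m. real (card (multi_indices (m - 1 - k) :: (real^'n \<Rightarrow> nat) set))) * (\<Sum>k=0..m - 1. gagliardo_energy a p (m - k - 1) (f k))"
proof -
  define M where "M = (\<Sum>k<m. real (card (multi_indices (m - 1 - k) :: (real^'n \<Rightarrow> nat) set)))"
  have e: "{0..m - 1} = {..<m}" using m by auto
  have "Esum a p m (bdata f) \<le> (\<Sum>k<m. ennreal M * gagliardo_energy a p (m - k - 1) (f k))"
    unfolding Esum_def
  proof (rule sum_mono)
    fix k assume k: "k \<in> {..<m}"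
    have "(\<Sum>\<alpha>\<in>multi_indices (m - 1 - k). gag a p (bdata f k \<alpha>)) \<le> (\<Sum>\<alpha>\<in>(multi_indices (m - 1 - k) :: (real^'n \<Rightarrow> nat) set). gagliardo_energy a p (m - k - 1) (f k))"
      using k by (intro sum_mono gag_bdata_le[OF p f]) auto
    also have "\<dots> = ennreal (real (card (multi_indices (m - 1 - k) :: (real^'n \<Rightarrow> nat) set))) * gagliardo_energy a p (m - k - 1) (f k)"
      by (simp add: ennreal_of_nat_eq_real_of_nat)
    also have "\<dots> \<le> ennreal M * gagliardo_energy a p (m - k - 1) (f k)"
      unfolding M_def using k by (intro mult_right_mono ennreal_leI member_le_sum) auto
    finally show "(\<Sum>\<alpha>\<in>multi_indices (m - 1 - k). gag a p (bdata f k \<alpha>)) \<le> ennreal M * gagliardo_energy a p (m - k - 1) (f k)" .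
  qed
  then show ?thesis unfolding M_def[symmetric] e by (simp add: sum_distrib_left)
qed

text \<open>Finitely many weak derivatives are involved, so off one null set they all equal their
  representatives, and there \<open>Qdiff\<close> is a component of the vector Q.\<close>

lemma Qdiff_bdata_le:
  fixes fm fp :: "nat \<Rightarrow> real^'n \<Rightarrow> real"
  assumes p: "1 \<le> p" and mk: "mkernel r (m - 1) (\<eta> :: real^'n \<Rightarrow> real)" and f: "fdata p m fm" "fdata p m fp" and bs: "set bs \<subseteq> Basis" "length bs < m"
  shows "Ip p UNIV (Qdiff m bm bp (bdata fm) (bdata fp) bs) \<le> Q_energy p bm bp fm fp m (length (tang bs)) (nrm bs)"
proof -
  define i where "i = length (tang bs)"
  define n where "n = nrm bs"
  define \<alpha> where "\<alpha> = mi_of (tang bs)"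
  have len: "length bs = n + i" unfolding n_def i_def using nrm_tang_length[OF bs(1)] by simp
  have a: "\<alpha> \<in> multi_indices i" unfolding \<alpha>_def i_def by (rule mi_of_multi_indices[OF tang_Basis[OF bs(1)]])
  have e: "{0..m - i - n - 1} = {..<m - length bs}" using bs(2) unfolding len by auto
  have ae: "AE x in lborel. \<forall>k\<in>{..<m - length bs}. weak_pderiv UNIV \<alpha> (f (n + k)) x = bdata f (n + k) \<alpha> x" if "fdata p m f" for f
    unfolding bdata_def using len by (intro AE_finite_allI brep(2) fdata_weak_pderiv(1)[OF that _ a]) auto
  have "Ip p UNIV (Qdiff m bm bp (bdata fm) (bdata fp) bs) \<le> (\<integral>\<^sup>+x. ennreal (L2_set (Q_coeff bm bp fm fp m i n x) (multi_indices i) powr p) \<partial>lborel)"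
    unfolding Ip_def
  proof (rule nn_integral_mono_AE)
    show "AE x in lborel. ennreal (\<bar>Qdiff m bm bp (bdata fm) (bdata fp) bs x\<bar> powr p) * indicator UNIV x \<le> ennreal (L2_set (Q_coeff bm bp fm fp m i n x) (multi_indices i) powr p)"
      using ae[OF f(1)] ae[OF f(2)]
    proof eventually_elim
      case (elim x)
      have "Qdiff m bm bp (bdata fm) (bdata fp) bs x = Q_coeff bm bp fm fp m i n x \<alpha>"
        unfolding Qdiff_def[OF p mk] Q_coeff_def e n_def[symmetric] \<alpha>_def[symmetric]
        using elim by (intro sum.cong) (auto simp: add.commute field_simps simp flip: power_add mult_2)
      then have "\<bar>Qdiff m bm bp (bdata fm) (bdata fp) bs x\<bar> \<le> L2_set (Q_coeff bm bp fm fp m i n x) (multi_indices i)"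
        using abs_le_L2_set[OF finite_multi_indices a] by simp
      then show ?case using p by (simp add: powr_mono2)
    qed
  qed
  then show ?thesis unfolding Q_energy_def nn_integral_completion i_def n_def .
qed

text \<open>Integrals ignore null sets, so an equation almost everywhere between the data becomes an
  equation of the averages at every point off t = 0.\<close>

lemma mol_lincomb:
  assumes p: "1 \<le> p" and k: "kern r \<eta>" and g: "Lploc p g" "Lploc p g'" and h: "h \<in> borel_measurable borel"
    and ae: "AE x in lborel. h x = s * g x + t * g' x" and z: "snd z \<noteq> 0"
  shows "mol \<eta> h z = s * mol \<eta> g z + t * mol \<eta> g' z"
proof -
  note [measurable] = kern_borel[OF k] Lploc_borel[OF g(1)] Lploc_borel[OF g(2)] h
  have "mol \<eta> h z = (\<integral>x. \<eta> x * h (fst z + snd z *\<^sub>R x) \<partial>lborel)" by (rule mol_lborel) measurable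
  also have "\<dots> = (\<integral>x. s * (\<eta> x * g (fst z + snd z *\<^sub>R x)) + t * (\<eta> x * g' (fst z + snd z *\<^sub>R x)) \<partial>lborel)"
  proof (rule integral_cong_AE)
    show "AE x in lborel. \<eta> x * h (fst z + snd z *\<^sub>R x) = s * (\<eta> x * g (fst z + snd z *\<^sub>R x)) + t * (\<eta> x * g' (fst z + snd z *\<^sub>R x))"
      using AE_affine[OF ae z, of "fst z"] by eventually_elim (simp add: algebra_simps)
  qed measurable
  also have "\<dots> = s * mol \<eta> g z + t * mol \<eta> g' z"
    using mol_integrable[OF p k g(1) z, of "fst z"] mol_integrable[OF p k g(2) z, of "fst z"] by (simp add: mol_lborel)
  finally show ?thesis .
qed

text \<open>Only entries of order zero are compared. The chosen representatives of higher weak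
  derivatives need not be linear in the data, and the extension does not contain them.\<close>

lemma vf_lincomb:
  assumes p: "1 \<le> p" and k: "kern r \<eta>" and g: "\<And>k. k < m \<Longrightarrow> Lploc p (G k (mi_of []))" "\<And>k. k < m \<Longrightarrow> Lploc p (G' k (mi_of []))"
    and h: "\<And>k. k < m \<Longrightarrow> H k (mi_of []) \<in> borel_measurable borel"
    and ae: "\<And>k. k < m \<Longrightarrow> AE x in lborel. H k (mi_of []) x = s * G k (mi_of []) x + t * G' k (mi_of []) x"
    and z: "z \<in> slab b0 b1" and f: "face \<sigma> b b0 b1"
  shows "vf \<sigma> b \<eta> m H z = s * vf \<sigma> b \<eta> m G z + t * vf \<sigma> b \<eta> m G' z"
proof -
  define y where "y = (fst z, \<sigma> * snd z + (- \<sigma> * b))"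
  have y: "snd y \<noteq> 0" using z f unfolding y_def face_def by auto
  have "mterm \<eta> (m - 1 - k) k 0 [] (sdata \<sigma> H k) y = s * mterm \<eta> (m - 1 - k) k 0 [] (sdata \<sigma> G k) y + t * mterm \<eta> (m - 1 - k) k 0 [] (sdata \<sigma> G' k) y"
    if km: "k < m" for k
  proof -
    have "mol \<eta> (sdata \<sigma> H k (mi_of [])) y = s * mol \<eta> (sdata \<sigma> G k (mi_of [])) y + t * mol \<eta> (sdata \<sigma> G' k (mi_of [])) y"
    proof (rule mol_lincomb[OF p k _ _ _ _ y])
      show "Lploc p (sdata \<sigma> G k (mi_of []))" "Lploc p (sdata \<sigma> G' k (mi_of []))"
        unfolding sdata_def[abs_def] by (intro Lploc_cmult g km)+
      show "sdata \<sigma> H k (mi_of []) \<in> borel_measurable borel"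
        unfolding sdata_def[abs_def] by (intro borel_measurable_times h km) auto
      show "AE x in lborel. sdata \<sigma> H k (mi_of []) x = s * sdata \<sigma> G k (mi_of []) x + t * sdata \<sigma> G' k (mi_of []) x"
        using ae[OF km] by eventually_elim (simp add: sdata_def algebra_simps)
    qed
    then show ?thesis unfolding mterm_def by (simp add: algebra_simps)
  qed
  then show ?thesis
    unfolding vf_def ext_def y_def[symmetric] by (simp add: sum.distrib sum_distrib_left)
qed

text \<open>The combinations \<open>hm\<close>, \<open>hp\<close> are given only almost everywhere;
  this covers linearity and, with s = 1 and t = 0, independence of the representatives.\<close>

lemma ufun_bdata_lincomb:
  fixes fm fp gm gp hm hp :: "nat \<Rightarrow> 'a::euclidean_space \<Rightarrow> real"
  assumes p: "1 \<le> p" and mk: "mkernel r (m - 1) \<eta>" and f: "fdata p m fm" "fdata p m fp" "fdata p m gm" "fdata p m gp"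
    and ae: "\<And>k. k < m \<Longrightarrow> AE x in lborel. hm k x = s * fm k x + t * gm k x" "\<And>k. k < m \<Longrightarrow> AE x in lborel. hp k x = s * fp k x + t * gp k x"
    and z: "z \<in> slab b0 b1"
  shows "ufun \<eta> m b0 b1 (bdata hm) (bdata hp) z = s * ufun \<eta> m b0 b1 (bdata fm) (bdata fp) z + t * ufun \<eta> m b0 b1 (bdata gm) (bdata gp) z"
proof -
  have k: "kern r \<eta>" using mk unfolding mkernel_def by (simp add: skern_kern)
  have e: "bdata f k (mi_of []) = brep (f k)" for f :: "nat \<Rightarrow> 'a \<Rightarrow> real" and k
    unfolding bdata_def weak_pderiv_def mi_of_Nil by simp
  have 0: "mi_of [] \<in> multi_indices 0" by (simp add: multi_indices_def mi_of_Nil)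
  have L: "Lploc p (bdata f k (mi_of []))" if "fdata p m f" "k < m" for f k
    using adm_Lploc[of p "m - 1 - k" "bdata f k", OF _ 0] bdata_admd[OF that(1)] that(2) unfolding admd_def by simp
  have W: "f k \<in> borel_measurable lebesgue" if "fdata p m f" "k < m" for f k
    using fdata_weak_pderiv(1)[OF that 0] unfolding weak_pderiv_def mi_of_Nil by simp
  have *: "bdata h k (mi_of []) \<in> borel_measurable borel \<and> (AE x in lborel. bdata h k (mi_of []) x = s * bdata f k (mi_of []) x + t * bdata g k (mi_of []) x)"
    if fg: "fdata p m f" "fdata p m g" and h: "\<And>k. k < m \<Longrightarrow> AE x in lborel. h k x = s * f k x + t * g k x" and km: "k < m" for f g h :: "nat \<Rightarrow> 'a \<Rightarrow> real" and k
  proof -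
    have "(\<lambda>x. s * f k x + t * g k x) \<in> borel_measurable lebesgue"
      by (intro borel_measurable_add borel_measurable_times W[OF fg(1) km] W[OF fg(2) km] borel_measurable_const)
    then have "h k \<in> borel_measurable lebesgue"
      by (rule borel_measurable_AE) (use AE_completion[OF h[OF km]] in auto)
    from brep[OF this] show ?thesis
      unfolding e using h[OF km] brep(2)[OF W[OF fg(1) km]] brep(2)[OF W[OF fg(2) km]] by auto
  qed
  have v: "vf \<sigma> b \<eta> m (bdata h) z = s * vf \<sigma> b \<eta> m (bdata f) z + t * vf \<sigma> b \<eta> m (bdata g) z"
    if "fdata p m f" "fdata p m g" "\<And>k. k < m \<Longrightarrow> AE x in lborel. h k x = s * f k x + t * g k x" "face \<sigma> b b0 b1" for f g h \<sigma> b
    by (rule vf_lincomb[OF p k _ _ _ _ z that(4)]) (use L that(1,2) *[OF that(1-3)] in blast)+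
  show ?thesis
    unfolding ufun_def wdiff_def[OF p mk]
    using v[OF f(1,3) ae(1), of 1 b0] v[OF f(2,4) ae(2), of "- 1" b1] by (simp add: face_def algebra_simps)
qed

lemma sum_ennreal_less_top: "finite I \<Longrightarrow> (\<And>i. i \<in> I \<Longrightarrow> f i < \<infinity>) \<Longrightarrow> (\<Sum>i\<in>I. f i :: ennreal) < \<infinity>"
  by (induction I rule: finite_induct) auto

text \<open>The Euclidean norm is at most the sum of the components, and for a smooth function these
  are classical derivatives almost everywhere; \<open>L\<close> selects a list for each
  multi-index.\<close>

lemma grad_energy_smooth:
  fixes F :: "'a::euclidean_space \<Rightarrow> real"
  assumes p: "0 \<le> p" and U: "open U" and F: "smooth_on U F"
    and L: "\<And>\<alpha>. \<alpha> \<in> multi_indices m \<Longrightarrow> set (L \<alpha>) \<subseteq> Basis \<and> \<alpha> = mi_of (L \<alpha>)"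
  shows "grad_energy m p U F \<le> ennreal (real (card (multi_indices m :: ('a \<Rightarrow> nat) set)) powr p) * (\<Sum>\<alpha>\<in>multi_indices m. Ip p U (iter_pderiv (L \<alpha>) F))"
proof -
  let ?I = "multi_indices m :: ('a \<Rightarrow> nat) set"
  have c: "continuous_on U (iter_pderiv (L \<alpha>) F)" if "\<alpha> \<in> ?I" for \<alpha>
    using L[OF that] by (intro smooth_on_continuous_on_iter[OF F]) auto
  have "AE x in lborel. \<forall>\<alpha>\<in>?I. x \<in> U \<longrightarrow> weak_pderiv U \<alpha> F x = iter_pderiv (L \<alpha>) F x"
  proof (intro AE_finite_allI finite_multi_indices weak_pderiv_AE U)
    fix \<alpha> assume a: "\<alpha> \<in> ?I"
    show "has_weak_pderiv U \<alpha> F (iter_pderiv (L \<alpha>) F)"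
      using smooth_on_has_weak_pderiv[OF U F, of "L \<alpha>"] L[OF a] by simp
  qed
  then have "grad_energy m p U F \<le> Ip p U (\<lambda>x. \<Sum>\<alpha>\<in>?I. \<bar>iter_pderiv (L \<alpha>) F x\<bar>)"
    unfolding grad_energy_def nn_integral_completion Ip_def
  proof (intro nn_integral_mono_AE, eventually_elim)
    case (elim x)
    have "L2_set (\<lambda>\<alpha>. weak_pderiv U \<alpha> F x) ?I \<le> (\<Sum>\<alpha>\<in>?I. \<bar>weak_pderiv U \<alpha> F x\<bar>)" by (rule L2_set_le_sum_abs)
    also have "\<dots> = (\<Sum>\<alpha>\<in>?I. \<bar>iter_pderiv (L \<alpha>) F x\<bar>)" if "x \<in> U" using elim that by simp
    finally show ?case
      using p by (cases "x \<in> U") (auto simp: abs_of_nonneg sum_nonneg intro!: ennreal_leI powr_mono2)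
  qed
  also have "\<dots> \<le> ennreal (real (card ?I) powr p) * (\<Sum>\<alpha>\<in>?I. Ip p U (\<lambda>x. \<bar>iter_pderiv (L \<alpha>) F x\<bar>))"
    using c by (intro Ip_sum_on p borel_open U finite_multi_indices on_meas_continuous continuous_intros)
  finally show ?thesis by (simp add: Ip_def)
qed

lemma homogeneous_sobolev_smooth:
  fixes F :: "'a::euclidean_space \<Rightarrow> real"
  assumes U: "open U" and F: "smooth_on U F" and fin: "\<And>bs. set bs \<subseteq> Basis \<Longrightarrow> length bs = m \<Longrightarrow> Ip p U (iter_pderiv bs F) < \<infinity>"
  shows "homogeneous_sobolev m p U F"
  unfolding homogeneous_sobolev_def
proof (intro conjI ballI)
  show "L1_loc U F" by (intro L1_loc_continuous_on smooth_on_continuous_on[OF F])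
  fix \<alpha> :: "'a \<Rightarrow> nat" assume "\<alpha> \<in> multi_indices m"
  then obtain bs :: "'a list" where bs: "set bs \<subseteq> Basis" "length bs = m" "\<alpha> = mi_of bs" by (rule multi_indices_list)
  have "Lp p U (iter_pderiv bs F)"
    unfolding Lp_def Ip_lebesgue using fin[OF bs(1,2)] U smooth_on_continuous_on_iter[OF F bs(1)]
    by (auto intro!: continuous_imp_measurable_on_sets_lebesgue sets_completionI_sets)
  then show "\<exists>v. has_weak_pderiv U \<alpha> F v \<and> Lp p U v"
    using smooth_on_has_weak_pderiv[OF U F bs(1)] bs(3) by blast
qed

lemma boundary_data_D:
  assumes "boundary_data a m p bm bp fm fp"
  shows "fdata p m fm" "fdata p m fp" "n + i \<le> m - 1 \<Longrightarrow> Q_energy p bm bp fm fp m i n < \<infinity>"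
    "k \<le> m - 1 \<Longrightarrow> gagliardo_energy a p (m - k - 1) (fm k) < \<infinity>" "k \<le> m - 1 \<Longrightarrow> gagliardo_energy a p (m - k - 1) (fp k) < \<infinity>"
  using assms unfolding boundary_data_def fdata_def by auto

lemma fdata_Lp_loc:
  fixes f :: "nat \<Rightarrow> 'a::euclidean_space \<Rightarrow> real"
  assumes p: "0 \<le> p" and f: "fdata p m f" and k: "k < m" shows "Lp_loc p UNIV (f k)"
  unfolding Lp_loc_def
proof (intro allI impI)
  fix K :: "'a set" assume K: "compact K \<and> K \<subseteq> UNIV"
  have 0: "(\<lambda>b. 0) \<in> multi_indices 0" by (simp add: multi_indices_def)
  have w: "f k \<in> borel_measurable lebesgue" "Ip p (ball 0 R) (f k) < \<infinity>" for R
    using fdata_weak_pderiv[OF f k 0] by (auto simp: weak_pderiv_def)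
  obtain R where R: "K \<subseteq> ball 0 R" using bounded_subset_ballD[of K 0] K compact_imp_bounded by blast
  show "Lp p K (f k)"
    unfolding Lp_def Ip_lebesgue
    using measurable_restrict_space1[OF w(1)] le_less_trans[OF Ip_mono[OF R] w(2)] by auto
qed

definition Qsum :: "real \<Rightarrow> nat \<Rightarrow> real \<Rightarrow> real \<Rightarrow> (nat \<Rightarrow> real^'n \<Rightarrow> real) \<Rightarrow> (nat \<Rightarrow> real^'n \<Rightarrow> real) \<Rightarrow> ennreal" where
  "Qsum p m bm bp fm fp = (\<Sum>n=0..m - 1. \<Sum>i=0..m - 1 - n.
     ennreal ((bp - bm) powr ((real n + real i - real m) * p + 1)) * Q_energy p bm bp fm fp m i n)"

definition Gsum :: "real \<Rightarrow> real \<Rightarrow> nat \<Rightarrow> (nat \<Rightarrow> real^'n \<Rightarrow> real) \<Rightarrow> ennreal" where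
  "Gsum a p m f = (\<Sum>k=0..m - 1. gagliardo_energy a p (m - k - 1) (f k))"

text \<open>Each bound on a \<open>Qdiff\<close> is covered by one summand of \<open>Qsum\<close>,
  and the factor of the Gagliardo sums counts the components of the gradients.\<close>

lemma dominated_bdata:
  fixes fm fp :: "nat \<Rightarrow> real^'n \<Rightarrow> real"
  assumes p: "1 \<le> p" and mk: "mkernel r (m - 1) (\<eta> :: real^'n \<Rightarrow> real)" and m: "0 < m" and f: "fdata p m fm" "fdata p m fp"
  shows "dominated p m a bm bp (bdata fm) (bdata fp) (Qsum p m bm bp fm fp +
    ennreal (\<Sum>k<m. real (card (multi_indices (m - 1 - k) :: (real^'n \<Rightarrow> nat) set))) * (Gsum a p m fm + Gsum a p m fp))"
  unfolding dominated_def[OF p mk]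
proof (intro conjI bdata_admd f allI impI)
  let ?M = "ennreal (\<Sum>k<m. real (card (multi_indices (m - 1 - k) :: (real^'n \<Rightarrow> nat) set)))"
  have "Esum a p m (bdata fm) + Esum a p m (bdata fp) \<le> ?M * Gsum a p m fm + ?M * Gsum a p m fp"
    unfolding Gsum_def by (intro add_mono Esum_bdata_le p f m)
  then show "Esum a p m (bdata fm) + Esum a p m (bdata fp) \<le> Qsum p m bm bp fm fp + ?M * (Gsum a p m fm + Gsum a p m fp)"
    unfolding distrib_left by (rule order_trans) simp
  fix bs :: "((real^'n) \<times> real) list" assume bs: "set bs \<subseteq> Basis" "length bs < m"
  define i n where "i = length (tang bs)" and "n = nrm bs"
  have len: "length bs = n + i" unfolding n_def i_def using nrm_tang_length[OF bs(1)] by simp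
  let ?t = "\<lambda>n i. ennreal ((bp - bm) powr ((real n + real i - real m) * p + 1)) * Q_energy p bm bp fm fp m i n"
  have "ennreal ((bp - bm) powr ((real (length bs) - real m) * p + 1)) * Ip p UNIV (Qdiff m bm bp (bdata fm) (bdata fp) bs) \<le> ?t n i"
    unfolding len n_def i_def of_nat_add by (intro mult_left_mono Qdiff_bdata_le[OF p mk f bs]) simp
  also have "\<dots> \<le> (\<Sum>i=0..m - 1 - n. ?t n i)" using bs(2) unfolding len by (intro member_le_sum[of i _ "?t n"]) auto
  also have "\<dots> \<le> Qsum p m bm bp fm fp"
    unfolding Qsum_def using bs(2) unfolding len by (intro member_le_sum[of n _ "\<lambda>n. \<Sum>i=0..m - 1 - n. ?t n i"]) auto
  also have "\<dots> \<le> Qsum p m bm bp fm fp + ?M * (Gsum a p m fm + Gsum a p m fp)" by simp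
  finally show "ennreal ((bp - bm) powr ((real (length bs) - real m) * p + 1)) * Ip p UNIV (Qdiff m bm bp (bdata fm) (bdata fp) bs)
    \<le> Qsum p m bm bp fm fp + ?M * (Gsum a p m fm + Gsum a p m fp)" .
qed

text \<open>The k-th normal derivative is smooth inside the slab and, as k + 1 <= m, locally
  p-integrable together with its first derivatives. Its limits at the faces are Borel versions of
  the data, so \<open>has_trace_smooth\<close> applies.\<close>

lemma ufun_traces:
  fixes fm fp :: "nat \<Rightarrow> real^'n \<Rightarrow> real"
  assumes p: "1 \<le> p" and mk: "mkernel r (m - 1) \<eta>" and f: "fdata p m fm" "fdata p m fp"
    and E: "Esum a p m (bdata fm) < \<infinity>" "Esum a p m (bdata fp) < \<infinity>" and r: "r * (bp - bm) \<le> a" and b: "bm < bp" and k: "k < m"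
  defines "u \<equiv> ufun \<eta> m bm bp (bdata fm) (bdata fp)"
  shows "has_trace p bm bp bm (weak_pderiv (slab bm bp) (normal_mi k) u) (fm k)" (is ?m)
    "has_trace p bm bp bp (weak_pderiv (slab bm bp) (normal_mi k) u) (fp k)" (is ?p)
proof -
  define F where "F = iter_pderiv (replicate k eN) u"
  note G = bdata_admd[OF f(1)] bdata_admd[OF f(2)]
  have su: "smooth_on (slab bm bp) u" unfolding u_def by (rule ufun_smooth[OF p mk G])
  have rB: "set (replicate k (eN :: (real^'n) \<times> real)) \<subseteq> Basis" using Basis_prod_nor by auto
  have sF: "smooth_on (slab bm bp) F" unfolding F_def by (rule smooth_on_iter[OF su rB])
  have "count_list (replicate k x) y = (if y = x then k else 0)" for x y :: "(real^'n) \<times> real"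
    by (induction k) auto
  then have n: "normal_mi k = mi_of (replicate k (eN :: (real^'n) \<times> real))"
    unfolding normal_mi_def mi_of_def by presburger
  have wp: "has_weak_pderiv (slab bm bp) (normal_mi k) u F"
    unfolding n F_def by (rule smooth_on_has_weak_pderiv[OF open_slab su rB])
  have v: "L1_loc (slab bm bp) (weak_pderiv (slab bm bp) (normal_mi k) u)"
    using has_weak_pderiv_weak_pderiv[OF wp] unfolding has_weak_pderiv_def by blast
  have fin: "Ip p (ball 0 R \<times> {bm<..<bp}) (iter_pderiv bs F) < \<infinity>" if "set bs \<subseteq> Basis" "length bs \<le> 1" for R bs
    using ufun_finite[OF p mk G E _ _ r b, of "bs @ replicate k eN" R] that rB k
    unfolding F_def u_def iter_pderiv_append by auto
  have ae: "AE x in lborel. bdata f k (mi_of []) x = f k x" if "fdata p m f" for f :: "nat \<Rightarrow> real^'n \<Rightarrow> real"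
  proof -
    have "(\<lambda>b. 0) \<in> multi_indices 0" by (simp add: multi_indices_def)
    from brep(2)[OF fdata_weak_pderiv(1)[OF that k this]] show ?thesis
      unfolding bdata_def mi_of_Nil by (simp add: weak_pderiv_def eq_commute)
  qed
  have lc: "Ip p A (\<lambda>x. F (x, s) - bdata f k (mi_of []) x) = Ip p A (\<lambda>x. F (x, s) - f k x)" if "fdata p m f" for f A s
    using ae[OF that] by (intro Ip_cong_AE) auto
  note lim = ufun_face_limit[OF p mk G rB _ b, unfolded tang_nrm_replicate length_replicate, OF k, folded u_def, folded F_def]
  note tr = has_trace_smooth[OF p b _ sF fin v weak_pderiv_AE[OF open_slab wp]]
  show ?m by (rule tr) (use lim(1) fdata_Lp_loc[OF _ f(1) k] p in \<open>auto simp: lc[OF f(1)]\<close>)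
  show ?p by (rule tr) (use lim(2) fdata_Lp_loc[OF _ f(2) k] p in \<open>auto simp: lc[OF f(2)]\<close>)
qed

theorem theorem4p3:
  fixes a p d :: real and m :: nat
  assumes "a > 0" and "m \<ge> 2" and "1 < p" and "d > 0"
  shows "\<exists>c::real. c > 0 \<and>
    (\<forall>bm bp :: real. bm < bp \<and> bp - bm \<le> d \<longrightarrow>
      (\<exists>T :: (nat \<Rightarrow> real^'n \<Rightarrow> real) \<Rightarrow> (nat \<Rightarrow> real^'n \<Rightarrow> real) \<Rightarrow> (real^'n) \<times> real \<Rightarrow> real.
        (\<forall>fm fp. boundary_data a m p bm bp fm fp \<longrightarrow>
           homogeneous_sobolev m p (strip bm bp) (T fm fp) \<and>
           (\<forall>k\<le>m - 1.
              has_trace p bm bp bm (weak_pderiv (strip bm bp) (normal_mi k) (T fm fp)) (fm k) \<and>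
              has_trace p bm bp bp (weak_pderiv (strip bm bp) (normal_mi k) (T fm fp)) (fp k)) \<and>
           grad_energy m p (strip bm bp) (T fm fp)
             \<le> ennreal c * (\<Sum>n=0..m - 1. \<Sum>i=0..m - 1 - n.
                   ennreal ((bp - bm) powr ((real n + real i - real m) * p + 1)) *
                   Q_energy p bm bp fm fp m i n)
             + ennreal c * (\<Sum>k=0..m - 1. gagliardo_energy a p (m - k - 1) (fm k))
             + ennreal c * (\<Sum>k=0..m - 1. gagliardo_energy a p (m - k - 1) (fp k))) \<and>
        (\<forall>fm fp gm gp. boundary_data a m p bm bp fm fp \<and> boundary_data a m p bm bp gm gp \<and>
           (\<forall>k\<le>m - 1. (AE x' in lebesgue. fm k x' = gm k x') \<and> (AE x' in lebesgue. fp k x' = gp k x')) \<longrightarrow>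
           (AE x in lebesgue_on (strip bm bp). T fm fp x = T gm gp x)) \<and>
        (\<forall>fm fp gm gp. \<forall>s t :: real.
           boundary_data a m p bm bp fm fp \<and> boundary_data a m p bm bp gm gp \<longrightarrow>
           (AE x in lebesgue_on (strip bm bp).
              T (\<lambda>k x'. s * fm k x' + t * gm k x') (\<lambda>k x'. s * fp k x' + t * gp k x') x
                = s * T fm fp x + t * T gm gp x))))" (is "\<exists>c. c > 0 \<and> (\<forall>bm bp. bm < bp \<and> bp - bm \<le> d \<longrightarrow> ?P c bm bp)")
proof -
  have p: "1 \<le> p" and m: "0 < m" using assms by auto
  \<comment> \<open>The kernel has radius a/d, so at heights below d the averages stay within
    distance a. It is fixed before the strip, and one constant serves every strip of thickness at
    most d.\<close>
  have r: "a / d > 0" "a / d * d \<le> a" using assms by auto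
  obtain \<eta> :: "real^'n \<Rightarrow> real" where mk: "mkernel (a / d) (m - 1) \<eta>"
    using moment_kernel_exists[OF r(1), of "m - 1"] unfolding mkernel_def by blast
  let ?I = "multi_indices m :: ((real^'n) \<times> real \<Rightarrow> nat) set"
  have "\<exists>bs. set bs \<subseteq> Basis \<and> length bs = m \<and> \<alpha> = mi_of bs" if "\<alpha> \<in> ?I" for \<alpha>
    using multi_indices_list[OF that] by blast
  then obtain L where L: "\<And>\<alpha>. \<alpha> \<in> ?I \<Longrightarrow> set (L \<alpha>) \<subseteq> Basis \<and> length (L \<alpha>) = m \<and> \<alpha> = mi_of (L \<alpha>)" by metis
  have "\<exists>C\<ge>0. \<forall>b0 b1 Gm Gp T. b0 < b1 \<longrightarrow> b1 - b0 \<le> d \<longrightarrow> dominated p m a b0 b1 Gm Gp T \<longrightarrow>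
    Ip p (slab b0 b1) (iter_pderiv bs (ufun \<eta> m b0 b1 Gm Gp)) \<le> ennreal C * T" if "set bs \<subseteq> Basis" "length bs = m" for bs
    by (rule ufun_energy[OF p mk that r(2)])
  then obtain C where C: "\<And>bs. set bs \<subseteq> Basis \<Longrightarrow> length bs = m \<Longrightarrow> 0 \<le> C bs"
    "\<And>bs b0 b1 Gm Gp T. set bs \<subseteq> Basis \<Longrightarrow> length bs = m \<Longrightarrow> b0 < b1 \<Longrightarrow> b1 - b0 \<le> d \<Longrightarrow> dominated p m a b0 b1 Gm Gp T \<Longrightarrow>
      Ip p (slab b0 b1) (iter_pderiv bs (ufun \<eta> m b0 b1 Gm Gp)) \<le> ennreal (C bs) * T"
    by metis
  define M where "M = (\<Sum>k<m. real (card (multi_indices (m - 1 - k) :: (real^'n \<Rightarrow> nat) set)))"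
  define C0 where "C0 = real (card ?I) powr p * (\<Sum>\<alpha>\<in>?I. C (L \<alpha>))"
  have M: "0 \<le> M" unfolding M_def by (intro sum_nonneg) auto
  have C0: "0 \<le> C0" unfolding C0_def using C(1) L by (intro mult_nonneg_nonneg sum_nonneg) auto
  \<comment> \<open>At least C0, the constant of the Q terms, and C0 M, that of the Gagliardo terms;
    the summand 1 makes it positive.\<close>
  define c where "c = C0 * (1 + M) + 1"
  have c: "c > 0" "C0 \<le> c" "C0 * M \<le> c" unfolding c_def using M C0 by (auto simp: distrib_left intro: add_nonneg_pos)
  show ?thesis
  proof (intro exI[of _ c] conjI c(1) allI impI; (elim conjE)?)
    fix bm bp :: real assume b: "bm < bp" "bp - bm \<le> d"
    have r': "a / d * (bp - bm) \<le> a" using mult_left_mono[OF b(2), of "a / d"] r by linarith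
    define T where "T fm fp = ufun \<eta> m bm bp (bdata fm) (bdata fp)" for fm fp :: "nat \<Rightarrow> real^'n \<Rightarrow> real"
    have S: "strip bm bp = slab bm bp" by (simp add: strip_def)
    \<comment> \<open>Both remaining claims, linearity and independence of representatives, are
      instances of this.\<close>
    have lin: "AE x in lebesgue_on (slab bm bp). T hm hp x = s * T fm fp x + t * T gm gp x"
      if "boundary_data a m p bm bp fm fp" "boundary_data a m p bm bp gm gp"
        "\<And>k. k < m \<Longrightarrow> AE x in lborel. hm k x = s * fm k x + t * gm k x" "\<And>k. k < m \<Longrightarrow> AE x in lborel. hp k x = s * fp k x + t * gp k x"
      for fm fp gm gp hm hp :: "nat \<Rightarrow> real^'n \<Rightarrow> real" and s t
      unfolding T_def using ufun_bdata_lincomb[OF p mk boundary_data_D(1,2)[OF that(1)] boundary_data_D(1,2)[OF that(2)] that(3,4)]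
      by (intro AE_I2) (auto simp: space_restrict_space)
    show "?P c bm bp"
      unfolding Qsum_def[symmetric] Gsum_def[symmetric] S
    proof (intro exI[of _ T] conjI allI impI; (elim conjE)?)
      fix fm fp :: "nat \<Rightarrow> real^'n \<Rightarrow> real" assume bd: "boundary_data a m p bm bp fm fp"
      note f = boundary_data_D(1,2)[OF bd]
      define B where "B = Qsum p m bm bp fm fp + ennreal M * (Gsum a p m fm + Gsum a p m fp)"
      have dom: "dominated p m a bm bp (bdata fm) (bdata fp) B" unfolding B_def M_def by (rule dominated_bdata[OF p mk m f])
      have "Qsum p m bm bp fm fp < \<infinity>" unfolding Qsum_def
        using boundary_data_D(3)[OF bd] by (intro sum_ennreal_less_top) (auto simp: ennreal_mult_less_top)
      moreover have "Gsum a p m fm < \<infinity>" "Gsum a p m fp < \<infinity>" unfolding Gsum_def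
        using boundary_data_D(4,5)[OF bd] by (auto intro!: sum_ennreal_less_top)
      ultimately have Bf: "B < \<infinity>" unfolding B_def by (auto simp: ennreal_mult_less_top)
      have "Esum a p m (bdata fm) + Esum a p m (bdata fp) \<le> B" using dom unfolding dominated_def[OF p mk] by blast
      then have "Esum a p m (bdata fm) + Esum a p m (bdata fp) < \<infinity>" using Bf by (rule le_less_trans)
      then have E: "Esum a p m (bdata fm) < \<infinity>" "Esum a p m (bdata fp) < \<infinity>" by auto
      have sT: "smooth_on (slab bm bp) (T fm fp)"
        unfolding T_def by (rule ufun_smooth[OF p mk bdata_admd[OF f(1)] bdata_admd[OF f(2)]])
      have en: "Ip p (slab bm bp) (iter_pderiv bs (T fm fp)) \<le> ennreal (C bs) * B" if "set bs \<subseteq> Basis" "length bs = m" for bs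
        unfolding T_def by (rule C(2)[OF that b dom])
      show "homogeneous_sobolev m p (slab bm bp) (T fm fp)"
        by (rule homogeneous_sobolev_smooth[OF open_slab sT])
          (rule le_less_trans[OF en], use Bf in \<open>auto simp: ennreal_mult_less_top\<close>)
      show "has_trace p bm bp bm (weak_pderiv (slab bm bp) (normal_mi k) (T fm fp)) (fm k)"
        "has_trace p bm bp bp (weak_pderiv (slab bm bp) (normal_mi k) (T fm fp)) (fp k)" if "k \<le> m - 1" for k
        using ufun_traces[OF p mk f E r' b(1), of k] that m unfolding T_def by auto
      have "grad_energy m p (slab bm bp) (T fm fp) \<le> ennreal (real (card ?I) powr p) * (\<Sum>\<alpha>\<in>?I. Ip p (slab bm bp) (iter_pderiv (L \<alpha>) (T fm fp)))"
        using p L by (intro grad_energy_smooth open_slab sT) auto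
      also have "\<dots> \<le> ennreal (real (card ?I) powr p) * (\<Sum>\<alpha>\<in>?I. ennreal (C (L \<alpha>)) * B)"
        using L by (intro mult_left_mono sum_mono en) auto
      also have "(\<Sum>\<alpha>\<in>?I. ennreal (C (L \<alpha>)) * B) = ennreal (\<Sum>\<alpha>\<in>?I. C (L \<alpha>)) * B"
        unfolding sum_distrib_right[symmetric] using C(1) L by (subst sum_ennreal) auto
      also have "ennreal (real (card ?I) powr p) * (ennreal (\<Sum>\<alpha>\<in>?I. C (L \<alpha>)) * B) = ennreal C0 * B"
        unfolding C0_def using C(1) L by (simp add: ennreal_mult sum_nonneg mult.assoc)
      also have "\<dots> = ennreal C0 * Qsum p m bm bp fm fp + ennreal (C0 * M) * Gsum a p m fm + ennreal (C0 * M) * Gsum a p m fp"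
        unfolding B_def using C0 M by (simp add: ennreal_mult distrib_left mult_ac add_ac)
      also have "\<dots> \<le> ennreal c * Qsum p m bm bp fm fp + ennreal c * Gsum a p m fm + ennreal c * Gsum a p m fp"
        by (intro add_mono mult_right_mono ennreal_leI c) auto
      finally show "grad_energy m p (slab bm bp) (T fm fp) \<le> ennreal c * Qsum p m bm bp fm fp + ennreal c * Gsum a p m fm + ennreal c * Gsum a p m fp" .
    next
      fix fm fp gm gp :: "nat \<Rightarrow> real^'n \<Rightarrow> real"
      assume bd: "boundary_data a m p bm bp fm fp" "boundary_data a m p bm bp gm gp"
        and ae: "\<forall>k\<le>m - 1. (AE x' in lebesgue. fm k x' = gm k x') \<and> (AE x' in lebesgue. fp k x' = gp k x')"
      \<comment> \<open>Independence of representatives is the combination with weights 1 and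
        0.\<close>
      have "AE x in lebesgue_on (slab bm bp). T fm fp x = 1 * T gm gp x + 0 * T gm gp x"
        using ae by (intro lin bd(2)) (auto simp: AE_completion_iff)
      then show "AE x in lebesgue_on (slab bm bp). T fm fp x = T gm gp x" by simp
    next
      fix fm fp gm gp :: "nat \<Rightarrow> real^'n \<Rightarrow> real" and s t :: real
      assume "boundary_data a m p bm bp fm fp" "boundary_data a m p bm bp gm gp"
      then show "AE x in lebesgue_on (slab bm bp). T (\<lambda>k x'. s * fm k x' + t * gm k x') (\<lambda>k x'. s * fp k x' + t * gp k x') x = s * T fm fp x + t * T gm gp x"
        by (rule lin) auto
    qed
  qed
qed

end
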